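(* For a map $h : Q \to P$ of fine monoids, the following are equivalent: (1) $h^* : Q^* \to P^*$ is injective with finite cokernel, and the commutative square formed by $h^* : Q^* \to P^*$, $h : Q \to P$ and the inclusions $Q^* \subseteq Q$, $P^* \subseteq P$ is a pushout diagram of monoids. (2) $h$ is injective, $\overline{h} : \overline{Q} \to \overline{P}$ is an isomorphism, and $P/Q$ is finite. (3) There exists a finite subset $S \subseteq P^*$ which is a $Q$-basis for $P$ (i.e. the map of sets $Q \times S \to P$, $(q,s) \mapsto h(q)+s$, is bijective), and any other $Q$-basis $S' \subseteq P$ for $P$ is contained in $P^*$ and has the same cardinality as $S$. (4) There is a finite subset $S \subseteq P^*$ which is a $Q$-basis for $P$. (5) $\operatorname{Spec} h$ is a homeomorphism on the level of topological spaces and $\operatorname{Spec} k[h]$ is a finite étale cover for any field $k$ of characteristic zero. (6) $\operatorname{Spec} k[h]$ is a finite étale cover for any field $k$ of characteristic zero. (7) There exists a field $k$ for which $k[h]$ is finite étale. (8) $h$ is finite, flat, reduced, and local. (9) $h$ is finite, flat, and reduced.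
   Context: Monoids are commutative, written additively, with $0$. $P^*$ is the group of units of $P$, $\overline{P} = P/P^*$, and $P^{\rm gp}$ is the groupification; $h^* : Q^* \to P^*$ and $\overline{h} : \overline{Q} \to \overline{P}$ are the maps induced by $h$. $P$ is fine if it is finitely generated and $P \to P^{\rm gp}$ is injective. For $h : Q \to P$, $P/Q$ denotes the quotient (cokernel) monoid of $P$ by the image of $Q$, and $k[h] : k[Q] \to k[P]$ the induced map of monoid algebras over $k$. The topological space $\operatorname{Spec} P$ is the set of faces of $P$ (submonoids $F$ such that $p+p' \in F$ implies $p,p' \in F$), with basis of open sets $U_p = \{F : p \in F\}$; $\operatorname{Spec} h$ is the map $F \mapsto h^{-1}(F)$. $\operatorname{Spec} k[h]$ denotes the map of schemes $\operatorname{Spec} k[P] \to \operatorname{Spec} k[Q]$; a finite étale cover is a finite étale surjective map of schemes. A module over a monoid $Q$ is a set with an associative, unital action of $Q$; it is free if it has a basis (a subset $S$ such that every element is $q+s$ for a unique pair $(q,s)$ with $q \in Q$, $s \in S$) and flat if it is a filtered direct limit of free modules. $P$ is regarded as a $Q$-module via $q+p := h(q)+p$, and $h$ is called flat if $P$ is a flat $Q$-module, and finite if $P$ is finitely generated as a $Q$-module (some finite $S \subseteq P$ satisfies $P = h(Q)+S$). $h$ is local if $h^{-1}(P^* ) = Q^*$. $h$ is reduced if the ideal $I = h(Q \setminus Q^* )+P$ of $P$ is saturated, meaning that $np \in I$ for some positive integer $n$ and $p \in P$ implies $p \in I$.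
   Formalization: In (7), "finite étale" is taken to include surjectivity of Spec k[h]; without it Z/2 → 0 over C is a counterexample. The test objects and diagrams in the definitions of pushout and flatness range over fixed, sufficiently large universes, which gives equivalent notions. *)

theory Defs
  imports "HOL-Algebra.Algebra" "HOL-Analysis.Abstract_Topology"
begin

text \<open>
  Monoids are objects of \<^locale>\<open>comm_monoid\<close> (hence written multiplicatively), so that the
  group of units of \<open>P\<close> is \<^term>\<open>Units P\<close>, or \<^term>\<open>units_of P\<close> as a monoid of its own.

  Several notions below quantify over structures of arbitrary size. HOL cannot quantify over types
  inside a definition, so such a quantifier ranges over the structures carried by subsets of a
  fixed type; in each case a remark says why that type is large enough.
\<close>

definition all_equivalent :: "bool list \<Rightarrow> bool" where
  "all_equivalent cs \<longleftrightarrow> (\<forall>a\<in>set cs. \<forall>b\<in>set cs. a \<longleftrightarrow> b)"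


section \<open>Monoids\<close>

definition monoid_homs ::
    "('a, 'c) monoid_scheme \<Rightarrow> ('b, 'd) monoid_scheme \<Rightarrow> ('a \<Rightarrow> 'b) set" where
  "monoid_homs M N = {f \<in> hom M N. f \<one>\<^bsub>M\<^esub> = \<one>\<^bsub>N\<^esub>}"

definition quotient_monoid ::
    "('a, 'c) monoid_scheme \<Rightarrow> ('a \<times> 'a) set \<Rightarrow> 'a set monoid" where
  "quotient_monoid M r =
     \<lparr>carrier = carrier M // r,
      monoid.mult = (\<lambda>V W. \<Union>x\<in>V. \<Union>y\<in>W. r `` {x \<otimes>\<^bsub>M\<^esub> y}),
      one = r `` {\<one>\<^bsub>M\<^esub>}\<rparr>"

text \<open>The congruence on a commutative monoid generated by identifying a submonoid with \<open>1\<close>.\<close>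

definition submonoid_cong :: "('a, 'c) monoid_scheme \<Rightarrow> 'a set \<Rightarrow> ('a \<times> 'a) set" where
  "submonoid_cong M S =
     {(x, y). x \<in> carrier M \<and> y \<in> carrier M \<and> (\<exists>s\<in>S. \<exists>t\<in>S. x \<otimes>\<^bsub>M\<^esub> s = y \<otimes>\<^bsub>M\<^esub> t)}"

definition cokernel_monoid ::
    "('q, 'c) monoid_scheme \<Rightarrow> ('p, 'd) monoid_scheme \<Rightarrow> ('q \<Rightarrow> 'p) \<Rightarrow> 'p set monoid" where
  "cokernel_monoid Q P h = quotient_monoid P (submonoid_cong P (h ` carrier Q))"

definition sharpening :: "('a, 'c) monoid_scheme \<Rightarrow> 'a set monoid" where
  "sharpening M = quotient_monoid M (submonoid_cong M (Units M))"

definition sharpening_map :: "('p, 'd) monoid_scheme \<Rightarrow> ('q \<Rightarrow> 'p) \<Rightarrow> 'q set \<Rightarrow> 'p set" where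
  "sharpening_map P h V = (\<Union>q\<in>V. submonoid_cong P (Units P) `` {h q})"

text \<open>A pair \<open>(a, b)\<close> stands for the fraction \<open>a / b\<close>.\<close>

definition groupification_cong ::
    "('a, 'c) monoid_scheme \<Rightarrow> (('a \<times> 'a) \<times> ('a \<times> 'a)) set" where
  "groupification_cong M =
     {((a, b), (c, d)). a \<in> carrier M \<and> b \<in> carrier M \<and> c \<in> carrier M \<and> d \<in> carrier M \<and>
        (\<exists>s\<in>carrier M. s \<otimes>\<^bsub>M\<^esub> (a \<otimes>\<^bsub>M\<^esub> d) = s \<otimes>\<^bsub>M\<^esub> (c \<otimes>\<^bsub>M\<^esub> b))}"

definition groupification :: "('a, 'c) monoid_scheme \<Rightarrow> ('a \<times> 'a) set monoid" where
  "groupification M = quotient_monoid (M \<times>\<times> M) (groupification_cong M)"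

definition groupification_map :: "('a, 'c) monoid_scheme \<Rightarrow> 'a \<Rightarrow> ('a \<times> 'a) set" where
  "groupification_map M x = groupification_cong M `` {(x, \<one>\<^bsub>M\<^esub>)}"

definition finitely_generated_monoid :: "('a, 'c) monoid_scheme \<Rightarrow> bool" where
  "finitely_generated_monoid M \<longleftrightarrow>
     (\<exists>S. finite S \<and> S \<subseteq> carrier M \<and> (\<forall>H. submonoid H M \<and> S \<subseteq> H \<longrightarrow> H = carrier M))"

definition fine_monoid :: "('a, 'c) monoid_scheme \<Rightarrow> bool" where
  "fine_monoid M \<longleftrightarrow>
     comm_monoid M \<and> finitely_generated_monoid M \<and> inj_on (groupification_map M) (carrier M)"

text \<open>
  The square with \<open>f : A \<rightarrow> B\<close>, \<open>g : A \<rightarrow> C\<close>, \<open>i : B \<rightarrow> D\<close>, \<open>j : C \<rightarrow> D\<close> is a pushout of commutative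
  monoids. The test monoids \<open>T\<close> are carried by subsets of \<open>'b \<times> 'c \<times> 'd\<close>: up to isomorphism these
  include \<open>D\<close> and the pushout of \<open>f\<close> and \<open>g\<close> (a quotient of \<open>B \<times> C\<close>), and testing against these
  two already shows that \<open>D\<close> is that pushout.
\<close>

definition is_pushout ::
    "'a monoid \<Rightarrow> 'b monoid \<Rightarrow> 'c monoid \<Rightarrow> 'd monoid \<Rightarrow>
     ('a \<Rightarrow> 'b) \<Rightarrow> ('a \<Rightarrow> 'c) \<Rightarrow> ('b \<Rightarrow> 'd) \<Rightarrow> ('c \<Rightarrow> 'd) \<Rightarrow> bool" where
  "is_pushout A B C D f g i j \<longleftrightarrow>
     f \<in> monoid_homs A B \<and> g \<in> monoid_homs A C \<and> i \<in> monoid_homs B D \<and> j \<in> monoid_homs C D \<and>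
     (\<forall>a\<in>carrier A. i (f a) = j (g a)) \<and>
     (\<forall>(T :: ('b \<times> 'c \<times> 'd) monoid) u v.
        comm_monoid T \<and> u \<in> monoid_homs B T \<and> v \<in> monoid_homs C T \<and>
        (\<forall>a\<in>carrier A. u (f a) = v (g a)) \<longrightarrow>
        (\<exists>!w. w \<in> monoid_homs D T \<and> w \<in> extensional (carrier D) \<and>
              (\<forall>b\<in>carrier B. w (i b) = u b) \<and> (\<forall>c\<in>carrier C. w (j c) = v c)))"

definition face :: "('a, 'c) monoid_scheme \<Rightarrow> 'a set \<Rightarrow> bool" where
  "face M F \<longleftrightarrow> submonoid F M \<and>
     (\<forall>x\<in>carrier M. \<forall>y\<in>carrier M. x \<otimes>\<^bsub>M\<^esub> y \<in> F \<longrightarrow> x \<in> F \<and> y \<in> F)"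

definition monoid_Spec :: "('a, 'c) monoid_scheme \<Rightarrow> 'a set topology" where
  "monoid_Spec M = topology_generated_by {{F. face M F \<and> x \<in> F} | x. x \<in> carrier M}"

definition monoid_Spec_map :: "('q, 'c) monoid_scheme \<Rightarrow> ('q \<Rightarrow> 'p) \<Rightarrow> 'p set \<Rightarrow> 'q set" where
  "monoid_Spec_map Q h F = {q \<in> carrier Q. h q \<in> F}"

definition local_hom ::
    "('q, 'c) monoid_scheme \<Rightarrow> ('p, 'd) monoid_scheme \<Rightarrow> ('q \<Rightarrow> 'p) \<Rightarrow> bool" where
  "local_hom Q P h \<longleftrightarrow> {q \<in> carrier Q. h q \<in> Units P} = Units Q"

definition saturated_ideal :: "('p, 'd) monoid_scheme \<Rightarrow> 'p set \<Rightarrow> bool" where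
  "saturated_ideal P I \<longleftrightarrow>
     (\<forall>p\<in>carrier P. \<forall>n::nat. n > 0 \<and> p [^]\<^bsub>P\<^esub> n \<in> I \<longrightarrow> p \<in> I)"

definition reduced_hom ::
    "('q, 'c) monoid_scheme \<Rightarrow> ('p, 'd) monoid_scheme \<Rightarrow> ('q \<Rightarrow> 'p) \<Rightarrow> bool" where
  "reduced_hom Q P h \<longleftrightarrow>
     saturated_ideal P {h q \<otimes>\<^bsub>P\<^esub> p | q p. q \<in> carrier Q - Units Q \<and> p \<in> carrier P}"


section \<open>Modules over monoids\<close>

definition monoid_module ::
    "('q, 'c) monoid_scheme \<Rightarrow> ('q \<Rightarrow> 'x \<Rightarrow> 'x) \<Rightarrow> 'x set \<Rightarrow> bool" where
  "monoid_module Q act V \<longleftrightarrow>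
     (\<forall>q\<in>carrier Q. \<forall>x\<in>V. act q x \<in> V) \<and>
     (\<forall>x\<in>V. act \<one>\<^bsub>Q\<^esub> x = x) \<and>
     (\<forall>q\<in>carrier Q. \<forall>r\<in>carrier Q. \<forall>x\<in>V. act (q \<otimes>\<^bsub>Q\<^esub> r) x = act q (act r x))"

definition monoid_module_homs ::
    "('q, 'c) monoid_scheme \<Rightarrow> ('q \<Rightarrow> 'x \<Rightarrow> 'x) \<Rightarrow> 'x set \<Rightarrow> ('q \<Rightarrow> 'y \<Rightarrow> 'y) \<Rightarrow> 'y set \<Rightarrow>
     ('x \<Rightarrow> 'y) set" where
  "monoid_module_homs Q act V act' W =
     {f \<in> V \<rightarrow> W. \<forall>q\<in>carrier Q. \<forall>x\<in>V. f (act q x) = act' q (f x)}"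

definition monoid_module_basis ::
    "('q, 'c) monoid_scheme \<Rightarrow> ('q \<Rightarrow> 'x \<Rightarrow> 'x) \<Rightarrow> 'x set \<Rightarrow> 'x set \<Rightarrow> bool" where
  "monoid_module_basis Q act V S \<longleftrightarrow>
     S \<subseteq> V \<and> bij_betw (\<lambda>(q, s). act q s) (carrier Q \<times> S) V"

definition free_monoid_module ::
    "('q, 'c) monoid_scheme \<Rightarrow> ('q \<Rightarrow> 'x \<Rightarrow> 'x) \<Rightarrow> 'x set \<Rightarrow> bool" where
  "free_monoid_module Q act V \<longleftrightarrow>
     monoid_module Q act V \<and> (\<exists>S. monoid_module_basis Q act V S)"

locale small_category =
  fixes Obj :: "'o set" and Arr :: "'m set"
    and dom :: "'m \<Rightarrow> 'o" and cod :: "'m \<Rightarrow> 'o"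
    and ident :: "'o \<Rightarrow> 'm" and comp :: "'m \<Rightarrow> 'm \<Rightarrow> 'm"
  assumes dom_cod: "f \<in> Arr \<Longrightarrow> dom f \<in> Obj \<and> cod f \<in> Obj"
    and ident: "i \<in> Obj \<Longrightarrow> ident i \<in> Arr \<and> dom (ident i) = i \<and> cod (ident i) = i"
    and comp: "\<lbrakk>f \<in> Arr; g \<in> Arr; cod f = dom g\<rbrakk> \<Longrightarrow>
                 comp g f \<in> Arr \<and> dom (comp g f) = dom f \<and> cod (comp g f) = cod g"
    and comp_ident: "f \<in> Arr \<Longrightarrow> comp f (ident (dom f)) = f \<and> comp (ident (cod f)) f = f"
    and comp_assoc: "\<lbrakk>f \<in> Arr; g \<in> Arr; e \<in> Arr; cod f = dom g; cod g = dom e\<rbrakk> \<Longrightarrow>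
                 comp e (comp g f) = comp (comp e g) f"

locale filtered_category = small_category +
  assumes nonempty: "Obj \<noteq> {}"
    and cospan: "\<lbrakk>i \<in> Obj; j \<in> Obj\<rbrakk> \<Longrightarrow>
                 \<exists>f\<in>Arr. \<exists>g\<in>Arr. dom f = i \<and> dom g = j \<and> cod f = cod g"
    and coequalizing: "\<lbrakk>f \<in> Arr; g \<in> Arr; dom f = dom g; cod f = cod g\<rbrakk> \<Longrightarrow>
                 \<exists>e\<in>Arr. dom e = cod f \<and> comp e f = comp e g"

text \<open>
  \<open>V\<close> (with transition maps \<open>T\<close>) is a filtered diagram of free \<open>Q\<close>-modules and the cocone \<open>\<iota>\<close>
  exhibits \<open>M\<close> as its direct limit: the last two assumptions say that the map to \<open>M\<close> from the
  disjoint union of the \<open>V i\<close> modulo eventual equality is bijective.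
\<close>

locale filtered_limit_of_free_modules = filtered_category Obj Arr dom cod ident comp
  for Obj :: "'o set" and Arr :: "'m set"
    and dom :: "'m \<Rightarrow> 'o" and cod :: "'m \<Rightarrow> 'o"
    and ident :: "'o \<Rightarrow> 'm" and comp :: "'m \<Rightarrow> 'm \<Rightarrow> 'm" +
  fixes Q :: "('q, 'c) monoid_scheme"
    and actV :: "'o \<Rightarrow> 'q \<Rightarrow> 'x \<Rightarrow> 'x" and V :: "'o \<Rightarrow> 'x set" and T :: "'m \<Rightarrow> 'x \<Rightarrow> 'x"
    and actM :: "'q \<Rightarrow> 'y \<Rightarrow> 'y" and M :: "'y set" and \<iota> :: "'o \<Rightarrow> 'x \<Rightarrow> 'y"
  assumes free: "i \<in> Obj \<Longrightarrow> free_monoid_module Q (actV i) (V i)"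
    and limit_module: "monoid_module Q actM M"
    and transition: "f \<in> Arr \<Longrightarrow>
      T f \<in> monoid_module_homs Q (actV (dom f)) (V (dom f)) (actV (cod f)) (V (cod f))"
    and transition_ident: "\<lbrakk>i \<in> Obj; x \<in> V i\<rbrakk> \<Longrightarrow> T (ident i) x = x"
    and transition_comp: "\<lbrakk>f \<in> Arr; g \<in> Arr; cod f = dom g; x \<in> V (dom f)\<rbrakk> \<Longrightarrow>
      T (comp g f) x = T g (T f x)"
    and cocone: "i \<in> Obj \<Longrightarrow> \<iota> i \<in> monoid_module_homs Q (actV i) (V i) actM M"
    and cocone_natural: "\<lbrakk>f \<in> Arr; x \<in> V (dom f)\<rbrakk> \<Longrightarrow> \<iota> (cod f) (T f x) = \<iota> (dom f) x"
    and limit_surj: "y \<in> M \<Longrightarrow> \<exists>i\<in>Obj. \<exists>x\<in>V i. \<iota> i x = y"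
    and limit_inj: "\<lbrakk>i \<in> Obj; j \<in> Obj; x \<in> V i; x' \<in> V j; \<iota> i x = \<iota> j x'\<rbrakk> \<Longrightarrow>
      \<exists>f\<in>Arr. \<exists>g\<in>Arr. dom f = i \<and> dom g = j \<and> cod f = cod g \<and> T f x = T g x'"

text \<open>
  The types are large enough: if \<open>M\<close> is a filtered direct limit of free modules at all, then it is
  the direct limit over the filtered category of all finitely generated free modules over \<open>M\<close>. Its
  objects are tuples in \<open>M\<close> (an \<open>n\<close>-tuple being a map to \<open>M\<close> from the free module on \<open>{0..<n}\<close>),
  an arrow is given by its source, its target and the images in \<open>Q \<times> {0..<m}\<close> of the basis
  elements, and the modules themselves are carried by subsets of \<open>'q \<times> nat\<close>.
\<close>

definition flat_monoid_module ::
    "('q, 'c) monoid_scheme \<Rightarrow> ('q \<Rightarrow> 'y \<Rightarrow> 'y) \<Rightarrow> 'y set \<Rightarrow> bool" where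
  "flat_monoid_module Q actM M \<longleftrightarrow>
     (\<exists>(Obj :: 'y list set) (Arr :: ('y list \<times> ('q \<times> nat) list \<times> 'y list) set)
        dom cod ident comp actV (V :: 'y list \<Rightarrow> ('q \<times> nat) set) T \<iota>.
        filtered_limit_of_free_modules Obj Arr dom cod ident comp Q actV V T actM M \<iota>)"

abbreviation hom_action :: "('p, 'd) monoid_scheme \<Rightarrow> ('q \<Rightarrow> 'p) \<Rightarrow> 'q \<Rightarrow> 'p \<Rightarrow> 'p" where
  "hom_action P h \<equiv> (\<lambda>q p. h q \<otimes>\<^bsub>P\<^esub> p)"

definition flat_hom ::
    "('q, 'c) monoid_scheme \<Rightarrow> ('p, 'd) monoid_scheme \<Rightarrow> ('q \<Rightarrow> 'p) \<Rightarrow> bool" where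
  "flat_hom Q P h \<longleftrightarrow> flat_monoid_module Q (hom_action P h) (carrier P)"

definition finite_hom ::
    "('q, 'c) monoid_scheme \<Rightarrow> ('p, 'd) monoid_scheme \<Rightarrow> ('q \<Rightarrow> 'p) \<Rightarrow> bool" where
  "finite_hom Q P h \<longleftrightarrow>
     (\<exists>S. finite S \<and> S \<subseteq> carrier P \<and> carrier P = {h q \<otimes>\<^bsub>P\<^esub> s | q s. q \<in> carrier Q \<and> s \<in> S})"


section \<open>Monoid algebras\<close>

text \<open>An element of \<open>R[M]\<close> is its coefficient function, extended by \<open>0\<close> outside \<^term>\<open>carrier M\<close>.\<close>

definition monoid_algebra ::
    "('a, 'c) ring_scheme \<Rightarrow> ('p, 'd) monoid_scheme \<Rightarrow> ('p \<Rightarrow> 'a) ring" where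
  "monoid_algebra R M =
     \<lparr>carrier = {f. (\<forall>p. f p \<in> carrier R) \<and> finite {p. f p \<noteq> \<zero>\<^bsub>R\<^esub>} \<and> {p. f p \<noteq> \<zero>\<^bsub>R\<^esub>} \<subseteq> carrier M},
      monoid.mult = (\<lambda>f g p. finsum R (\<lambda>(x, y). f x \<otimes>\<^bsub>R\<^esub> g y)
                {(x, y). f x \<noteq> \<zero>\<^bsub>R\<^esub> \<and> g y \<noteq> \<zero>\<^bsub>R\<^esub> \<and> x \<otimes>\<^bsub>M\<^esub> y = p}),
      one = (\<lambda>p. if p = \<one>\<^bsub>M\<^esub> then \<one>\<^bsub>R\<^esub> else \<zero>\<^bsub>R\<^esub>),
      ring.zero = (\<lambda>p. \<zero>\<^bsub>R\<^esub>),
      ring.add = (\<lambda>f g p. f p \<oplus>\<^bsub>R\<^esub> g p)\<rparr>"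

definition monoid_algebra_map ::
    "('a, 'c) ring_scheme \<Rightarrow> ('q \<Rightarrow> 'p) \<Rightarrow> ('q \<Rightarrow> 'a) \<Rightarrow> 'p \<Rightarrow> 'a" where
  "monoid_algebra_map R h f p = finsum R f {q. f q \<noteq> \<zero>\<^bsub>R\<^esub> \<and> h q = p}"

definition char_zero :: "('a, 'c) ring_scheme \<Rightarrow> bool" where
  "char_zero R \<longleftrightarrow> (\<forall>n::nat. n > 0 \<longrightarrow> [n] \<cdot>\<^bsub>R\<^esub> \<one>\<^bsub>R\<^esub> \<noteq> \<zero>\<^bsub>R\<^esub>)"


section \<open>Finite etale covers of affine schemes\<close>

text \<open>In this section \<open>\<phi>\<close> is a homomorphism of commutative rings from \<open>A\<close> to \<open>B\<close>.\<close>

definition finite_ring_hom :: "'a ring \<Rightarrow> 'b ring \<Rightarrow> ('a \<Rightarrow> 'b) \<Rightarrow> bool" where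
  "finite_ring_hom A B \<phi> \<longleftrightarrow>
     (\<exists>S. finite S \<and> S \<subseteq> carrier B \<and>
        (\<forall>b\<in>carrier B. \<exists>c\<in>S \<rightarrow> carrier A. b = (\<Oplus>\<^bsub>B\<^esub>s\<in>S. \<phi> (c s) \<otimes>\<^bsub>B\<^esub> s)))"

definition exponent_monoid :: "nat \<Rightarrow> (nat \<Rightarrow> nat) monoid" where
  "exponent_monoid n =
     \<lparr>carrier = {e. \<forall>i\<ge>n. e i = 0}, monoid.mult = (\<lambda>e e' i. e i + e' i), one = (\<lambda>i. 0)\<rparr>"

definition polynomial_ring :: "'a ring \<Rightarrow> nat \<Rightarrow> ((nat \<Rightarrow> nat) \<Rightarrow> 'a) ring" where
  "polynomial_ring A n = monoid_algebra A (exponent_monoid n)"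

definition finitely_presented_ring_hom :: "'a ring \<Rightarrow> 'b ring \<Rightarrow> ('a \<Rightarrow> 'b) \<Rightarrow> bool" where
  "finitely_presented_ring_hom A B \<phi> \<longleftrightarrow>
     (\<exists>n \<psi> G. \<psi> \<in> ring_hom (polynomial_ring A n) B \<and>
        \<psi> ` carrier (polynomial_ring A n) = carrier B \<and>
        (\<forall>a\<in>carrier A. \<psi> (\<lambda>e. if e = (\<lambda>i. 0) then a else \<zero>\<^bsub>A\<^esub>) = \<phi> a) \<and>
        finite G \<and> G \<subseteq> carrier (polynomial_ring A n) \<and>
        a_kernel (polynomial_ring A n) B \<psi> = Idl\<^bsub>polynomial_ring A n\<^esub> G)"

text \<open>
  Tensor products of modules over \<open>A\<close>, as abelian groups. Module records inherit the fields
  \<^term>\<open>monoid.mult\<close> and \<^term>\<open>one\<close> from rings; these play no role for modules.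
\<close>

definition tensor_relations ::
    "'a ring \<Rightarrow> ('a, 'm) module \<Rightarrow> ('a, 'n) module \<Rightarrow> (('m \<times> 'n) \<Rightarrow>\<^sub>0 int) set" where
  "tensor_relations A M N = generate (free_Abelian_group (carrier M \<times> carrier N))
     ({frag_of (x \<oplus>\<^bsub>M\<^esub> x', y) - frag_of (x, y) - frag_of (x', y) | x x' y.
         x \<in> carrier M \<and> x' \<in> carrier M \<and> y \<in> carrier N} \<union>
      {frag_of (x, y \<oplus>\<^bsub>N\<^esub> y') - frag_of (x, y) - frag_of (x, y') | x y y'.
         x \<in> carrier M \<and> y \<in> carrier N \<and> y' \<in> carrier N} \<union>
      {frag_of (a \<odot>\<^bsub>M\<^esub> x, y) - frag_of (x, a \<odot>\<^bsub>N\<^esub> y) | a x y.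
         a \<in> carrier A \<and> x \<in> carrier M \<and> y \<in> carrier N})"

definition tensor_product ::
    "'a ring \<Rightarrow> ('a, 'm) module \<Rightarrow> ('a, 'n) module \<Rightarrow> (('m \<times> 'n) \<Rightarrow>\<^sub>0 int) set monoid" where
  "tensor_product A M N =
     free_Abelian_group (carrier M \<times> carrier N) Mod tensor_relations A M N"

text \<open>
  Flatness: for every submodule \<open>H\<close> of an \<open>A\<close>-module \<open>M\<close>, the map from \<open>H \<otimes> N\<close> to \<open>M \<otimes> N\<close> induced
  by the inclusion is injective. It sends the coset of an element modulo the relations for
  \<open>H \<otimes> N\<close> to its coset modulo the relations for \<open>M \<otimes> N\<close>. The test modules are carried by subsets
  of \<open>'a list\<close>, which up to isomorphism includes all finitely generated modules; it is well known
  that these suffice (even \<open>M = A\<close> does).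
\<close>

definition flat_module :: "'a ring \<Rightarrow> ('a, 'n) module \<Rightarrow> bool" where
  "flat_module A N \<longleftrightarrow>
     (\<forall>(M :: ('a, 'a list) module) H. module A M \<and> submodule H A M \<longrightarrow>
        inj_on (\<lambda>V. tensor_relations A M N
                      <#>\<^bsub>free_Abelian_group (carrier M \<times> carrier N)\<^esub> V)
               (carrier (tensor_product A (M\<lparr>carrier := H\<rparr>) N)))"

definition module_via :: "'b ring \<Rightarrow> ('a \<Rightarrow> 'b) \<Rightarrow> ('a, 'b) module" where
  "module_via B \<phi> =
     \<lparr>carrier = carrier B, monoid.mult = monoid.mult B, one = \<one>\<^bsub>B\<^esub>, ring.zero = \<zero>\<^bsub>B\<^esub>, ring.add = ring.add B,
      smult = (\<lambda>a b. \<phi> a \<otimes>\<^bsub>B\<^esub> b)\<rparr>"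

definition flat_ring_hom :: "'a ring \<Rightarrow> 'b ring \<Rightarrow> ('a \<Rightarrow> 'b) \<Rightarrow> bool" where
  "flat_ring_hom A B \<phi> \<longleftrightarrow> flat_module A (module_via B \<phi>)"

definition free_module :: "'b ring \<Rightarrow> 'x set \<Rightarrow> ('b, 'x \<Rightarrow> 'b) module" where
  "free_module B S =
     \<lparr>carrier = {f. (\<forall>x. f x \<in> carrier B) \<and> finite {x. f x \<noteq> \<zero>\<^bsub>B\<^esub>} \<and> {x. f x \<noteq> \<zero>\<^bsub>B\<^esub>} \<subseteq> S},
      monoid.mult = undefined, one = undefined,
      ring.zero = (\<lambda>x. \<zero>\<^bsub>B\<^esub>), ring.add = (\<lambda>f g x. f x \<oplus>\<^bsub>B\<^esub> g x),
      smult = (\<lambda>b f x. b \<otimes>\<^bsub>B\<^esub> f x)\<rparr>"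

definition free_generator :: "'b ring \<Rightarrow> 'x \<Rightarrow> 'x \<Rightarrow> 'b" where
  "free_generator B s = (\<lambda>x. if x = s then \<one>\<^bsub>B\<^esub> else \<zero>\<^bsub>B\<^esub>)"

text \<open>
  The module of Kaehler differentials of \<open>B\<close> over \<open>A\<close> is the quotient of the free \<open>B\<close>-module on
  symbols \<open>d b\<close>, for \<open>b\<close> in \<open>B\<close>, by the submodule generated by the following elements.
\<close>

definition kaehler_relations :: "'a ring \<Rightarrow> 'b ring \<Rightarrow> ('a \<Rightarrow> 'b) \<Rightarrow> ('b \<Rightarrow> 'b) set" where
  "kaehler_relations A B \<phi> =
     (let F = free_module B (carrier B); d = free_generator B in
      {d (b \<oplus>\<^bsub>B\<^esub> c) \<ominus>\<^bsub>F\<^esub> (d b \<oplus>\<^bsub>F\<^esub> d c) | b c. b \<in> carrier B \<and> c \<in> carrier B} \<union>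
      {d (b \<otimes>\<^bsub>B\<^esub> c) \<ominus>\<^bsub>F\<^esub> (b \<odot>\<^bsub>F\<^esub> d c \<oplus>\<^bsub>F\<^esub> c \<odot>\<^bsub>F\<^esub> d b) | b c. b \<in> carrier B \<and> c \<in> carrier B} \<union>
      {d (\<phi> a) | a. a \<in> carrier A})"

definition kaehler_submodule :: "'a ring \<Rightarrow> 'b ring \<Rightarrow> ('a \<Rightarrow> 'b) \<Rightarrow> ('b \<Rightarrow> 'b) set" where
  "kaehler_submodule A B \<phi> =
     \<Inter>{H. submodule H B (free_module B (carrier B)) \<and> kaehler_relations A B \<phi> \<subseteq> H}"

text \<open>The vanishing of the module of Kaehler differentials:\<close>

definition unramified_ring_hom :: "'a ring \<Rightarrow> 'b ring \<Rightarrow> ('a \<Rightarrow> 'b) \<Rightarrow> bool" where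
  "unramified_ring_hom A B \<phi> \<longleftrightarrow>
     carrier (free_module B (carrier B)) = kaehler_submodule A B \<phi>"

definition etale_ring_hom :: "'a ring \<Rightarrow> 'b ring \<Rightarrow> ('a \<Rightarrow> 'b) \<Rightarrow> bool" where
  "etale_ring_hom A B \<phi> \<longleftrightarrow>
     finitely_presented_ring_hom A B \<phi> \<and> flat_ring_hom A B \<phi> \<and> unramified_ring_hom A B \<phi>"

definition Spec_surjective :: "'a ring \<Rightarrow> 'b ring \<Rightarrow> ('a \<Rightarrow> 'b) \<Rightarrow> bool" where
  "Spec_surjective A B \<phi> \<longleftrightarrow>
     (\<forall>I. primeideal I A \<longrightarrow> (\<exists>J. primeideal J B \<and> {a \<in> carrier A. \<phi> a \<in> J} = I))"

text \<open>A map of affine schemes is a finite etale cover iff its ring homomorphism is as follows.\<close>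

definition finite_etale_cover :: "'a ring \<Rightarrow> 'b ring \<Rightarrow> ('a \<Rightarrow> 'b) \<Rightarrow> bool" where
  "finite_etale_cover A B \<phi> \<longleftrightarrow>
     \<phi> \<in> ring_hom A B \<and>
     finite_ring_hom A B \<phi> \<and> etale_ring_hom A B \<phi> \<and> Spec_surjective A B \<phi>"

text \<open>
  Surjectivity is not automatic: for the map \<open>h\<close> from the group of order two to the trivial monoid
  and \<open>k\<close> of characteristic other than two, \<open>k[h]\<close> is a projection \<open>k \<times> k \<rightarrow> k\<close>, which is finite and
  etale although \<open>h\<close> is not injective.
\<close>

definition monoid_algebra_finite_etale_cover ::
    "'k ring \<Rightarrow> ('q, 'c) monoid_scheme \<Rightarrow> ('p, 'd) monoid_scheme \<Rightarrow> ('q \<Rightarrow> 'p) \<Rightarrow> bool" where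
  "monoid_algebra_finite_etale_cover k Q P h \<longleftrightarrow>
     finite_etale_cover (monoid_algebra k Q) (monoid_algebra k P) (monoid_algebra_map k h)"

end

theory Submission
  imports Defs
begin

text \<open>
  All conditions are compared with the existence of a finite basis \<open>S\<close> of \<open>P\<close> over \<open>Q\<close> that consists
  of units. Such an \<open>S\<close> represents the cosets of \<open>Q\<^sup>*\<close> in \<open>P\<^sup>*\<close>, which gives the conditions on
  sharpenings, pushouts and faces, and the elements \<open>x^s\<close> for \<open>s\<close> in \<open>S\<close> form a basis of \<open>k[P]\<close> over
  \<open>k[Q]\<close>. Some power of every \<open>x^s\<close> is in \<open>k[Q]\<close>, and so \<open>d x^s = 0\<close> in characteristic zero.

  Conversely, flatness of \<open>P\<close> over \<open>Q\<close>, or faithful flatness of \<open>k[P]\<close> over \<open>k[Q]\<close>, implies that \<open>h\<close> is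
  injective and that \<open>q + p = q' + p'\<close> only if \<open>p = r + x\<close> and \<open>p' = r' + x\<close> for some \<open>x\<close> in \<open>P\<close> and
  \<open>r\<close>, \<open>r'\<close> in \<open>Q\<close> with \<open>q + r = q' + r'\<close>; then a generating set of minimal cardinality is a basis. A
  basis element that is not a unit contradicts reducedness. It also contradicts the vanishing of the
  Kaehler differentials: taking the coefficients at the nonunits that are neither products of two
  nonunits nor multiples of nonunits of \<open>Q\<close> is a derivation of \<open>k[P]\<close> over \<open>k[Q]\<close>.
\<close>

section \<open>Bases of a monoid over another\<close>

text \<open>Injectivity into the groupification means that both monoids are cancellative, and this
  is used throughout. Flatness of \<open>k[P]\<close> over \<open>k[Q]\<close> does not by itself
  make \<open>h\<close> injective, as a group of order two mapping to the trivial group shows.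
  Surjectivity on spectra has to enter: if \<open>h q = h q'\<close>, flatness makes the annihilator
  of \<open>x^q - x^q'\<close> generate the unit ideal of \<open>k[P]\<close>, whereas a prime of
  \<open>k[Q]\<close> over this annihilator must lift. The passage back from one field has to work
  in every characteristic, so it cannot divide by integers; the derivation therefore multiplies each
  monomial by 0 or 1 instead of by an exponent. Flatness of modules is available only through
  generators and relations of tensor products. It is tested on ideals of \<open>k[Q]\<close>, and
  each conclusion is drawn by evaluating a balanced map on two equal tensors. The conditions on all
  fields of characteristic zero carried by \<open>'k\<close> have content only if there is such a
  field, which is why the type is infinite: it then carries a copy of the rational numbers.\<close>

lemma comm_monoid_cancel_of_fine:
  assumes "fine_monoid M"
  shows "comm_monoid_cancel M"
proof -
  interpret comm_monoid M using assms by (simp add: fine_monoid_def)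
  have "a = b" if eq: "a \<otimes>\<^bsub>M\<^esub> c = b \<otimes>\<^bsub>M\<^esub> c" and abc: "a \<in> carrier M" "b \<in> carrier M" "c \<in> carrier M"
    for a b c
  proof -
    have sub: "groupification_map M a \<subseteq> groupification_map M b"
      if eq: "a \<otimes>\<^bsub>M\<^esub> c = b \<otimes>\<^bsub>M\<^esub> c" and "a \<in> carrier M" "b \<in> carrier M" for a b
    proof
      fix z assume "z \<in> groupification_map M a"
      then obtain x y s where z: "z = (x, y)" and x: "x \<in> carrier M" and y: "y \<in> carrier M"
        and s: "s \<in> carrier M" and xy: "s \<otimes>\<^bsub>M\<^esub> (a \<otimes>\<^bsub>M\<^esub> y) = s \<otimes>\<^bsub>M\<^esub> (x \<otimes>\<^bsub>M\<^esub> \<one>\<^bsub>M\<^esub>)"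
        by (auto simp: groupification_map_def groupification_cong_def)
      \<comment> \<open>The witness \<open>s\<close> for the class of \<open>a\<close> is enlarged
        to \<open>s \<otimes> c\<close>; after multiplication by \<open>c\<close> the elements
        \<open>a\<close> and \<open>b\<close> can be exchanged.\<close>
      have "(s \<otimes>\<^bsub>M\<^esub> c) \<otimes>\<^bsub>M\<^esub> (b \<otimes>\<^bsub>M\<^esub> y) = s \<otimes>\<^bsub>M\<^esub> (b \<otimes>\<^bsub>M\<^esub> c) \<otimes>\<^bsub>M\<^esub> y"
        using that(2,3) x y s abc by (simp add: m_ac)
      also have "\<dots> = s \<otimes>\<^bsub>M\<^esub> (a \<otimes>\<^bsub>M\<^esub> c) \<otimes>\<^bsub>M\<^esub> y"
        by (simp only: eq)
      also have "\<dots> = c \<otimes>\<^bsub>M\<^esub> (s \<otimes>\<^bsub>M\<^esub> (a \<otimes>\<^bsub>M\<^esub> y))"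
        using that(2,3) x y s abc by (simp add: m_ac)
      also have "\<dots> = (s \<otimes>\<^bsub>M\<^esub> c) \<otimes>\<^bsub>M\<^esub> (x \<otimes>\<^bsub>M\<^esub> \<one>\<^bsub>M\<^esub>)"
        unfolding xy using that x y s abc by (simp add: m_ac)
      finally show "z \<in> groupification_map M b"
        using that x y s abc z unfolding groupification_map_def groupification_cong_def by auto
    qed
    have "groupification_map M a = groupification_map M b"
      using sub [of a b] sub [of b a] eq abc by auto
    then show "a = b"
      using assms abc by (auto simp: fine_monoid_def inj_on_def)
  qed
  then show ?thesis
    by (intro comm_monoid_cancelI) unfold_locales
qed

locale cancel_monoid_map =
  Q: comm_monoid_cancel Q + P: comm_monoid_cancel P
  for Q :: "'q monoid" and P :: "'p monoid" (structure) +
  fixes h :: "'q \<Rightarrow> 'p"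
  assumes hom: "h \<in> monoid_homs Q P"
begin

abbreviation basis :: "'p set \<Rightarrow> bool" where
  "basis S \<equiv> monoid_module_basis Q (hom_action P h) (carrier P) S"

definition unit_basis :: "'p set \<Rightarrow> bool" where
  "unit_basis S \<longleftrightarrow> finite S \<and> S \<subseteq> Units P \<and> basis S"

lemma h_closed [simp, intro]: "q \<in> carrier Q \<Longrightarrow> h q \<in> carrier P"
  using hom by (auto simp: monoid_homs_def hom_def)

lemma h_mult: "\<lbrakk>q \<in> carrier Q; r \<in> carrier Q\<rbrakk> \<Longrightarrow> h (q \<otimes>\<^bsub>Q\<^esub> r) = h q \<otimes> h r"
  using hom by (auto simp: monoid_homs_def hom_def)

lemma h_one [simp]: "h \<one>\<^bsub>Q\<^esub> = \<one>"
  using hom by (auto simp: monoid_homs_def)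

lemma h_mult_assoc:
  "\<lbrakk>q \<in> carrier Q; r \<in> carrier Q; p \<in> carrier P\<rbrakk> \<Longrightarrow> h (q \<otimes>\<^bsub>Q\<^esub> r) \<otimes> p = h q \<otimes> (h r \<otimes> p)"
  by (simp add: h_mult P.m_assoc)

lemma h_Units: "q \<in> Units Q \<Longrightarrow> h q \<in> Units P"
  by (metis Q.Units_closed Q.Units_inv_closed Q.Units_r_inv P.Units_one_closed P.unit_factor
      h_closed h_mult h_one)

lemma h_inv: "q \<in> Units Q \<Longrightarrow> h (inv\<^bsub>Q\<^esub> q) \<otimes> h q = \<one>"
  by (metis Q.Units_closed Q.Units_inv_closed Q.Units_l_inv h_mult h_one)

lemma h_pow: "q \<in> carrier Q \<Longrightarrow> h (q [^]\<^bsub>Q\<^esub> (n::nat)) = h q [^] n"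
  by (induction n) (auto simp: h_mult)

lemma basisI:
  assumes "S \<subseteq> carrier P"
    and "\<And>p. p \<in> carrier P \<Longrightarrow> \<exists>q\<in>carrier Q. \<exists>s\<in>S. p = h q \<otimes> s"
    and "\<And>q q' s s'. \<lbrakk>q \<in> carrier Q; q' \<in> carrier Q; s \<in> S; s' \<in> S; h q \<otimes> s = h q' \<otimes> s'\<rbrakk>
      \<Longrightarrow> q = q' \<and> s = s'"
  shows "basis S"
  unfolding monoid_module_basis_def bij_betw_def
proof (intro conjI)
  show "inj_on (\<lambda>(q, s). h q \<otimes> s) (carrier Q \<times> S)"
    using assms(3) by (auto simp: inj_on_def)
  show "(\<lambda>(q, s). h q \<otimes> s) ` (carrier Q \<times> S) = carrier P"
    using assms(1,2) by (auto simp: image_iff) 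
qed (fact assms(1))

lemma basis_carrier: "basis S \<Longrightarrow> s \<in> S \<Longrightarrow> s \<in> carrier P"
  by (auto simp: monoid_module_basis_def)

lemma basis_decomp:
  assumes "basis S" "p \<in> carrier P"
  obtains q s where "q \<in> carrier Q" "s \<in> S" "p = h q \<otimes> s"
proof -
  have "p \<in> (\<lambda>(q, s). h q \<otimes> s) ` (carrier Q \<times> S)"
    using assms by (simp add: monoid_module_basis_def bij_betw_def)
  then show ?thesis using that by auto
qed

lemma basis_unique:
  assumes "basis S" "q \<in> carrier Q" "q' \<in> carrier Q" "s \<in> S" "s' \<in> S" "h q \<otimes> s = h q' \<otimes> s'"
  shows "q = q' \<and> s = s'"
proof -
  have "inj_on (\<lambda>(q, s). h q \<otimes> s) (carrier Q \<times> S)"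
    using assms by (simp add: monoid_module_basis_def bij_betw_def)
  then show ?thesis
    using assms(2-) by (auto dest!: inj_onD [where x = "(q, s)" and y = "(q', s')"])
qed

lemma basis_obtain:
  assumes "basis S" obtains s where "s \<in> S" "s \<in> carrier P"
  using basis_decomp [OF assms P.one_closed] basis_carrier [OF assms] by metis

text \<open>A basis is nonempty, and a single basis element already separates the scalars.\<close>

lemma basis_inj:
  assumes "basis S" shows "inj_on h (carrier Q)"
proof (rule inj_onI)
  fix q q' assume "q \<in> carrier Q" "q' \<in> carrier Q" "h q = h q'"
  then show "q = q'"
    using basis_obtain [OF assms] basis_unique [OF assms] by metis
qed

text \<open>Expand the inverse of \<open>h q\<close> times a basis element \<open>s\<close> as
  \<open>h a \<otimes> t\<close>. Multiplying back by \<open>h q\<close> gives two expansions of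
  \<open>s\<close>, and comparison of their coefficients shows that \<open>a\<close> is inverse to
  \<open>q\<close>.\<close>

lemma basis_local:
  assumes "basis S" "q \<in> carrier Q" "h q \<in> Units P"
  shows "q \<in> Units Q"
proof -
  obtain s where s: "s \<in> S" "s \<in> carrier P" using basis_obtain [OF assms(1)] .
  obtain a t where a: "a \<in> carrier Q" and t: "t \<in> S" and at: "inv h q \<otimes> s = h a \<otimes> t"
    using basis_decomp [OF assms(1)] assms(3) s by (metis P.Units_inv_closed P.m_closed)
  have "h (q \<otimes>\<^bsub>Q\<^esub> a) \<otimes> t = h q \<otimes> (inv h q \<otimes> s)"
    using a t assms basis_carrier by (simp add: h_mult_assoc at)
  also have "\<dots> = h \<one>\<^bsub>Q\<^esub> \<otimes> s"
    using s assms by (simp flip: P.m_assoc)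
  finally have "q \<otimes>\<^bsub>Q\<^esub> a = \<one>\<^bsub>Q\<^esub>"
    using basis_unique [OF assms(1)] a t s assms(2) by blast
  then show ?thesis
    using Q.unit_factor [of q a] a assms(2) by simp
qed

lemma local_hom_if_basis: "basis S \<Longrightarrow> local_hom Q P h"
  using basis_local h_Units by (auto simp: local_hom_def)

text \<open>Factors of a unit are units in a commutative monoid, and locality carries this back to
  \<open>Q\<close>.\<close>

lemma basis_unit_decomp:
  assumes "basis S" "u \<in> Units P" "q \<in> carrier Q" "s \<in> S" "u = h q \<otimes> s"
  shows "q \<in> Units Q" "s \<in> Units P"
proof -
  have "h q \<in> Units P" "s \<in> Units P"
    using assms P.unit_factor [of "h q" s] P.unit_factor [of s "h q"] basis_carrier [OF assms(1)]
    by (auto simp: P.m_comm)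
  then show "q \<in> Units Q" "s \<in> Units P"
    using basis_local assms by auto
qed

lemma finite_hom_if_basis:
  assumes "basis S" "finite S" shows "finite_hom Q P h"
  unfolding finite_hom_def
proof (intro exI conjI)
  show "carrier P = {h q \<otimes> s |q s. q \<in> carrier Q \<and> s \<in> S}"
    using basis_decomp [OF assms(1)] basis_carrier [OF assms(1)] by blast
qed (use assms basis_carrier in auto)


text \<open>Expanding an element of one basis over the other and back again gives a second expansion
  of it over its own basis, so the coefficients are units. Corresponding elements of the two bases
  thus differ by units of \<open>Q\<close>, which gives both the inclusion in \<open>Units P\<close>
  and the bijection.\<close>

lemma unit_basis_contains_bases:
  assumes S: "unit_basis S" and S': "basis S'"
  shows "S' \<subseteq> Units P" "\<exists>b. bij_betw b S S'"
proof -
  have S1: "basis S" and SU: "S \<subseteq> Units P" using S by (auto simp: unit_basis_def)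
  have ex: "\<exists>q\<in>Units Q. \<exists>s\<in>S. s' = h q \<otimes> s" if ins': "s' \<in> S'" for s'
  proof -
    obtain q s where q: "q \<in> carrier Q" and s: "s \<in> S" and s': "s' = h q \<otimes> s"
      using basis_decomp [OF S1 basis_carrier [OF S' ins']] .
    have sc: "s \<in> carrier P" using s SU by auto
    obtain r t where r: "r \<in> carrier Q" and t: "t \<in> S'" and st: "s = h r \<otimes> t"
      using basis_decomp [OF S' sc] .
    have "h \<one>\<^bsub>Q\<^esub> \<otimes> s' = h (q \<otimes>\<^bsub>Q\<^esub> r) \<otimes> t"
      using s' st q r basis_carrier [OF S'] t that by (simp add: h_mult_assoc)
    then have "q \<otimes>\<^bsub>Q\<^esub> r = \<one>\<^bsub>Q\<^esub>"
      using basis_unique [OF S', of "\<one>\<^bsub>Q\<^esub>" "q \<otimes>\<^bsub>Q\<^esub> r" s' t] q r t that by auto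
    then have "q \<in> Units Q" using Q.unit_factor [of q r] q r by auto
    then show ?thesis using s s' by auto
  qed
  show sub: "S' \<subseteq> Units P"
    using ex h_Units SU by (metis P.Units_m_closed subsetD subsetI)
  \<comment> \<open>In this direction the coefficient is a unit because it divides the unit
    \<open>s\<close>.\<close>
  have ex': "\<exists>s'\<in>S'. \<exists>q\<in>Units Q. s = h q \<otimes> s'" if s: "s \<in> S" for s
  proof -
    obtain q s' where "q \<in> carrier Q" "s' \<in> S'" "s = h q \<otimes> s'"
      using basis_decomp [OF S' basis_carrier [OF S1 s]] .
    moreover then have "q \<in> Units Q"
      using basis_unit_decomp [OF S'] s SU by blast
    ultimately show ?thesis by blast
  qed
  then obtain b where b: "\<And>s. s \<in> S \<Longrightarrow> b s \<in> S' \<and> (\<exists>q\<in>Units Q. s = h q \<otimes> b s)"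
    by metis
  have swap: "t = h (inv\<^bsub>Q\<^esub> q) \<otimes> s" if "s = h q \<otimes> t" "q \<in> Units Q" "t \<in> carrier P" for q s t
    using that by (metis P.l_one P.m_assoc Q.Units_closed Q.Units_inv_closed h_closed h_inv)
  have "bij_betw b S S'"
    unfolding bij_betw_def
  proof
    show "inj_on b S"
    proof (rule inj_onI)
      fix s t assume s: "s \<in> S" and t: "t \<in> S" and eq: "b s = b t"
      obtain q r where q: "q \<in> Units Q" and r: "r \<in> Units Q"
        and sq: "s = h q \<otimes> b s" and tr: "t = h r \<otimes> b s"
        using b s t eq by metis
      have bs: "b s \<in> carrier P" using b s sub by auto
      \<comment> \<open>Both \<open>s\<close> and \<open>t\<close> are unit multiples of
        \<open>b s\<close>. Eliminating it relates them by a unit of \<open>Q\<close>, so they agree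
        by uniqueness.\<close>
      have "h (q \<otimes>\<^bsub>Q\<^esub> inv\<^bsub>Q\<^esub> r) \<otimes> t = h \<one>\<^bsub>Q\<^esub> \<otimes> s"
        using q r s t SU sq swap [OF tr r bs] by (auto simp: h_mult_assoc Q.Units_closed P.Units_closed)
      then show "s = t"
        using basis_unique [OF S1] q r s t by (metis Q.Units_closed Q.Units_inv_closed Q.m_closed Q.one_closed)
    qed
    show "b ` S = S'"
    proof
      show "b ` S \<subseteq> S'" using b by auto
      show "S' \<subseteq> b ` S"
      proof
        fix s' assume s': "s' \<in> S'"
        then obtain q s where q: "q \<in> Units Q" and s: "s \<in> S" and sq: "s' = h q \<otimes> s"
          using ex by blast
        obtain r where r: "r \<in> Units Q" and sr: "s = h r \<otimes> b s" using b s by blast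
        have "h (q \<otimes>\<^bsub>Q\<^esub> r) \<otimes> b s = h \<one>\<^bsub>Q\<^esub> \<otimes> s'"
          using sq sr q r s b sub SU s' by (auto simp: h_mult_assoc Q.Units_closed P.Units_closed subset_iff)
        then have "s' = b s"
          using basis_unique [OF S'] q r s s' b
          by (metis Q.Units_closed Q.m_closed Q.one_closed)
        then show "s' \<in> b ` S" using s by auto
      qed
    qed
  qed
  then show "\<exists>b. bij_betw b S S'" by blast
qed

end

section \<open>Flatness and freeness\<close>

text \<open>Pigeonhole, for finding two powers of an element that lie over the same basis
  element.\<close>

lemma infinite_sequence_repeats:
  assumes "finite S" "\<And>n::nat. f n \<in> S"
  obtains m n where "m < n" "f m = f n"
proof -
  have "range f \<subseteq> S" using assms(2) by blast
  then have "\<not> inj f"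
    using assms(1) range_inj_infinite finite_subset by blast
  then obtain m n where "m \<noteq> n" "f m = f n" by (auto simp: inj_def)
  then show ?thesis using that [of m n] that [of n m] by (cases "m < n") auto
qed

context cancel_monoid_map
begin

text \<open>
  A consequence of flatness, of \<open>P\<close> over \<open>Q\<close> or of the monoid algebras, that is strong enough to
  make a finite \<open>P\<close> free over \<open>Q\<close>.
\<close>

definition equationally_flat :: bool where
  "equationally_flat \<longleftrightarrow>
     inj_on h (carrier Q) \<and>
     (\<forall>q\<in>carrier Q. \<forall>q'\<in>carrier Q. \<forall>p\<in>carrier P. \<forall>p'\<in>carrier P. h q \<otimes> p = h q' \<otimes> p' \<longrightarrow>
        (\<exists>r\<in>carrier Q. \<exists>r'\<in>carrier Q. \<exists>x\<in>carrier P. p = h r \<otimes> x \<and> p' = h r' \<otimes> x))"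

text \<open>Elements and relations of a filtered limit already occur in one of the free modules.
  There, two elements with a common multiple lie over the same basis element, and the image of this
  basis element in \<open>P\<close> is the common divisor \<open>x\<close>.\<close>

lemma equationally_flat_if_flat:
  assumes "flat_hom Q P h"
  shows equationally_flat
proof -
  obtain Obj :: "'p list set" and Arr :: "('p list \<times> ('q \<times> nat) list \<times> 'p list) set"
    and dom cod ident comp actV and V :: "'p list \<Rightarrow> ('q \<times> nat) set" and T \<iota>
    where L: "filtered_limit_of_free_modules Obj Arr dom cod ident comp Q actV V T
                (hom_action P h) (carrier P) \<iota>"
    using assms unfolding flat_hom_def flat_monoid_module_def by blast
  interpret L: filtered_limit_of_free_modules Obj Arr dom cod ident comp Q actV V T
    "hom_action P h" "carrier P" \<iota> by (fact L)
  have act: "actV i q x \<in> V i" if "i \<in> Obj" "q \<in> carrier Q" "x \<in> V i" for i q x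
    using L.free [OF that(1)] that by (auto simp: free_monoid_module_def monoid_module_def)
  have act_mult: "actV i (q \<otimes>\<^bsub>Q\<^esub> r) x = actV i q (actV i r x)"
    if "i \<in> Obj" "q \<in> carrier Q" "r \<in> carrier Q" "x \<in> V i" for i q r x
    using L.free [OF that(1)] that by (auto simp: free_monoid_module_def monoid_module_def)
  have free: "\<exists>r\<in>carrier Q. \<exists>r'\<in>carrier Q. \<exists>b\<in>V i. x = actV i r b \<and> x' = actV i r' b \<and>
      q \<otimes>\<^bsub>Q\<^esub> r = q' \<otimes>\<^bsub>Q\<^esub> r'"
    if i: "i \<in> Obj" and q: "q \<in> carrier Q" "q' \<in> carrier Q" and x: "x \<in> V i" "x' \<in> V i"
      and eq: "actV i q x = actV i q' x'" for i q q' x x'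
  proof -
    obtain S where S: "S \<subseteq> V i" and bij: "bij_betw (\<lambda>(q, s). actV i q s) (carrier Q \<times> S) (V i)"
      using L.free [OF i] by (auto simp: free_monoid_module_def monoid_module_basis_def)
    have "\<exists>r\<in>carrier Q. \<exists>b\<in>S. x = actV i r b" if "x \<in> V i" for x
    proof -
      have "x \<in> (\<lambda>(q, s). actV i q s) ` (carrier Q \<times> S)"
        using bij_betw_imp_surj_on [OF bij] that by blast
      then show ?thesis by auto
    qed
    then obtain r b r' b' where r: "r \<in> carrier Q" "b \<in> S" "x = actV i r b"
      and r': "r' \<in> carrier Q" "b' \<in> S" "x' = actV i r' b'"
      using x by metis
    have "actV i (q \<otimes>\<^bsub>Q\<^esub> r) b = actV i (q' \<otimes>\<^bsub>Q\<^esub> r') b'"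
      using eq r r' q S act_mult [OF i] by (metis subsetD)
    then have "(q \<otimes>\<^bsub>Q\<^esub> r, b) = (q' \<otimes>\<^bsub>Q\<^esub> r', b')"
      using r r' q by (intro inj_onD [OF bij_betw_imp_inj_on [OF bij]]) auto
    then show ?thesis using r r' S by blast
  qed
  have \<iota>_closed: "\<iota> i x \<in> carrier P" if "i \<in> Obj" "x \<in> V i" for i x
    using L.cocone that by (auto simp: monoid_module_homs_def)
  have \<iota>_act: "\<iota> i (actV i q x) = h q \<otimes> \<iota> i x" if "i \<in> Obj" "q \<in> carrier Q" "x \<in> V i" for i q x
    using L.cocone that by (auto simp: monoid_module_homs_def)
  have T_closed: "T f x \<in> V (cod f)" if "f \<in> Arr" "x \<in> V (dom f)" for f x
    using L.transition [OF that(1)] that by (auto simp: monoid_module_homs_def)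
  have T_act: "T f (actV (dom f) q x) = actV (cod f) q (T f x)"
    if "f \<in> Arr" "x \<in> V (dom f)" "q \<in> carrier Q" for f q x
    using L.transition [OF that(1)] that by (auto simp: monoid_module_homs_def)
  show ?thesis
    unfolding equationally_flat_def
  proof (intro conjI ballI impI inj_onI)
    fix q q' assume q: "q \<in> carrier Q" "q' \<in> carrier Q" and eq: "h q = h q'"
    \<comment> \<open>Injectivity is tested on an element over \<open>\<one>\<close>: its multiples
      by \<open>q\<close> and \<open>q'\<close> have the images \<open>h q\<close> and
      \<open>h q'\<close>.\<close>
    obtain i x where i: "i \<in> Obj" and x: "x \<in> V i" and ix: "\<iota> i x = \<one>"
      using L.limit_surj [OF P.one_closed] by auto
    have "\<iota> i (actV i q x) = \<iota> i (actV i q' x)"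
      using i x ix q eq by (simp add: \<iota>_act)
    then obtain f g where f: "f \<in> Arr" "dom f = i" and g: "g \<in> Arr" "dom g = i" "cod f = cod g"
      and fg: "T f (actV i q x) = T g (actV i q' x)"
      using L.limit_inj i x q act by metis
    \<comment> \<open>Equality in the limit may compare \<open>x\<close> along two different arrows
      \<open>f\<close> and \<open>g\<close>. Coequalizing them makes both sides multiples of one
      element of \<open>V (cod e)\<close>.\<close>
    obtain e where e: "e \<in> Arr" "dom e = cod f" and efg: "comp e f = comp e g"
      using L.coequalizing f g by metis
    have y: "T (comp e f) (actV i r x) = actV (cod e) r (T (comp e f) x)" if "r \<in> carrier Q" for r
      using T_act [of "comp e f" x r] L.comp [OF f(1) e(1)] f g e x that by metis
    have "T e (T f (actV i q x)) = T e (T g (actV i q' x))" by (simp add: fg)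
    then have "T (comp e f) (actV i q x) = T (comp e f) (actV i q' x)"
      using L.transition_comp f g e x act i q efg by metis
    then have "actV (cod e) q (T (comp e f) x) = actV (cod e) q' (T (comp e f) x)"
      using y q by simp
    moreover have "T (comp e f) x \<in> V (cod e)" "cod e \<in> Obj"
      using T_closed [of "comp e f"] L.comp [OF f(1) e(1)] L.dom_cod e f x by metis+
    ultimately have *: "\<exists>r\<in>carrier Q. \<exists>r'\<in>carrier Q. \<exists>b\<in>V (cod e).
        T (comp e f) x = actV (cod e) r b \<and> T (comp e f) x = actV (cod e) r' b \<and>
        q \<otimes>\<^bsub>Q\<^esub> r = q' \<otimes>\<^bsub>Q\<^esub> r'"
      using free q by blast
    then obtain r r' b where r: "r \<in> carrier Q" "r' \<in> carrier Q" "b \<in> V (cod e)"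
      "actV (cod e) r b = actV (cod e) r' b" "q \<otimes>\<^bsub>Q\<^esub> r = q' \<otimes>\<^bsub>Q\<^esub> r'" by metis
    have "h r = h r'"
      using \<iota>_act \<iota>_closed \<open>cod e \<in> Obj\<close> r P.r_cancel h_closed by metis
    \<comment> \<open>The multiples of a basis element \<open>c\<close> determine their scalars.
      Writing \<open>b\<close> as a multiple of \<open>c\<close> turns the equality of the multiples
      of \<open>b\<close> by \<open>r\<close> and \<open>r'\<close> into an equation in
      \<open>Q\<close>, where the coefficient of \<open>b\<close> cancels.\<close>
    obtain c where c: "c \<in> V (cod e)" "\<exists>a\<in>carrier Q. b = actV (cod e) a c"
        "\<forall>s\<in>carrier Q. \<forall>s'\<in>carrier Q. actV (cod e) s c = actV (cod e) s' c \<longrightarrow> s = s'"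
    proof -
      obtain S where S: "S \<subseteq> V (cod e)"
        and bij: "bij_betw (\<lambda>(q, s). actV (cod e) q s) (carrier Q \<times> S) (V (cod e))"
        using L.free [OF \<open>cod e \<in> Obj\<close>] by (auto simp: free_monoid_module_def monoid_module_basis_def)
      have "b \<in> (\<lambda>(q, s). actV (cod e) q s) ` (carrier Q \<times> S)"
        using bij_betw_imp_surj_on [OF bij] r(3) by blast
      then obtain a c where "a \<in> carrier Q" "c \<in> S" "b = actV (cod e) a c"
        by auto
      moreover have "s = s'" if "s \<in> carrier Q" "s' \<in> carrier Q" "actV (cod e) s c = actV (cod e) s' c" for s s'
        using inj_onD [OF bij_betw_imp_inj_on [OF bij], of "(s, c)" "(s', c)"] that \<open>c \<in> S\<close> by auto
      ultimately show ?thesis using that S by blast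
    qed
    then obtain a where a: "a \<in> carrier Q" "b = actV (cod e) a c" by blast
    have "actV (cod e) (r \<otimes>\<^bsub>Q\<^esub> a) c = actV (cod e) (r' \<otimes>\<^bsub>Q\<^esub> a) c"
      using r a c act_mult [OF \<open>cod e \<in> Obj\<close>] by metis
    then have "r \<otimes>\<^bsub>Q\<^esub> a = r' \<otimes>\<^bsub>Q\<^esub> a" using c(3) r a by blast
    then have "r = r'" using r a Q.r_cancel by blast
    then show "q = q'" using r q Q.r_cancel by blast
  next
    fix q q' p p'
    assume q: "q \<in> carrier Q" "q' \<in> carrier Q" and p: "p \<in> carrier P" "p' \<in> carrier P"
      and eq: "h q \<otimes> p = h q' \<otimes> p'"
    obtain i x where i: "i \<in> Obj" "x \<in> V i" "\<iota> i x = p" using L.limit_surj [OF p(1)] by auto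
    obtain j x' where j: "j \<in> Obj" "x' \<in> V j" "\<iota> j x' = p'" using L.limit_surj [OF p(2)] by auto
    have "\<iota> i (actV i q x) = \<iota> j (actV j q' x')"
      using i j q eq by (simp add: \<iota>_act)
    then obtain f g where f: "f \<in> Arr" "dom f = i" and g: "g \<in> Arr" "dom g = j" "cod f = cod g"
      and fg: "T f (actV i q x) = T g (actV j q' x')"
      using L.limit_inj i j q act by metis
    have k: "cod f \<in> Obj" using L.dom_cod f by blast
    have "actV (cod f) q (T f x) = actV (cod f) q' (T g x')"
      using fg T_act f g i j q by metis
    moreover have "T f x \<in> V (cod f)" "T g x' \<in> V (cod f)"
      using T_closed f g i j by metis+
    ultimately obtain r r' b where r: "r \<in> carrier Q" "r' \<in> carrier Q" and b: "b \<in> V (cod f)"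
      "T f x = actV (cod f) r b" "T g x' = actV (cod f) r' b"
      using free [OF k q] by blast
    have "p = h r \<otimes> \<iota> (cod f) b" "p' = h r' \<otimes> \<iota> (cod f) b"
      using b r f g i j k L.cocone_natural \<iota>_act by metis+
    then show "\<exists>r\<in>carrier Q. \<exists>r'\<in>carrier Q. \<exists>x\<in>carrier P. p = h r \<otimes> x \<and> p' = h r' \<otimes> x"
      using r \<iota>_closed k b by blast
  qed
qed

lemma equationally_flatD:
  assumes equationally_flat "q \<in> carrier Q" "q' \<in> carrier Q" "p \<in> carrier P" "p' \<in> carrier P"
    and "h q \<otimes> p = h q' \<otimes> p'"
  obtains r r' x where "r \<in> carrier Q" "r' \<in> carrier Q" "x \<in> carrier P" "p = h r \<otimes> x" "p' = h r' \<otimes> x"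
proof -
  have "\<exists>r\<in>carrier Q. \<exists>r'\<in>carrier Q. \<exists>x\<in>carrier P. p = h r \<otimes> x \<and> p' = h r' \<otimes> x"
    using assms(1) [unfolded equationally_flat_def, THEN conjunct2, rule_format, OF assms(2-6)] .
  then show ?thesis using that by auto
qed

text \<open>A generating set of minimal cardinality is a basis.\<close>

lemma basis_if_finite_equationally_flat:
  assumes "finite_hom Q P h" equationally_flat
  shows "\<exists>S. finite S \<and> basis S"
proof -
  define gen where "gen S \<longleftrightarrow> finite S \<and> S \<subseteq> carrier P \<and>
    (\<forall>p\<in>carrier P. \<exists>q\<in>carrier Q. \<exists>s\<in>S. p = h q \<otimes> s)" for S
  obtain S0 where S0: "finite S0" "S0 \<subseteq> carrier P"
    "carrier P = {h q \<otimes> s | q s. q \<in> carrier Q \<and> s \<in> S0}"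
    using assms(1) unfolding finite_hom_def by auto
  have "\<exists>q\<in>carrier Q. \<exists>s\<in>S0. p = h q \<otimes> s" if p: "p \<in> carrier P" for p
  proof -
    from p have "p \<in> {h q \<otimes> s | q s. q \<in> carrier Q \<and> s \<in> S0}"
      unfolding S0(3) [symmetric] .
    then show ?thesis by auto
  qed
  then have "gen S0" using S0(1,2) by (simp add: gen_def)
  then obtain S where S: "gen S" and min: "\<And>T. gen T \<Longrightarrow> card S \<le> card T"
    using ex_has_least_nat [of gen _ card] by auto
  have decomp: "\<exists>q\<in>carrier Q. \<exists>s\<in>S. p = h q \<otimes> s" if "p \<in> carrier P" for p
    using S that by (simp add: gen_def)
  have Sc: "S \<subseteq> carrier P" and fS: "finite S" using S by (auto simp: gen_def)
  \<comment> \<open>A generator that is a multiple of another one could be removed, so minimality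
    forbids divisibility between different elements of \<open>S\<close>.\<close>
  have div: "s = t" if st: "s \<in> S" "t \<in> S" "r \<in> carrier Q" "s = h r \<otimes> t" for s t r
  proof (rule ccontr)
    assume ne: "s \<noteq> t"
    have "gen (S - {s})"
      unfolding gen_def
    proof (intro conjI ballI)
      fix p assume "p \<in> carrier P"
      then obtain q s' where q: "q \<in> carrier Q" "s' \<in> S" "p = h q \<otimes> s'"
        using decomp [of p] by auto
      show "\<exists>q\<in>carrier Q. \<exists>s\<in>S - {s}. p = h q \<otimes> s"
      proof (cases "s' = s")
        case True
        then have "p = h (q \<otimes>\<^bsub>Q\<^esub> r) \<otimes> t"
          using q st Sc by (auto simp: h_mult_assoc)
        then show ?thesis using q st ne by (intro bexI [of _ "q \<otimes>\<^bsub>Q\<^esub> r"] bexI [of _ t]) auto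
      next
        case False
        then show ?thesis using q by (intro bexI [of _ q] bexI [of _ s']) auto
      qed
    next
      show "finite (S - {s})" using fS by simp
      show "S - {s} \<subseteq> carrier P" using Sc by auto
    qed
    then show False using min [of "S - {s}"] card_Diff1_less [OF fS st(1)] by simp
  qed
  have "basis S"
  proof (rule basisI [OF Sc])
    fix q q' s s'
    assume q: "q \<in> carrier Q" "q' \<in> carrier Q" and s: "s \<in> S" "s' \<in> S" and eq: "h q \<otimes> s = h q' \<otimes> s'"
    have sc: "s \<in> carrier P" "s' \<in> carrier P" using s Sc by auto
    \<comment> \<open>The common divisor \<open>x\<close> is itself a multiple of some generator
      \<open>t\<close>. Then \<open>t\<close> divides both \<open>s\<close> and \<open>s'\<close>,
      and all three coincide.\<close>
    obtain r r' x where r: "r \<in> carrier Q" "r' \<in> carrier Q" and x: "x \<in> carrier P"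
      and sx: "s = h r \<otimes> x" "s' = h r' \<otimes> x"
      using equationally_flatD [OF assms(2) q sc eq] .
    obtain c t where c: "c \<in> carrier Q" and t: "t \<in> S" and xt: "x = h c \<otimes> t"
      using decomp [OF x] by auto
    have "s = h (r \<otimes>\<^bsub>Q\<^esub> c) \<otimes> t" "s' = h (r' \<otimes>\<^bsub>Q\<^esub> c) \<otimes> t"
      using sx xt r c t Sc by (auto simp: h_mult_assoc)
    then have "s = t" "s' = t"
      using div [OF s(1) t, of "r \<otimes>\<^bsub>Q\<^esub> c"] div [OF s(2) t, of "r' \<otimes>\<^bsub>Q\<^esub> c"] r c by auto
    moreover have "h q = h q'"
      using P.r_cancel [of "h q" s "h q'"] eq calculation q s Sc by auto
    ultimately show "q = q' \<and> s = s'"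
      using assms(2) q by (auto simp: equationally_flat_def inj_on_def)
  qed (rule decomp)
  then show ?thesis using fS by blast
qed

abbreviation nonunit_ideal :: "'p set" where
  "nonunit_ideal \<equiv> {h q \<otimes> p | q p. q \<in> carrier Q - Units Q \<and> p \<in> carrier P}"

text \<open>Membership in the ideal can be read off the coefficient: a multiple of
  \<open>h r\<close> has a coefficient divisible by \<open>r\<close>, and divisors of units are
  units.\<close>

lemma basis_in_nonunit_ideal:
  assumes "basis S" "s \<in> S" "q \<in> carrier Q"
  shows "h q \<otimes> s \<in> nonunit_ideal \<longleftrightarrow> q \<notin> Units Q"
proof
  assume "h q \<otimes> s \<in> nonunit_ideal"
  then obtain r p where r: "r \<in> carrier Q" "r \<notin> Units Q" and p: "p \<in> carrier P" "h q \<otimes> s = h r \<otimes> p"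
    by auto
  obtain c t where c: "c \<in> carrier Q" "t \<in> S" "p = h c \<otimes> t" using basis_decomp [OF assms(1) p(1)] .
  have "h q \<otimes> s = h (r \<otimes>\<^bsub>Q\<^esub> c) \<otimes> t"
    using p c r basis_carrier [OF assms(1)] by (simp add: h_mult_assoc)
  then have "q = r \<otimes>\<^bsub>Q\<^esub> c" using basis_unique [OF assms(1)] assms c r by blast
  then show "q \<notin> Units Q" using Q.unit_factor r c by blast
qed (use assms basis_carrier in blast)

lemma nonunit_ideal_mult:
  assumes "x \<in> nonunit_ideal" "y \<in> carrier P"
  shows "x \<otimes> y \<in> nonunit_ideal"
  using assms P.m_assoc by fastforce

text \<open>Cancelling \<open>t\<close> from the two expansions leaves \<open>s [^] (n - m)\<close>
  as a factor of the unit \<open>h b\<close>.\<close>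

lemma basis_unit_if_power_unit_multiple:
  assumes "basis S" "s \<in> S" "t \<in> S" "a \<in> Units Q" "b \<in> Units Q" "m < n"
    "s [^] m = h a \<otimes> t" "s [^] (n::nat) = h b \<otimes> t"
  shows "s \<in> Units P"
proof -
  have c: "s \<in> carrier P" "t \<in> carrier P" using assms basis_carrier by auto
  have "s [^] n = s [^] m \<otimes> s [^] (n - m)"
    using c assms(6) by (simp add: P.nat_pow_mult)
  then have "h b \<otimes> t = (h a \<otimes> s [^] (n - m)) \<otimes> t"
    using assms(4,7,8) c by (simp add: P.m_ac Q.Units_closed)
  then have "h b = h a \<otimes> s [^] (n - m)"
    using P.r_cancel c assms(4,5) by (metis P.m_closed P.nat_pow_closed Q.Units_closed h_closed)
  then have "s [^] (n - m) \<otimes> h a \<in> Units P"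
    using h_Units assms c by (metis P.m_comm P.nat_pow_closed Q.Units_closed h_closed)
  then have "s [^] (n - m) \<in> Units P"
    using P.unit_factor c assms by (metis P.nat_pow_closed Q.Units_closed h_closed)
  moreover have "s [^] (n - m) = s \<otimes> s [^] (n - m - 1)"
    using c assms(6) by (metis P.m_comm P.nat_pow_Suc P.nat_pow_closed Suc_diff_1 zero_less_diff)
  ultimately show ?thesis using P.unit_factor c by (metis P.nat_pow_closed)
qed

text \<open>The element \<open>s\<close> has coefficient \<open>\<one>\<close> and hence lies
  outside \<open>nonunit_ideal\<close>. Reducedness keeps its positive powers outside as well, so
  they have unit coefficients, and finiteness of \<open>S\<close> makes two of them lie over the
  same basis element.\<close>

lemma unit_basis_if_finite_flat_reduced:
  assumes "finite_hom Q P h" "flat_hom Q P h" "reduced_hom Q P h"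
  shows "\<exists>S. unit_basis S"
proof -
  obtain S where fS: "finite S" and S: "basis S"
    using basis_if_finite_equationally_flat assms equationally_flat_if_flat by blast
  have "s \<in> Units P" if s: "s \<in> S" for s
  proof -
    have sc: "s \<in> carrier P" using basis_carrier [OF S s] .
    \<comment> \<open>The exponents start at 1, since saturation is a condition on positive
      multiples.\<close>
    have "\<exists>t\<in>S. \<exists>a\<in>Units Q. s [^] Suc n = h a \<otimes> t" for n :: nat
    proof -
      obtain a t where a: "a \<in> carrier Q" and t: "t \<in> S" and at: "s [^] Suc n = h a \<otimes> t"
        using basis_decomp [OF S, of "s [^] Suc n"] sc by auto
      have "h \<one>\<^bsub>Q\<^esub> \<otimes> s \<notin> nonunit_ideal"
        using basis_in_nonunit_ideal [OF S s] by blast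
      then have "s [^] Suc n \<notin> nonunit_ideal"
        using assms(3) sc unfolding reduced_hom_def saturated_ideal_def
        by (metis (no_types, lifting) P.l_one h_one zero_less_Suc)
      then show ?thesis using a t at basis_in_nonunit_ideal [OF S t a] by metis
    qed
    then obtain f where f: "\<And>n. f n \<in> S \<and> (\<exists>a\<in>Units Q. s [^] Suc n = h a \<otimes> f n)" by metis
    obtain m n where "m < n" "f m = f n" using infinite_sequence_repeats [OF fS, of f] f by blast
    then show ?thesis
      using f basis_unit_if_power_unit_multiple [OF S s, of "f m" _ _ "Suc m" "Suc n"] by (metis Suc_less_eq)
  qed
  then show ?thesis using fS S by (auto simp: unit_basis_def)
qed

text \<open>
  If some basis element is not a unit, pick one with the fewest divisors in the basis: it is the
  product of two nonunits, each of which lies over a basis element with fewer divisors.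
\<close>

lemma unit_basis_if_nonunits_decompose:
  assumes fS: "finite S" and S: "basis S"
    and dec: "\<And>p. p \<in> carrier P - Units P \<Longrightarrow>
      p \<in> nonunit_ideal \<or> (\<exists>x\<in>carrier P - Units P. \<exists>y\<in>carrier P - Units P. p = x \<otimes> y)"
  shows "unit_basis S"
proof -
  define D where "D s = {t \<in> S. \<exists>p\<in>carrier P. s = t \<otimes> p}" for s
  have "S \<subseteq> Units P"
  proof (rule ccontr)
    assume "\<not> S \<subseteq> Units P"
    then have "\<exists>s. s \<in> S - Units P" by auto
    then obtain s where s: "s \<in> S - Units P" and min: "\<And>t. t \<in> S - Units P \<Longrightarrow> card (D s) \<le> card (D t)"
      using ex_has_least_nat [of "\<lambda>s. s \<in> S - Units P" _ "\<lambda>s. card (D s)"] by blast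
    have sc: "s \<in> carrier P" using s basis_carrier [OF S] by auto
    have "h \<one>\<^bsub>Q\<^esub> \<otimes> s \<notin> nonunit_ideal"
      using basis_in_nonunit_ideal [OF S] s by blast
    then have sI: "s \<notin> nonunit_ideal" using sc by simp
    then obtain x y where x: "x \<in> carrier P" "x \<notin> Units P" and y: "y \<in> carrier P" "y \<notin> Units P"
      and sxy: "s = x \<otimes> y"
      using dec [of s] s sc by auto
    \<comment> \<open>As \<open>s\<close> is a multiple of \<open>x\<close> and is not in the ideal,
      neither is \<open>x\<close>. So \<open>x\<close> differs from a basis element \<open>t\<close>
      by a unit, and \<open>t\<close> is a nonunit divisor of \<open>s\<close>.\<close>
    have "x \<notin> nonunit_ideal" using nonunit_ideal_mult y sI sxy by blast
    moreover obtain q t where q: "q \<in> carrier Q" and t: "t \<in> S" and xt: "x = h q \<otimes> t"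
      using basis_decomp [OF S x(1)] .
    ultimately have qU: "q \<in> Units Q" using basis_in_nonunit_ideal [OF S t q] by blast
    have tc: "t \<in> carrier P" using t basis_carrier [OF S] by auto
    have "t \<notin> Units P" using x xt h_Units [OF qU] by auto
    have st: "s = t \<otimes> (h q \<otimes> y)" using sxy xt q tc y by (simp add: P.m_ac)
    \<comment> \<open>If \<open>s\<close> divided \<open>t\<close>, the two would divide each other,
      and cancelling \<open>t\<close> would make \<open>y\<close> a unit. This makes the inclusion
      of the sets of divisors strict.\<close>
    have "s \<notin> D t"
    proof
      assume "s \<in> D t"
      then obtain p where p: "p \<in> carrier P" "t = s \<otimes> p" by (auto simp: D_def)
      have "t \<otimes> (h q \<otimes> y) \<otimes> p = t" by (metis p(2) st)
      then have "t \<otimes> \<one> = t \<otimes> (p \<otimes> (h q \<otimes> y))" using p(1) tc q y by (simp add: P.m_ac)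
      then have "\<one> = p \<otimes> (h q \<otimes> y)"
        using P.l_cancel [of t \<one> "p \<otimes> (h q \<otimes> y)"] tc p q y by auto
      moreover have "y \<otimes> (p \<otimes> h q) = p \<otimes> (h q \<otimes> y)"
        using p q y by (simp add: P.m_ac)
      ultimately have "y \<otimes> (p \<otimes> h q) \<in> Units P"
        by (metis P.Units_one_closed)
      then show False using P.unit_factor y p q by (metis P.m_closed h_closed)
    qed
    moreover have "s \<in> D s" using s sc by (auto simp: D_def intro!: bexI [of _ \<one>])
    moreover have "D t \<subseteq> D s"
    proof
      fix r assume "r \<in> D t"
      then obtain p where p: "r \<in> S" "p \<in> carrier P" "t = r \<otimes> p" by (auto simp: D_def)
      then have "s = r \<otimes> (p \<otimes> (h q \<otimes> y))"
        using st q y basis_carrier [OF S] by (simp add: P.m_assoc)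
      then show "r \<in> D s" using p q y by (auto simp: D_def)
    qed
    ultimately have "D t \<subset> D s" by blast
    moreover have "finite (D s)" using fS by (simp add: D_def)
    ultimately have "card (D t) < card (D s)" by (simp add: psubset_card_mono)
    then show False using min [of t] t \<open>t \<notin> Units P\<close> by simp
  qed
  then show ?thesis using fS S by (simp add: unit_basis_def)
qed

end

section \<open>Consequences of a basis of units\<close>

text \<open>On \<open>A\<close> the map \<open>g\<close> factors through \<open>f\<close>. It is
  applied to units of \<open>P\<close>, with \<open>f\<close> the class in the cokernel and
  \<open>g\<close> the coset modulo units of \<open>Q\<close>.\<close>

lemma finite_image_factor:
  assumes "finite (f ` A)" "\<And>x y. \<lbrakk>x \<in> A; y \<in> A; f x = f y\<rbrakk> \<Longrightarrow> g x = g y"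
  shows "finite (g ` A)"
proof -
  have "g x = g (inv_into A f (f x))" if "x \<in> A" for x
    using assms(2) [of x "inv_into A f (f x)"] that by (simp add: f_inv_into_f inv_into_into)
  then have "g ` A = (\<lambda>c. g (inv_into A f c)) ` (f ` A)"
    unfolding image_image by (intro image_cong) auto
  then show ?thesis using assms(1) by simp
qed

context comm_monoid
begin

lemma equiv_submonoid_cong:
  assumes "submonoid S G"
  shows "equiv (carrier G) (submonoid_cong G S)"
proof (rule equivI)
  interpret S: submonoid S G by (fact assms)
  have SG: "s \<in> carrier G" if "s \<in> S" for s using that by simp
  show "refl_on (carrier G) (submonoid_cong G S)"
    using S.one_closed unfolding refl_on_def submonoid_cong_def by blast
  show "submonoid_cong G S \<subseteq> carrier G \<times> carrier G"
    by (auto simp: submonoid_cong_def)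
  show "sym (submonoid_cong G S)"
    by (auto simp: sym_def submonoid_cong_def) metis
  show "trans (submonoid_cong G S)"
  proof (rule transI)
    fix x y z assume "(x, y) \<in> submonoid_cong G S" "(y, z) \<in> submonoid_cong G S"
    then obtain s t s' t' where xyz: "x \<in> carrier G" "y \<in> carrier G" "z \<in> carrier G"
      and st: "s \<in> S" "t \<in> S" "s' \<in> S" "t' \<in> S" and 1: "x \<otimes> s = y \<otimes> t" and 2: "y \<otimes> s' = z \<otimes> t'"
      by (auto simp: submonoid_cong_def)
    have "x \<otimes> (s \<otimes> s') = (y \<otimes> t) \<otimes> s'" using xyz st SG by (simp add: m_assoc flip: 1)
    also have "\<dots> = (y \<otimes> s') \<otimes> t" using xyz st SG by (simp add: m_ac)
    also have "\<dots> = z \<otimes> (t' \<otimes> t)" using xyz st SG by (simp add: m_assoc 2)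
    finally show "(x, z) \<in> submonoid_cong G S"
      using xyz st S.m_closed unfolding submonoid_cong_def by blast
  qed
qed

text \<open>The product in \<open>quotient_monoid\<close> is a union over representatives. All of
  them yield the same class, to which the union collapses.\<close>

lemma submonoid_cong_mult_class:
  assumes S: "submonoid S G" and x: "x \<in> carrier G" and y: "y \<in> carrier G"
  shows "submonoid_cong G S `` {x} \<otimes>\<^bsub>quotient_monoid G (submonoid_cong G S)\<^esub> submonoid_cong G S `` {y}
    = submonoid_cong G S `` {x \<otimes> y}"
proof -
  let ?r = "submonoid_cong G S"
  interpret S: submonoid S G by (fact assms)
  have eq: "?r `` {x' \<otimes> y'} = ?r `` {x \<otimes> y}" if x': "(x, x') \<in> ?r" and y': "(y, y') \<in> ?r" for x' y'
  proof -
    obtain s t s' t' where c: "x' \<in> carrier G" "y' \<in> carrier G"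
      and st: "s \<in> S" "t \<in> S" "s' \<in> S" "t' \<in> S" and 1: "x \<otimes> s = x' \<otimes> t" and 2: "y \<otimes> s' = y' \<otimes> t'"
      using x' y' by (auto simp: submonoid_cong_def)
    have SG: "s \<in> carrier G" if "s \<in> S" for s using that by simp
    have "x \<otimes> y \<otimes> (s \<otimes> s') = (x \<otimes> s) \<otimes> (y \<otimes> s')" using x y c SG st by (simp add: m_ac)
    also have "\<dots> = x' \<otimes> y' \<otimes> (t \<otimes> t')" unfolding 1 2 using x y c SG st by (simp add: m_ac)
    finally have "(x \<otimes> y, x' \<otimes> y') \<in> ?r"
      using x y c st S.m_closed unfolding submonoid_cong_def by blast
    then show ?thesis using equiv_class_eq [OF equiv_submonoid_cong [OF S]] by metis
  qed
  have "(x, x) \<in> ?r" "(y, y) \<in> ?r"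
    using equiv_submonoid_cong [OF S] x y by (auto simp: equiv_def refl_on_def)
  then have "(\<Union>x'\<in>?r `` {x}. \<Union>y'\<in>?r `` {y}. ?r `` {x' \<otimes> y'}) = ?r `` {x \<otimes> y}"
    using eq by blast
  then show ?thesis by (simp add: quotient_monoid_def)
qed

lemma submonoid_Units: "submonoid (Units G) G"
  by unfold_locales auto

text \<open>Units can be moved to one side, so the two multipliers of the congruence reduce to
  one.\<close>

lemma Units_cong_class_eq_iff:
  assumes "x \<in> carrier G" "y \<in> carrier G"
  shows "submonoid_cong G (Units G) `` {x} = submonoid_cong G (Units G) `` {y} \<longleftrightarrow>
    (\<exists>u\<in>Units G. x = y \<otimes> u)"
proof -
  have "submonoid_cong G (Units G) `` {x} = submonoid_cong G (Units G) `` {y} \<longleftrightarrow>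
      (x, y) \<in> submonoid_cong G (Units G)"
    using eq_equiv_class_iff [OF equiv_submonoid_cong [OF submonoid_Units]] assms by blast
  also have "\<dots> \<longleftrightarrow> (\<exists>u\<in>Units G. x = y \<otimes> u)"
  proof
    assume "(x, y) \<in> submonoid_cong G (Units G)"
    then obtain s t where st: "s \<in> Units G" "t \<in> Units G" "x \<otimes> s = y \<otimes> t"
      by (auto simp: submonoid_cong_def)
    have "x = x \<otimes> s \<otimes> inv s" using st(1,2) assms by (simp add: m_assoc Units_closed)
    also have "\<dots> = y \<otimes> t \<otimes> inv s" by (simp only: st(3))
    also have "\<dots> = y \<otimes> (t \<otimes> inv s)" using st(1,2) assms by (simp add: m_assoc Units_closed)
    finally show "\<exists>u\<in>Units G. x = y \<otimes> u" using st by blast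
  next
    assume "\<exists>u\<in>Units G. x = y \<otimes> u"
    then obtain u where "u \<in> Units G" "x = y \<otimes> u" by blast
    then have "u \<in> Units G" "x \<otimes> \<one> = y \<otimes> u" using assms by auto
    then show "(x, y) \<in> submonoid_cong G (Units G)"
      using assms unfolding submonoid_cong_def by blast
  qed
  finally show ?thesis .
qed

end

context cancel_monoid_map
begin

lemma unit_basis_decomp:
  assumes "unit_basis S" "u \<in> Units P"
  obtains a s where "a \<in> Units Q" "s \<in> S" "u = h a \<otimes> s"
proof -
  have S: "basis S" using assms by (simp add: unit_basis_def)
  obtain a s where "a \<in> carrier Q" "s \<in> S" "u = h a \<otimes> s"
    using basis_decomp [OF S P.Units_closed [OF assms(2)]] .
  then show ?thesis using that basis_unit_decomp(1) [OF S assms(2)] by blast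
qed

text \<open>The units \<open>u\<close> and \<open>u'\<close> have expansions with unit coefficients,
  so they change \<open>q\<close> and \<open>q'\<close> only by units. In effect this is the
  injectivity of the induced map of sharpenings.\<close>

lemma unit_basis_multiple_iff:
  assumes S: "unit_basis S" and q: "q \<in> carrier Q" "q' \<in> carrier Q" and u: "u \<in> Units P" "u' \<in> Units P"
    and eq: "h q \<otimes> u = h q' \<otimes> u'"
  shows "\<exists>a\<in>Units Q. q = q' \<otimes>\<^bsub>Q\<^esub> a"
proof -
  have S1: "basis S" using S by (simp add: unit_basis_def)
  obtain a s where a: "a \<in> Units Q" "s \<in> S" "u = h a \<otimes> s" using unit_basis_decomp [OF S u(1)] .
  obtain b t where b: "b \<in> Units Q" "t \<in> S" "u' = h b \<otimes> t" using unit_basis_decomp [OF S u(2)] .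
  have "h (q \<otimes>\<^bsub>Q\<^esub> a) \<otimes> s = h (q' \<otimes>\<^bsub>Q\<^esub> b) \<otimes> t"
    using a b q eq basis_carrier [OF S1] by (simp add: h_mult_assoc Q.Units_closed)
  then have e: "q \<otimes>\<^bsub>Q\<^esub> a = q' \<otimes>\<^bsub>Q\<^esub> b"
    using basis_unique [OF S1] a b q by (meson Q.Units_closed Q.m_closed)
  have "q = (q \<otimes>\<^bsub>Q\<^esub> a) \<otimes>\<^bsub>Q\<^esub> inv\<^bsub>Q\<^esub> a"
    using q a by (simp add: Q.m_assoc Q.Units_closed)
  also have "\<dots> = q' \<otimes>\<^bsub>Q\<^esub> (b \<otimes>\<^bsub>Q\<^esub> inv\<^bsub>Q\<^esub> a)"
    using q a b unfolding e by (simp add: Q.m_assoc Q.Units_closed)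
  finally show ?thesis using a b by blast
qed

text \<open>Up to a unit, a power of \<open>h q \<otimes> s\<close> has the coefficient
  \<open>q [^] n\<close>, because \<open>s [^] n\<close> is a unit. If this is a nonunit then so is
  \<open>q\<close>.\<close>

lemma reduced_hom_if_unit_basis:
  assumes S: "unit_basis S"
  shows "reduced_hom Q P h"
  unfolding reduced_hom_def saturated_ideal_def
proof (intro ballI allI impI)
  have S1: "basis S" using S by (simp add: unit_basis_def)
  fix p and n :: nat
  assume p: "p \<in> carrier P" and n: "n > 0 \<and> p [^] n \<in> nonunit_ideal"
  obtain q s where q: "q \<in> carrier Q" and s: "s \<in> S" and ps: "p = h q \<otimes> s" using basis_decomp [OF S1 p] .
  have su: "s \<in> Units P" using S s by (auto simp: unit_basis_def)
  then have sn: "s [^] n \<in> Units P" by (rule P.Units_pow_closed)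
  obtain a t where a: "a \<in> Units Q" and t: "t \<in> S" and sat: "s [^] n = h a \<otimes> t"
    using unit_basis_decomp [OF S sn] .
  have "p [^] n = h (q [^]\<^bsub>Q\<^esub> n \<otimes>\<^bsub>Q\<^esub> a) \<otimes> t"
    using q su a t basis_carrier [OF S1] ps sat
    by (simp add: P.nat_pow_distrib h_pow h_mult_assoc Q.Units_closed P.Units_closed)
  then have "q [^]\<^bsub>Q\<^esub> n \<otimes>\<^bsub>Q\<^esub> a \<notin> Units Q"
    using basis_in_nonunit_ideal [OF S1 t, of "q [^]\<^bsub>Q\<^esub> n \<otimes>\<^bsub>Q\<^esub> a"] q a n by (simp add: Q.Units_closed)
  then have "q \<notin> Units Q" using a Q.Units_pow_closed [of q n] by blast
  then show "p \<in> nonunit_ideal" using basis_in_nonunit_ideal [OF S1 s q] ps by simp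
qed

text \<open>A free module with a finite basis is the limit of the constant diagram on one object.\<close>

lemma flat_hom_if_finite_basis:
  assumes S: "basis S" and fS: "finite S"
  shows "flat_hom Q P h"
proof -
  obtain f where f: "bij_betw f {0..<card S} S" using ex_bij_betw_nat_finite [OF fS] by blast
  have fin: "f i \<in> S" if "i < card S" for i
    using bij_betwE [OF f] that by simp
  then have fc: "f i \<in> carrier P" if "i < card S" for i
    using basis_carrier [OF S] that by blast
  \<comment> \<open>The definition of flatness fixes the types of the diagram. Its single object is
    the empty list, and the free module consists of pairs of a scalar and a number that stands for a
    basis element.\<close>
  let ?V = "\<lambda>_ :: 'p list. carrier Q \<times> {0..<card S}"
  let ?act = "\<lambda>_ :: 'p list. \<lambda>q (r, i). (q \<otimes>\<^bsub>Q\<^esub> r, i :: nat)"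
  let ?pt = "([], [], []) :: 'p list \<times> ('q \<times> nat) list \<times> 'p list"
  have free: "free_monoid_module Q (?act i) (?V i)" for i :: "'p list"
    unfolding free_monoid_module_def monoid_module_def monoid_module_basis_def
  proof (intro conjI exI)
    show "bij_betw (\<lambda>(q, s). ?act i q s) (carrier Q \<times> ({\<one>\<^bsub>Q\<^esub>} \<times> {0..<card S})) (?V i)"
      by (rule bij_betwI [where g = "\<lambda>(q, j). (q, \<one>\<^bsub>Q\<^esub>, j)"]) auto
  qed (auto simp: Q.m_assoc)
  have "filtered_category {[]} {?pt} (\<lambda>_. []) (\<lambda>_. []) (\<lambda>_. ?pt) (\<lambda>_ _. ?pt)"
    by unfold_locales auto
  moreover have "filtered_limit_of_free_modules_axioms {[]} {?pt} (\<lambda>_. []) (\<lambda>_. []) (\<lambda>_. ?pt)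
      (\<lambda>_ _. ?pt) Q ?act ?V (\<lambda>_ x. x) (hom_action P h) (carrier P) (\<lambda>_ (r, i). h r \<otimes> f i)"
  proof (rule filtered_limit_of_free_modules_axioms.intro)
    show "free_monoid_module Q (?act i) (?V i)" for i :: "'p list" by (rule free)
  next
    fix y assume y: "y \<in> carrier P"
    obtain q s where q: "q \<in> carrier Q" "s \<in> S" "y = h q \<otimes> s" using basis_decomp [OF S y] .
    obtain i where "i < card S" "s = f i"
      using bij_betw_imp_surj_on [OF f] q(2) by (metis atLeastLessThan_iff imageE)
    then show "\<exists>i\<in>{[]}. \<exists>x\<in>?V i. (case x of (r, i) \<Rightarrow> h r \<otimes> f i) = y"
      using q(1,3) by (auto intro!: bexI [of _ q] bexI [of _ i])
  next
    fix i j :: "'p list" and x x'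
    assume "x \<in> ?V i" "x' \<in> ?V j" "(case x of (r, i) \<Rightarrow> h r \<otimes> f i) = (case x' of (r, i) \<Rightarrow> h r \<otimes> f i)"
    then obtain r k r' k' where x: "x = (r, k)" "x' = (r', k')" "r \<in> carrier Q" "r' \<in> carrier Q"
      "k < card S" "k' < card S" "h r \<otimes> f k = h r' \<otimes> f k'" by auto
    have "r = r' \<and> f k = f k'" using basis_unique [OF S x(3,4) fin [OF x(5)] fin [OF x(6)] x(7)] .
    moreover then have "k = k'"
      using inj_onD [OF bij_betw_imp_inj_on [OF f], of k k'] x by simp
    ultimately show "\<exists>f\<in>{?pt}. \<exists>g\<in>{?pt}. [] = i \<and> [] = j \<and> [] = [] \<and> x = x'"
      if "i \<in> {[]}" "j \<in> {[]}" using x that by auto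
  qed (auto simp: monoid_module_def monoid_module_homs_def h_mult_assoc fc P.m_assoc)
  ultimately have "filtered_limit_of_free_modules {[]} {?pt} (\<lambda>_. []) (\<lambda>_. []) (\<lambda>_. ?pt)
      (\<lambda>_ _. ?pt) Q ?act ?V (\<lambda>_ x. x) (hom_action P h) (carrier P) (\<lambda>_ (r, i). h r \<otimes> f i)"
    by (rule filtered_limit_of_free_modules.intro)
  then show ?thesis
    unfolding flat_hom_def flat_monoid_module_def by blast
qed

end

section \<open>Faces\<close>

text \<open>Every face contains the identity, so the basic open set of the identity is already the
  whole space.\<close>

lemma topspace_monoid_Spec:
  assumes "monoid M" shows "topspace (monoid_Spec M) = {F. face M F}"
proof -
  have "\<one>\<^bsub>M\<^esub> \<in> carrier M" "\<And>F. face M F \<Longrightarrow> \<one>\<^bsub>M\<^esub> \<in> F"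
    using monoid.one_closed [OF assms] submonoid.one_closed by (auto simp: face_def)
  then show ?thesis unfolding monoid_Spec_def topology_generated_by_topspace by blast
qed

lemma openin_monoid_Spec: "x \<in> carrier M \<Longrightarrow> openin (monoid_Spec M) {F. face M F \<and> x \<in> F}"
  unfolding monoid_Spec_def by (intro topology_generated_by_Basis) blast

lemma continuous_map_monoid_Spec:
  assumes "monoid M" "\<And>F. F \<in> topspace Y \<Longrightarrow> face M (f F)"
    and "\<And>x. x \<in> carrier M \<Longrightarrow> openin Y {F \<in> topspace Y. x \<in> f F}"
  shows "continuous_map Y (monoid_Spec M) f"
  unfolding monoid_Spec_def continuous_on_generated_topo_iff
proof (intro conjI allI impI)
  fix U assume "U \<in> {{F. face M F \<and> x \<in> F} |x. x \<in> carrier M}"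
  then obtain x where x: "x \<in> carrier M" "U = {F. face M F \<and> x \<in> F}" by auto
  then have "f -` U \<inter> topspace Y = {F \<in> topspace Y. x \<in> f F}" using assms(2) by auto
  then show "openin Y (f -` U \<inter> topspace Y)" using assms(3) [OF x(1)] by simp
next
  show "f ` topspace Y \<subseteq> \<Union> {{F. face M F \<and> x \<in> F} |x. x \<in> carrier M}"
    using assms(2) topspace_monoid_Spec [OF assms(1)]
    unfolding monoid_Spec_def topology_generated_by_topspace by blast
qed

text \<open>A unit divides \<open>\<one>\<close>, and faces contain the divisors of their
  elements.\<close>

lemma (in comm_monoid) face_Units:
  assumes "face G F" "u \<in> Units G" shows "u \<in> F"
proof -
  have "\<one> \<in> F" using assms(1) submonoid.one_closed by (auto simp: face_def)
  then have "inv u \<otimes> u \<in> F" using assms(2) by simp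
  then show ?thesis
    using assms(1) Units_inv_closed [OF assms(2)] Units_closed [OF assms(2)] unfolding face_def by blast
qed

lemma faceD:
  assumes "face M F"
  shows "\<And>x. x \<in> F \<Longrightarrow> x \<in> carrier M" "\<one>\<^bsub>M\<^esub> \<in> F"
    "\<And>x y. x \<in> F \<Longrightarrow> y \<in> F \<Longrightarrow> x \<otimes>\<^bsub>M\<^esub> y \<in> F"
    "\<And>x y. \<lbrakk>x \<in> carrier M; y \<in> carrier M; x \<otimes>\<^bsub>M\<^esub> y \<in> F\<rbrakk> \<Longrightarrow> x \<in> F"
    "\<And>x y. \<lbrakk>x \<in> carrier M; y \<in> carrier M; x \<otimes>\<^bsub>M\<^esub> y \<in> F\<rbrakk> \<Longrightarrow> y \<in> F"
proof -
  have F: "submonoid F M" "\<And>x y. \<lbrakk>x \<in> carrier M; y \<in> carrier M; x \<otimes>\<^bsub>M\<^esub> y \<in> F\<rbrakk> \<Longrightarrow> x \<in> F \<and> y \<in> F"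
    using assms by (simp_all add: face_def)
  show "x \<in> carrier M" if "x \<in> F" for x using submonoid.subset [OF F(1)] that by blast
  show "\<one>\<^bsub>M\<^esub> \<in> F" using submonoid.one_closed [OF F(1)] .
  show "x \<otimes>\<^bsub>M\<^esub> y \<in> F" if "x \<in> F" "y \<in> F" for x y using submonoid.m_closed [OF F(1) that] .
  show "x \<in> F" "y \<in> F" if "x \<in> carrier M" "y \<in> carrier M" "x \<otimes>\<^bsub>M\<^esub> y \<in> F" for x y
    using F(2) [OF that] by auto
qed

context cancel_monoid_map
begin

lemma face_monoid_Spec_map:
  assumes "face P F" shows "face Q (monoid_Spec_map Q h F)"
proof -
  note F = faceD [OF assms]
  show ?thesis
    unfolding face_def monoid_Spec_map_def
  proof (intro conjI ballI impI)
    show "submonoid {q \<in> carrier Q. h q \<in> F} Q"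
    proof
      show "x \<otimes>\<^bsub>Q\<^esub> y \<in> {q \<in> carrier Q. h q \<in> F}"
        if "x \<in> {q \<in> carrier Q. h q \<in> F}" "y \<in> {q \<in> carrier Q. h q \<in> F}" for x y
        using that F(3) [of "h x" "h y"] by (simp add: h_mult)
      show "\<one>\<^bsub>Q\<^esub> \<in> {q \<in> carrier Q. h q \<in> F}" using F(2) by simp
    qed blast
    fix x y assume xy: "x \<in> carrier Q" "y \<in> carrier Q" "x \<otimes>\<^bsub>Q\<^esub> y \<in> {q \<in> carrier Q. h q \<in> F}"
    then have "h x \<otimes> h y \<in> F" by (simp add: h_mult)
    then have "h x \<in> F" "h y \<in> F" using F(4,5) [OF h_closed h_closed] xy by blast+
    then show "x \<in> {q \<in> carrier Q. h q \<in> F}" "y \<in> {q \<in> carrier Q. h q \<in> F}" using xy by auto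
  qed
qed

text \<open>Each element of \<open>P\<close> is some \<open>h q\<close> times a unit, and units lie
  in every face. A face is therefore determined by its preimage in \<open>Q\<close>; the inverse map
  multiplies the image of a face by all units of \<open>P\<close>.\<close>

lemma homeomorphic_map_if_unit_basis:
  assumes S: "unit_basis S"
  shows "homeomorphic_map (monoid_Spec P) (monoid_Spec Q) (monoid_Spec_map Q h)"
proof -
  let ?f = "monoid_Spec_map Q h"
  define g where "g G = {h q \<otimes> u | q u. q \<in> G \<and> u \<in> Units P}" for G
  have S1: "basis S" and SU: "S \<subseteq> Units P" using S by (auto simp: unit_basis_def)
  have topP: "topspace (monoid_Spec P) = {F. face P F}" and topQ: "topspace (monoid_Spec Q) = {F. face Q F}"
    by (intro topspace_monoid_Spec P.monoid_axioms Q.monoid_axioms)+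
  \<comment> \<open>The factor \<open>q\<close> is determined up to units of \<open>Q\<close>, and
    these lie in \<open>G\<close>.\<close>
  have mem_g: "h q \<otimes> u \<in> g G \<longleftrightarrow> q \<in> G"
    if G: "face Q G" and q: "q \<in> carrier Q" and u: "u \<in> Units P" for q u G
  proof
    assume "h q \<otimes> u \<in> g G"
    then obtain r v where r: "r \<in> G" "v \<in> Units P" "h q \<otimes> u = h r \<otimes> v" unfolding g_def by blast
    obtain a where "a \<in> Units Q" "q = r \<otimes>\<^bsub>Q\<^esub> a"
      using unit_basis_multiple_iff [OF S q faceD(1) [OF G r(1)] u r(2,3)] by blast
    then show "q \<in> G" using faceD(3) [OF G r(1)] Q.face_Units [OF G] by blast
  qed (use u g_def in blast)
  have decomp: "\<exists>q\<in>carrier Q. \<exists>u\<in>Units P. p = h q \<otimes> u" if p: "p \<in> carrier P" for p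
    using basis_decomp [OF S1 p] SU by (metis subsetD)
  have face_g: "face P (g G)" if G: "face Q G" for G
    unfolding face_def
  proof (intro conjI ballI impI)
    show "submonoid (g G) P"
    proof
      show "g G \<subseteq> carrier P" using faceD(1) [OF G] by (auto simp: g_def)
      show "\<one> \<in> g G" using mem_g [OF G Q.one_closed P.Units_one_closed] faceD(2) [OF G] by simp
      fix x y assume "x \<in> g G" "y \<in> g G"
      then obtain q u r v where xy: "q \<in> G" "u \<in> Units P" "x = h q \<otimes> u" "r \<in> G" "v \<in> Units P" "y = h r \<otimes> v"
        unfolding g_def by blast
      have "x \<otimes> y = h (q \<otimes>\<^bsub>Q\<^esub> r) \<otimes> (u \<otimes> v)"
        using xy faceD(1) [OF G] by (simp add: h_mult P.m_ac P.Units_closed)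
      then show "x \<otimes> y \<in> g G"
        using mem_g [OF G] xy faceD(1,3) [OF G] by (metis P.Units_m_closed)
    qed
    fix x y assume x: "x \<in> carrier P" and y: "y \<in> carrier P" and xy: "x \<otimes> y \<in> g G"
    obtain q u where q: "q \<in> carrier Q" "u \<in> Units P" "x = h q \<otimes> u" using decomp [OF x] by blast
    obtain r v where r: "r \<in> carrier Q" "v \<in> Units P" "y = h r \<otimes> v" using decomp [OF y] by blast
    have "x \<otimes> y = h (q \<otimes>\<^bsub>Q\<^esub> r) \<otimes> (u \<otimes> v)"
      using q r by (simp add: h_mult P.m_ac P.Units_closed)
    then have "q \<otimes>\<^bsub>Q\<^esub> r \<in> G" using mem_g [OF G] q r xy by (metis P.Units_m_closed Q.m_closed)
    then have "q \<in> G" "r \<in> G" using faceD(4,5) [OF G] q r by blast+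
    then show "x \<in> g G" "y \<in> g G" using mem_g [OF G] q r by auto
  qed
  have fg: "?f (g G) = G" if G: "face Q G" for G
  proof -
    have "h q \<in> g G \<longleftrightarrow> q \<in> G" if "q \<in> carrier Q" for q
      using mem_g [OF G that P.Units_one_closed] that by simp
    then show ?thesis using faceD(1) [OF G] by (auto simp: monoid_Spec_map_def)
  qed
  have gf: "g (?f F) = F" if F: "face P F" for F
  proof -
    have "p \<in> g (?f F) \<longleftrightarrow> p \<in> F" if p: "p \<in> carrier P" for p
    proof -
      obtain q u where q: "q \<in> carrier Q" "u \<in> Units P" "p = h q \<otimes> u" using decomp [OF p] by blast
      have "p \<in> g (?f F) \<longleftrightarrow> h q \<in> F"
        using mem_g [OF face_monoid_Spec_map [OF F] q(1,2)] q by (simp add: monoid_Spec_map_def)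
      also have "\<dots> \<longleftrightarrow> p \<in> F"
        using faceD(3,4) [OF F] P.face_Units [OF F] q by (metis P.Units_closed h_closed)
      finally show ?thesis .
    qed
    then show ?thesis using faceD(1) [OF F] faceD(1) [OF face_g [OF face_monoid_Spec_map [OF F]]] by blast
  qed
  have "continuous_map (monoid_Spec P) (monoid_Spec Q) ?f"
  proof (rule continuous_map_monoid_Spec [OF Q.monoid_axioms])
    fix q assume q: "q \<in> carrier Q"
    have "{F \<in> topspace (monoid_Spec P). q \<in> ?f F} = {F. face P F \<and> h q \<in> F}"
      using q by (auto simp: topP monoid_Spec_map_def)
    then show "openin (monoid_Spec P) {F \<in> topspace (monoid_Spec P). q \<in> ?f F}"
      using openin_monoid_Spec [of "h q" P] q by simp
  qed (use face_monoid_Spec_map topP in auto)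
  moreover have "continuous_map (monoid_Spec Q) (monoid_Spec P) g"
  proof (rule continuous_map_monoid_Spec [OF P.monoid_axioms])
    fix p assume p: "p \<in> carrier P"
    obtain q u where q: "q \<in> carrier Q" "u \<in> Units P" "p = h q \<otimes> u" using decomp [OF p] by blast
    \<comment> \<open>Whether \<open>p\<close> lies in the face depends only on its factor
      \<open>q\<close>, so the preimage of a basic open set is again a basic open set.\<close>
    have "{G \<in> topspace (monoid_Spec Q). p \<in> g G} = {G. face Q G \<and> q \<in> G}"
      using q mem_g by (auto simp: topQ)
    then show "openin (monoid_Spec Q) {G \<in> topspace (monoid_Spec Q). p \<in> g G}" using openin_monoid_Spec [OF q(1)] by simp
  qed (use face_g topQ in auto)
  ultimately have "homeomorphic_maps (monoid_Spec P) (monoid_Spec Q) ?f g"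
    unfolding homeomorphic_maps_def using fg gf topP topQ by simp
  then show ?thesis using homeomorphic_map_maps by blast
qed

section \<open>Cosets of the units of \<open>Q\<close> among the units of \<open>P\<close>\<close>

definition unit_coset :: "'p \<Rightarrow> 'p set" where
  "unit_coset u = {h a \<otimes> u | a. a \<in> Units Q}"

lemma unit_coset_self: "u \<in> carrier P \<Longrightarrow> u \<in> unit_coset u"
  unfolding unit_coset_def using Q.Units_one_closed h_one P.l_one by force

lemma unit_coset_mult:
  assumes a: "a \<in> Units Q" and u: "u \<in> carrier P"
  shows "unit_coset (h a \<otimes> u) = unit_coset u"
proof -
  have sub: "unit_coset (h a \<otimes> u) \<subseteq> unit_coset u" if "a \<in> Units Q" "u \<in> carrier P" for a u
  proof
    fix x assume "x \<in> unit_coset (h a \<otimes> u)"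
    then obtain b where b: "b \<in> Units Q" "x = h b \<otimes> (h a \<otimes> u)" by (auto simp: unit_coset_def)
    then have "x = h (b \<otimes>\<^bsub>Q\<^esub> a) \<otimes> u" using that by (simp add: h_mult_assoc Q.Units_closed)
    then show "x \<in> unit_coset u" using b(1) that(1) by (auto simp: unit_coset_def)
  qed
  have "h (inv\<^bsub>Q\<^esub> a) \<otimes> (h a \<otimes> u) = u"
    using a u h_inv [OF a] by (simp add: Q.Units_closed flip: P.m_assoc)
  then have "unit_coset u \<subseteq> unit_coset (h a \<otimes> u)"
    using sub [of "inv\<^bsub>Q\<^esub> a" "h a \<otimes> u"] a u by (simp add: Q.Units_closed)
  then show ?thesis using sub [OF a u] by blast
qed

text \<open>One representative is chosen in every coset by \<open>inv_into\<close>. Such a set is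
  the candidate for the basis when the pushout or the isomorphism of sharpenings is given.\<close>

lemma unit_coset_representatives:
  assumes "finite (unit_coset ` Units P)"
  obtains S where "finite S" "S \<subseteq> Units P"
    "\<And>u. u \<in> Units P \<Longrightarrow> \<exists>a\<in>Units Q. \<exists>s\<in>S. u = h a \<otimes> s"
    "\<And>s s' a. \<lbrakk>s \<in> S; s' \<in> S; a \<in> Units Q; s = h a \<otimes> s'\<rbrakk> \<Longrightarrow> s = s'"
proof -
  define f where "f = inv_into (Units P) unit_coset"
  define S where "S = f ` (unit_coset ` Units P)"
  have f: "f c \<in> Units P" "unit_coset (f c) = c" if "c \<in> unit_coset ` Units P" for c
    using that inv_into_into [of c unit_coset "Units P"] f_inv_into_f [of c unit_coset "Units P"]
    by (auto simp: f_def)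
  show ?thesis
  proof (rule that [of S])
    show "finite S" using assms by (simp add: S_def)
    show "S \<subseteq> Units P" using f by (auto simp: S_def)
    show "\<exists>a\<in>Units Q. \<exists>s\<in>S. u = h a \<otimes> s" if u: "u \<in> Units P" for u
    proof -
      have c: "unit_coset u \<in> unit_coset ` Units P" using u by blast
      have "u \<in> unit_coset (f (unit_coset u))"
        unfolding f(2) [OF c] using unit_coset_self u by blast
      then obtain a where "a \<in> Units Q" "u = h a \<otimes> f (unit_coset u)"
        unfolding unit_coset_def by blast
      moreover have "f (unit_coset u) \<in> S" using c by (simp add: S_def)
      ultimately show ?thesis by blast
    qed
    show "s = s'" if ss': "s \<in> S" "s' \<in> S" "a \<in> Units Q" "s = h a \<otimes> s'" for s s' a
    proof -
      obtain c where c: "c \<in> unit_coset ` Units P" "s = f c" using ss'(1) by (auto simp: S_def)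
      obtain c' where c': "c' \<in> unit_coset ` Units P" "s' = f c'" using ss'(2) by (auto simp: S_def)
      have "s' \<in> carrier P" using f(1) [OF c'(1)] c'(2) by auto
      then have "unit_coset s = unit_coset s'" using unit_coset_mult ss'(3,4) by simp
      then have "c = c'" using f(2) [OF c(1)] f(2) [OF c'(1)] c(2) c'(2) by simp
      then show ?thesis using c(2) c'(2) by simp
    qed
  qed
qed

lemma finite_unit_cosets:
  assumes S: "unit_basis S"
  shows "finite (unit_coset ` Units P)"
proof (rule finite_subset)
  show "unit_coset ` Units P \<subseteq> unit_coset ` S"
  proof
    fix c assume "c \<in> unit_coset ` Units P"
    then obtain u where u: "u \<in> Units P" "c = unit_coset u" by blast
    obtain a s where a: "a \<in> Units Q" and s: "s \<in> S" and us: "u = h a \<otimes> s"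
      using unit_basis_decomp [OF S u(1)] .
    have "s \<in> carrier P" using s S by (auto simp: unit_basis_def)
    then have "c = unit_coset s" using u(2) us unit_coset_mult a by simp
    then show "c \<in> unit_coset ` S" using s by blast
  qed
  show "finite (unit_coset ` S)" using S by (simp add: unit_basis_def)
qed

end

section \<open>Sharpenings and pushouts\<close>

context cancel_monoid_map
begin

abbreviation "injective_with_isomorphic_sharpening \<equiv>
  inj_on h (carrier Q) \<and> sharpening_map P h \<in> iso (sharpening Q) (sharpening P) \<and>
  finite (carrier (cokernel_monoid Q P h))"

lemma submonoid_image: "submonoid (h ` carrier Q) P"
proof
  show "x \<otimes> y \<in> h ` carrier Q" if "x \<in> h ` carrier Q" "y \<in> h ` carrier Q" for x y
    using that by (auto simp flip: h_mult)
  show "\<one> \<in> h ` carrier Q" using h_one Q.one_closed by (metis image_eqI)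
qed auto

text \<open>\<open>sharpening_map\<close> is a union over the members of a class; their images
  differ by units and have one class in common.\<close>

lemma sharpening_map_class:
  assumes q: "q \<in> carrier Q"
  shows "sharpening_map P h (submonoid_cong Q (Units Q) `` {q}) = submonoid_cong P (Units P) `` {h q}"
proof -
  let ?r = "submonoid_cong Q (Units Q)"
  have "submonoid_cong P (Units P) `` {h q'} = submonoid_cong P (Units P) `` {h q}"
    if q': "q' \<in> ?r `` {q}" for q'
  proof -
    have c: "q' \<in> carrier Q" using q' by (auto simp: submonoid_cong_def)
    have "?r `` {q} = ?r `` {q'}"
      using q' equiv_class_eq [OF Q.equiv_submonoid_cong [OF Q.submonoid_Units]] by blast
    then obtain a where "a \<in> Units Q" "q = q' \<otimes>\<^bsub>Q\<^esub> a"
      using Q.Units_cong_class_eq_iff [OF q c] by blast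
    then have "\<exists>u\<in>Units P. h q = h q' \<otimes> u"
      using c h_Units by (auto simp: h_mult Q.Units_closed)
    then show ?thesis using P.Units_cong_class_eq_iff q c by (metis h_closed)
  qed
  moreover have "q \<in> ?r `` {q}"
    by (rule equiv_class_self [OF Q.equiv_submonoid_cong [OF Q.submonoid_Units] q])
  ultimately show ?thesis unfolding sharpening_map_def by blast
qed

text \<open>Since the basis consists of units, \<open>p = h q \<otimes> s\<close> has the class of
  \<open>h q\<close> in the sharpening and the class of \<open>s\<close> in the cokernel. This gives
  surjectivity and finiteness; \<open>unit_basis_multiple_iff\<close> gives injectivity.\<close>

lemma isomorphic_sharpening_if_unit_basis:
  assumes S: "unit_basis S"
  shows injective_with_isomorphic_sharpening
proof (intro conjI)
  have S1: "basis S" and SU: "S \<subseteq> Units P" and fS: "finite S" using S by (auto simp: unit_basis_def)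
  show "inj_on h (carrier Q)" by (rule basis_inj [OF S1])
  let ?rQ = "submonoid_cong Q (Units Q)" and ?rP = "submonoid_cong P (Units P)"
  have cQ: "carrier (sharpening Q) = carrier Q // ?rQ" and cP: "carrier (sharpening P) = carrier P // ?rP"
    by (auto simp: sharpening_def quotient_monoid_def)
  have mQ: "?rQ `` {x} \<otimes>\<^bsub>sharpening Q\<^esub> ?rQ `` {y} = ?rQ `` {x \<otimes>\<^bsub>Q\<^esub> y}" if "x \<in> carrier Q" "y \<in> carrier Q" for x y
    unfolding sharpening_def using Q.submonoid_cong_mult_class [OF Q.submonoid_Units that] .
  have mP: "?rP `` {x} \<otimes>\<^bsub>sharpening P\<^esub> ?rP `` {y} = ?rP `` {x \<otimes> y}" if "x \<in> carrier P" "y \<in> carrier P" for x y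
    unfolding sharpening_def using P.submonoid_cong_mult_class [OF P.submonoid_Units that] .
  show "sharpening_map P h \<in> iso (sharpening Q) (sharpening P)"
    unfolding iso_def
  proof (intro CollectI conjI)
    show "sharpening_map P h \<in> hom (sharpening Q) (sharpening P)"
    proof (rule homI)
      fix V assume "V \<in> carrier (sharpening Q)"
      then obtain q where "q \<in> carrier Q" "V = ?rQ `` {q}" by (auto simp: cQ elim: quotientE)
      then show "sharpening_map P h V \<in> carrier (sharpening P)"
        by (simp add: sharpening_map_class cP quotientI)
    next
      fix V W assume "V \<in> carrier (sharpening Q)" "W \<in> carrier (sharpening Q)"
      then obtain q r where "q \<in> carrier Q" "V = ?rQ `` {q}" "r \<in> carrier Q" "W = ?rQ `` {r}"
        by (auto simp: cQ elim!: quotientE)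
      then show "sharpening_map P h (V \<otimes>\<^bsub>sharpening Q\<^esub> W) =
          sharpening_map P h V \<otimes>\<^bsub>sharpening P\<^esub> sharpening_map P h W"
        by (simp add: sharpening_map_class mP mQ h_mult)
    qed
    show "bij_betw (sharpening_map P h) (carrier (sharpening Q)) (carrier (sharpening P))"
      unfolding bij_betw_def
    proof
      show "inj_on (sharpening_map P h) (carrier (sharpening Q))"
      proof (rule inj_onI)
        fix V W assume "V \<in> carrier (sharpening Q)" "W \<in> carrier (sharpening Q)"
          and eq: "sharpening_map P h V = sharpening_map P h W"
        then obtain q r where q: "q \<in> carrier Q" "V = ?rQ `` {q}" and r: "r \<in> carrier Q" "W = ?rQ `` {r}"
          by (auto simp: cQ elim!: quotientE)
        then obtain u where u: "u \<in> Units P" "h q = h r \<otimes> u"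
          using eq P.Units_cong_class_eq_iff [of "h q" "h r"] by (auto simp: sharpening_map_class)
        have "h q \<otimes> \<one> = h r \<otimes> u" using u(2) q(1) by (metis P.r_one h_closed)
        then have "\<exists>a\<in>Units Q. q = r \<otimes>\<^bsub>Q\<^esub> a"
          using unit_basis_multiple_iff [OF S q(1) r(1) P.Units_one_closed u(1)] by blast
        then show "V = W" using Q.Units_cong_class_eq_iff q r by simp
      qed
      show "sharpening_map P h ` carrier (sharpening Q) = carrier (sharpening P)"
      proof
        show "sharpening_map P h ` carrier (sharpening Q) \<subseteq> carrier (sharpening P)"
          by (auto simp: cQ cP sharpening_map_class quotientI elim!: quotientE)
        show "carrier (sharpening P) \<subseteq> sharpening_map P h ` carrier (sharpening Q)"
        proof
          fix V assume "V \<in> carrier (sharpening P)"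
          then obtain p where p: "p \<in> carrier P" "V = ?rP `` {p}" by (auto simp: cP elim!: quotientE)
          obtain q s where q: "q \<in> carrier Q" "s \<in> S" "p = h q \<otimes> s" using basis_decomp [OF S1 p(1)] .
          have "\<exists>u\<in>Units P. p = h q \<otimes> u" using q(2,3) SU by blast
          then have "V = sharpening_map P h (?rQ `` {q})"
            using p q(1) P.Units_cong_class_eq_iff [of p "h q"] by (simp add: sharpening_map_class)
          then show "V \<in> sharpening_map P h ` carrier (sharpening Q)"
            using q(1) by (auto simp: cQ quotientI)
        qed
      qed
    qed
  qed
  let ?r = "submonoid_cong P (h ` carrier Q)"
  have "carrier (cokernel_monoid Q P h) \<subseteq> (\<lambda>s. ?r `` {s}) ` S"
  proof
    fix V assume "V \<in> carrier (cokernel_monoid Q P h)"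
    then obtain p where p: "p \<in> carrier P" "V = ?r `` {p}"
      by (auto simp: cokernel_monoid_def quotient_monoid_def elim!: quotientE)
    obtain q s where q: "q \<in> carrier Q" "s \<in> S" "p = h q \<otimes> s" using basis_decomp [OF S1 p(1)] .
    have sc: "s \<in> carrier P" using q(2) SU by auto
    have "p \<otimes> h \<one>\<^bsub>Q\<^esub> = s \<otimes> h q" using q sc by (simp add: P.m_comm)
    then have "(p, s) \<in> ?r" using p q(1) sc unfolding submonoid_cong_def by blast
    then have "V = ?r `` {s}"
      using p equiv_class_eq [OF P.equiv_submonoid_cong [OF submonoid_image]] by simp
    then show "V \<in> (\<lambda>s. ?r `` {s}) ` S" using q by blast
  qed
  then show "finite (carrier (cokernel_monoid Q P h))" using fS finite_subset by blast
qed

text \<open>Surjectivity on sharpenings gives a factorization \<open>h q \<otimes> u\<close> of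
  every element. Injectivity, together with cancellation, makes it unique up to a unit of
  \<open>Q\<close>, so representatives of the cosets of units form a basis.\<close>

lemma unit_basis_if_isomorphic_sharpening:
  assumes injective_with_isomorphic_sharpening
  shows "\<exists>S. unit_basis S"
proof -
  let ?rQ = "submonoid_cong Q (Units Q)" and ?rP = "submonoid_cong P (Units P)"
    and ?r = "submonoid_cong P (h ` carrier Q)"
  have cQ: "carrier (sharpening Q) = carrier Q // ?rQ" and cP: "carrier (sharpening P) = carrier P // ?rP"
    by (auto simp: sharpening_def quotient_monoid_def)
  have inj: "inj_on h (carrier Q)" using assms by simp
  have bij: "bij_betw (sharpening_map P h) (carrier Q // ?rQ) (carrier P // ?rP)"
    using assms by (simp add: iso_def cQ cP)
  have decomp: "\<exists>q\<in>carrier Q. \<exists>u\<in>Units P. p = h q \<otimes> u" if p: "p \<in> carrier P" for p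
  proof -
    have "?rP `` {p} \<in> sharpening_map P h ` (carrier Q // ?rQ)"
      using bij_betw_imp_surj_on [OF bij] p by (simp add: quotientI)
    then obtain q where "q \<in> carrier Q" "?rP `` {p} = ?rP `` {h q}"
      by (auto simp: sharpening_map_class elim!: quotientE)
    then show ?thesis using P.Units_cong_class_eq_iff [of p "h q"] p by auto
  qed
  have assoc: "\<exists>a\<in>Units Q. q = q' \<otimes>\<^bsub>Q\<^esub> a \<and> h a \<otimes> u = u'"
    if q: "q \<in> carrier Q" "q' \<in> carrier Q" and u: "u \<in> Units P" "u' \<in> Units P" and eq: "h q \<otimes> u = h q' \<otimes> u'"
    for q q' u u'
  proof -
    have "h q = (h q \<otimes> u) \<otimes> inv u" using q u by (simp add: P.m_assoc P.Units_closed)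
    also have "\<dots> = h q' \<otimes> (u' \<otimes> inv u)" unfolding eq using q u by (simp add: P.m_assoc P.Units_closed)
    finally have "\<exists>w\<in>Units P. h q = h q' \<otimes> w" using u by blast
    then have "sharpening_map P h (?rQ `` {q}) = sharpening_map P h (?rQ `` {q'})"
      using q P.Units_cong_class_eq_iff by (simp add: sharpening_map_class)
    then have "?rQ `` {q} = ?rQ `` {q'}"
      using inj_onD [OF bij_betw_imp_inj_on [OF bij]] q by (simp add: quotientI)
    then obtain a where a: "a \<in> Units Q" "q = q' \<otimes>\<^bsub>Q\<^esub> a"
      using Q.Units_cong_class_eq_iff q by auto
    have "h q' \<otimes> (h a \<otimes> u) = h q' \<otimes> u'"
      using eq q a u by (simp add: h_mult_assoc Q.Units_closed P.Units_closed)
    then have "h a \<otimes> u = u'"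
      using P.l_cancel q a u by (meson P.Units_closed P.m_closed Q.Units_closed h_closed)
    then show ?thesis using a by blast
  qed
  \<comment> \<open>Units with the same class in the cokernel satisfy
    \<open>h q \<otimes> u = h q' \<otimes> v\<close> and therefore differ by the image of a unit of
    \<open>Q\<close>. So the finite cokernel bounds the number of cosets.\<close>
  have "finite (unit_coset ` Units P)"
  proof (rule finite_image_factor [where f = "\<lambda>u. ?r `` {u}"])
    have "(\<lambda>u. ?r `` {u}) ` Units P \<subseteq> carrier (cokernel_monoid Q P h)"
      by (auto simp: cokernel_monoid_def quotient_monoid_def quotientI P.Units_closed)
    then show "finite ((\<lambda>u. ?r `` {u}) ` Units P)" using assms finite_subset by blast
    fix u v assume u: "u \<in> Units P" and v: "v \<in> Units P" and eq: "?r `` {u} = ?r `` {v}"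
    have "(u, v) \<in> ?r"
      using eq_equiv_class [OF eq P.equiv_submonoid_cong [OF submonoid_image]] v by auto
    then obtain q q' where q: "q \<in> carrier Q" "q' \<in> carrier Q" "u \<otimes> h q = v \<otimes> h q'"
      by (auto simp: submonoid_cong_def)
    then have "h q \<otimes> u = h q' \<otimes> v" using u v by (simp add: P.m_comm P.Units_closed)
    then obtain a where "a \<in> Units Q" "h a \<otimes> u = v" using assoc q(1,2) u v by blast
    then show "unit_coset u = unit_coset v" using unit_coset_mult u by auto
  qed
  then obtain S where fS: "finite S" and SU: "S \<subseteq> Units P"
    and ex: "\<And>u. u \<in> Units P \<Longrightarrow> \<exists>a\<in>Units Q. \<exists>s\<in>S. u = h a \<otimes> s"
    and uniq: "\<And>s s' a. \<lbrakk>s \<in> S; s' \<in> S; a \<in> Units Q; s = h a \<otimes> s'\<rbrakk> \<Longrightarrow> s = s'"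
    using unit_coset_representatives by blast
  have Sc: "S \<subseteq> carrier P" using SU by auto
  have "basis S"
  proof (rule basisI [OF Sc])
    fix p assume "p \<in> carrier P"
    then obtain q u where q: "q \<in> carrier Q" "u \<in> Units P" "p = h q \<otimes> u" using decomp by blast
    obtain a s where a: "a \<in> Units Q" "s \<in> S" "u = h a \<otimes> s" using ex [OF q(2)] by blast
    have "s \<in> carrier P" using a Sc by blast
    then have "p = h (q \<otimes>\<^bsub>Q\<^esub> a) \<otimes> s" using q a by (simp add: h_mult_assoc Q.Units_closed)
    then show "\<exists>q\<in>carrier Q. \<exists>s\<in>S. p = h q \<otimes> s" using q(1) a(1,2) by blast
  next
    fix q q' s s' assume q: "q \<in> carrier Q" "q' \<in> carrier Q" and s: "s \<in> S" "s' \<in> S"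
      and eq: "h q \<otimes> s = h q' \<otimes> s'"
    have su: "s \<in> Units P" "s' \<in> Units P" using s SU by auto
    obtain a where "a \<in> Units Q" "h a \<otimes> s = s'" using assoc [OF q su eq] by blast
    then have ss: "s' = s" using uniq s by blast
    then have "h q = h q'" using P.r_cancel eq su q by (metis P.Units_closed h_closed)
    then show "q = q' \<and> s = s'" using ss inj q by (simp add: inj_on_def)
  qed
  then show ?thesis using fS SU unit_basis_def by blast
qed

end

section \<open>The pushout square of units\<close>

context cancel_monoid_map
begin

abbreviation "pushout_of_units_with_finite_cokernel \<equiv>
  inj_on h (Units Q) \<and> finite (carrier (units_of P Mod (h ` Units Q))) \<and>
  is_pushout (units_of Q) (units_of P) Q P h (\<lambda>q. q) (\<lambda>p. p) h"

lemma carrier_units_Mod: "carrier (units_of P Mod (h ` Units Q)) = unit_coset ` Units P"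
  by (auto simp: FactGroup_def RCOSETS_def r_coset_def unit_coset_def units_of_def)

text \<open>The map out of \<open>P\<close> must send \<open>h q \<otimes> x\<close> to the product
  of \<open>v q\<close> and \<open>u x\<close>. It is well defined because the factorization is
  unique up to units of \<open>Q\<close>, on which \<open>u\<close> and \<open>v\<close> are
  compatible.\<close>

lemma pushout_if_unit_basis:
  assumes S: "unit_basis S"
  shows pushout_of_units_with_finite_cokernel
proof (intro conjI)
  have S1: "basis S" and SU: "S \<subseteq> Units P" using S by (auto simp: unit_basis_def)
  show "inj_on h (Units Q)" using basis_inj [OF S1] by (rule inj_on_subset) auto
  show "finite (carrier (units_of P Mod (h ` Units Q)))"
    unfolding carrier_units_Mod by (rule finite_unit_cosets [OF S])
  show "is_pushout (units_of Q) (units_of P) Q P h (\<lambda>q. q) (\<lambda>p. p) h"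
    unfolding is_pushout_def
  proof (intro conjI ballI allI impI)
    show "h \<in> monoid_homs (units_of Q) (units_of P)"
      by (auto simp: monoid_homs_def hom_def units_of_def h_Units h_mult Q.Units_closed)
    show "(\<lambda>q. q) \<in> monoid_homs (units_of Q) Q" "(\<lambda>p. p) \<in> monoid_homs (units_of P) P"
      by (auto simp: monoid_homs_def hom_def units_of_def)
    show "h \<in> monoid_homs Q P" by (rule hom)
    fix T :: "('p \<times> 'q \<times> 'p) monoid" and u v
    assume asm: "comm_monoid T \<and> u \<in> monoid_homs (units_of P) T \<and> v \<in> monoid_homs Q T \<and>
      (\<forall>a\<in>carrier (units_of Q). u (h a) = v a)"
    interpret T: comm_monoid T using asm by blast
    have u_closed: "\<And>x. x \<in> Units P \<Longrightarrow> u x \<in> carrier T" and u_one: "u \<one> = \<one>\<^bsub>T\<^esub>"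
      and u_mult: "\<And>x y. \<lbrakk>x \<in> Units P; y \<in> Units P\<rbrakk> \<Longrightarrow> u (x \<otimes> y) = u x \<otimes>\<^bsub>T\<^esub> u y"
      using asm by (auto simp: monoid_homs_def hom_def units_of_def)
    have v_closed: "\<And>x. x \<in> carrier Q \<Longrightarrow> v x \<in> carrier T" and v_one: "v \<one>\<^bsub>Q\<^esub> = \<one>\<^bsub>T\<^esub>"
      and v_mult: "\<And>x y. \<lbrakk>x \<in> carrier Q; y \<in> carrier Q\<rbrakk> \<Longrightarrow> v (x \<otimes>\<^bsub>Q\<^esub> y) = v x \<otimes>\<^bsub>T\<^esub> v y"
      using asm by (auto simp: monoid_homs_def hom_def)
    have uv: "u (h a) = v a" if "a \<in> Units Q" for a
      using asm that by (auto simp: units_of_def)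
    have wd: "v q \<otimes>\<^bsub>T\<^esub> u x = v r \<otimes>\<^bsub>T\<^esub> u y"
      if q: "q \<in> carrier Q" "r \<in> carrier Q" and x: "x \<in> Units P" "y \<in> Units P" and eq: "h q \<otimes> x = h r \<otimes> y"
      for q r x y
    proof -
      obtain a where a: "a \<in> Units Q" "q = r \<otimes>\<^bsub>Q\<^esub> a"
        using unit_basis_multiple_iff [OF S q x eq] by blast
      have "h r \<otimes> (h a \<otimes> x) = h r \<otimes> y"
        using eq a q x by (simp add: h_mult_assoc Q.Units_closed P.Units_closed)
      then have y: "y = h a \<otimes> x"
        using P.l_cancel [of "h r" "h a \<otimes> x" y] q x a by (simp add: Q.Units_closed P.Units_closed)
      show ?thesis
        using a q x h_Units by (simp add: y u_mult uv v_mult v_closed u_closed T.m_assoc Q.Units_closed)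
    qed
    have decomp: "\<exists>q x. q \<in> carrier Q \<and> x \<in> Units P \<and> p = h q \<otimes> x" if p: "p \<in> carrier P" for p
    proof -
      obtain q s where "q \<in> carrier Q" "s \<in> S" "p = h q \<otimes> s" using basis_decomp [OF S1 p] .
      then show ?thesis using SU by auto
    qed
    then obtain f g where fg: "\<And>p. p \<in> carrier P \<Longrightarrow> f p \<in> carrier Q \<and> g p \<in> Units P \<and> p = h (f p) \<otimes> g p"
      by metis
    \<comment> \<open>Chosen factorizations define the map, and \<open>wd\<close> then allows
      arbitrary ones. Restriction to the carrier makes it extensional, as the uniqueness statement
      demands.\<close>
    define w where "w = (\<lambda>p\<in>carrier P. v (f p) \<otimes>\<^bsub>T\<^esub> u (g p))"
    have w: "w (h q \<otimes> x) = v q \<otimes>\<^bsub>T\<^esub> u x" if q: "q \<in> carrier Q" and x: "x \<in> Units P" for q x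
    proof -
      have c: "h q \<otimes> x \<in> carrier P" using that by auto
      then show ?thesis using wd [of "f (h q \<otimes> x)" q "g (h q \<otimes> x)" x] fg [OF c] q x by (simp add: w_def)
    qed
    show "\<exists>!w. w \<in> monoid_homs P T \<and> w \<in> extensional (carrier P) \<and>
        (\<forall>b\<in>carrier (units_of P). w b = u b) \<and> (\<forall>c\<in>carrier Q. w (h c) = v c)"
    proof (rule ex1I [of _ w])
      have w_mult: "w (x \<otimes> y) = w x \<otimes>\<^bsub>T\<^esub> w y" if xy: "x \<in> carrier P" "y \<in> carrier P" for x y
      proof -
        obtain q a where q: "q \<in> carrier Q" "a \<in> Units P" "x = h q \<otimes> a" using decomp [OF xy(1)] by blast
        obtain r b where r: "r \<in> carrier Q" "b \<in> Units P" "y = h r \<otimes> b" using decomp [OF xy(2)] by blast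
        have "x \<otimes> y = h (q \<otimes>\<^bsub>Q\<^esub> r) \<otimes> (a \<otimes> b)"
          using q r by (simp add: h_mult P.m_ac P.Units_closed)
        then have "w (x \<otimes> y) = v (q \<otimes>\<^bsub>Q\<^esub> r) \<otimes>\<^bsub>T\<^esub> u (a \<otimes> b)"
          using w [of "q \<otimes>\<^bsub>Q\<^esub> r" "a \<otimes> b"] q r by simp
        then show ?thesis
          using q r by (simp add: w u_mult v_mult u_closed v_closed T.m_ac)
      qed
      have "w p \<in> carrier T" if "p \<in> carrier P" for p
        using fg [OF that] that by (simp add: w_def u_closed v_closed)
      moreover have "w b = u b" if "b \<in> Units P" for b
        using w [OF Q.one_closed that] that by (simp add: v_one u_closed P.Units_closed)
      moreover have "w (h c) = v c" if "c \<in> carrier Q" for c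
        using w [OF that P.Units_one_closed] that by (simp add: u_one v_closed)
      moreover have "w \<in> extensional (carrier P)" by (simp add: w_def)
      ultimately show "w \<in> monoid_homs P T \<and> w \<in> extensional (carrier P) \<and>
        (\<forall>b\<in>carrier (units_of P). w b = u b) \<and> (\<forall>c\<in>carrier Q. w (h c) = v c)"
        using w_mult u_one by (auto simp: monoid_homs_def hom_def units_of_def)
    next
      fix w' assume w': "w' \<in> monoid_homs P T \<and> w' \<in> extensional (carrier P) \<and>
        (\<forall>b\<in>carrier (units_of P). w' b = u b) \<and> (\<forall>c\<in>carrier Q. w' (h c) = v c)"
      show "w' = w"
      proof (rule extensionalityI)
        show "w' \<in> extensional (carrier P)" "w \<in> extensional (carrier P)" using w' by (auto simp: w_def)
        fix p assume p: "p \<in> carrier P"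
        have "w' p = w' (h (f p) \<otimes> g p)" using fg [OF p] by simp
        also have "\<dots> = w' (h (f p)) \<otimes>\<^bsub>T\<^esub> w' (g p)"
          using w' fg [OF p] by (intro hom_mult) (auto simp: monoid_homs_def)
        also have "\<dots> = v (f p) \<otimes>\<^bsub>T\<^esub> u (g p)"
          using w' fg [OF p] by (simp add: units_of_carrier)
        finally show "w' p = w p" using p by (simp add: w_def)
      qed
    qed
  qed (simp add: units_of_def)
qed

text \<open>
  Comparing \<open>P\<close> with the explicit pushout carried by \<open>S \<times> Q\<close>, where \<open>S\<close> is a set of
  representatives of the cosets of \<open>Q\<^sup>*\<close> in \<open>P\<^sup>*\<close>, shows that \<open>S\<close> is a basis.
\<close>

lemma unit_basis_if_pushout:
  assumes pushout_of_units_with_finite_cokernel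
  shows "\<exists>S. unit_basis S"
proof -
  have inj: "inj_on h (Units Q)" and fin: "finite (unit_coset ` Units P)"
    and push: "is_pushout (units_of Q) (units_of P) Q P h (\<lambda>q. q) (\<lambda>p. p) h"
    using assms by (auto simp: carrier_units_Mod)
  have pushD: "comm_monoid T \<and> u \<in> monoid_homs (units_of P) T \<and> v \<in> monoid_homs Q T \<and>
        (\<forall>a\<in>carrier (units_of Q). u (h a) = v a) \<Longrightarrow>
      \<exists>!w. w \<in> monoid_homs P T \<and> w \<in> extensional (carrier P) \<and>
        (\<forall>b\<in>carrier (units_of P). w b = u b) \<and> (\<forall>c\<in>carrier Q. w (h c) = v c)"
    for T :: "('p \<times> 'q \<times> 'p) monoid" and u v
    by (rule push [unfolded is_pushout_def, THEN conjunct2, THEN conjunct2, THEN conjunct2,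
          THEN conjunct2, THEN conjunct2, THEN spec, THEN spec, THEN spec, THEN mp])
  obtain S where fS: "finite S" and SU: "S \<subseteq> Units P"
    and ex: "\<And>u. u \<in> Units P \<Longrightarrow> \<exists>a\<in>Units Q. \<exists>s\<in>S. u = h a \<otimes> s"
    and uniq: "\<And>s s' a. \<lbrakk>s \<in> S; s' \<in> S; a \<in> Units Q; s = h a \<otimes> s'\<rbrakk> \<Longrightarrow> s = s'"
    using unit_coset_representatives [OF fin] by blast
  have Sc: "s \<in> carrier P" if "s \<in> S" for s using SU that by auto
  \<comment> \<open>\<open>\<sigma> u\<close> is the representative of the coset of
    \<open>u\<close>, and \<open>\<alpha> u\<close> is the unit of \<open>Q\<close> by which the two
    differ.\<close>
  obtain \<alpha> \<sigma> where dec: "\<And>u. u \<in> Units P \<Longrightarrow> \<alpha> u \<in> Units Q \<and> \<sigma> u \<in> S \<and> u = h (\<alpha> u) \<otimes> \<sigma> u"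
    using ex by metis
  have \<alpha>c: "\<alpha> u \<in> carrier Q" and \<sigma>c: "\<sigma> u \<in> carrier P" and \<sigma>U: "\<sigma> u \<in> Units P" if "u \<in> Units P" for u
    using dec [OF that] SU by auto
  have rep: "\<sigma> (h a \<otimes> s) = s \<and> \<alpha> (h a \<otimes> s) = a" if a: "a \<in> Units Q" and s: "s \<in> S" for a s
  proof -
    let ?u = "h a \<otimes> s"
    have u: "?u \<in> Units P" using a s SU h_Units by blast
    note d = dec [OF u]
    have "s = h (inv\<^bsub>Q\<^esub> a) \<otimes> ?u"
      using a s Sc h_inv [OF a] by (simp add: Q.Units_closed flip: P.m_assoc)
    also have "\<dots> = h (inv\<^bsub>Q\<^esub> a) \<otimes> (h (\<alpha> ?u) \<otimes> \<sigma> ?u)" using d by simp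
    also have "\<dots> = h (inv\<^bsub>Q\<^esub> a \<otimes>\<^bsub>Q\<^esub> \<alpha> ?u) \<otimes> \<sigma> ?u"
      using a \<alpha>c [OF u] \<sigma>c [OF u] by (simp add: h_mult_assoc)
    finally have s': "s = \<sigma> ?u" using uniq [of s "\<sigma> ?u" "inv\<^bsub>Q\<^esub> a \<otimes>\<^bsub>Q\<^esub> \<alpha> ?u"] s d a by simp
    have "h a = h (\<alpha> ?u)"
      using P.r_cancel [of "h a" s "h (\<alpha> ?u)"] d s' a s Sc \<alpha>c [OF u] by (simp add: Q.Units_closed)
    then have "a = \<alpha> ?u" using inj a d by (simp add: inj_on_def)
    then show ?thesis using s' by simp
  qed
  have mul: "\<sigma> (h a \<otimes> u) = \<sigma> u \<and> \<alpha> (h a \<otimes> u) = a \<otimes>\<^bsub>Q\<^esub> \<alpha> u" if a: "a \<in> Units Q" and u: "u \<in> Units P" for a u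
  proof -
    have "h a \<otimes> u = h (a \<otimes>\<^bsub>Q\<^esub> \<alpha> u) \<otimes> \<sigma> u"
      using dec [OF u] a \<alpha>c [OF u] \<sigma>c [OF u] by (metis Q.Units_closed h_mult_assoc)
    then show ?thesis using rep [of "a \<otimes>\<^bsub>Q\<^esub> \<alpha> u" "\<sigma> u"] dec [OF u] a by simp
  qed
  \<comment> \<open>The first factor may be replaced by its representative at the cost of
    \<open>\<alpha> u\<close>. This is the source of the cocycle identity behind the associativity
    of \<open>T\<close>.\<close>
  have mul2: "\<sigma> (u \<otimes> v) = \<sigma> (\<sigma> u \<otimes> v) \<and> \<alpha> (u \<otimes> v) = \<alpha> u \<otimes>\<^bsub>Q\<^esub> \<alpha> (\<sigma> u \<otimes> v)"
    if u: "u \<in> Units P" and v: "v \<in> Units P" for u v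
  proof -
    have "u \<otimes> v = h (\<alpha> u) \<otimes> (\<sigma> u \<otimes> v)"
      using dec [OF u] \<alpha>c [OF u] \<sigma>c [OF u] v by (metis P.Units_closed P.m_assoc h_closed)
    then show ?thesis using mul [of "\<alpha> u" "\<sigma> u \<otimes> v"] dec [OF u] \<sigma>U [OF u] v by simp
  qed
  \<comment> \<open>The pushout in coordinates. A product of representatives need not be a
    representative, so the factor \<open>\<alpha> (s \<otimes> t)\<close> corrects it, as in an
    extension given by a cocycle. The identity is adjusted as well, because \<open>\<one>\<close>
    need not be in \<open>S\<close>. The constant last component fits \<open>T\<close> into the type
    of test monoids.\<close>
  define T :: "('p \<times> 'q \<times> 'p) monoid" where
    "T = \<lparr>carrier = S \<times> carrier Q \<times> {\<one>},
      monoid.mult = (\<lambda>(s, q, _) (t, r, _). (\<sigma> (s \<otimes> t), q \<otimes>\<^bsub>Q\<^esub> r \<otimes>\<^bsub>Q\<^esub> \<alpha> (s \<otimes> t), \<one>)),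
      one = (\<sigma> \<one>, \<alpha> \<one>, \<one>)\<rparr>"
  have one_mul: "\<sigma> (\<sigma> \<one> \<otimes> s) = s" "\<alpha> \<one> \<otimes>\<^bsub>Q\<^esub> \<alpha> (\<sigma> \<one> \<otimes> s) = \<one>\<^bsub>Q\<^esub>" if s: "s \<in> S" for s
    using mul2 [OF P.Units_one_closed, of s] rep [OF Q.Units_one_closed s] s SU Sc by auto
  have T: "comm_monoid T"
  proof (rule comm_monoidI)
    show "x \<otimes>\<^bsub>T\<^esub> y \<in> carrier T" if "x \<in> carrier T" "y \<in> carrier T" for x y
      using that dec SU \<alpha>c by (auto simp: T_def subset_iff)
    show "\<one>\<^bsub>T\<^esub> \<in> carrier T" using dec \<alpha>c by (auto simp: T_def)
    show "x \<otimes>\<^bsub>T\<^esub> y = y \<otimes>\<^bsub>T\<^esub> x" if "x \<in> carrier T" "y \<in> carrier T" for x y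
      using that Sc by (auto simp: T_def P.m_comm Q.m_comm)
    show "\<one>\<^bsub>T\<^esub> \<otimes>\<^bsub>T\<^esub> x = x" if x: "x \<in> carrier T" for x
    proof -
      obtain s q where sq: "x = (s, q, \<one>)" "s \<in> S" "q \<in> carrier Q" using x by (auto simp: T_def)
      have "\<sigma> \<one> \<otimes> s \<in> Units P" using sq(2) SU \<sigma>U by blast
      then have "\<alpha> \<one> \<otimes>\<^bsub>Q\<^esub> q \<otimes>\<^bsub>Q\<^esub> \<alpha> (\<sigma> \<one> \<otimes> s) = q \<otimes>\<^bsub>Q\<^esub> (\<alpha> \<one> \<otimes>\<^bsub>Q\<^esub> \<alpha> (\<sigma> \<one> \<otimes> s))"
        using sq(3) \<alpha>c by (simp add: Q.m_ac)
      then show ?thesis using one_mul [OF sq(2)] sq by (simp add: T_def)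
    qed
    show "(x \<otimes>\<^bsub>T\<^esub> y) \<otimes>\<^bsub>T\<^esub> z = x \<otimes>\<^bsub>T\<^esub> (y \<otimes>\<^bsub>T\<^esub> z)"
      if xyz: "x \<in> carrier T" "y \<in> carrier T" "z \<in> carrier T" for x y z
    proof -
      obtain s q t r u c where x: "x = (s, q, \<one>)" "s \<in> S" "q \<in> carrier Q"
        and y: "y = (t, r, \<one>)" "t \<in> S" "r \<in> carrier Q" and z: "z = (u, c, \<one>)" "u \<in> S" "c \<in> carrier Q"
        using xyz by (auto simp: T_def)
      have U: "s \<in> Units P" "t \<in> Units P" "u \<in> Units P" using x y z SU by auto
      \<comment> \<open>The product of the three representatives is decomposed with two different
        bracketings; equating the values of \<open>\<alpha>\<close> is the cocycle identity.\<close>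
      then have 1: "\<sigma> (s \<otimes> t \<otimes> u) = \<sigma> (\<sigma> (s \<otimes> t) \<otimes> u)"
          "\<alpha> (s \<otimes> t \<otimes> u) = \<alpha> (s \<otimes> t) \<otimes>\<^bsub>Q\<^esub> \<alpha> (\<sigma> (s \<otimes> t) \<otimes> u)"
        using mul2 [of "s \<otimes> t" u] by auto
      have 2: "\<sigma> (t \<otimes> u \<otimes> s) = \<sigma> (\<sigma> (t \<otimes> u) \<otimes> s)"
          "\<alpha> (t \<otimes> u \<otimes> s) = \<alpha> (t \<otimes> u) \<otimes>\<^bsub>Q\<^esub> \<alpha> (\<sigma> (t \<otimes> u) \<otimes> s)"
        using mul2 [of "t \<otimes> u" s] U by auto
      have 3: "t \<otimes> u \<otimes> s = s \<otimes> t \<otimes> u" "\<sigma> (t \<otimes> u) \<otimes> s = s \<otimes> \<sigma> (t \<otimes> u)"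
        using U \<sigma>c by (auto simp: P.m_ac P.Units_closed)
      have c4: "\<alpha> (s \<otimes> t) \<in> carrier Q" "\<alpha> (\<sigma> (s \<otimes> t) \<otimes> u) \<in> carrier Q"
          "\<alpha> (t \<otimes> u) \<in> carrier Q" "\<alpha> (s \<otimes> \<sigma> (t \<otimes> u)) \<in> carrier Q"
        using U \<alpha>c \<sigma>U by auto
      have "q \<otimes>\<^bsub>Q\<^esub> r \<otimes>\<^bsub>Q\<^esub> \<alpha> (s \<otimes> t) \<otimes>\<^bsub>Q\<^esub> c \<otimes>\<^bsub>Q\<^esub> \<alpha> (\<sigma> (s \<otimes> t) \<otimes> u) =
          (q \<otimes>\<^bsub>Q\<^esub> r \<otimes>\<^bsub>Q\<^esub> c) \<otimes>\<^bsub>Q\<^esub> (\<alpha> (s \<otimes> t) \<otimes>\<^bsub>Q\<^esub> \<alpha> (\<sigma> (s \<otimes> t) \<otimes> u))"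
        using x y z c4 by (simp add: Q.m_ac)
      also have "\<dots> = (q \<otimes>\<^bsub>Q\<^esub> r \<otimes>\<^bsub>Q\<^esub> c) \<otimes>\<^bsub>Q\<^esub> (\<alpha> (t \<otimes> u) \<otimes>\<^bsub>Q\<^esub> \<alpha> (s \<otimes> \<sigma> (t \<otimes> u)))"
        using 1(2) 2(2) 3 by simp
      also have "\<dots> = q \<otimes>\<^bsub>Q\<^esub> (r \<otimes>\<^bsub>Q\<^esub> c \<otimes>\<^bsub>Q\<^esub> \<alpha> (t \<otimes> u)) \<otimes>\<^bsub>Q\<^esub> \<alpha> (s \<otimes> \<sigma> (t \<otimes> u))"
        using x y z c4 by (simp add: Q.m_ac)
      finally show ?thesis using x y z 1(1) 2(1) 3 by (simp add: T_def)
    qed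
  qed
  define u where "u p = (\<sigma> p, \<alpha> p, \<one>)" for p
  define v where "v q = (\<sigma> \<one>, q \<otimes>\<^bsub>Q\<^esub> \<alpha> \<one>, \<one>)" for q
  have uT: "u \<in> monoid_homs (units_of P) T"
  proof -
    have "u (x \<otimes> y) = u x \<otimes>\<^bsub>T\<^esub> u y" if xy: "x \<in> Units P" "y \<in> Units P" for x y
    proof -
      have s: "\<sigma> y \<otimes> \<sigma> x = \<sigma> x \<otimes> \<sigma> y" "y \<otimes> \<sigma> x = \<sigma> x \<otimes> y"
        using \<sigma>c xy by (auto simp: P.m_comm P.Units_closed)
      have "\<sigma> x \<otimes> \<sigma> y \<in> Units P" using xy \<sigma>U by blast
      then have "\<alpha> x \<otimes>\<^bsub>Q\<^esub> (\<alpha> y \<otimes>\<^bsub>Q\<^esub> \<alpha> (\<sigma> x \<otimes> \<sigma> y)) = \<alpha> x \<otimes>\<^bsub>Q\<^esub> \<alpha> y \<otimes>\<^bsub>Q\<^esub> \<alpha> (\<sigma> x \<otimes> \<sigma> y)"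
        using \<alpha>c xy by (simp add: Q.m_assoc)
      then show ?thesis
        using mul2 [OF xy] mul2 [OF xy(2) \<sigma>U [OF xy(1)]] s by (simp add: u_def T_def)
    qed
    then show ?thesis using dec \<alpha>c by (auto simp: monoid_homs_def hom_def units_of_def u_def T_def)
  qed
  have vT: "v \<in> monoid_homs Q T"
  proof -
    have "v (q \<otimes>\<^bsub>Q\<^esub> r) = v q \<otimes>\<^bsub>T\<^esub> v r" if qr: "q \<in> carrier Q" "r \<in> carrier Q" for q r
    proof -
      have s1: "\<sigma> \<one> \<in> S" using dec [OF P.Units_one_closed] by blast
      have c: "\<sigma> \<one> \<otimes> \<sigma> \<one> \<in> Units P" using \<sigma>U by blast
      have "q \<otimes>\<^bsub>Q\<^esub> \<alpha> \<one> \<otimes>\<^bsub>Q\<^esub> (r \<otimes>\<^bsub>Q\<^esub> \<alpha> \<one>) \<otimes>\<^bsub>Q\<^esub> \<alpha> (\<sigma> \<one> \<otimes> \<sigma> \<one>) =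
          q \<otimes>\<^bsub>Q\<^esub> r \<otimes>\<^bsub>Q\<^esub> \<alpha> \<one> \<otimes>\<^bsub>Q\<^esub> (\<alpha> \<one> \<otimes>\<^bsub>Q\<^esub> \<alpha> (\<sigma> \<one> \<otimes> \<sigma> \<one>))"
        using qr \<alpha>c c by (simp add: Q.m_ac)
      then show ?thesis using one_mul [OF s1] qr \<alpha>c by (simp add: v_def T_def)
    qed
    then show ?thesis using dec \<alpha>c by (auto simp: monoid_homs_def hom_def v_def T_def)
  qed
  have "u (h a) = v a" if "a \<in> Units Q" for a
    using mul [OF that P.Units_one_closed] that by (simp add: u_def v_def Q.Units_closed)
  then have "\<exists>!w. w \<in> monoid_homs P T \<and> w \<in> extensional (carrier P) \<and>
      (\<forall>b\<in>carrier (units_of P). w b = u b) \<and> (\<forall>c\<in>carrier Q. w (h c) = v c)"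
    using pushD [of T u v] T uT vT by (simp add: units_of_carrier)
  then obtain w where w: "w \<in> monoid_homs P T" "\<And>b. b \<in> Units P \<Longrightarrow> w b = u b"
      "\<And>c. c \<in> carrier Q \<Longrightarrow> w (h c) = v c"
    by (auto simp: units_of_carrier)
  \<comment> \<open>The map \<open>w\<close> returns the coordinates of
    \<open>h q \<otimes> s\<close>, which makes expansions unique.\<close>
  have w_eval: "w (h q \<otimes> s) = (s, q, \<one>)" if q: "q \<in> carrier Q" and s: "s \<in> S" for q s
  proof -
    have su: "s \<in> Units P" using s SU by auto
    have "\<sigma> s = s" "\<alpha> s = \<one>\<^bsub>Q\<^esub>" using rep [OF Q.Units_one_closed s] Sc [OF s] by auto
    moreover have "\<sigma> \<one> \<otimes> s \<in> Units P" using su \<sigma>U by blast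
    moreover have "w (h q \<otimes> s) = v q \<otimes>\<^bsub>T\<^esub> u s"
      using w q su by (simp add: monoid_homs_def hom_def P.Units_closed)
    ultimately show ?thesis
      using one_mul [OF s] q \<alpha>c by (simp add: u_def v_def T_def Q.m_assoc)
  qed
  \<comment> \<open>A copy of \<open>P\<close> on the type of test monoids. Uniqueness of maps into
    it shows that the composite of \<open>w\<close> with the evident map from \<open>T\<close> back
    to \<open>P\<close> is the identity, so every element has an expansion.\<close>
  define D :: "('p \<times> 'q \<times> 'p) monoid" where
    "D = \<lparr>carrier = {(p, \<one>\<^bsub>Q\<^esub>, \<one>) | p. p \<in> carrier P},
      monoid.mult = (\<lambda>(s, _) (t, _). (s \<otimes> t, \<one>\<^bsub>Q\<^esub>, \<one>)), one = (\<one>, \<one>\<^bsub>Q\<^esub>, \<one>)\<rparr>"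
  have D: "comm_monoid D"
    by (rule comm_monoidI) (auto simp: D_def P.m_ac)
  define d :: "'p \<Rightarrow> 'p \<times> 'q \<times> 'p" where "d p = (p, \<one>\<^bsub>Q\<^esub>, \<one>)" for p
  have dP: "d \<in> monoid_homs P D" by (auto simp: monoid_homs_def hom_def d_def D_def)
  define e where "e = (\<lambda>p. case w p of (s, q, _) \<Rightarrow> d (h q \<otimes> s))"
  have wc: "w p \<in> carrier T" if "p \<in> carrier P" for p
    using w(1) that by (auto simp: monoid_homs_def hom_def)
  have eP: "e \<in> monoid_homs P D"
  proof -
    have "e (x \<otimes> y) = e x \<otimes>\<^bsub>D\<^esub> e y" if xy: "x \<in> carrier P" "y \<in> carrier P" for x y
    proof -
      obtain s q where x: "w x = (s, q, \<one>)" "s \<in> S" "q \<in> carrier Q" using wc [OF xy(1)] by (auto simp: T_def)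
      obtain t r where y: "w y = (t, r, \<one>)" "t \<in> S" "r \<in> carrier Q" using wc [OF xy(2)] by (auto simp: T_def)
      have st: "s \<otimes> t \<in> Units P" using x y SU by blast
      have "w (x \<otimes> y) = w x \<otimes>\<^bsub>T\<^esub> w y" using w(1) xy by (auto simp: monoid_homs_def hom_def)
      then have "e (x \<otimes> y) = d (h (q \<otimes>\<^bsub>Q\<^esub> r \<otimes>\<^bsub>Q\<^esub> \<alpha> (s \<otimes> t)) \<otimes> \<sigma> (s \<otimes> t))"
        by (simp add: e_def x y T_def)
      also have "h (q \<otimes>\<^bsub>Q\<^esub> r \<otimes>\<^bsub>Q\<^esub> \<alpha> (s \<otimes> t)) \<otimes> \<sigma> (s \<otimes> t) = h (q \<otimes>\<^bsub>Q\<^esub> r) \<otimes> (s \<otimes> t)"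
        using dec [OF st] \<alpha>c [OF st] \<sigma>c [OF st] x y by (simp add: h_mult_assoc)
      also have "\<dots> = (h q \<otimes> s) \<otimes> (h r \<otimes> t)" using x y Sc by (simp add: h_mult P.m_ac)
      finally show ?thesis by (simp add: e_def x y D_def d_def)
    qed
    moreover have "e x \<in> carrier D" if "x \<in> carrier P" for x
      using wc [OF that] Sc by (auto simp: e_def T_def D_def d_def)
    moreover have "e \<one> = \<one>\<^bsub>D\<^esub>"
      using w(2) [OF P.Units_one_closed] dec [OF P.Units_one_closed] by (simp add: e_def u_def d_def D_def)
    ultimately show ?thesis by (auto simp: monoid_homs_def hom_def)
  qed
  have e_unit: "e b = d b" if "b \<in> Units P" for b
    using w(2) [OF that] dec [OF that] by (simp add: e_def u_def)
  have e_h: "e (h c) = d (h c)" if "c \<in> carrier Q" for c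
  proof -
    have "h (c \<otimes>\<^bsub>Q\<^esub> \<alpha> \<one>) \<otimes> \<sigma> \<one> = h c"
      using dec [OF P.Units_one_closed] \<alpha>c \<sigma>c that by (simp add: h_mult_assoc)
    then show ?thesis using w(3) [OF that] by (simp add: e_def v_def)
  qed
  have "\<exists>!f. f \<in> monoid_homs P D \<and> f \<in> extensional (carrier P) \<and>
      (\<forall>b\<in>carrier (units_of P). f b = d b) \<and> (\<forall>c\<in>carrier Q. f (h c) = d (h c))"
  proof -
    have "d \<in> monoid_homs (units_of P) D" using dP by (auto simp: monoid_homs_def hom_def units_of_def)
    moreover have "(\<lambda>c. d (h c)) \<in> monoid_homs Q D"
      using dP by (auto simp: monoid_homs_def hom_def h_mult)
    ultimately show ?thesis using pushD [of D d "\<lambda>c. d (h c)"] D by simp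
  qed
  moreover have restr: "restrict f (carrier P) \<in> monoid_homs P D" if "f \<in> monoid_homs P D" for f
    using that by (auto simp: monoid_homs_def hom_def)
  ultimately obtain f where f: "\<And>f'. f' \<in> monoid_homs P D \<and> f' \<in> extensional (carrier P) \<and>
      (\<forall>b\<in>carrier (units_of P). f' b = d b) \<and> (\<forall>c\<in>carrier Q. f' (h c) = d (h c)) \<Longrightarrow> f' = f"
    by (elim ex1E) blast
  have "restrict e (carrier P) = f"
    by (rule f) (simp add: restr eP e_unit e_h units_of_carrier P.Units_closed)
  moreover have "restrict d (carrier P) = f"
    by (rule f) (simp add: restr dP units_of_carrier P.Units_closed)
  ultimately have eq: "restrict e (carrier P) = restrict d (carrier P)" by simp
  have "basis S"
  proof (rule basisI)
    show "S \<subseteq> carrier P" using Sc by blast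
    fix p assume p: "p \<in> carrier P"
    obtain s q where "w p = (s, q, \<one>)" "s \<in> S" "q \<in> carrier Q" using wc [OF p] by (auto simp: T_def)
    moreover have "e p = d p" using fun_cong [OF eq, of p] p by simp
    ultimately show "\<exists>q\<in>carrier Q. \<exists>s\<in>S. p = h q \<otimes> s" by (auto simp: e_def d_def)
  next
    fix q q' s s' assume "q \<in> carrier Q" "q' \<in> carrier Q" "s \<in> S" "s' \<in> S" "h q \<otimes> s = h q' \<otimes> s'"
    then have "(s, q, \<one>) = (s', q', \<one>)" using w_eval by metis
    then show "q = q' \<and> s = s'" by simp
  qed
  then show ?thesis using fS SU by (auto simp: unit_basis_def)
qed

end

section \<open>Monoid algebras\<close>

context abelian_monoid
begin

lemma finsum_Times:
  assumes "finite I" "finite J" "\<And>i j. \<lbrakk>i \<in> I; j \<in> J\<rbrakk> \<Longrightarrow> f (i, j) \<in> carrier G"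
  shows "(\<Oplus>z\<in>I \<times> J. f z) = (\<Oplus>i\<in>I. \<Oplus>j\<in>J. f (i, j))"
  using assms
proof (induction I rule: finite_induct)
  case (insert a I)
  have "(\<Oplus>z\<in>insert a I \<times> J. f z) = (\<Oplus>z\<in>(Pair a ` J) \<union> (I \<times> J). f z)"
    by (rule arg_cong [of _ _ "finsum G f"]) auto
  also have "\<dots> = (\<Oplus>z\<in>Pair a ` J. f z) \<oplus> (\<Oplus>z\<in>I \<times> J. f z)"
    using insert.hyps insert.prems by (intro finsum_Un_disjoint) auto
  also have "(\<Oplus>z\<in>Pair a ` J. f z) = (\<Oplus>j\<in>J. f (a, j))"
    using insert.prems by (intro finsum_reindex) (auto simp: inj_on_def)
  finally show ?case
    using insert by (simp add: Pi_def finsum_closed)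
qed simp

lemma finsum_swap:
  assumes "finite I" "finite J" "\<And>i j. \<lbrakk>i \<in> I; j \<in> J\<rbrakk> \<Longrightarrow> f i j \<in> carrier G"
  shows "(\<Oplus>i\<in>I. \<Oplus>j\<in>J. f i j) = (\<Oplus>j\<in>J. \<Oplus>i\<in>I. f i j)"
  using assms
proof (induction I rule: finite_induct)
  case (insert a I)
  have "(\<Oplus>j\<in>J. \<Oplus>i\<in>insert a I. f i j) = (\<Oplus>j\<in>J. f a j \<oplus> (\<Oplus>i\<in>I. f i j))"
    using insert by (intro finsum_cong') (auto intro!: finsum_closed)
  also have "\<dots> = (\<Oplus>j\<in>J. f a j) \<oplus> (\<Oplus>j\<in>J. \<Oplus>i\<in>I. f i j)"
    using insert by (intro finsum_addf) (auto intro!: finsum_closed)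
  finally show ?case
    using insert by (simp add: Pi_def finsum_closed)
qed (simp add: finsum_zero)

lemma finsum_fibers:
  assumes "finite Z" "\<And>z. z \<in> Z \<Longrightarrow> f z \<in> carrier G"
  shows "(\<Oplus>z\<in>Z. f z) = (\<Oplus>p\<in>m ` Z. \<Oplus>z\<in>{z \<in> Z. m z = p}. f z)"
proof -
  have "(\<Oplus>z\<in>Z. f z) = (\<Oplus>z\<in>(\<Union>p\<in>m ` Z. {z \<in> Z. m z = p}). f z)"
    by (rule arg_cong [of _ _ "finsum G f"]) auto
  also have "\<dots> = (\<Oplus>p\<in>m ` Z. \<Oplus>z\<in>{z \<in> Z. m z = p}. f z)"
    using assms by (intro add.finprod_UN_disjoint) (auto simp: pairwise_def disjnt_def)
  finally show ?thesis .
qed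

end

text \<open>
  An element \<open>f\<close> of \<open>R[M]\<close> is determined by the values of \<open>alg_eval R R id f\<close> on functions
  \<open>w\<close>, and products and images in monoid algebras are easily described in these terms.
\<close>

definition alg_eval :: "'a ring \<Rightarrow> 'b ring \<Rightarrow> ('a \<Rightarrow> 'b) \<Rightarrow> ('p \<Rightarrow> 'a) \<Rightarrow> ('p \<Rightarrow> 'b) \<Rightarrow> 'b" where
  "alg_eval R B \<phi> f w = finsum B (\<lambda>x. \<phi> (f x) \<otimes>\<^bsub>B\<^esub> w x) {x. f x \<noteq> \<zero>\<^bsub>R\<^esub>}"

definition alg_monom :: "'a ring \<Rightarrow> 'a \<Rightarrow> 'p \<Rightarrow> 'p \<Rightarrow> 'a" where
  "alg_monom R a p = (\<lambda>x. if x = p then a else \<zero>\<^bsub>R\<^esub>)"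

lemma alg_monom_apply: "alg_monom R a p x = (if x = p then a else \<zero>\<^bsub>R\<^esub>)"
  by (simp add: alg_monom_def)

lemma monoid_algebra_carrier_iff:
  "f \<in> carrier (monoid_algebra R M) \<longleftrightarrow>
    (\<forall>p. f p \<in> carrier R) \<and> finite {p. f p \<noteq> \<zero>\<^bsub>R\<^esub>} \<and> {p. f p \<noteq> \<zero>\<^bsub>R\<^esub>} \<subseteq> carrier M"
  by (simp add: monoid_algebra_def)

lemma monoid_algebraD:
  assumes "f \<in> carrier (monoid_algebra R M)"
  shows "f p \<in> carrier R" "finite {p. f p \<noteq> \<zero>\<^bsub>R\<^esub>}" "f p \<noteq> \<zero>\<^bsub>R\<^esub> \<Longrightarrow> p \<in> carrier M"
  using assms by (auto simp: monoid_algebra_carrier_iff)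

lemma monoid_algebra_simps:
  "\<one>\<^bsub>monoid_algebra R M\<^esub> = alg_monom R \<one>\<^bsub>R\<^esub> \<one>\<^bsub>M\<^esub>"
  "\<zero>\<^bsub>monoid_algebra R M\<^esub> = (\<lambda>p. \<zero>\<^bsub>R\<^esub>)"
  "(f \<oplus>\<^bsub>monoid_algebra R M\<^esub> g) = (\<lambda>p. f p \<oplus>\<^bsub>R\<^esub> g p)"
  by (auto simp: monoid_algebra_def alg_monom_def)

text \<open>With the identity as \<open>\<phi>\<close> this serves computations inside a monoid
  algebra; with the structure map of an algebra it serves the evaluation of polynomials.\<close>

locale monoid_algebra_eval =
  R: cring R + B: cring B + M: comm_monoid M + \<phi>: ring_hom_cring R B \<phi>
  for R :: "'a ring" and B :: "'b ring" and \<phi> :: "'a \<Rightarrow> 'b" and M :: "'p monoid"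
begin

abbreviation "RM \<equiv> monoid_algebra R M"
abbreviation "ev \<equiv> alg_eval R B \<phi>"

text \<open>Sums over the supports of different elements can be compared once they are extended to a
  common finite set.\<close>

lemma ev_superset:
  assumes f: "f \<in> carrier RM" and Z: "finite Z" "{x. f x \<noteq> \<zero>\<^bsub>R\<^esub>} \<subseteq> Z"
    and w: "\<And>x. x \<in> Z \<Longrightarrow> w x \<in> carrier B"
  shows "ev f w = (\<Oplus>\<^bsub>B\<^esub>x\<in>Z. \<phi> (f x) \<otimes>\<^bsub>B\<^esub> w x)"
  unfolding alg_eval_def
  by (rule B.add.finprod_mono_neutral_cong_left [OF Z]) (use f w in \<open>auto simp: monoid_algebra_carrier_iff\<close>)

lemma ev_closed [simp, intro]:
  assumes f: "f \<in> carrier RM" and w: "\<And>x. x \<in> carrier M \<Longrightarrow> w x \<in> carrier B"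
  shows "ev f w \<in> carrier B"
  unfolding alg_eval_def using f w by (intro B.finsum_closed) (auto simp: monoid_algebra_carrier_iff)

lemma ev_cong:
  assumes f: "f \<in> carrier RM" and w: "\<And>x. x \<in> carrier M \<Longrightarrow> v x \<in> carrier B"
    and eq: "\<And>x. x \<in> carrier M \<Longrightarrow> f x \<noteq> \<zero>\<^bsub>R\<^esub> \<Longrightarrow> w x = v x"
  shows "ev f w = ev f v"
  unfolding alg_eval_def
  by (rule B.finsum_cong') (use f w eq monoid_algebraD(3) [OF f] in \<open>auto simp: monoid_algebra_carrier_iff\<close>)

lemma ev_add_left:
  assumes f: "f \<in> carrier RM" and g: "g \<in> carrier RM" and w: "\<And>x. x \<in> carrier M \<Longrightarrow> w x \<in> carrier B"
  shows "ev (f \<oplus>\<^bsub>RM\<^esub> g) w = ev f w \<oplus>\<^bsub>B\<^esub> ev g w"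
proof -
  let ?Z = "{x. f x \<noteq> \<zero>\<^bsub>R\<^esub>} \<union> {x. g x \<noteq> \<zero>\<^bsub>R\<^esub>}"
  have fc: "f x \<in> carrier R" and gc: "g x \<in> carrier R" for x
    using f g by (auto simp: monoid_algebra_carrier_iff)
  have Z: "finite ?Z" "?Z \<subseteq> carrier M"
    using f g by (auto simp: monoid_algebra_carrier_iff)
  have wZ: "w x \<in> carrier B" if "x \<in> ?Z" for x using w that Z by blast
  have sub: "{x. f x \<oplus>\<^bsub>R\<^esub> g x \<noteq> \<zero>\<^bsub>R\<^esub>} \<subseteq> ?Z" by auto
  have fg: "f \<oplus>\<^bsub>RM\<^esub> g \<in> carrier RM"
    using Z fc gc sub by (auto simp: monoid_algebra_carrier_iff monoid_algebra_simps intro: finite_subset)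
  have "ev (f \<oplus>\<^bsub>RM\<^esub> g) w = (\<Oplus>\<^bsub>B\<^esub>x\<in>?Z. \<phi> (f x \<oplus>\<^bsub>R\<^esub> g x) \<otimes>\<^bsub>B\<^esub> w x)"
    using ev_superset [OF fg Z(1) _ wZ] sub by (simp add: monoid_algebra_simps)
  also have "\<dots> = (\<Oplus>\<^bsub>B\<^esub>x\<in>?Z. \<phi> (f x) \<otimes>\<^bsub>B\<^esub> w x \<oplus>\<^bsub>B\<^esub> \<phi> (g x) \<otimes>\<^bsub>B\<^esub> w x)"
    using fc gc wZ by (intro B.finsum_cong') (auto simp: B.l_distr)
  also have "\<dots> = (\<Oplus>\<^bsub>B\<^esub>x\<in>?Z. \<phi> (f x) \<otimes>\<^bsub>B\<^esub> w x) \<oplus>\<^bsub>B\<^esub> (\<Oplus>\<^bsub>B\<^esub>x\<in>?Z. \<phi> (g x) \<otimes>\<^bsub>B\<^esub> w x)"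
    using fc gc wZ by (intro B.finsum_addf) auto
  also have "\<dots> = ev f w \<oplus>\<^bsub>B\<^esub> ev g w"
    using ev_superset [OF f Z(1) _ wZ] ev_superset [OF g Z(1) _ wZ] by simp
  finally show ?thesis .
qed

lemma ev_mult_right:
  assumes f: "f \<in> carrier RM" and w: "\<And>x. x \<in> carrier M \<Longrightarrow> w x \<in> carrier B" and b: "b \<in> carrier B"
  shows "ev f (\<lambda>x. w x \<otimes>\<^bsub>B\<^esub> b) = ev f w \<otimes>\<^bsub>B\<^esub> b"
proof -
  have Z: "finite {x. f x \<noteq> \<zero>\<^bsub>R\<^esub>}" "\<And>x. f x \<in> carrier R" "\<And>x. f x \<noteq> \<zero>\<^bsub>R\<^esub> \<Longrightarrow> w x \<in> carrier B"
    using f w by (auto simp: monoid_algebra_carrier_iff)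
  show ?thesis
    unfolding alg_eval_def using Z b
    by (subst B.finsum_ldistr) (auto intro!: B.finsum_cong' simp: B.m_assoc)
qed

lemma ev_add_right:
  assumes f: "f \<in> carrier RM" and w: "\<And>x. x \<in> carrier M \<Longrightarrow> w x \<in> carrier B"
    and v: "\<And>x. x \<in> carrier M \<Longrightarrow> v x \<in> carrier B"
  shows "ev f (\<lambda>x. w x \<oplus>\<^bsub>B\<^esub> v x) = ev f w \<oplus>\<^bsub>B\<^esub> ev f v"
proof -
  have Z: "\<And>x. f x \<in> carrier R" "\<And>x. f x \<noteq> \<zero>\<^bsub>R\<^esub> \<Longrightarrow> w x \<in> carrier B" "\<And>x. f x \<noteq> \<zero>\<^bsub>R\<^esub> \<Longrightarrow> v x \<in> carrier B"
    using f w v by (auto simp: monoid_algebra_carrier_iff)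
  have "ev f (\<lambda>x. w x \<oplus>\<^bsub>B\<^esub> v x) =
      (\<Oplus>\<^bsub>B\<^esub>x\<in>{x. f x \<noteq> \<zero>\<^bsub>R\<^esub>}. \<phi> (f x) \<otimes>\<^bsub>B\<^esub> w x \<oplus>\<^bsub>B\<^esub> \<phi> (f x) \<otimes>\<^bsub>B\<^esub> v x)"
    unfolding alg_eval_def using Z by (intro B.finsum_cong') (auto simp: B.r_distr)
  also have "\<dots> = ev f w \<oplus>\<^bsub>B\<^esub> ev f v"
    unfolding alg_eval_def using Z by (intro B.finsum_addf) auto
  finally show ?thesis .
qed

lemma ev_swap:
  assumes f: "f \<in> carrier RM" and g: "g \<in> carrier RM"
    and v: "\<And>x y. \<lbrakk>x \<in> carrier M; y \<in> carrier M\<rbrakk> \<Longrightarrow> v x y \<in> carrier B"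
  shows "ev f (\<lambda>x. ev g (\<lambda>y. v x y)) = ev g (\<lambda>y. ev f (\<lambda>x. v x y))"
proof -
  let ?F = "{x. f x \<noteq> \<zero>\<^bsub>R\<^esub>}" and ?G = "{x. g x \<noteq> \<zero>\<^bsub>R\<^esub>}"
  have fin: "finite ?F" "finite ?G" and sub: "?F \<subseteq> carrier M" "?G \<subseteq> carrier M"
    and fc: "f x \<in> carrier R" and gc: "g x \<in> carrier R" for x
    using f g by (auto simp: monoid_algebra_carrier_iff)
  have vc: "v x y \<in> carrier B" if "x \<in> ?F" "y \<in> ?G" for x y using v that sub by blast
  have "ev f (\<lambda>x. ev g (\<lambda>y. v x y)) = (\<Oplus>\<^bsub>B\<^esub>x\<in>?F. \<Oplus>\<^bsub>B\<^esub>y\<in>?G. \<phi> (f x) \<otimes>\<^bsub>B\<^esub> (\<phi> (g y) \<otimes>\<^bsub>B\<^esub> v x y))"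
    unfolding alg_eval_def using fin fc gc vc
    by (intro B.finsum_cong') (auto intro!: B.finsum_closed B.finsum_rdistr)
  also have "\<dots> = (\<Oplus>\<^bsub>B\<^esub>y\<in>?G. \<Oplus>\<^bsub>B\<^esub>x\<in>?F. \<phi> (f x) \<otimes>\<^bsub>B\<^esub> (\<phi> (g y) \<otimes>\<^bsub>B\<^esub> v x y))"
    using fin fc gc vc by (intro B.finsum_swap) auto
  also have "\<dots> = (\<Oplus>\<^bsub>B\<^esub>y\<in>?G. \<Oplus>\<^bsub>B\<^esub>x\<in>?F. \<phi> (g y) \<otimes>\<^bsub>B\<^esub> (\<phi> (f x) \<otimes>\<^bsub>B\<^esub> v x y))"
    using fin fc gc vc by (intro B.finsum_cong') (auto intro!: B.finsum_closed B.finsum_cong' B.m_lcomm)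
  also have "\<dots> = ev g (\<lambda>y. ev f (\<lambda>x. v x y))"
    unfolding alg_eval_def using fin fc gc vc
    by (intro B.finsum_cong') (auto intro!: B.finsum_closed B.finsum_rdistr [symmetric])
  finally show ?thesis .
qed

lemma ev_monom:
  assumes "a \<in> carrier R" "p \<in> carrier M" "w p \<in> carrier B"
  shows "ev (alg_monom R a p) w = \<phi> a \<otimes>\<^bsub>B\<^esub> w p"
proof -
  have "alg_monom R a p \<in> carrier RM"
    using assms by (auto simp: monoid_algebra_carrier_iff alg_monom_def)
  then have "ev (alg_monom R a p) w = (\<Oplus>\<^bsub>B\<^esub>x\<in>{p}. \<phi> (alg_monom R a p x) \<otimes>\<^bsub>B\<^esub> w x)"
    using assms by (intro ev_superset) (auto simp: alg_monom_def)
  then show ?thesis using assms by (simp add: alg_monom_def)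
qed

lemma mult_coeff:
  "(f \<otimes>\<^bsub>RM\<^esub> g) p = (\<Oplus>\<^bsub>R\<^esub>z\<in>{z \<in> {x. f x \<noteq> \<zero>\<^bsub>R\<^esub>} \<times> {y. g y \<noteq> \<zero>\<^bsub>R\<^esub>}. fst z \<otimes>\<^bsub>M\<^esub> snd z = p}.
    f (fst z) \<otimes>\<^bsub>R\<^esub> g (snd z))"
  unfolding monoid_algebra_def
  by (simp add: case_prod_beta') (rule arg_cong [of _ _ "finsum R _"], auto)

lemma mult_support:
  assumes "(f \<otimes>\<^bsub>RM\<^esub> g) p \<noteq> \<zero>\<^bsub>R\<^esub>"
  shows "p \<in> (\<lambda>z. fst z \<otimes>\<^bsub>M\<^esub> snd z) ` ({x. f x \<noteq> \<zero>\<^bsub>R\<^esub>} \<times> {y. g y \<noteq> \<zero>\<^bsub>R\<^esub>})"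
proof (rule ccontr)
  assume "\<not> ?thesis"
  then have e: "{z \<in> {x. f x \<noteq> \<zero>\<^bsub>R\<^esub>} \<times> {y. g y \<noteq> \<zero>\<^bsub>R\<^esub>}. fst z \<otimes>\<^bsub>M\<^esub> snd z = p} = {}" by blast
  show False using assms unfolding mult_coeff e by simp
qed

lemma mult_closed:
  assumes f: "f \<in> carrier RM" and g: "g \<in> carrier RM"
  shows "f \<otimes>\<^bsub>RM\<^esub> g \<in> carrier RM"
  unfolding monoid_algebra_carrier_iff
proof (intro conjI allI)
  let ?Z = "(\<lambda>z. fst z \<otimes>\<^bsub>M\<^esub> snd z) ` ({x. f x \<noteq> \<zero>\<^bsub>R\<^esub>} \<times> {y. g y \<noteq> \<zero>\<^bsub>R\<^esub>})"
  show "(f \<otimes>\<^bsub>RM\<^esub> g) p \<in> carrier R" for p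
    unfolding mult_coeff using f g by (intro R.finsum_closed) (auto simp: monoid_algebra_carrier_iff)
  have Z: "finite ?Z" "?Z \<subseteq> carrier M"
    using monoid_algebraD [OF f] monoid_algebraD [OF g] by auto
  have sub: "{p. (f \<otimes>\<^bsub>RM\<^esub> g) p \<noteq> \<zero>\<^bsub>R\<^esub>} \<subseteq> ?Z" using mult_support by blast
  show "finite {p. (f \<otimes>\<^bsub>RM\<^esub> g) p \<noteq> \<zero>\<^bsub>R\<^esub>}" using sub Z(1) by (rule finite_subset)
  show "{p. (f \<otimes>\<^bsub>RM\<^esub> g) p \<noteq> \<zero>\<^bsub>R\<^esub>} \<subseteq> carrier M" using sub Z(2) by (rule subset_trans)
qed

text \<open>Grouping pairs of exponents by their product turns the convolution into a double sum.
  The laws of the algebra become rearrangements of such sums, and coefficients of products can be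
  avoided.\<close>

lemma ev_mult:
  assumes f: "f \<in> carrier RM" and g: "g \<in> carrier RM" and w: "\<And>x. x \<in> carrier M \<Longrightarrow> w x \<in> carrier B"
  shows "ev (f \<otimes>\<^bsub>RM\<^esub> g) w = ev f (\<lambda>x. ev g (\<lambda>y. w (x \<otimes>\<^bsub>M\<^esub> y)))"
proof -
  let ?F = "{x. f x \<noteq> \<zero>\<^bsub>R\<^esub>}" and ?G = "{x. g x \<noteq> \<zero>\<^bsub>R\<^esub>}" and ?m = "\<lambda>z. fst z \<otimes>\<^bsub>M\<^esub> snd z"
  let ?Z = "?F \<times> ?G"
  have fin: "finite ?F" "finite ?G" "finite ?Z" and sub: "?F \<subseteq> carrier M" "?G \<subseteq> carrier M"
    and fc: "f x \<in> carrier R" and gc: "g x \<in> carrier R" for x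
    using f g by (auto simp: monoid_algebra_carrier_iff)
  have wc: "w (x \<otimes>\<^bsub>M\<^esub> y) \<in> carrier B" if "x \<in> ?F" "y \<in> ?G" for x y
    using w that sub by (meson M.m_closed subsetD)
  have "ev (f \<otimes>\<^bsub>RM\<^esub> g) w = (\<Oplus>\<^bsub>B\<^esub>p\<in>?m ` ?Z. \<phi> ((f \<otimes>\<^bsub>RM\<^esub> g) p) \<otimes>\<^bsub>B\<^esub> w p)"
  proof (rule ev_superset [OF mult_closed [OF f g]])
    show "finite (?m ` ?Z)" using fin by blast
    show "{p. (f \<otimes>\<^bsub>RM\<^esub> g) p \<noteq> \<zero>\<^bsub>R\<^esub>} \<subseteq> ?m ` ?Z" using mult_support by blast
    show "w p \<in> carrier B" if "p \<in> ?m ` ?Z" for p using wc that by auto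
  qed
  also have "\<dots> = (\<Oplus>\<^bsub>B\<^esub>p\<in>?m ` ?Z. \<Oplus>\<^bsub>B\<^esub>z\<in>{z \<in> ?Z. ?m z = p}.
      \<phi> (f (fst z) \<otimes>\<^bsub>R\<^esub> g (snd z)) \<otimes>\<^bsub>B\<^esub> w (?m z))"
  proof (rule B.finsum_cong' [OF refl])
    show "(\<lambda>p. \<Oplus>\<^bsub>B\<^esub>z\<in>{z \<in> ?Z. ?m z = p}. \<phi> (f (fst z) \<otimes>\<^bsub>R\<^esub> g (snd z)) \<otimes>\<^bsub>B\<^esub> w (?m z))
        \<in> ?m ` ?Z \<rightarrow> carrier B"
      using fc gc wc by (auto intro!: B.finsum_closed)
    fix p assume p: "p \<in> ?m ` ?Z"
    then have wp: "w p \<in> carrier B" using wc by auto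
    have "\<phi> ((f \<otimes>\<^bsub>RM\<^esub> g) p) \<otimes>\<^bsub>B\<^esub> w p =
        (\<Oplus>\<^bsub>B\<^esub>z\<in>{z \<in> ?Z. ?m z = p}. \<phi> (f (fst z) \<otimes>\<^bsub>R\<^esub> g (snd z))) \<otimes>\<^bsub>B\<^esub> w p"
      unfolding mult_coeff using fc gc by (subst \<phi>.hom_finsum) (auto simp: o_def)
    also have "\<dots> = (\<Oplus>\<^bsub>B\<^esub>z\<in>{z \<in> ?Z. ?m z = p}. \<phi> (f (fst z) \<otimes>\<^bsub>R\<^esub> g (snd z)) \<otimes>\<^bsub>B\<^esub> w p)"
      using fin fc gc wp by (intro B.finsum_ldistr) auto
    also have "\<dots> = (\<Oplus>\<^bsub>B\<^esub>z\<in>{z \<in> ?Z. ?m z = p}. \<phi> (f (fst z) \<otimes>\<^bsub>R\<^esub> g (snd z)) \<otimes>\<^bsub>B\<^esub> w (?m z))"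
      using fc gc wp by (intro B.finsum_cong') auto
    finally show "\<phi> ((f \<otimes>\<^bsub>RM\<^esub> g) p) \<otimes>\<^bsub>B\<^esub> w p = (\<Oplus>\<^bsub>B\<^esub>z\<in>{z \<in> ?Z. ?m z = p}.
        \<phi> (f (fst z) \<otimes>\<^bsub>R\<^esub> g (snd z)) \<otimes>\<^bsub>B\<^esub> w (?m z))" .
  qed
  also have "\<dots> = (\<Oplus>\<^bsub>B\<^esub>z\<in>?Z. \<phi> (f (fst z) \<otimes>\<^bsub>R\<^esub> g (snd z)) \<otimes>\<^bsub>B\<^esub> w (?m z))"
    using fin fc gc wc by (intro B.finsum_fibers [symmetric]) auto
  also have "\<dots> = (\<Oplus>\<^bsub>B\<^esub>x\<in>?F. \<Oplus>\<^bsub>B\<^esub>y\<in>?G. \<phi> (f x \<otimes>\<^bsub>R\<^esub> g y) \<otimes>\<^bsub>B\<^esub> w (x \<otimes>\<^bsub>M\<^esub> y))"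
    using fin fc gc wc by (subst B.finsum_Times) auto
  also have "\<dots> = (\<Oplus>\<^bsub>B\<^esub>x\<in>?F. \<phi> (f x) \<otimes>\<^bsub>B\<^esub> (\<Oplus>\<^bsub>B\<^esub>y\<in>?G. \<phi> (g y) \<otimes>\<^bsub>B\<^esub> w (x \<otimes>\<^bsub>M\<^esub> y)))"
  proof (rule B.finsum_cong' [OF refl])
    fix x assume x: "x \<in> ?F"
    have "(\<Oplus>\<^bsub>B\<^esub>y\<in>?G. \<phi> (f x \<otimes>\<^bsub>R\<^esub> g y) \<otimes>\<^bsub>B\<^esub> w (x \<otimes>\<^bsub>M\<^esub> y)) =
        (\<Oplus>\<^bsub>B\<^esub>y\<in>?G. \<phi> (f x) \<otimes>\<^bsub>B\<^esub> (\<phi> (g y) \<otimes>\<^bsub>B\<^esub> w (x \<otimes>\<^bsub>M\<^esub> y)))"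
      using fc gc wc [OF x] by (intro B.finsum_cong') (auto simp: B.m_assoc)
    then show "(\<Oplus>\<^bsub>B\<^esub>y\<in>?G. \<phi> (f x \<otimes>\<^bsub>R\<^esub> g y) \<otimes>\<^bsub>B\<^esub> w (x \<otimes>\<^bsub>M\<^esub> y)) =
        \<phi> (f x) \<otimes>\<^bsub>B\<^esub> (\<Oplus>\<^bsub>B\<^esub>y\<in>?G. \<phi> (g y) \<otimes>\<^bsub>B\<^esub> w (x \<otimes>\<^bsub>M\<^esub> y))"
      using fin fc gc wc [OF x] by (subst B.finsum_rdistr) auto
  qed (use fin fc gc wc in \<open>auto intro!: B.finsum_closed\<close>)
  finally show ?thesis by (simp add: alg_eval_def)
qed

end

context monoid_algebra_eval
begin

lemma ev_zero: "ev (\<lambda>p. \<zero>\<^bsub>R\<^esub>) w = \<zero>\<^bsub>B\<^esub>"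
  by (simp add: alg_eval_def)

lemma ev_mult_left:
  assumes "f \<in> carrier RM" "\<And>x. x \<in> carrier M \<Longrightarrow> w x \<in> carrier B" "b \<in> carrier B"
  shows "ev f (\<lambda>x. b \<otimes>\<^bsub>B\<^esub> w x) = b \<otimes>\<^bsub>B\<^esub> ev f w"
proof -
  have "ev f (\<lambda>x. b \<otimes>\<^bsub>B\<^esub> w x) = ev f (\<lambda>x. w x \<otimes>\<^bsub>B\<^esub> b)"
    using assms by (intro ev_cong) (auto simp: B.m_comm)
  also have "\<dots> = b \<otimes>\<^bsub>B\<^esub> ev f w"
    using assms by (simp add: ev_mult_right B.m_comm)
  finally show ?thesis .
qed

end

section \<open>The ring structure of a monoid algebra\<close>

locale monoid_algebra_ring = R: cring R + M: comm_monoid M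
  for R :: "'a ring" and M :: "'p monoid"
begin

sublocale monoid_algebra_eval R R id M
proof -
  have "ring_hom_cring R R id"
    by (intro ring_hom_cring.intro ring_hom_cring_axioms.intro R.cring_axioms id_ring_hom)
  then show "monoid_algebra_eval R R id M"
    by (intro monoid_algebra_eval.intro R.cring_axioms M.comm_monoid_axioms)
qed

lemma ev_coeff:
  assumes f: "f \<in> carrier RM" and p: "p \<in> carrier M"
  shows "ev f (\<lambda>x. if x = p then \<one>\<^bsub>R\<^esub> else \<zero>\<^bsub>R\<^esub>) = f p"
proof -
  let ?Z = "insert p {x. f x \<noteq> \<zero>\<^bsub>R\<^esub>}"
  have fc: "f x \<in> carrier R" for x using monoid_algebraD(1) [OF f] .
  have Z: "finite ?Z" using monoid_algebraD(2) [OF f] by simp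
  have "ev f (\<lambda>x. if x = p then \<one>\<^bsub>R\<^esub> else \<zero>\<^bsub>R\<^esub>) =
      (\<Oplus>\<^bsub>R\<^esub>x\<in>?Z. id (f x) \<otimes>\<^bsub>R\<^esub> (if x = p then \<one>\<^bsub>R\<^esub> else \<zero>\<^bsub>R\<^esub>))"
    using Z by (intro ev_superset [OF f]) auto
  also have "\<dots> = (\<Oplus>\<^bsub>R\<^esub>x\<in>?Z. if p = x then f x else \<zero>\<^bsub>R\<^esub>)"
    using fc by (intro R.finsum_cong') auto
  also have "\<dots> = f p" using Z fc by (intro R.finsum_singleton) auto
  finally show ?thesis .
qed

text \<open>Pairing with the indicator function of \<open>p\<close> extracts the coefficient at
  \<open>p\<close>.\<close>

lemma ev_ext:
  assumes f: "f \<in> carrier RM" and g: "g \<in> carrier RM"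
    and eq: "\<And>w. (\<And>x. x \<in> carrier M \<Longrightarrow> w x \<in> carrier R) \<Longrightarrow> ev f w = ev g w"
  shows "f = g"
proof
  fix p
  show "f p = g p"
  proof (cases "p \<in> carrier M")
    case True
    then show ?thesis using eq [of "\<lambda>x. if x = p then \<one>\<^bsub>R\<^esub> else \<zero>\<^bsub>R\<^esub>"] ev_coeff f g by simp
  next
    case False
    then show ?thesis using monoid_algebraD(3) [OF f, of p] monoid_algebraD(3) [OF g, of p] by metis
  qed
qed

lemma monom_closed [simp]:
  "\<lbrakk>a \<in> carrier R; p \<in> carrier M\<rbrakk> \<Longrightarrow> alg_monom R a p \<in> carrier RM"
  by (auto simp: monoid_algebra_carrier_iff alg_monom_def)

lemma add_closed:
  assumes f: "f \<in> carrier RM" and g: "g \<in> carrier RM"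
  shows "f \<oplus>\<^bsub>RM\<^esub> g \<in> carrier RM"
proof -
  have sub: "{x. f x \<oplus>\<^bsub>R\<^esub> g x \<noteq> \<zero>\<^bsub>R\<^esub>} \<subseteq> {x. f x \<noteq> \<zero>\<^bsub>R\<^esub>} \<union> {x. g x \<noteq> \<zero>\<^bsub>R\<^esub>}" by auto
  then show ?thesis
    using f g by (auto simp: monoid_algebra_carrier_iff monoid_algebra_simps intro: finite_subset [OF sub])
qed

lemma monom_one_eval:
  "w \<one>\<^bsub>M\<^esub> \<in> carrier R \<Longrightarrow> ev (alg_monom R \<one>\<^bsub>R\<^esub> \<one>\<^bsub>M\<^esub>) w = w \<one>\<^bsub>M\<^esub>"
  by (simp add: ev_monom)

text \<open>Both sides of each multiplicative law are paired with an arbitrary function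
  \<open>w\<close>. Commutativity is then the interchange of two sums, and associativity is that of
  \<open>M\<close> inside a triple sum.\<close>

lemma algebra_cring: "cring RM"
proof (rule cringI)
  show "abelian_group RM"
  proof (rule abelian_groupI)
    show "\<exists>g\<in>carrier RM. g \<oplus>\<^bsub>RM\<^esub> f = \<zero>\<^bsub>RM\<^esub>" if f: "f \<in> carrier RM" for f
    proof (rule bexI [of _ "\<lambda>p. \<ominus>\<^bsub>R\<^esub> f p"])
      have "{p. \<ominus>\<^bsub>R\<^esub> f p \<noteq> \<zero>\<^bsub>R\<^esub>} = {p. f p \<noteq> \<zero>\<^bsub>R\<^esub>}"
        using f by (auto simp: monoid_algebra_carrier_iff)
      then show "(\<lambda>p. \<ominus>\<^bsub>R\<^esub> f p) \<in> carrier RM" using f by (auto simp: monoid_algebra_carrier_iff)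
      show "(\<lambda>p. \<ominus>\<^bsub>R\<^esub> f p) \<oplus>\<^bsub>RM\<^esub> f = \<zero>\<^bsub>RM\<^esub>"
        using f by (auto simp: monoid_algebra_simps monoid_algebra_carrier_iff R.l_neg)
    qed
  qed (use add_closed in \<open>auto simp: monoid_algebra_simps monoid_algebra_carrier_iff R.a_ac\<close>)
  show "comm_monoid RM"
  proof (rule comm_monoidI)
    show one: "\<one>\<^bsub>RM\<^esub> \<in> carrier RM" by (simp add: monoid_algebra_simps)
    show "f \<otimes>\<^bsub>RM\<^esub> g \<in> carrier RM" if "f \<in> carrier RM" "g \<in> carrier RM" for f g
      using mult_closed that .
    show "f \<otimes>\<^bsub>RM\<^esub> g = g \<otimes>\<^bsub>RM\<^esub> f" if f: "f \<in> carrier RM" and g: "g \<in> carrier RM" for f g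
    proof (rule ev_ext [OF mult_closed [OF f g] mult_closed [OF g f]])
      fix w :: "'p \<Rightarrow> 'a" assume w: "\<And>x. x \<in> carrier M \<Longrightarrow> w x \<in> carrier R"
      have "ev (f \<otimes>\<^bsub>RM\<^esub> g) w = ev f (\<lambda>x. ev g (\<lambda>y. w (x \<otimes>\<^bsub>M\<^esub> y)))"
        by (rule ev_mult [OF f g w])
      also have "\<dots> = ev g (\<lambda>y. ev f (\<lambda>x. w (x \<otimes>\<^bsub>M\<^esub> y)))"
        using w by (intro ev_swap f g) auto
      also have "\<dots> = ev g (\<lambda>y. ev f (\<lambda>x. w (y \<otimes>\<^bsub>M\<^esub> x)))"
        using w by (intro ev_cong f g ev_closed) (auto simp: M.m_comm)
      also have "\<dots> = ev (g \<otimes>\<^bsub>RM\<^esub> f) w"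
        by (rule ev_mult [OF g f w, symmetric])
      finally show "ev (f \<otimes>\<^bsub>RM\<^esub> g) w = ev (g \<otimes>\<^bsub>RM\<^esub> f) w" .
    qed
    show "f \<otimes>\<^bsub>RM\<^esub> g \<otimes>\<^bsub>RM\<^esub> k = f \<otimes>\<^bsub>RM\<^esub> (g \<otimes>\<^bsub>RM\<^esub> k)"
      if f: "f \<in> carrier RM" and g: "g \<in> carrier RM" and k: "k \<in> carrier RM" for f g k
    proof (rule ev_ext [OF mult_closed [OF mult_closed [OF f g] k] mult_closed [OF f mult_closed [OF g k]]])
      fix w :: "'p \<Rightarrow> 'a" assume w: "\<And>x. x \<in> carrier M \<Longrightarrow> w x \<in> carrier R"
      have "ev (f \<otimes>\<^bsub>RM\<^esub> g \<otimes>\<^bsub>RM\<^esub> k) w = ev f (\<lambda>x. ev g (\<lambda>y. ev k (\<lambda>z. w (x \<otimes>\<^bsub>M\<^esub> y \<otimes>\<^bsub>M\<^esub> z))))"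
        using w by (simp add: ev_mult mult_closed f g k)
      also have "\<dots> = ev f (\<lambda>x. ev g (\<lambda>y. ev k (\<lambda>z. w (x \<otimes>\<^bsub>M\<^esub> (y \<otimes>\<^bsub>M\<^esub> z)))))"
        using w by (intro ev_cong f g k ev_closed) (auto simp: M.m_assoc)
      also have "\<dots> = ev f (\<lambda>x. ev (g \<otimes>\<^bsub>RM\<^esub> k) (\<lambda>y. w (x \<otimes>\<^bsub>M\<^esub> y)))"
        using w by (intro ev_cong f ev_closed mult_closed g k) (auto simp: ev_mult g k)
      also have "\<dots> = ev (f \<otimes>\<^bsub>RM\<^esub> (g \<otimes>\<^bsub>RM\<^esub> k)) w"
        by (rule ev_mult [OF f mult_closed [OF g k] w, symmetric])
      finally show "ev (f \<otimes>\<^bsub>RM\<^esub> g \<otimes>\<^bsub>RM\<^esub> k) w = ev (f \<otimes>\<^bsub>RM\<^esub> (g \<otimes>\<^bsub>RM\<^esub> k)) w" .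
    qed
    show "\<one>\<^bsub>RM\<^esub> \<otimes>\<^bsub>RM\<^esub> f = f" if f: "f \<in> carrier RM" for f
    proof (rule ev_ext [OF mult_closed [OF one f] f])
      fix w :: "'p \<Rightarrow> 'a" assume w: "\<And>x. x \<in> carrier M \<Longrightarrow> w x \<in> carrier R"
      have "ev (\<one>\<^bsub>RM\<^esub> \<otimes>\<^bsub>RM\<^esub> f) w = ev \<one>\<^bsub>RM\<^esub> (\<lambda>x. ev f (\<lambda>y. w (x \<otimes>\<^bsub>M\<^esub> y)))"
        by (rule ev_mult [OF one f w])
      also have "\<dots> = ev f (\<lambda>y. w (\<one>\<^bsub>M\<^esub> \<otimes>\<^bsub>M\<^esub> y))"
        unfolding monoid_algebra_simps by (rule monom_one_eval) (use w f in auto)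
      also have "\<dots> = ev f w" using w by (intro ev_cong f) auto
      finally show "ev (\<one>\<^bsub>RM\<^esub> \<otimes>\<^bsub>RM\<^esub> f) w = ev f w" .
    qed
  qed
  show "(f \<oplus>\<^bsub>RM\<^esub> g) \<otimes>\<^bsub>RM\<^esub> k = f \<otimes>\<^bsub>RM\<^esub> k \<oplus>\<^bsub>RM\<^esub> g \<otimes>\<^bsub>RM\<^esub> k"
    if f: "f \<in> carrier RM" and g: "g \<in> carrier RM" and k: "k \<in> carrier RM" for f g k
  proof (rule ev_ext)
    show "(f \<oplus>\<^bsub>RM\<^esub> g) \<otimes>\<^bsub>RM\<^esub> k \<in> carrier RM" "f \<otimes>\<^bsub>RM\<^esub> k \<oplus>\<^bsub>RM\<^esub> g \<otimes>\<^bsub>RM\<^esub> k \<in> carrier RM"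
      by (intro mult_closed add_closed f g k)+
    fix w :: "'p \<Rightarrow> 'a" assume w: "\<And>x. x \<in> carrier M \<Longrightarrow> w x \<in> carrier R"
    show "ev ((f \<oplus>\<^bsub>RM\<^esub> g) \<otimes>\<^bsub>RM\<^esub> k) w = ev (f \<otimes>\<^bsub>RM\<^esub> k \<oplus>\<^bsub>RM\<^esub> g \<otimes>\<^bsub>RM\<^esub> k) w"
      using w k by (simp add: ev_mult ev_add_left mult_closed add_closed f g k)
  qed
qed

sublocale RM: cring RM by (rule algebra_cring)

lemma a_inv_apply:
  assumes f: "f \<in> carrier RM" shows "(\<ominus>\<^bsub>RM\<^esub> f) p = \<ominus>\<^bsub>R\<^esub> f p"
proof -
  have "(\<ominus>\<^bsub>RM\<^esub> f) \<oplus>\<^bsub>RM\<^esub> f = \<zero>\<^bsub>RM\<^esub>" using f by (rule RM.l_neg)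
  then have "(\<ominus>\<^bsub>RM\<^esub> f) p \<oplus>\<^bsub>R\<^esub> f p = \<zero>\<^bsub>R\<^esub>" by (metis monoid_algebra_simps(2,3))
  then show ?thesis
    using monoid_algebraD(1) [OF f] monoid_algebraD(1) [OF RM.a_inv_closed [OF f]] R.minus_equality
    by metis
qed

lemma finsum_apply:
  assumes "finite I" "\<And>i. i \<in> I \<Longrightarrow> F i \<in> carrier RM"
  shows "(\<Oplus>\<^bsub>RM\<^esub>i\<in>I. F i) p = (\<Oplus>\<^bsub>R\<^esub>i\<in>I. F i p)"
  using assms
proof (induction I rule: finite_induct)
  case empty
  then show ?case by (simp add: monoid_algebra_simps(2))
next
  case (insert i I)
  have "(\<Oplus>\<^bsub>RM\<^esub>i\<in>insert i I. F i) = F i \<oplus>\<^bsub>RM\<^esub> (\<Oplus>\<^bsub>RM\<^esub>i\<in>I. F i)"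
    using insert by (intro RM.finsum_insert) auto
  moreover have "F j p \<in> carrier R" if "j \<in> insert i I" for j
    using monoid_algebraD(1) [OF insert.prems [OF that]] .
  ultimately show ?case
    using insert by (simp add: monoid_algebra_simps(3) Pi_def)
qed

lemma monom_mult:
  assumes "a \<in> carrier R" "b \<in> carrier R" "p \<in> carrier M" "q \<in> carrier M"
  shows "alg_monom R a p \<otimes>\<^bsub>RM\<^esub> alg_monom R b q = alg_monom R (a \<otimes>\<^bsub>R\<^esub> b) (p \<otimes>\<^bsub>M\<^esub> q)"
proof (rule ev_ext)
  fix w :: "'p \<Rightarrow> 'a" assume w: "\<And>x. x \<in> carrier M \<Longrightarrow> w x \<in> carrier R"
  show "ev (alg_monom R a p \<otimes>\<^bsub>RM\<^esub> alg_monom R b q) w =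
      ev (alg_monom R (a \<otimes>\<^bsub>R\<^esub> b) (p \<otimes>\<^bsub>M\<^esub> q)) w"
    using assms w by (simp add: ev_mult ev_monom R.m_assoc)
qed (use assms in auto)

lemma monom_add:
  assumes "a \<in> carrier R" "b \<in> carrier R"
  shows "alg_monom R a p \<oplus>\<^bsub>RM\<^esub> alg_monom R b p = alg_monom R (a \<oplus>\<^bsub>R\<^esub> b) p"
  using assms by (auto simp: monoid_algebra_simps alg_monom_def)

lemma monom_zero: "alg_monom R \<zero>\<^bsub>R\<^esub> p = \<zero>\<^bsub>RM\<^esub>"
  by (auto simp: monoid_algebra_simps alg_monom_def)

lemma monom_pow:
  assumes "p \<in> carrier M"
  shows "alg_monom R \<one>\<^bsub>R\<^esub> p [^]\<^bsub>RM\<^esub> (n::nat) = alg_monom R \<one>\<^bsub>R\<^esub> (p [^]\<^bsub>M\<^esub> n)"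
  by (induction n) (simp_all add: monoid_algebra_simps(1) monom_mult assms)

text \<open>Induction over the support, splitting off one monomial at a time; it reduces linear
  statements to monomials.\<close>

lemma monoid_algebra_induct [consumes 1, case_names zero add]:
  assumes f: "f \<in> carrier RM" and z: "T \<zero>\<^bsub>RM\<^esub>"
    and add: "\<And>a p g. \<lbrakk>a \<in> carrier R; p \<in> carrier M; g \<in> carrier RM; T g\<rbrakk>
      \<Longrightarrow> T (alg_monom R a p \<oplus>\<^bsub>RM\<^esub> g)"
  shows "T f"
proof -
  have "T f" if "f \<in> carrier RM" "{x. f x \<noteq> \<zero>\<^bsub>R\<^esub>} = Z" "finite Z" for Z f
    using that(3,1,2)
  proof (induction Z arbitrary: f rule: finite_induct)
    case empty
    then have "f = \<zero>\<^bsub>RM\<^esub>" by (auto simp: monoid_algebra_simps)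
    then show ?case using z by simp
  next
    case (insert p Z)
    let ?g = "f(p := \<zero>\<^bsub>R\<^esub>)"
    have fc: "f x \<in> carrier R" for x using monoid_algebraD(1) [OF insert.prems(1)] .
    have Z: "{x. ?g x \<noteq> \<zero>\<^bsub>R\<^esub>} = Z" using insert.prems(2) insert.hyps by auto
    have pM: "p \<in> carrier M" using monoid_algebraD(3) [OF insert.prems(1)] insert.prems(2) by blast
    have "Z \<subseteq> carrier M" using monoid_algebraD(3) [OF insert.prems(1)] insert.prems(2) by blast
    then have g: "?g \<in> carrier RM"
      unfolding monoid_algebra_carrier_iff Z using fc insert.hyps by simp
    have "alg_monom R (f p) p \<oplus>\<^bsub>RM\<^esub> ?g = f"
      using fc by (auto simp: monoid_algebra_simps alg_monom_def)
    moreover have "T (alg_monom R (f p) p \<oplus>\<^bsub>RM\<^esub> ?g)"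
      by (rule add [OF fc pM g insert.IH [OF g Z]])
    ultimately show ?case by simp
  qed
  then show ?thesis using f monoid_algebraD(2) [OF f] by blast
qed

end

context monoid_algebra_eval
begin

interpretation alg: monoid_algebra_ring R M
  by (intro monoid_algebra_ring.intro R.cring_axioms M.comm_monoid_axioms)

text \<open>The universal property of the monoid algebra: for multiplicative \<open>\<mu>\<close>
  the double sum of \<open>ev_mult\<close> factors into two sums.\<close>

lemma ev_ring_hom:
  assumes \<mu>: "\<And>x. x \<in> carrier M \<Longrightarrow> \<mu> x \<in> carrier B"
    and mult: "\<And>x y. \<lbrakk>x \<in> carrier M; y \<in> carrier M\<rbrakk> \<Longrightarrow> \<mu> (x \<otimes>\<^bsub>M\<^esub> y) = \<mu> x \<otimes>\<^bsub>B\<^esub> \<mu> y"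
    and one: "\<mu> \<one>\<^bsub>M\<^esub> = \<one>\<^bsub>B\<^esub>"
  shows "(\<lambda>f. ev f \<mu>) \<in> ring_hom RM B"
proof (rule ring_hom_memI)
  fix f g assume f: "f \<in> carrier RM" and g: "g \<in> carrier RM"
  have "ev (f \<otimes>\<^bsub>RM\<^esub> g) \<mu> = ev f (\<lambda>x. ev g (\<lambda>y. \<mu> (x \<otimes>\<^bsub>M\<^esub> y)))" by (rule ev_mult [OF f g \<mu>])
  also have "\<dots> = ev f (\<lambda>x. \<mu> x \<otimes>\<^bsub>B\<^esub> ev g \<mu>)"
  proof (rule ev_cong [OF f])
    fix x assume x: "x \<in> carrier M"
    show "\<mu> x \<otimes>\<^bsub>B\<^esub> ev g \<mu> \<in> carrier B" using x \<mu> g by auto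
    have "ev g (\<lambda>y. \<mu> (x \<otimes>\<^bsub>M\<^esub> y)) = ev g (\<lambda>y. \<mu> x \<otimes>\<^bsub>B\<^esub> \<mu> y)"
      using x \<mu> mult by (intro ev_cong [OF g]) auto
    then show "ev g (\<lambda>y. \<mu> (x \<otimes>\<^bsub>M\<^esub> y)) = \<mu> x \<otimes>\<^bsub>B\<^esub> ev g \<mu>"
      using x \<mu> g by (simp add: ev_mult_left)
  qed
  also have "\<dots> = ev f \<mu> \<otimes>\<^bsub>B\<^esub> ev g \<mu>" using f g \<mu> by (simp add: ev_mult_right)
  finally show "ev (f \<otimes>\<^bsub>RM\<^esub> g) \<mu> = ev f \<mu> \<otimes>\<^bsub>B\<^esub> ev g \<mu>" .
qed (use \<mu> one in \<open>auto simp: ev_add_left monoid_algebra_simps(1) ev_monom\<close>)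

end

section \<open>Maps of monoid algebras\<close>

locale monoid_algebra_hom =
  Q: monoid_algebra_ring R Q + P: monoid_algebra_ring R P
  for R :: "'a ring" and Q :: "'q monoid" and P :: "'p monoid" +
  fixes h :: "'q \<Rightarrow> 'p"
  assumes h: "h \<in> monoid_homs Q P"
begin

abbreviation "mmap \<equiv> monoid_algebra_map R h"

lemma h_closed [simp]: "q \<in> carrier Q \<Longrightarrow> h q \<in> carrier P"
  using h by (auto simp: monoid_homs_def hom_def)

lemma map_support:
  assumes "mmap f p \<noteq> \<zero>\<^bsub>R\<^esub>" shows "p \<in> h ` {q. f q \<noteq> \<zero>\<^bsub>R\<^esub>}"
proof (rule ccontr)
  assume "\<not> ?thesis"
  then have e: "{q. f q \<noteq> \<zero>\<^bsub>R\<^esub> \<and> h q = p} = {}" by blast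
  show False using assms unfolding monoid_algebra_map_def e by simp
qed

lemma map_closed [simp]:
  assumes f: "f \<in> carrier (monoid_algebra R Q)"
  shows "mmap f \<in> carrier (monoid_algebra R P)"
  unfolding monoid_algebra_carrier_iff
proof (intro conjI allI)
  note D = monoid_algebraD [OF f]
  show "mmap f p \<in> carrier R" for p
    unfolding monoid_algebra_map_def using D(1) by (intro Q.R.finsum_closed) auto
  have sub: "{p. mmap f p \<noteq> \<zero>\<^bsub>R\<^esub>} \<subseteq> h ` {q. f q \<noteq> \<zero>\<^bsub>R\<^esub>}" using map_support by blast
  show "finite {p. mmap f p \<noteq> \<zero>\<^bsub>R\<^esub>}" using sub D(2) finite_subset by blast
  show "{p. mmap f p \<noteq> \<zero>\<^bsub>R\<^esub>} \<subseteq> carrier P" using sub D(3) by auto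
qed

text \<open>The coefficients of the image are sums over the fibers of \<open>h\<close>. This formula
  reduces the multiplicativity of \<open>mmap\<close> to that of \<open>h\<close>.\<close>

lemma ev_map:
  assumes f: "f \<in> carrier (monoid_algebra R Q)" and w: "\<And>x. x \<in> carrier P \<Longrightarrow> w x \<in> carrier R"
  shows "P.ev (mmap f) w = Q.ev f (\<lambda>q. w (h q))"
proof -
  note D = monoid_algebraD [OF f]
  let ?Z = "{q. f q \<noteq> \<zero>\<^bsub>R\<^esub>}"
  have wZ: "w (h q) \<in> carrier R" if "q \<in> ?Z" for q using w D(3) that by auto
  have "P.ev (mmap f) w = (\<Oplus>\<^bsub>R\<^esub>p\<in>h ` ?Z. id (mmap f p) \<otimes>\<^bsub>R\<^esub> w p)"
  proof (rule P.ev_superset [OF map_closed [OF f]])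
    show "finite (h ` ?Z)" using D(2) by simp
    show "{p. mmap f p \<noteq> \<zero>\<^bsub>R\<^esub>} \<subseteq> h ` ?Z" using map_support by blast
  qed (use wZ in auto)
  also have "\<dots> = (\<Oplus>\<^bsub>R\<^esub>p\<in>h ` ?Z. \<Oplus>\<^bsub>R\<^esub>q\<in>{q \<in> ?Z. h q = p}. f q \<otimes>\<^bsub>R\<^esub> w (h q))"
  proof (rule Q.R.finsum_cong' [OF refl])
    fix p assume p: "p \<in> h ` ?Z"
    have "mmap f p \<otimes>\<^bsub>R\<^esub> w p = (\<Oplus>\<^bsub>R\<^esub>q\<in>{q \<in> ?Z. h q = p}. f q \<otimes>\<^bsub>R\<^esub> w p)"
      unfolding monoid_algebra_map_def using D(1,2) wZ p
      by (subst Q.R.finsum_ldistr [symmetric]) auto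
    also have "\<dots> = (\<Oplus>\<^bsub>R\<^esub>q\<in>{q \<in> ?Z. h q = p}. f q \<otimes>\<^bsub>R\<^esub> w (h q))"
      using D(1) wZ by (intro Q.R.finsum_cong') auto
    finally show "id (mmap f p) \<otimes>\<^bsub>R\<^esub> w p = (\<Oplus>\<^bsub>R\<^esub>q\<in>{q \<in> ?Z. h q = p}. f q \<otimes>\<^bsub>R\<^esub> w (h q))" by simp
  qed (use D(1) wZ in \<open>auto intro!: Q.R.finsum_closed\<close>)
  also have "\<dots> = (\<Oplus>\<^bsub>R\<^esub>q\<in>?Z. f q \<otimes>\<^bsub>R\<^esub> w (h q))"
    using D(1,2) wZ by (intro Q.R.finsum_fibers [symmetric]) auto
  finally show ?thesis by (simp add: alg_eval_def)
qed

lemma map_monom: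
  assumes "a \<in> carrier R" "q \<in> carrier Q"
  shows "mmap (alg_monom R a q) = alg_monom R a (h q)"
proof (rule P.ev_ext)
  fix w :: "'p \<Rightarrow> 'a" assume w: "\<And>x. x \<in> carrier P \<Longrightarrow> w x \<in> carrier R"
  show "P.ev (mmap (alg_monom R a q)) w = P.ev (alg_monom R a (h q)) w"
    using assms w by (simp add: ev_map Q.ev_monom P.ev_monom)
qed (use assms in auto)

lemma map_ring_hom: "mmap \<in> ring_hom (monoid_algebra R Q) (monoid_algebra R P)"
proof (rule ring_hom_memI)
  fix f g assume f: "f \<in> carrier (monoid_algebra R Q)" and g: "g \<in> carrier (monoid_algebra R Q)"
  show "mmap f \<in> carrier (monoid_algebra R P)" by (rule map_closed [OF f])
  show "mmap (f \<otimes>\<^bsub>monoid_algebra R Q\<^esub> g) = mmap f \<otimes>\<^bsub>monoid_algebra R P\<^esub> mmap g"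
  proof (rule P.ev_ext)
    fix w :: "'p \<Rightarrow> 'a" assume w: "\<And>x. x \<in> carrier P \<Longrightarrow> w x \<in> carrier R"
    have "P.ev (mmap (f \<otimes>\<^bsub>monoid_algebra R Q\<^esub> g)) w = Q.ev f (\<lambda>x. Q.ev g (\<lambda>y. w (h (x \<otimes>\<^bsub>Q\<^esub> y))))"
      using w by (simp add: ev_map f g Q.ev_mult)
    also have "\<dots> = Q.ev f (\<lambda>x. Q.ev g (\<lambda>y. w (h x \<otimes>\<^bsub>P\<^esub> h y)))"
      using w h by (intro Q.ev_cong f g Q.ev_closed) (auto simp: monoid_homs_def hom_def)
    also have "\<dots> = Q.ev f (\<lambda>x. P.ev (mmap g) (\<lambda>y. w (h x \<otimes>\<^bsub>P\<^esub> y)))"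
      using w by (intro Q.ev_cong f P.ev_closed map_closed g) (auto simp: ev_map g)
    also have "\<dots> = P.ev (mmap f \<otimes>\<^bsub>monoid_algebra R P\<^esub> mmap g) w"
      using w by (simp add: P.ev_mult ev_map f g)
    finally show "P.ev (mmap (f \<otimes>\<^bsub>monoid_algebra R Q\<^esub> g)) w =
        P.ev (mmap f \<otimes>\<^bsub>monoid_algebra R P\<^esub> mmap g) w" .
  qed (use f g in auto)
  show "mmap (f \<oplus>\<^bsub>monoid_algebra R Q\<^esub> g) = mmap f \<oplus>\<^bsub>monoid_algebra R P\<^esub> mmap g"
  proof (rule P.ev_ext)
    fix w :: "'p \<Rightarrow> 'a" assume w: "\<And>x. x \<in> carrier P \<Longrightarrow> w x \<in> carrier R"
    show "P.ev (mmap (f \<oplus>\<^bsub>monoid_algebra R Q\<^esub> g)) w = P.ev (mmap f \<oplus>\<^bsub>monoid_algebra R P\<^esub> mmap g) w"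
      using w by (simp add: ev_map f g Q.ev_add_left P.ev_add_left)
  qed (use f g in auto)
next
  show "mmap \<one>\<^bsub>monoid_algebra R Q\<^esub> = \<one>\<^bsub>monoid_algebra R P\<^esub>"
    using h by (simp add: monoid_algebra_simps(1) map_monom monoid_homs_def)
qed

lemma map_ring_hom_cring: "ring_hom_cring (monoid_algebra R Q) (monoid_algebra R P) mmap"
  by (intro ring_hom_cring.intro ring_hom_cring_axioms.intro map_ring_hom Q.algebra_cring P.algebra_cring)

end

section \<open>Tensor products and flat modules\<close>

locale module_pair = M: module A M + N: module A N
  for A :: "'a ring" and M :: "('a, 'm) module" and N :: "('a, 'n) module"
begin

definition gens :: "(('m \<times> 'n) \<Rightarrow>\<^sub>0 int) set" where
  "gens = {frag_of (x \<oplus>\<^bsub>M\<^esub> x', y) - frag_of (x, y) - frag_of (x', y) | x x' y.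
         x \<in> carrier M \<and> x' \<in> carrier M \<and> y \<in> carrier N} \<union>
      {frag_of (x, y \<oplus>\<^bsub>N\<^esub> y') - frag_of (x, y) - frag_of (x, y') | x y y'.
         x \<in> carrier M \<and> y \<in> carrier N \<and> y' \<in> carrier N} \<union>
      {frag_of (a \<odot>\<^bsub>M\<^esub> x, y) - frag_of (x, a \<odot>\<^bsub>N\<^esub> y) | a x y.
         a \<in> carrier A \<and> x \<in> carrier M \<and> y \<in> carrier N}"

abbreviation "rels \<equiv> tensor_relations A M N"
abbreviation "free_group \<equiv> free_Abelian_group (carrier M \<times> carrier N)"

sublocale G: comm_group free_group by (rule abelian_free_Abelian_group)

lemma rels_eq: "rels = generate free_group gens"
  unfolding tensor_relations_def gens_def ..

lemma gens_cases:
  assumes "z \<in> gens"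
  obtains (add_left) x x' y where "x \<in> carrier M" "x' \<in> carrier M" "y \<in> carrier N"
      "z = frag_of (x \<oplus>\<^bsub>M\<^esub> x', y) - frag_of (x, y) - frag_of (x', y)"
    | (add_right) x y y' where "x \<in> carrier M" "y \<in> carrier N" "y' \<in> carrier N"
      "z = frag_of (x, y \<oplus>\<^bsub>N\<^esub> y') - frag_of (x, y) - frag_of (x, y')"
    | (smult) a x y where "a \<in> carrier A" "x \<in> carrier M" "y \<in> carrier N"
      "z = frag_of (a \<odot>\<^bsub>M\<^esub> x, y) - frag_of (x, a \<odot>\<^bsub>N\<^esub> y)"
  using assms unfolding gens_def
proof (elim UnE)
  assume "z \<in> {frag_of (x \<oplus>\<^bsub>M\<^esub> x', y) - frag_of (x, y) - frag_of (x', y) | x x' y.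
         x \<in> carrier M \<and> x' \<in> carrier M \<and> y \<in> carrier N}"
  then show ?thesis using that(1) by auto
next
  assume "z \<in> {frag_of (x, y \<oplus>\<^bsub>N\<^esub> y') - frag_of (x, y) - frag_of (x, y') | x y y'.
         x \<in> carrier M \<and> y \<in> carrier N \<and> y' \<in> carrier N}"
  then show ?thesis using that(2) by auto
next
  assume "z \<in> {frag_of (a \<odot>\<^bsub>M\<^esub> x, y) - frag_of (x, a \<odot>\<^bsub>N\<^esub> y) | a x y.
         a \<in> carrier A \<and> x \<in> carrier M \<and> y \<in> carrier N}"
  then show ?thesis using that(3) by auto
qed

lemma gens_carrier: "gens \<subseteq> carrier free_group"
proof -
  have 2: "frag_of u - frag_of v \<in> carrier free_group"
    if "u \<in> carrier M \<times> carrier N" "v \<in> carrier M \<times> carrier N" for u v :: "'m \<times> 'n"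
    using keys_diff [of "frag_of u" "frag_of v"] that by auto
  have 3: "frag_of u - frag_of v - frag_of w \<in> carrier free_group"
    if "u \<in> carrier M \<times> carrier N" "v \<in> carrier M \<times> carrier N" "w \<in> carrier M \<times> carrier N" for u v w :: "'m \<times> 'n"
    using keys_diff [of "frag_of u - frag_of v" "frag_of w"] keys_diff [of "frag_of u" "frag_of v"] that by auto
  show ?thesis
  proof
    fix z assume "z \<in> gens"
    then show "z \<in> carrier free_group"
    proof (cases rule: gens_cases)
      case (add_left x x' y)
      then show ?thesis using 3 [of "(x \<oplus>\<^bsub>M\<^esub> x', y)" "(x, y)" "(x', y)"] by simp
    next
      case (add_right x y y')
      then show ?thesis using 3 [of "(x, y \<oplus>\<^bsub>N\<^esub> y')" "(x, y)" "(x, y')"] by simp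
    next
      case (smult a x y)
      then show ?thesis using 2 [of "(a \<odot>\<^bsub>M\<^esub> x, y)" "(x, a \<odot>\<^bsub>N\<^esub> y)"] by simp
    qed
  qed
qed

lemma rels_subgroup: "subgroup rels free_group"
  unfolding rels_eq by (rule G.generate_is_subgroup [OF gens_carrier])

lemma rels_zero: "0 \<in> rels"
  using subgroup.one_closed [OF rels_subgroup] by simp

lemma rels_add: "x \<in> rels \<Longrightarrow> y \<in> rels \<Longrightarrow> x + y \<in> rels"
  using subgroup.m_closed [OF rels_subgroup] by simp

lemma rels_uminus:
  assumes "x \<in> rels" shows "- x \<in> rels"
proof -
  have "Poly_Mapping.keys x \<subseteq> carrier M \<times> carrier N"
    using subgroup.subset [OF rels_subgroup] assms by (auto simp: subset_iff)
  then show ?thesis using subgroup.m_inv_closed [OF rels_subgroup assms] by simp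
qed

lemma rels_diff: "x \<in> rels \<Longrightarrow> y \<in> rels \<Longrightarrow> x - y \<in> rels"
  using rels_add [OF _ rels_uminus, of x y] by simp

lemma rels_sum: "(\<And>i. i \<in> I \<Longrightarrow> f i \<in> rels) \<Longrightarrow> sum f I \<in> rels"
  by (induction I rule: infinite_finite_induct) (auto intro: rels_add rels_zero)

lemma rels_add_left:
  "\<lbrakk>x \<in> carrier M; x' \<in> carrier M; y \<in> carrier N\<rbrakk>
    \<Longrightarrow> frag_of (x \<oplus>\<^bsub>M\<^esub> x', y) - frag_of (x, y) - frag_of (x', y) \<in> rels"
  unfolding rels_eq by (rule generate.incl) (unfold gens_def, blast)

lemma rels_add_right:
  "\<lbrakk>x \<in> carrier M; y \<in> carrier N; y' \<in> carrier N\<rbrakk>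
    \<Longrightarrow> frag_of (x, y \<oplus>\<^bsub>N\<^esub> y') - frag_of (x, y) - frag_of (x, y') \<in> rels"
  unfolding rels_eq by (rule generate.incl) (unfold gens_def, blast)

lemma rels_smult:
  "\<lbrakk>a \<in> carrier A; x \<in> carrier M; y \<in> carrier N\<rbrakk>
    \<Longrightarrow> frag_of (a \<odot>\<^bsub>M\<^esub> x, y) - frag_of (x, a \<odot>\<^bsub>N\<^esub> y) \<in> rels"
  unfolding rels_eq by (rule generate.incl) (unfold gens_def, blast)

lemma rels_zero_left: "y \<in> carrier N \<Longrightarrow> frag_of (\<zero>\<^bsub>M\<^esub>, y) \<in> rels"
  using rels_uminus [OF rels_add_left [of "\<zero>\<^bsub>M\<^esub>" "\<zero>\<^bsub>M\<^esub>" y]] by simp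

lemma rels_zero_right: "x \<in> carrier M \<Longrightarrow> frag_of (x, \<zero>\<^bsub>N\<^esub>) \<in> rels"
  using rels_uminus [OF rels_add_right [of x "\<zero>\<^bsub>N\<^esub>" "\<zero>\<^bsub>N\<^esub>"]] by simp

lemma rels_minus_left:
  assumes "x \<in> carrier M" "x' \<in> carrier M" "y \<in> carrier N"
  shows "frag_of (x \<oplus>\<^bsub>M\<^esub> \<ominus>\<^bsub>M\<^esub> x', y) - (frag_of (x, y) - frag_of (x', y)) \<in> rels"
proof -
  have "(x \<oplus>\<^bsub>M\<^esub> \<ominus>\<^bsub>M\<^esub> x') \<oplus>\<^bsub>M\<^esub> x' = x"
    using assms by (simp add: M.a_assoc M.M.l_neg)
  then have "frag_of (x, y) - frag_of (x \<oplus>\<^bsub>M\<^esub> \<ominus>\<^bsub>M\<^esub> x', y) - frag_of (x', y) \<in> rels"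
    using rels_add_left [of "x \<oplus>\<^bsub>M\<^esub> \<ominus>\<^bsub>M\<^esub> x'" x' y] assms by simp
  from rels_uminus [OF this] show ?thesis by (simp add: algebra_simps)
qed

lemma rels_finsum_right:
  assumes "finite I" "x \<in> carrier M" "\<And>i. i \<in> I \<Longrightarrow> f i \<in> carrier N"
  shows "frag_of (x, \<Oplus>\<^bsub>N\<^esub>i\<in>I. f i) - (\<Sum>i\<in>I. frag_of (x, f i)) \<in> rels"
  using assms
proof (induction I rule: finite_induct)
  case (insert j I)
  have fc: "f \<in> I \<rightarrow> carrier N" "f j \<in> carrier N" using insert.prems by auto
  have 1: "frag_of (x, f j \<oplus>\<^bsub>N\<^esub> (\<Oplus>\<^bsub>N\<^esub>i\<in>I. f i)) - frag_of (x, f j) - frag_of (x, \<Oplus>\<^bsub>N\<^esub>i\<in>I. f i) \<in> rels"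
    using insert.prems fc by (intro rels_add_right) auto
  have 2: "frag_of (x, \<Oplus>\<^bsub>N\<^esub>i\<in>I. f i) - (\<Sum>i\<in>I. frag_of (x, f i)) \<in> rels"
    using insert by simp
  show ?case
    using rels_add [OF 1 2] insert.hyps fc by (simp add: algebra_simps)
qed (simp add: rels_zero_right)

text \<open>The map on the free abelian group kills the generating relations and hence all of
  \<open>rels\<close>, so equal tensors have equal values under every balanced map. Additivity is
  stated for differences, the form taken by the relations and by induction on free abelian
  groups.\<close>

lemma balanced_map_extends:
  fixes C :: "('c, 'd) ring_scheme"
  assumes C: "abelian_group C"
    and f: "\<And>x y. \<lbrakk>x \<in> carrier M; y \<in> carrier N\<rbrakk> \<Longrightarrow> f x y \<in> carrier C"
    and add_left: "\<And>x x' y. \<lbrakk>x \<in> carrier M; x' \<in> carrier M; y \<in> carrier N\<rbrakk>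
      \<Longrightarrow> f (x \<oplus>\<^bsub>M\<^esub> x') y = f x y \<oplus>\<^bsub>C\<^esub> f x' y"
    and add_right: "\<And>x y y'. \<lbrakk>x \<in> carrier M; y \<in> carrier N; y' \<in> carrier N\<rbrakk>
      \<Longrightarrow> f x (y \<oplus>\<^bsub>N\<^esub> y') = f x y \<oplus>\<^bsub>C\<^esub> f x y'"
    and smult: "\<And>a x y. \<lbrakk>a \<in> carrier A; x \<in> carrier M; y \<in> carrier N\<rbrakk>
      \<Longrightarrow> f (a \<odot>\<^bsub>M\<^esub> x) y = f x (a \<odot>\<^bsub>N\<^esub> y)"
  obtains g where "\<And>x y. \<lbrakk>x \<in> carrier M; y \<in> carrier N\<rbrakk> \<Longrightarrow> g (frag_of (x, y)) = f x y"
    "\<And>z. z \<in> rels \<Longrightarrow> g z = \<zero>\<^bsub>C\<^esub>"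
    "\<And>x y. \<lbrakk>Poly_Mapping.keys x \<subseteq> carrier M \<times> carrier N; Poly_Mapping.keys y \<subseteq> carrier M \<times> carrier N\<rbrakk>
      \<Longrightarrow> g (x - y) = g x \<oplus>\<^bsub>C\<^esub> \<ominus>\<^bsub>C\<^esub> g y"
proof -
  interpret C: abelian_group C by (fact C)
  \<comment> \<open>The additive group of \<open>C\<close> in multiplicative form, to which the
    universal property of free abelian groups applies.\<close>
  define D :: "'c monoid" where "D = \<lparr>carrier = carrier C, monoid.mult = (\<lambda>x y. x \<oplus>\<^bsub>C\<^esub> y), one = \<zero>\<^bsub>C\<^esub>\<rparr>"
  interpret D: comm_group D
  proof (rule comm_groupI)
    show "\<exists>y\<in>carrier D. y \<otimes>\<^bsub>D\<^esub> x = \<one>\<^bsub>D\<^esub>" if "x \<in> carrier D" for x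
      using that C.l_neg [of x] by (auto simp: D_def intro!: bexI [of _ "\<ominus>\<^bsub>C\<^esub> x"])
  qed (auto simp: D_def C.a_ac)
  have D: "carrier D = carrier C" "\<And>x y. x \<otimes>\<^bsub>D\<^esub> y = x \<oplus>\<^bsub>C\<^esub> y" "\<one>\<^bsub>D\<^esub> = \<zero>\<^bsub>C\<^esub>"
    by (auto simp: D_def)
  have "case_prod f ` (carrier M \<times> carrier N) \<subseteq> carrier D" using f by (auto simp: D)
  then obtain g where g: "g \<in> hom free_group D"
    and gf': "\<And>x. x \<in> carrier M \<times> carrier N \<Longrightarrow> g (frag_of x) = case_prod f x"
    using D.free_Abelian_group_universal by blast
  interpret g: group_hom free_group D g
    by (intro group_hom.intro group_hom_axioms.intro g G.group_axioms D.group_axioms)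
  have gf: "g (frag_of (x, y)) = f x y" if "x \<in> carrier M" "y \<in> carrier N" for x y
    using gf' that by simp
  have gc: "g x \<in> carrier C" if "Poly_Mapping.keys x \<subseteq> carrier M \<times> carrier N" for x
    using g.hom_closed [of x] that by (simp add: D)
  have gdiff: "g (x - y) = g x \<oplus>\<^bsub>C\<^esub> \<ominus>\<^bsub>C\<^esub> g y"
    if x: "Poly_Mapping.keys x \<subseteq> carrier M \<times> carrier N" and y: "Poly_Mapping.keys y \<subseteq> carrier M \<times> carrier N" for x y
  proof -
    have xy: "Poly_Mapping.keys (x - y) \<subseteq> carrier M \<times> carrier N" using keys_diff [of x y] x y by blast
    have "g ((x - y) \<otimes>\<^bsub>free_group\<^esub> y) = g (x - y) \<otimes>\<^bsub>D\<^esub> g y"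
      using xy y by (intro g.hom_mult) simp_all
    then have "g x = g (x - y) \<oplus>\<^bsub>C\<^esub> g y" by (simp add: D)
    then show ?thesis using gc [OF xy] gc [OF y] by (simp add: C.a_assoc C.r_neg)
  qed
  have gdiff3: "g (frag_of (x, y) - frag_of (x', y') - frag_of (x'', y'')) = f x y \<oplus>\<^bsub>C\<^esub> \<ominus>\<^bsub>C\<^esub> f x' y' \<oplus>\<^bsub>C\<^esub> \<ominus>\<^bsub>C\<^esub> f x'' y''"
    if "x \<in> carrier M" "y \<in> carrier N" "x' \<in> carrier M" "y' \<in> carrier N" "x'' \<in> carrier M" "y'' \<in> carrier N"
    for x y x' y' x'' y''
  proof -
    have "Poly_Mapping.keys (frag_of (x, y) - frag_of (x', y')) \<subseteq> carrier M \<times> carrier N"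
      using keys_diff [of "frag_of (x, y)" "frag_of (x', y')"] that by auto
    then show ?thesis using gdiff that by (simp add: gf)
  qed
  have "gens \<subseteq> kernel free_group D g"
  proof
    fix z assume z: "z \<in> gens"
    have cancel: "u \<oplus>\<^bsub>C\<^esub> v \<oplus>\<^bsub>C\<^esub> \<ominus>\<^bsub>C\<^esub> u \<oplus>\<^bsub>C\<^esub> \<ominus>\<^bsub>C\<^esub> v = \<zero>\<^bsub>C\<^esub>" if "u \<in> carrier C" "v \<in> carrier C" for u v
    proof -
      have "u \<oplus>\<^bsub>C\<^esub> v \<oplus>\<^bsub>C\<^esub> \<ominus>\<^bsub>C\<^esub> u \<oplus>\<^bsub>C\<^esub> \<ominus>\<^bsub>C\<^esub> v = (u \<oplus>\<^bsub>C\<^esub> \<ominus>\<^bsub>C\<^esub> u) \<oplus>\<^bsub>C\<^esub> (v \<oplus>\<^bsub>C\<^esub> \<ominus>\<^bsub>C\<^esub> v)"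
        using that by (simp add: C.a_ac)
      then show ?thesis using that by (simp add: C.r_neg)
    qed
    have "g z = \<zero>\<^bsub>C\<^esub>"
      using z
    proof (cases rule: gens_cases)
      case 1: (add_left x x' y)
      then show ?thesis using f by (simp add: gdiff3 add_left cancel)
    next
      case 2: (add_right x y y')
      then show ?thesis using f by (simp add: gdiff3 add_right cancel)
    next
      case 3: (smult a x y)
      then show ?thesis using f by (simp add: gdiff gf smult C.r_neg)
    qed
    then show "z \<in> kernel free_group D g"
      using subsetD [OF gens_carrier z] unfolding kernel_def D by blast
  qed
  then have "rels \<subseteq> kernel free_group D g"
    unfolding rels_eq by (rule G.generate_subgroup_incl [OF _ g.subgroup_kernel])
  then have "g z = \<zero>\<^bsub>C\<^esub>" if "z \<in> rels" for z using that by (auto simp: kernel_def D)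
  then show ?thesis using that gf gdiff by blast
qed

end

lemma r_coset_free_Abelian_group: "T #>\<^bsub>free_Abelian_group S\<^esub> x = {t + x | t. t \<in> T}"
  by (auto simp: r_coset_def)

lemma set_mult_free_Abelian_group: "T <#>\<^bsub>free_Abelian_group S\<^esub> V = {t + v | t v. t \<in> T \<and> v \<in> V}"
  by (auto simp: set_mult_def)

lemma carrier_tensor_product:
  "carrier (tensor_product A M N) =
    {{t + x | t. t \<in> tensor_relations A M N} | x. Poly_Mapping.keys x \<subseteq> carrier M \<times> carrier N}"
  unfolding tensor_product_def FactGroup_def RCOSETS_def r_coset_free_Abelian_group by auto blast

locale submodule_pair = M: module_pair A M N + sub: submodule H A M
  for A :: "'a ring" and M :: "('a, 'm) module" and N :: "('a, 'n) module" and H :: "'m set"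
begin

lemma H_sub: "x \<in> H \<Longrightarrow> x \<in> carrier M"
  using sub.mem_carrier by simp

sublocale H: module_pair A "M\<lparr>carrier := H\<rparr>" N
  by (intro module_pair.intro sub.submodule_is_module M.M.module_axioms M.N.module_axioms)

lemma rels_mono: "H.rels \<subseteq> M.rels"
proof
  have "x \<in> M.rels" if "x \<in> generate H.free_group H.gens" for x
    using that
  proof induction
    case (incl x)
    then show ?case
      unfolding H.gens_def using M.rels_add_left M.rels_add_right M.rels_smult H_sub by auto
  next
    case (inv x)
    have "x \<in> M.rels" using inv
      unfolding H.gens_def using M.rels_add_left M.rels_add_right M.rels_smult H_sub by auto
    moreover have "Poly_Mapping.keys x \<subseteq> H \<times> carrier N" using H.gens_carrier inv by (auto simp: subset_iff)
    ultimately show ?case using M.rels_uminus by simp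
  qed (auto intro: M.rels_zero M.rels_add)
  then show "x \<in> M.rels" if "x \<in> H.rels" for x using that unfolding H.rels_eq by blast
qed

text \<open>A homomorphism is injective when its kernel vanishes, and the coset of \<open>z\<close>
  lies in the kernel exactly when \<open>z\<close> is a relation over \<open>M\<close>.\<close>

lemma inj_on_iff:
  "inj_on (\<lambda>V. M.rels <#>\<^bsub>M.free_group\<^esub> V) (carrier (tensor_product A (M\<lparr>carrier := H\<rparr>) N)) \<longleftrightarrow>
    (\<forall>z. Poly_Mapping.keys z \<subseteq> H \<times> carrier N \<and> z \<in> M.rels \<longrightarrow> z \<in> H.rels)"
proof
  let ?c = "\<lambda>x. {t + x | t. t \<in> H.rels}"
  have coset: "M.rels <#>\<^bsub>M.free_group\<^esub> ?c x = {t + x | t. t \<in> M.rels}" for x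
  proof (intro equalityI subsetI)
    fix y assume "y \<in> M.rels <#>\<^bsub>M.free_group\<^esub> ?c x"
    then obtain t s where "t \<in> M.rels" "s \<in> H.rels" "y = (t + s) + x"
      unfolding set_mult_free_Abelian_group by (auto simp: algebra_simps)
    then show "y \<in> {t + x | t. t \<in> M.rels}" using M.rels_add rels_mono by blast
  next
    fix y assume "y \<in> {t + x | t. t \<in> M.rels}"
    then obtain t where "t \<in> M.rels" "y = t + (0 + x)" by auto
    then show "y \<in> M.rels <#>\<^bsub>M.free_group\<^esub> ?c x"
      unfolding set_mult_free_Abelian_group using H.rels_zero by blast
  qed
  have carr: "carrier (tensor_product A (M\<lparr>carrier := H\<rparr>) N) =
      {?c x | x. Poly_Mapping.keys x \<subseteq> H \<times> carrier N}"
    unfolding carrier_tensor_product by simp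
  {
    assume inj: "inj_on (\<lambda>V. M.rels <#>\<^bsub>M.free_group\<^esub> V) (carrier (tensor_product A (M\<lparr>carrier := H\<rparr>) N))"
    show "\<forall>z. Poly_Mapping.keys z \<subseteq> H \<times> carrier N \<and> z \<in> M.rels \<longrightarrow> z \<in> H.rels"
    proof (intro allI impI)
      fix z assume z: "Poly_Mapping.keys z \<subseteq> H \<times> carrier N \<and> z \<in> M.rels"
      have "{t + z | t. t \<in> M.rels} = {t + 0 | t. t \<in> M.rels}"
      proof (intro equalityI subsetI)
        fix y assume "y \<in> {t + z | t. t \<in> M.rels}"
        then show "y \<in> {t + 0 | t. t \<in> M.rels}" using z M.rels_add by auto
      next
        fix y assume "y \<in> {t + 0 | t. t \<in> M.rels}"
        then have "y - z \<in> M.rels" "y = (y - z) + z" using z M.rels_diff by auto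
        then show "y \<in> {t + z | t. t \<in> M.rels}" by blast
      qed
      then have "M.rels <#>\<^bsub>M.free_group\<^esub> ?c z = M.rels <#>\<^bsub>M.free_group\<^esub> ?c 0" unfolding coset .
      moreover have "?c z \<in> {?c x | x. Poly_Mapping.keys x \<subseteq> H \<times> carrier N}" using z by blast
      moreover have "?c 0 \<in> {?c x | x. Poly_Mapping.keys x \<subseteq> H \<times> carrier N}" by (intro CollectI exI [of _ 0]) simp
      ultimately have "?c z = ?c 0" using inj_onD [OF inj] unfolding carr by blast
      moreover have "z = 0 + z" by simp
      then have "z \<in> ?c z" using H.rels_zero by blast
      ultimately show "z \<in> H.rels" by auto
    qed
  next
    assume incl: "\<forall>z. Poly_Mapping.keys z \<subseteq> H \<times> carrier N \<and> z \<in> M.rels \<longrightarrow> z \<in> H.rels"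
    show "inj_on (\<lambda>V. M.rels <#>\<^bsub>M.free_group\<^esub> V) (carrier (tensor_product A (M\<lparr>carrier := H\<rparr>) N))"
      unfolding carr
    proof (rule inj_onI)
      fix V W assume "V \<in> {?c x | x. Poly_Mapping.keys x \<subseteq> H \<times> carrier N}"
        and "W \<in> {?c x | x. Poly_Mapping.keys x \<subseteq> H \<times> carrier N}"
        and eq: "M.rels <#>\<^bsub>M.free_group\<^esub> V = M.rels <#>\<^bsub>M.free_group\<^esub> W"
      then obtain x y where x: "V = ?c x" "Poly_Mapping.keys x \<subseteq> H \<times> carrier N"
        and y: "W = ?c y" "Poly_Mapping.keys y \<subseteq> H \<times> carrier N" by blast
      have "x = 0 + x" by simp
      then have "x \<in> {t + x | t. t \<in> M.rels}" using M.rels_zero by blast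
      then have "x \<in> {t + y | t. t \<in> M.rels}" using eq unfolding x(1) y(1) coset by simp
      then have "x - y \<in> M.rels" by auto
      moreover have "Poly_Mapping.keys (x - y) \<subseteq> H \<times> carrier N" using keys_diff [of x y] x y by blast
      ultimately have xy: "x - y \<in> H.rels" using incl by blast
      show "V = W"
      proof (intro equalityI subsetI)
        fix z assume "z \<in> V"
        then obtain t where t: "t \<in> H.rels" "z = t + x" using x by blast
        then have "z = (t + (x - y)) + y" by simp
        then show "z \<in> W" using y(1) H.rels_add [OF t(1) xy] by blast
      next
        fix z assume "z \<in> W"
        then obtain t where t: "t \<in> H.rels" "z = t + y" using y by blast
        then have "z = (t - (x - y)) + x" by simp
        then show "z \<in> V" using x(1) H.rels_diff [OF t(1) xy] by blast
      qed
    qed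
  }
qed

end

lemma flat_module_iff:
  assumes "module A N"
  shows "flat_module A N \<longleftrightarrow>
    (\<forall>(M :: ('a, 'a list) module) H z. module A M \<and> submodule H A M \<and>
      Poly_Mapping.keys z \<subseteq> H \<times> carrier N \<and> z \<in> tensor_relations A M N \<longrightarrow>
      z \<in> tensor_relations A (M\<lparr>carrier := H\<rparr>) N)"
proof -
  have "inj_on (\<lambda>V. tensor_relations A M N <#>\<^bsub>free_Abelian_group (carrier M \<times> carrier N)\<^esub> V)
        (carrier (tensor_product A (M\<lparr>carrier := H\<rparr>) N)) \<longleftrightarrow>
      (\<forall>z. Poly_Mapping.keys z \<subseteq> H \<times> carrier N \<and> z \<in> tensor_relations A M N \<longrightarrow>
        z \<in> tensor_relations A (M\<lparr>carrier := H\<rparr>) N)"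
    if M: "module A M" and H: "submodule H A M" for M :: "('a, 'a list) module" and H
  proof -
    interpret submodule_pair A M N H
      by (intro submodule_pair.intro module_pair.intro M H assms)
    show ?thesis by (rule inj_on_iff)
  qed
  then show ?thesis unfolding flat_module_def by blast
qed

lemma module_module_via:
  fixes A :: "'a ring" and B :: "'b ring"
  assumes "ring_hom_cring A B \<phi>"
  shows "module A (module_via B \<phi>)"
proof -
  interpret ring_hom_cring A B \<phi> by (fact assms)
  show ?thesis
  proof (rule moduleI)
    show "abelian_group (module_via B \<phi>)"
    proof (rule abelian_groupI)
      show "\<exists>y\<in>carrier (module_via B \<phi>). y \<oplus>\<^bsub>module_via B \<phi>\<^esub> x = \<zero>\<^bsub>module_via B \<phi>\<^esub>"
        if "x \<in> carrier (module_via B \<phi>)" for x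
        using that by (intro bexI [of _ "\<ominus>\<^bsub>B\<^esub> x"]) (auto simp: module_via_def S.l_neg)
    qed (auto simp: module_via_def S.a_ac)
  qed (auto simp: module_via_def R.cring_axioms S.l_distr S.r_distr S.m_assoc)
qed

section \<open>Finite free algebras\<close>

text \<open>Zorn's lemma gives an ideal that is maximal among those over \<open>K\<close> that avoid
  \<open>S\<close>. If it contained \<open>a \<otimes> b\<close> but neither factor, enlarging it by
  either factor would meet \<open>S\<close>, and the product of the two elements of \<open>S\<close>
  found there would lie in the ideal.\<close>

lemma (in cring) prime_ideal_avoiding:
  assumes K: "ideal K R" and S: "S \<subseteq> carrier R" "\<one> \<in> S"
    and mult: "\<And>s t. \<lbrakk>s \<in> S; t \<in> S\<rbrakk> \<Longrightarrow> s \<otimes> t \<in> S" and disj: "K \<inter> S = {}"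
  obtains J where "primeideal J R" "K \<subseteq> J" "J \<inter> S = {}"
proof -
  define F where "F = {J. ideal J R \<and> K \<subseteq> J \<and> J \<inter> S = {}}"
  have "K \<in> F" using K disj by (simp add: F_def)
  moreover have "\<Union>\<C> \<in> F" if ne: "\<C> \<noteq> {}" and ch: "subset.chain F \<C>" for \<C>
  proof -
    have "\<C> \<subseteq> F" using ch by (simp add: subset.chain_def)
    have "subset.chain {J. ideal J R} \<C>" using ch by (auto simp: subset.chain_def F_def)
    then have "ideal (\<Union>\<C>) R" using chain_Union_is_ideal [of \<C>] ne by simp
    then show ?thesis using \<open>\<C> \<subseteq> F\<close> ne by (auto simp: F_def)
  qed
  ultimately obtain J where J: "J \<in> F" and max: "\<And>J'. \<lbrakk>J' \<in> F; J \<subseteq> J'\<rbrakk> \<Longrightarrow> J' = J"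
    using subset_Zorn_nonempty [of F] by blast
  then interpret J: ideal J R by (simp add: F_def)
  have larger: "\<exists>s\<in>S. \<exists>j\<in>J. \<exists>r\<in>carrier R. s = j \<oplus> r \<otimes> a" if a: "a \<in> carrier R" "a \<notin> J" for a
  proof -
    have id: "ideal (J <+>\<^bsub>R\<^esub> PIdl a) R"
      by (intro add_ideals J.is_ideal cgenideal_ideal a)
    have mem: "x \<in> J <+>\<^bsub>R\<^esub> PIdl a \<longleftrightarrow> (\<exists>j\<in>J. \<exists>r\<in>carrier R. x = j \<oplus> r \<otimes> a)" for x
      by (auto simp: set_add_def' cgenideal_def)
    have "J \<subseteq> J <+>\<^bsub>R\<^esub> PIdl a"
    proof
      fix j assume j: "j \<in> J"
      then have "j = j \<oplus> \<zero> \<otimes> a" using a J.Icarr by simp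
      then show "j \<in> J <+>\<^bsub>R\<^esub> PIdl a" unfolding mem using j by blast
    qed
    moreover have "a = \<zero> \<oplus> \<one> \<otimes> a" using a by simp
    then have "a \<in> J <+>\<^bsub>R\<^esub> PIdl a" unfolding mem using J.zero_closed by blast
    ultimately have "J <+>\<^bsub>R\<^esub> PIdl a \<notin> F" using max a by blast
    then have "(J <+>\<^bsub>R\<^esub> PIdl a) \<inter> S \<noteq> {}"
      using id J \<open>J \<subseteq> J <+>\<^bsub>R\<^esub> PIdl a\<close> by (auto simp: F_def)
    then show ?thesis using mem by blast
  qed
  have "primeideal J R"
  proof (rule primeidealI [OF J.is_ideal cring_axioms])
    show "carrier R \<noteq> J" using J S by (auto simp: F_def)
    fix a b assume ab: "a \<in> carrier R" "b \<in> carrier R" "a \<otimes> b \<in> J"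
    show "a \<in> J \<or> b \<in> J"
    proof (rule ccontr)
      assume "\<not> (a \<in> J \<or> b \<in> J)"
      then obtain s j r t k u where s: "s \<in> S" "j \<in> J" "r \<in> carrier R" "s = j \<oplus> r \<otimes> a"
        and t: "t \<in> S" "k \<in> J" "u \<in> carrier R" "t = k \<oplus> u \<otimes> b"
        using larger [of a] larger [of b] ab by blast
      have jk: "j \<in> carrier R" "k \<in> carrier R" using s t J.Icarr by auto
      have st: "s \<otimes> t = j \<otimes> t \<oplus> ((r \<otimes> a) \<otimes> k \<oplus> (r \<otimes> u) \<otimes> (a \<otimes> b))"
        using s(3,4) t(3,4) jk ab by (simp add: l_distr r_distr m_ac a_ac)
      have "s \<otimes> t \<in> J"
      proof -
        have "j \<otimes> t \<in> J" using s t S J.I_r_closed by blast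
        moreover have "(r \<otimes> a) \<otimes> k \<in> J" using t s ab by (intro J.I_l_closed) auto
        moreover have "(r \<otimes> u) \<otimes> (a \<otimes> b) \<in> J" using t s by (intro J.I_l_closed [OF ab(3)]) auto
        ultimately show ?thesis unfolding st by (intro J.a_closed)
      qed
      moreover have "s \<otimes> t \<in> S" using s t mult by blast
      moreover have "J \<inter> S = {}" using J by (simp add: F_def)
      ultimately show False by blast
    qed
  qed
  then show ?thesis using that J by (auto simp: F_def)
qed

text \<open>
  If \<open>A \<rightarrow> B\<close> has an \<open>A\<close>-linear retraction \<open>\<rho>\<close>, then the ideal \<open>K\<close> of all \<open>b\<close> with
  \<open>\<rho> (b B) \<subseteq> I\<close> contracts to \<open>I\<close>, and a prime over \<open>K\<close> that is maximal with this property lies over \<open>I\<close>.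
\<close>

lemma Spec_surjective_if_retraction:
  fixes A :: "'a ring" and B :: "'b ring"
  assumes "ring_hom_cring A B \<phi>"
    and \<rho>: "\<And>b. b \<in> carrier B \<Longrightarrow> \<rho> b \<in> carrier A"
    and \<rho>_add: "\<And>b c. \<lbrakk>b \<in> carrier B; c \<in> carrier B\<rbrakk> \<Longrightarrow> \<rho> (b \<oplus>\<^bsub>B\<^esub> c) = \<rho> b \<oplus>\<^bsub>A\<^esub> \<rho> c"
    and \<rho>_mult: "\<And>a b. \<lbrakk>a \<in> carrier A; b \<in> carrier B\<rbrakk> \<Longrightarrow> \<rho> (\<phi> a \<otimes>\<^bsub>B\<^esub> b) = a \<otimes>\<^bsub>A\<^esub> \<rho> b"
    and \<rho>_one: "\<rho> \<one>\<^bsub>B\<^esub> = \<one>\<^bsub>A\<^esub>"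
  shows "Spec_surjective A B \<phi>"
  unfolding Spec_surjective_def
proof (intro allI impI)
  interpret hom: ring_hom_cring A B \<phi> by (fact assms)
  fix I assume "primeideal I A"
  then interpret I: primeideal I A .
  define K where "K = {b \<in> carrier B. \<forall>b'\<in>carrier B. \<rho> (b \<otimes>\<^bsub>B\<^esub> b') \<in> I}"
  have K: "ideal K B"
  proof (rule idealI [OF hom.S.ring_axioms])
    show "subgroup K (add_monoid B)"
    proof (rule hom.S.add.subgroupI)
      show "K \<subseteq> carrier B" by (auto simp: K_def)
      have "\<rho> \<zero>\<^bsub>B\<^esub> = \<zero>\<^bsub>A\<^esub>"
        using \<rho>_mult [of "\<zero>\<^bsub>A\<^esub>" "\<one>\<^bsub>B\<^esub>"] \<rho> by simp
      then show "K \<noteq> {}" using I.zero_closed by (auto simp: K_def intro!: exI [of _ "\<zero>\<^bsub>B\<^esub>"])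
      fix b c assume b: "b \<in> K" and c: "c \<in> K"
      have "\<ominus>\<^bsub>B\<^esub> b \<otimes>\<^bsub>B\<^esub> b' = b \<otimes>\<^bsub>B\<^esub> (\<ominus>\<^bsub>B\<^esub> b')" if "b' \<in> carrier B" for b'
        using b that by (simp add: K_def hom.S.l_minus hom.S.r_minus)
      then show "\<ominus>\<^bsub>B\<^esub> b \<in> K" using b by (simp add: K_def)
      show "b \<oplus>\<^bsub>B\<^esub> c \<in> K"
        using b c by (auto simp: K_def hom.S.l_distr \<rho>_add intro: I.a_closed)
    qed
    fix b x assume b: "b \<in> K" and x: "x \<in> carrier B"
    show "b \<otimes>\<^bsub>B\<^esub> x \<in> K" using b x by (auto simp: K_def hom.S.m_assoc)
    then show "x \<otimes>\<^bsub>B\<^esub> b \<in> K" using b x by (simp add: K_def hom.S.m_comm)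
  qed
  have \<phi>K: "\<phi> a \<in> K \<longleftrightarrow> a \<in> I" if a: "a \<in> carrier A" for a
  proof
    assume "a \<in> I"
    then show "\<phi> a \<in> K" using a \<rho> by (auto simp: K_def \<rho>_mult intro: I.I_r_closed)
  next
    assume "\<phi> a \<in> K"
    then have "\<rho> (\<phi> a \<otimes>\<^bsub>B\<^esub> \<one>\<^bsub>B\<^esub>) \<in> I" using hom.S.one_closed unfolding K_def by blast
    then show "a \<in> I" using \<rho>_mult [OF a hom.S.one_closed] \<rho>_one a by simp
  qed
  \<comment> \<open>The set is multiplicative because \<open>I\<close> is prime. A prime over
    \<open>K\<close> that avoids it contracts to \<open>I\<close>: it contains the image of
    \<open>I\<close>, which is part of \<open>K\<close>, and the image of no other element of
    \<open>A\<close>.\<close>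
  define S where "S = \<phi> ` (carrier A - I)"
  have "K \<inter> S = {}" using \<phi>K by (auto simp: S_def)
  moreover have "S \<subseteq> carrier B" by (auto simp: S_def)
  moreover have "\<one>\<^bsub>B\<^esub> \<in> S"
    using I.one_imp_carrier I.I_notcarr by (auto simp: S_def intro!: image_eqI [of _ _ "\<one>\<^bsub>A\<^esub>"])
  moreover have "s \<otimes>\<^bsub>B\<^esub> t \<in> S" if "s \<in> S" "t \<in> S" for s t
  proof -
    obtain a b where "a \<in> carrier A - I" "s = \<phi> a" "b \<in> carrier A - I" "t = \<phi> b" using \<open>s \<in> S\<close> \<open>t \<in> S\<close> by (auto simp: S_def)
    then show ?thesis using I.I_prime [of a b] by (auto simp: S_def intro!: image_eqI [of _ _ "a \<otimes>\<^bsub>A\<^esub> b"])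
  qed
  ultimately obtain J where J: "primeideal J B" "K \<subseteq> J" "J \<inter> S = {}"
    using hom.S.prime_ideal_avoiding [OF K] by blast
  have "{a \<in> carrier A. \<phi> a \<in> J} = I"
    using J \<phi>K I.Icarr by (auto simp: S_def)
  then show "\<exists>J. primeideal J B \<and> {a \<in> carrier A. \<phi> a \<in> J} = I" using J by blast
qed

text \<open>The coordinate functions \<open>c i\<close> are part of the data. Indexing the basis by
  \<open>I\<close>, rather than taking a set of elements, allows it to be renumbered.\<close>

locale finite_free_algebra = A: cring A + B: cring B + hom: ring_hom_cring A B \<phi>
  for A :: "'a ring" and B :: "'b ring" and \<phi> :: "'a \<Rightarrow> 'b" +
  fixes I :: "'i set" and e :: "'i \<Rightarrow> 'b" and c :: "'i \<Rightarrow> 'b \<Rightarrow> 'a"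
  assumes finite_I: "finite I"
    and e_closed: "i \<in> I \<Longrightarrow> e i \<in> carrier B"
    and c_closed: "i \<in> I \<Longrightarrow> b \<in> carrier B \<Longrightarrow> c i b \<in> carrier A"
    and c_add: "\<lbrakk>i \<in> I; b \<in> carrier B; b' \<in> carrier B\<rbrakk> \<Longrightarrow> c i (b \<oplus>\<^bsub>B\<^esub> b') = c i b \<oplus>\<^bsub>A\<^esub> c i b'"
    and c_mult: "\<lbrakk>i \<in> I; a \<in> carrier A; b \<in> carrier B\<rbrakk> \<Longrightarrow> c i (\<phi> a \<otimes>\<^bsub>B\<^esub> b) = a \<otimes>\<^bsub>A\<^esub> c i b"
    and c_e: "\<lbrakk>i \<in> I; j \<in> I\<rbrakk> \<Longrightarrow> c i (e j) = (if i = j then \<one>\<^bsub>A\<^esub> else \<zero>\<^bsub>A\<^esub>)"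
    and expand: "b \<in> carrier B \<Longrightarrow> b = (\<Oplus>\<^bsub>B\<^esub>i\<in>I. \<phi> (c i b) \<otimes>\<^bsub>B\<^esub> e i)"
begin

text \<open>Finiteness of a ring map asks for a set of elements, so the coordinates of indices with
  the same \<open>e i\<close> are added up. Over the zero ring all the \<open>e i\<close>
  coincide.\<close>

lemma image_generates:
  assumes b: "b \<in> carrier B"
  shows "\<exists>d\<in>e ` I \<rightarrow> carrier A. b = (\<Oplus>\<^bsub>B\<^esub>s\<in>e ` I. \<phi> (d s) \<otimes>\<^bsub>B\<^esub> s)"
proof -
  let ?d = "\<lambda>s. \<Oplus>\<^bsub>A\<^esub>i\<in>{i \<in> I. e i = s}. c i b"
  have "b = (\<Oplus>\<^bsub>B\<^esub>i\<in>I. \<phi> (c i b) \<otimes>\<^bsub>B\<^esub> e i)" by (rule expand [OF b])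
  also have "\<dots> = (\<Oplus>\<^bsub>B\<^esub>s\<in>e ` I. \<Oplus>\<^bsub>B\<^esub>i\<in>{i \<in> I. e i = s}. \<phi> (c i b) \<otimes>\<^bsub>B\<^esub> e i)"
    using finite_I c_closed [OF _ b] e_closed by (intro B.finsum_fibers) auto
  also have "\<dots> = (\<Oplus>\<^bsub>B\<^esub>s\<in>e ` I. \<phi> (?d s) \<otimes>\<^bsub>B\<^esub> s)"
  proof (rule B.finsum_cong' [OF refl])
    fix s assume "s \<in> e ` I"
    then have s: "s \<in> carrier B" using e_closed by blast
    have "\<phi> (?d s) \<otimes>\<^bsub>B\<^esub> s = (\<Oplus>\<^bsub>B\<^esub>i\<in>{i \<in> I. e i = s}. \<phi> (c i b)) \<otimes>\<^bsub>B\<^esub> s"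
      using c_closed [OF _ b] by (subst hom.hom_finsum) (auto simp: o_def)
    also have "\<dots> = (\<Oplus>\<^bsub>B\<^esub>i\<in>{i \<in> I. e i = s}. \<phi> (c i b) \<otimes>\<^bsub>B\<^esub> s)"
      using finite_I c_closed [OF _ b] s by (intro B.finsum_ldistr) auto
    also have "\<dots> = (\<Oplus>\<^bsub>B\<^esub>i\<in>{i \<in> I. e i = s}. \<phi> (c i b) \<otimes>\<^bsub>B\<^esub> e i)"
      using c_closed [OF _ b] s by (intro B.finsum_cong') auto
    finally show "(\<Oplus>\<^bsub>B\<^esub>i\<in>{i \<in> I. e i = s}. \<phi> (c i b) \<otimes>\<^bsub>B\<^esub> e i) = \<phi> (?d s) \<otimes>\<^bsub>B\<^esub> s" ..
  qed (use c_closed [OF _ b] e_closed in \<open>auto intro!: A.finsum_closed\<close>)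
  finally show ?thesis
    using c_closed [OF _ b] by (intro bexI [of _ ?d]) (auto intro!: A.finsum_closed)
qed

lemma finite_ring_hom: "finite_ring_hom A B \<phi>"
  unfolding finite_ring_hom_def
proof (intro exI conjI ballI)
  show "finite (e ` I)" using finite_I by simp
  show "e ` I \<subseteq> carrier B" using e_closed by blast
qed (rule image_generates)

lemma finsum_module_via: "finsum (module_via B \<phi>) f J = finsum B f J"
  by (simp add: finsum_def finprod_def module_via_def)

text \<open>
  Modulo the relations over the submodule \<open>H\<close>, every \<open>z\<close> is equal to the sum of the
  \<open>g i z \<otimes> e i\<close>, where the coordinates \<open>g i z\<close> only depend on \<open>z\<close> modulo the relations over \<open>M\<close>.
\<close>

lemma flat_ring_hom: "flat_ring_hom A B \<phi>"
  unfolding flat_ring_hom_def flat_module_iff [OF module_module_via [OF hom.ring_hom_cring_axioms]]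
proof (intro allI impI; elim conjE)
  let ?N = "module_via B \<phi>"
  fix M :: "('a, 'a list) module" and H z
  assume M: "module A M" and H: "submodule H A M" and z: "Poly_Mapping.keys z \<subseteq> H \<times> carrier ?N"
    and zM: "z \<in> tensor_relations A M ?N"
  interpret submodule_pair A M ?N H
    by (intro submodule_pair.intro module_pair.intro M H module_module_via hom.ring_hom_cring_axioms)
  have N: "carrier ?N = carrier B" "\<And>x y. x \<oplus>\<^bsub>?N\<^esub> y = x \<oplus>\<^bsub>B\<^esub> y" "\<And>a b. a \<odot>\<^bsub>?N\<^esub> b = \<phi> a \<otimes>\<^bsub>B\<^esub> b"
    by (auto simp: module_via_def)
  \<comment> \<open>On generators this is the balanced map that multiplies \<open>x\<close> by the
    coordinate of \<open>b\<close> at \<open>i\<close>.\<close>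
  have "\<exists>g. (\<forall>x\<in>carrier M. \<forall>b\<in>carrier B. g (frag_of (x, b)) = c i b \<odot>\<^bsub>M\<^esub> x) \<and>
      (\<forall>z\<in>M.rels. g z = \<zero>\<^bsub>M\<^esub>) \<and>
      (\<forall>x y. Poly_Mapping.keys x \<subseteq> carrier M \<times> carrier B \<and> Poly_Mapping.keys y \<subseteq> carrier M \<times> carrier B \<longrightarrow>
        g (x - y) = g x \<oplus>\<^bsub>M\<^esub> \<ominus>\<^bsub>M\<^esub> g y)" if i: "i \<in> I" for i
  proof -
    obtain g where "\<And>x y. \<lbrakk>x \<in> carrier M; y \<in> carrier ?N\<rbrakk> \<Longrightarrow> g (frag_of (x, y)) = c i y \<odot>\<^bsub>M\<^esub> x"
        "\<And>z. z \<in> M.rels \<Longrightarrow> g z = \<zero>\<^bsub>M\<^esub>"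
        "\<And>x y. \<lbrakk>Poly_Mapping.keys x \<subseteq> carrier M \<times> carrier ?N; Poly_Mapping.keys y \<subseteq> carrier M \<times> carrier ?N\<rbrakk>
          \<Longrightarrow> g (x - y) = g x \<oplus>\<^bsub>M\<^esub> \<ominus>\<^bsub>M\<^esub> g y"
    proof (rule M.balanced_map_extends [OF M.M.M.abelian_group_axioms, where f = "\<lambda>x b. c i b \<odot>\<^bsub>M\<^esub> x"])
      show "c i y \<odot>\<^bsub>M\<^esub> (a \<odot>\<^bsub>M\<^esub> x) = c i (a \<odot>\<^bsub>?N\<^esub> y) \<odot>\<^bsub>M\<^esub> x"
        if "a \<in> carrier A" "x \<in> carrier M" "y \<in> carrier ?N" for a x y
        using that i c_closed by (simp add: N c_mult A.m_comm flip: M.M.smult_assoc1)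
    qed (use i c_closed in \<open>auto simp: N c_add M.M.smult_l_distr M.M.smult_r_distr\<close>)
    then show ?thesis by (intro exI [of _ g]) (auto simp: N)
  qed
  then have "\<exists>g. \<forall>i\<in>I. (\<forall>x\<in>carrier M. \<forall>b\<in>carrier B. g i (frag_of (x, b)) = c i b \<odot>\<^bsub>M\<^esub> x) \<and>
      (\<forall>z\<in>M.rels. g i z = \<zero>\<^bsub>M\<^esub>) \<and>
      (\<forall>x y. Poly_Mapping.keys x \<subseteq> carrier M \<times> carrier B \<and> Poly_Mapping.keys y \<subseteq> carrier M \<times> carrier B \<longrightarrow>
        g i (x - y) = g i x \<oplus>\<^bsub>M\<^esub> \<ominus>\<^bsub>M\<^esub> g i y)" by (intro bchoice) blast
  then obtain g where g: "\<And>i. i \<in> I \<Longrightarrow> (\<forall>x\<in>carrier M. \<forall>b\<in>carrier B. g i (frag_of (x, b)) = c i b \<odot>\<^bsub>M\<^esub> x) \<and>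
      (\<forall>z\<in>M.rels. g i z = \<zero>\<^bsub>M\<^esub>) \<and>
      (\<forall>x y. Poly_Mapping.keys x \<subseteq> carrier M \<times> carrier B \<and> Poly_Mapping.keys y \<subseteq> carrier M \<times> carrier B \<longrightarrow>
        g i (x - y) = g i x \<oplus>\<^bsub>M\<^esub> \<ominus>\<^bsub>M\<^esub> g i y)" by (elim exE) blast
  have g_frag: "g i (frag_of (x, b)) = c i b \<odot>\<^bsub>M\<^esub> x" if "i \<in> I" "x \<in> carrier M" "b \<in> carrier B" for i x b
    using g [OF that(1)] that by simp
  have g_rels: "g i z = \<zero>\<^bsub>M\<^esub>" if "i \<in> I" "z \<in> M.rels" for i z
    using g [OF that(1)] that by simp
  have g_diff: "g i (x - y) = g i x \<oplus>\<^bsub>M\<^esub> \<ominus>\<^bsub>M\<^esub> g i y"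
    if "i \<in> I" "Poly_Mapping.keys x \<subseteq> carrier M \<times> carrier B" "Poly_Mapping.keys y \<subseteq> carrier M \<times> carrier B" for i x y
    using g [OF that(1)] that by simp
  have sub: "Poly_Mapping.keys x \<subseteq> carrier M \<times> carrier B"
    if "Poly_Mapping.keys x \<subseteq> H \<times> carrier B" for x :: "('a list \<times> 'b) \<Rightarrow>\<^sub>0 int"
    using that H_sub by blast
  have HM: "x \<oplus>\<^bsub>M\<lparr>carrier := H\<rparr>\<^esub> y = x \<oplus>\<^bsub>M\<^esub> y" "a \<odot>\<^bsub>M\<lparr>carrier := H\<rparr>\<^esub> x = a \<odot>\<^bsub>M\<^esub> x" for x y a
    by auto
  have Hclosed: "\<zero>\<^bsub>M\<^esub> \<in> H" "\<And>x. x \<in> H \<Longrightarrow> \<ominus>\<^bsub>M\<^esub> x \<in> H" "\<And>x y. x \<in> H \<Longrightarrow> y \<in> H \<Longrightarrow> x \<oplus>\<^bsub>M\<^esub> y \<in> H"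
    using sub.one_closed M.M.submoduleE [OF H] by auto
  have Hinv: "\<ominus>\<^bsub>M\<lparr>carrier := H\<rparr>\<^esub> x = \<ominus>\<^bsub>M\<^esub> x" if "x \<in> H" for x
  proof -
    have "\<ominus>\<^bsub>M\<^esub> x \<oplus>\<^bsub>M\<^esub> x = \<zero>\<^bsub>M\<^esub>" using H_sub that M.M.M.l_neg by blast
    then show ?thesis
      using H.M.minus_equality [of "\<ominus>\<^bsub>M\<^esub> x" x] Hclosed that by simp
  qed
  \<comment> \<open>Induction on the free abelian group: both claims pass to differences, and for a
    generator formed from \<open>m\<close> and \<open>b\<close> the coordinates of \<open>b\<close>
    are moved across the tensor sign.\<close>
  have main: "(\<forall>i\<in>I. g i x \<in> H) \<and> x - (\<Sum>i\<in>I. frag_of (g i x, e i)) \<in> H.rels"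
    if "Poly_Mapping.keys x \<subseteq> H \<times> carrier B" for x
    using that
  proof (induction x rule: free_Abelian_group_induct [consumes 1])
    case 1
    have "g i 0 = \<zero>\<^bsub>M\<^esub>" if "i \<in> I" for i using g_rels M.rels_zero that by blast
    moreover have "(\<Sum>i\<in>I. frag_of (\<zero>\<^bsub>M\<^esub>, e i)) \<in> H.rels"
      using H.rels_zero_left e_closed by (intro H.rels_sum) (simp add: N)
    ultimately show ?case using Hclosed(1) H.rels_uminus by simp
  next
    case (2 x y)
    have gH: "g i x \<in> H" "g i y \<in> H" "g i (x - y) = g i x \<oplus>\<^bsub>M\<^esub> \<ominus>\<^bsub>M\<^esub> g i y" if "i \<in> I" for i
      using 2 g_diff sub that by auto
    have "frag_of (g i (x - y), e i) - (frag_of (g i x, e i) - frag_of (g i y, e i)) \<in> H.rels" if "i \<in> I" for i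
      using H.rels_minus_left [of "g i x" "g i y" "e i"] gH [OF that] Hinv e_closed [OF that] by (simp add: N)
    then have "(\<Sum>i\<in>I. frag_of (g i (x - y), e i) - (frag_of (g i x, e i) - frag_of (g i y, e i))) \<in> H.rels"
      by (rule H.rels_sum)
    then have s: "(\<Sum>i\<in>I. frag_of (g i (x - y), e i)) -
        ((\<Sum>i\<in>I. frag_of (g i x, e i)) - (\<Sum>i\<in>I. frag_of (g i y, e i))) \<in> H.rels"
      by (simp add: sum_subtractf)
    have "(x - (\<Sum>i\<in>I. frag_of (g i x, e i))) - (y - (\<Sum>i\<in>I. frag_of (g i y, e i))) \<in> H.rels"
      using H.rels_diff [of "x - (\<Sum>i\<in>I. frag_of (g i x, e i))" "y - (\<Sum>i\<in>I. frag_of (g i y, e i))"] 2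
      by blast
    then have "(x - (\<Sum>i\<in>I. frag_of (g i x, e i))) - (y - (\<Sum>i\<in>I. frag_of (g i y, e i))) -
        ((\<Sum>i\<in>I. frag_of (g i (x - y), e i)) -
        ((\<Sum>i\<in>I. frag_of (g i x, e i)) - (\<Sum>i\<in>I. frag_of (g i y, e i)))) \<in> H.rels"
      using s by (rule H.rels_diff)
    then have "x - y - (\<Sum>i\<in>I. frag_of (g i (x - y), e i)) \<in> H.rels" by (simp add: algebra_simps)
    then show ?case using gH Hclosed by simp
  next
    case (3 mb)
    then obtain m b where mb: "mb = (m, b)" "m \<in> H" "b \<in> carrier B" by auto
    have g: "g i (frag_of mb) = c i b \<odot>\<^bsub>M\<^esub> m" if "i \<in> I" for i
      using g_frag that mb H_sub by simp
    have "frag_of (m, \<Oplus>\<^bsub>?N\<^esub>i\<in>I. \<phi> (c i b) \<otimes>\<^bsub>B\<^esub> e i) - (\<Sum>i\<in>I. frag_of (m, \<phi> (c i b) \<otimes>\<^bsub>B\<^esub> e i)) \<in> H.rels"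
      using finite_I mb e_closed c_closed by (intro H.rels_finsum_right) (auto simp: N)
    then have 1: "frag_of mb - (\<Sum>i\<in>I. frag_of (m, \<phi> (c i b) \<otimes>\<^bsub>B\<^esub> e i)) \<in> H.rels"
      using expand [OF mb(3)] mb(1) by (simp add: finsum_module_via)
    have "frag_of (c i b \<odot>\<^bsub>M\<^esub> m, e i) - frag_of (m, \<phi> (c i b) \<otimes>\<^bsub>B\<^esub> e i) \<in> H.rels" if "i \<in> I" for i
      using H.rels_smult [of "c i b" m "e i"] that mb e_closed c_closed by (simp add: N)
    then have "(\<Sum>i\<in>I. frag_of (c i b \<odot>\<^bsub>M\<^esub> m, e i) - frag_of (m, \<phi> (c i b) \<otimes>\<^bsub>B\<^esub> e i)) \<in> H.rels"
      by (rule H.rels_sum)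
    then have "(\<Sum>i\<in>I. frag_of (c i b \<odot>\<^bsub>M\<^esub> m, e i)) - (\<Sum>i\<in>I. frag_of (m, \<phi> (c i b) \<otimes>\<^bsub>B\<^esub> e i)) \<in> H.rels"
      by (simp add: sum_subtractf)
    from H.rels_diff [OF 1 this] have "frag_of mb - (\<Sum>i\<in>I. frag_of (c i b \<odot>\<^bsub>M\<^esub> m, e i)) \<in> H.rels"
      by simp
    moreover have "c i b \<odot>\<^bsub>M\<^esub> m \<in> H" if "i \<in> I" for i
      using that mb c_closed by (intro sub.smult_closed) auto
    ultimately show ?case using g by simp
  qed
  have "(\<Sum>i\<in>I. frag_of (g i z, e i)) = (\<Sum>i\<in>I. frag_of (\<zero>\<^bsub>M\<^esub>, e i))"
    using g_rels zM by (intro sum.cong) auto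
  moreover have "(\<Sum>i\<in>I. frag_of (\<zero>\<^bsub>M\<^esub>, e i)) \<in> H.rels"
    using H.rels_zero_left e_closed by (intro H.rels_sum) (simp add: N)
  moreover have "z - (\<Sum>i\<in>I. frag_of (g i z, e i)) \<in> H.rels"
    using main z by (simp add: N)
  ultimately show "z \<in> H.rels" using H.rels_add by fastforce
qed

end

section \<open>Finite presentation of finite free algebras\<close>

lemma comm_monoid_exponent_monoid: "comm_monoid (exponent_monoid n)"
  by (rule comm_monoidI) (auto simp: exponent_monoid_def)

lemma (in ideal) finsum_closed_ideal:
  assumes "finite K" "\<And>k. k \<in> K \<Longrightarrow> f k \<in> I"
  shows "finsum R f K \<in> I"
  using assms
proof (induction K rule: finite_induct)
  case (insert k K)
  then show ?case using Icarr by (subst finsum_insert) (auto intro: a_closed)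
qed simp

text \<open>
  With \<open>L b\<close> the linear form in the variables that maps to \<open>b\<close>, the polynomials \<open>X i X j - L (v i v j)\<close>
  and \<open>1 - L 1\<close> generate the kernel: modulo these, every polynomial is equivalent to a linear form.
\<close>

lemma finitely_presented_if_free_nat:
  fixes A :: "'a ring" and B :: "'b ring" and n :: nat
  assumes "finite_free_algebra A B \<phi> {..<n} v d"
  shows "finitely_presented_ring_hom A B \<phi>"
proof -
  interpret finite_free_algebra A B \<phi> "{..<n}" v d by (fact assms)
  let ?E = "exponent_monoid n"
  let ?PR = "polynomial_ring A n"
  interpret E: comm_monoid ?E by (rule comm_monoid_exponent_monoid)
  interpret ev: monoid_algebra_eval A B \<phi> ?E
    by (intro monoid_algebra_eval.intro A.cring_axioms B.cring_axioms E.comm_monoid_axioms hom.ring_hom_cring_axioms)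
  interpret mr: monoid_algebra_ring A ?E
    by (intro monoid_algebra_ring.intro A.cring_axioms E.comm_monoid_axioms)
  have PR: "?PR = monoid_algebra A ?E" by (simp add: polynomial_ring_def)
  interpret PR: cring ?PR unfolding PR by (rule mr.algebra_cring)
  have E: "carrier ?E = {x. \<forall>i\<ge>n. x i = 0}" "\<And>x y. x \<otimes>\<^bsub>?E\<^esub> y = (\<lambda>i. x i + y i)" "\<one>\<^bsub>?E\<^esub> = (\<lambda>i. 0)"
    by (auto simp: exponent_monoid_def)
  have vc: "v k \<in> carrier B" if "k < n" for k using e_closed that by simp
  have dc: "d k b \<in> carrier A" if "k < n" "b \<in> carrier B" for k b using c_closed that by simp
  \<comment> \<open>\<open>\<mu>\<close> is the value of a monomial at the basis \<open>v\<close>,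
    so that \<open>\<psi>\<close> evaluates polynomials at \<open>v\<close>.\<close>
  define \<mu> where "\<mu> x = finprod B (\<lambda>k. v k [^]\<^bsub>B\<^esub> (x k :: nat)) {..<n}" for x
  define \<psi> where "\<psi> F = alg_eval A B \<phi> F \<mu>" for F
  have \<mu>c: "\<mu> x \<in> carrier B" for x using vc by (auto simp: \<mu>_def intro!: B.finprod_closed)
  have \<mu>_mult: "\<mu> (x \<otimes>\<^bsub>?E\<^esub> y) = \<mu> x \<otimes>\<^bsub>B\<^esub> \<mu> y" for x y
  proof -
    have "\<mu> (x \<otimes>\<^bsub>?E\<^esub> y) = finprod B (\<lambda>k. v k [^]\<^bsub>B\<^esub> x k \<otimes>\<^bsub>B\<^esub> v k [^]\<^bsub>B\<^esub> y k) {..<n}"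
      unfolding \<mu>_def E using vc by (intro B.finprod_cong') (auto simp: B.nat_pow_mult)
    also have "\<dots> = \<mu> x \<otimes>\<^bsub>B\<^esub> \<mu> y"
      unfolding \<mu>_def using vc by (intro B.finprod_multf) auto
    finally show ?thesis .
  qed
  have \<mu>_one: "\<mu> \<one>\<^bsub>?E\<^esub> = \<one>\<^bsub>B\<^esub>" by (simp add: \<mu>_def E)
  have \<psi>: "\<psi> \<in> ring_hom ?PR B"
    unfolding \<psi>_def PR using \<mu>c \<mu>_mult \<mu>_one by (intro ev.ev_ring_hom) auto
  interpret \<psi>: ring_hom_cring ?PR B \<psi>
    by (intro ring_hom_cring.intro ring_hom_cring_axioms.intro PR.cring_axioms B.cring_axioms \<psi>)
  define \<delta> :: "nat \<Rightarrow> nat \<Rightarrow> nat" where "\<delta> k = (\<lambda>i. if i = k then 1 else 0)" for k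
  have \<delta>c: "\<delta> k \<in> carrier ?E" if "k < n" for k using that by (auto simp: E \<delta>_def)
  have \<mu>\<delta>: "\<mu> (\<delta> k) = v k" if "k < n" for k
  proof -
    have "\<mu> (\<delta> k) = finprod B (\<lambda>i. if k = i then v i else \<one>\<^bsub>B\<^esub>) {..<n}"
      unfolding \<mu>_def using vc by (intro B.finprod_cong') (auto simp: \<delta>_def)
    also have "\<dots> = v k" using that vc by (intro B.finprod_singleton) auto
    finally show ?thesis .
  qed
  define cst where "cst a = alg_monom A a \<one>\<^bsub>?E\<^esub>" for a
  define V where "V k = alg_monom A \<one>\<^bsub>A\<^esub> (\<delta> k)" for k
  have cst_closed [simp]: "cst a \<in> carrier ?PR" if "a \<in> carrier A" for a
    using that by (simp add: cst_def PR)
  have V_closed [simp]: "V k \<in> carrier ?PR" if "k < n" for k using that \<delta>c by (simp add: V_def PR)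
  have \<psi>_cst: "\<psi> (cst a) = \<phi> a" if "a \<in> carrier A" for a
    using that \<mu>c by (simp add: \<psi>_def cst_def ev.ev_monom \<mu>_one)
  have \<psi>_V: "\<psi> (V k) = v k" if "k < n" for k
    using that \<mu>c \<delta>c vc by (simp add: \<psi>_def V_def ev.ev_monom \<mu>\<delta>)
  have cst_add: "cst (a \<oplus>\<^bsub>A\<^esub> b) = cst a \<oplus>\<^bsub>?PR\<^esub> cst b" if "a \<in> carrier A" "b \<in> carrier A" for a b
    using that by (simp add: cst_def PR mr.monom_add)
  have cst_mult: "cst (a \<otimes>\<^bsub>A\<^esub> b) = cst a \<otimes>\<^bsub>?PR\<^esub> cst b" if "a \<in> carrier A" "b \<in> carrier A" for a b
    using that by (simp add: cst_def PR mr.monom_mult)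
  have cst_zero: "cst \<zero>\<^bsub>A\<^esub> = \<zero>\<^bsub>?PR\<^esub>" by (simp add: cst_def PR mr.monom_zero)
  have cst_one: "cst \<one>\<^bsub>A\<^esub> = \<one>\<^bsub>?PR\<^esub>" by (simp add: cst_def PR monoid_algebra_simps(1))
  define L where "L b = (\<Oplus>\<^bsub>?PR\<^esub>k\<in>{..<n}. cst (d k b) \<otimes>\<^bsub>?PR\<^esub> V k)" for b
  have L_closed [simp]: "L b \<in> carrier ?PR" if "b \<in> carrier B" for b
    unfolding L_def using that dc by (intro PR.finsum_closed) auto
  have \<psi>_L: "\<psi> (L b) = b" if b: "b \<in> carrier B" for b
  proof -
    have "\<psi> (L b) = (\<Oplus>\<^bsub>B\<^esub>k\<in>{..<n}. \<psi> (cst (d k b) \<otimes>\<^bsub>?PR\<^esub> V k))"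
      unfolding L_def using b dc by (subst \<psi>.hom_finsum) (auto simp: o_def)
    also have "\<dots> = (\<Oplus>\<^bsub>B\<^esub>k\<in>{..<n}. \<phi> (d k b) \<otimes>\<^bsub>B\<^esub> v k)"
      using b dc vc by (intro B.finsum_cong') (auto simp: \<psi>_cst \<psi>_V)
    also have "\<dots> = b" using expand [OF b] ..
    finally show ?thesis .
  qed
  have L_add: "L (b \<oplus>\<^bsub>B\<^esub> b') = L b \<oplus>\<^bsub>?PR\<^esub> L b'" if b: "b \<in> carrier B" "b' \<in> carrier B" for b b'
  proof -
    have "L (b \<oplus>\<^bsub>B\<^esub> b') = (\<Oplus>\<^bsub>?PR\<^esub>k\<in>{..<n}. cst (d k b) \<otimes>\<^bsub>?PR\<^esub> V k \<oplus>\<^bsub>?PR\<^esub> cst (d k b') \<otimes>\<^bsub>?PR\<^esub> V k)"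
      unfolding L_def using b dc by (intro PR.finsum_cong') (auto simp: c_add cst_add PR.l_distr)
    also have "\<dots> = L b \<oplus>\<^bsub>?PR\<^esub> L b'"
      unfolding L_def using b dc by (intro PR.finsum_addf) auto
    finally show ?thesis .
  qed
  have L_mult: "L (\<phi> a \<otimes>\<^bsub>B\<^esub> b) = cst a \<otimes>\<^bsub>?PR\<^esub> L b" if a: "a \<in> carrier A" and b: "b \<in> carrier B" for a b
  proof -
    have "cst a \<otimes>\<^bsub>?PR\<^esub> L b = (\<Oplus>\<^bsub>?PR\<^esub>k\<in>{..<n}. cst a \<otimes>\<^bsub>?PR\<^esub> (cst (d k b) \<otimes>\<^bsub>?PR\<^esub> V k))"
      unfolding L_def using a b dc by (intro PR.finsum_rdistr) auto
    also have "\<dots> = L (\<phi> a \<otimes>\<^bsub>B\<^esub> b)"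
      unfolding L_def using a b dc by (intro PR.finsum_cong') (auto simp: c_mult cst_mult PR.m_assoc)
    finally show ?thesis ..
  qed
  have L_zero: "L \<zero>\<^bsub>B\<^esub> = \<zero>\<^bsub>?PR\<^esub>"
    using L_mult [of "\<zero>\<^bsub>A\<^esub>" "\<zero>\<^bsub>B\<^esub>"] by (simp add: cst_zero)
  have L_finsum: "L (\<Oplus>\<^bsub>B\<^esub>k\<in>K. f k) = (\<Oplus>\<^bsub>?PR\<^esub>k\<in>K. L (f k))"
    if "finite K" "\<And>k. k \<in> K \<Longrightarrow> f k \<in> carrier B" for K :: "nat set" and f
    using that
  proof (induction K rule: finite_induct)
    case (insert k K)
    then show ?case
      by (subst B.finsum_insert, simp, simp, force, simp)
        (subst PR.finsum_insert, simp, simp, force, simp, subst L_add, auto intro!: B.finsum_closed)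
  qed (simp add: L_zero)
  \<comment> \<open>The relation for the identity accounts for constants: \<open>\<one>\<close> need
    not be a basis element of \<open>B\<close>, so the constant polynomial also has to be rewritten
    as a linear form.\<close>
  define gs where "gs = (\<lambda>(i, j). V i \<otimes>\<^bsub>?PR\<^esub> V j \<ominus>\<^bsub>?PR\<^esub> L (v i \<otimes>\<^bsub>B\<^esub> v j)) ` ({..<n} \<times> {..<n})
      \<union> {\<one>\<^bsub>?PR\<^esub> \<ominus>\<^bsub>?PR\<^esub> L \<one>\<^bsub>B\<^esub>}"
  have gs_closed: "gs \<subseteq> carrier ?PR"
    using vc by (auto simp: gs_def)
  define J where "J = Idl\<^bsub>?PR\<^esub> gs"
  interpret J: ideal J ?PR unfolding J_def by (rule PR.genideal_ideal [OF gs_closed])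
  have gsJ: "gs \<subseteq> J" unfolding J_def by (rule PR.genideal_self [OF gs_closed])
  \<comment> \<open>Both sides are linear in \<open>b\<close>, and for a basis element
    \<open>v k\<close> the difference is one of the generators.\<close>
  have V_L: "V j \<otimes>\<^bsub>?PR\<^esub> L b \<ominus>\<^bsub>?PR\<^esub> L (v j \<otimes>\<^bsub>B\<^esub> b) \<in> J" if j: "j < n" and b: "b \<in> carrier B" for j b
  proof -
    let ?g = "\<lambda>k. V j \<otimes>\<^bsub>?PR\<^esub> V k \<ominus>\<^bsub>?PR\<^esub> L (v j \<otimes>\<^bsub>B\<^esub> v k)"
    have gJ: "?g k \<in> J" if "k < n" for k using gsJ j that by (auto simp: gs_def)
    have gc: "?g k \<in> carrier ?PR" if "k < n" for k using gJ [OF that] J.Icarr by blast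
    have split: "V j \<otimes>\<^bsub>?PR\<^esub> V k = L (v j \<otimes>\<^bsub>B\<^esub> v k) \<oplus>\<^bsub>?PR\<^esub> ?g k" if "k < n" for k
    proof -
      have "x = y \<oplus>\<^bsub>?PR\<^esub> (x \<ominus>\<^bsub>?PR\<^esub> y)" if "x \<in> carrier ?PR" "y \<in> carrier ?PR" for x y
        using that by (simp add: PR.minus_eq PR.a_lcomm [of y x] PR.r_neg)
      then show ?thesis using that j vc by simp
    qed
    have L_prod: "(\<Oplus>\<^bsub>?PR\<^esub>k\<in>{..<n}. cst (d k b) \<otimes>\<^bsub>?PR\<^esub> L (v j \<otimes>\<^bsub>B\<^esub> v k)) = L (v j \<otimes>\<^bsub>B\<^esub> b)"
    proof -
      have "v j \<otimes>\<^bsub>B\<^esub> b = v j \<otimes>\<^bsub>B\<^esub> (\<Oplus>\<^bsub>B\<^esub>k\<in>{..<n}. \<phi> (d k b) \<otimes>\<^bsub>B\<^esub> v k)" using expand [OF b] by simp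
      also have "\<dots> = (\<Oplus>\<^bsub>B\<^esub>k\<in>{..<n}. v j \<otimes>\<^bsub>B\<^esub> (\<phi> (d k b) \<otimes>\<^bsub>B\<^esub> v k))"
        using j b dc vc by (intro B.finsum_rdistr) auto
      also have "\<dots> = (\<Oplus>\<^bsub>B\<^esub>k\<in>{..<n}. \<phi> (d k b) \<otimes>\<^bsub>B\<^esub> (v j \<otimes>\<^bsub>B\<^esub> v k))"
        using j b dc vc by (intro B.finsum_cong') (auto simp: B.m_lcomm)
      finally have "L (v j \<otimes>\<^bsub>B\<^esub> b) = (\<Oplus>\<^bsub>?PR\<^esub>k\<in>{..<n}. L (\<phi> (d k b) \<otimes>\<^bsub>B\<^esub> (v j \<otimes>\<^bsub>B\<^esub> v k)))"
        using j b dc vc L_finsum [of "{..<n}" "\<lambda>k. \<phi> (d k b) \<otimes>\<^bsub>B\<^esub> (v j \<otimes>\<^bsub>B\<^esub> v k)"] by auto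
      also have "\<dots> = (\<Oplus>\<^bsub>?PR\<^esub>k\<in>{..<n}. cst (d k b) \<otimes>\<^bsub>?PR\<^esub> L (v j \<otimes>\<^bsub>B\<^esub> v k))"
        using j b dc vc by (intro PR.finsum_cong') (auto simp: L_mult)
      finally show ?thesis ..
    qed
    have "V j \<otimes>\<^bsub>?PR\<^esub> L b = (\<Oplus>\<^bsub>?PR\<^esub>k\<in>{..<n}. V j \<otimes>\<^bsub>?PR\<^esub> (cst (d k b) \<otimes>\<^bsub>?PR\<^esub> V k))"
      unfolding L_def using j b dc by (intro PR.finsum_rdistr) auto
    also have "\<dots> = (\<Oplus>\<^bsub>?PR\<^esub>k\<in>{..<n}. cst (d k b) \<otimes>\<^bsub>?PR\<^esub> L (v j \<otimes>\<^bsub>B\<^esub> v k) \<oplus>\<^bsub>?PR\<^esub> cst (d k b) \<otimes>\<^bsub>?PR\<^esub> ?g k)"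
    proof (rule PR.finsum_cong' [OF refl])
      fix k assume "k \<in> {..<n}"
      then have k: "k < n" by simp
      have "V j \<otimes>\<^bsub>?PR\<^esub> (cst (d k b) \<otimes>\<^bsub>?PR\<^esub> V k) = cst (d k b) \<otimes>\<^bsub>?PR\<^esub> (V j \<otimes>\<^bsub>?PR\<^esub> V k)"
        using j k b dc by (simp add: PR.m_lcomm)
      also have "\<dots> = cst (d k b) \<otimes>\<^bsub>?PR\<^esub> (L (v j \<otimes>\<^bsub>B\<^esub> v k) \<oplus>\<^bsub>?PR\<^esub> ?g k)"
        using split [OF k] by (rule arg_cong)
      also have "\<dots> = cst (d k b) \<otimes>\<^bsub>?PR\<^esub> L (v j \<otimes>\<^bsub>B\<^esub> v k) \<oplus>\<^bsub>?PR\<^esub> cst (d k b) \<otimes>\<^bsub>?PR\<^esub> ?g k"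
        using j k b dc vc gc by (intro PR.r_distr) auto
      finally show "V j \<otimes>\<^bsub>?PR\<^esub> (cst (d k b) \<otimes>\<^bsub>?PR\<^esub> V k) =
          cst (d k b) \<otimes>\<^bsub>?PR\<^esub> L (v j \<otimes>\<^bsub>B\<^esub> v k) \<oplus>\<^bsub>?PR\<^esub> cst (d k b) \<otimes>\<^bsub>?PR\<^esub> ?g k" .
    qed (use b dc vc gc j in auto)
    also have "\<dots> = (\<Oplus>\<^bsub>?PR\<^esub>k\<in>{..<n}. cst (d k b) \<otimes>\<^bsub>?PR\<^esub> L (v j \<otimes>\<^bsub>B\<^esub> v k)) \<oplus>\<^bsub>?PR\<^esub>
        (\<Oplus>\<^bsub>?PR\<^esub>k\<in>{..<n}. cst (d k b) \<otimes>\<^bsub>?PR\<^esub> ?g k)"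
      using b dc vc gc j by (intro PR.finsum_addf) auto
    finally have VL: "V j \<otimes>\<^bsub>?PR\<^esub> L b = (\<Oplus>\<^bsub>?PR\<^esub>k\<in>{..<n}. cst (d k b) \<otimes>\<^bsub>?PR\<^esub> L (v j \<otimes>\<^bsub>B\<^esub> v k)) \<oplus>\<^bsub>?PR\<^esub>
        (\<Oplus>\<^bsub>?PR\<^esub>k\<in>{..<n}. cst (d k b) \<otimes>\<^bsub>?PR\<^esub> ?g k)" .
    have "V j \<otimes>\<^bsub>?PR\<^esub> L b = L (v j \<otimes>\<^bsub>B\<^esub> b) \<oplus>\<^bsub>?PR\<^esub> (\<Oplus>\<^bsub>?PR\<^esub>k\<in>{..<n}. cst (d k b) \<otimes>\<^bsub>?PR\<^esub> ?g k)"
      using VL unfolding L_prod .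
    moreover have r: "(\<Oplus>\<^bsub>?PR\<^esub>k\<in>{..<n}. cst (d k b) \<otimes>\<^bsub>?PR\<^esub> ?g k) \<in> J"
      using b dc gJ by (intro J.finsum_closed_ideal) (auto intro: J.I_l_closed)
    moreover have "(x \<oplus>\<^bsub>?PR\<^esub> y) \<ominus>\<^bsub>?PR\<^esub> x = y" if "x \<in> carrier ?PR" "y \<in> carrier ?PR" for x y
      using that by (simp add: PR.minus_eq PR.a_assoc PR.a_lcomm [of x y "\<ominus>\<^bsub>?PR\<^esub> x"] PR.r_neg)
    ultimately show ?thesis using j b vc J.Icarr [OF r] by simp
  qed
  have diff_mult: "x \<otimes>\<^bsub>?PR\<^esub> y \<ominus>\<^bsub>?PR\<^esub> x \<otimes>\<^bsub>?PR\<^esub> z = x \<otimes>\<^bsub>?PR\<^esub> (y \<ominus>\<^bsub>?PR\<^esub> z)"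
    if "x \<in> carrier ?PR" "y \<in> carrier ?PR" "z \<in> carrier ?PR" for x y z
    using that by (simp add: PR.minus_eq PR.r_distr PR.r_minus)
  have diff_add: "(x \<oplus>\<^bsub>?PR\<^esub> y) \<ominus>\<^bsub>?PR\<^esub> (z \<oplus>\<^bsub>?PR\<^esub> w) = (x \<ominus>\<^bsub>?PR\<^esub> z) \<oplus>\<^bsub>?PR\<^esub> (y \<ominus>\<^bsub>?PR\<^esub> w)"
    if "x \<in> carrier ?PR" "y \<in> carrier ?PR" "z \<in> carrier ?PR" "w \<in> carrier ?PR" for x y z w
    using that by (simp add: PR.minus_eq PR.minus_add PR.a_ac)
  have diff_trans: "x \<ominus>\<^bsub>?PR\<^esub> z \<in> J"
    if "x \<in> carrier ?PR" "y \<in> carrier ?PR" "z \<in> carrier ?PR" "x \<ominus>\<^bsub>?PR\<^esub> y \<in> J" "y \<ominus>\<^bsub>?PR\<^esub> z \<in> J" for x y z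
  proof -
    have "x \<ominus>\<^bsub>?PR\<^esub> z = (x \<ominus>\<^bsub>?PR\<^esub> y) \<oplus>\<^bsub>?PR\<^esub> (y \<ominus>\<^bsub>?PR\<^esub> z)"
      using that(1-3) by (simp add: PR.minus_eq PR.a_assoc PR.r_neg1 PR.r_neg2)
    then show ?thesis using that(4,5) J.a_closed by simp
  qed
  \<comment> \<open>\<open>W F\<close> says that \<open>F\<close> is congruent modulo
    \<open>J\<close> to the linear form with the same value. The property is linear and survives
    multiplication by variables, so induction on the degree gives it for all monomials and then for
    all polynomials.\<close>
  define W where "W F \<longleftrightarrow> F \<in> carrier ?PR \<and> F \<ominus>\<^bsub>?PR\<^esub> L (\<psi> F) \<in> J" for F
  have W_add: "W (F \<oplus>\<^bsub>?PR\<^esub> F')" if "W F" "W F'" for F F'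
    using that by (auto simp: W_def L_add diff_add intro: J.a_closed)
  have W_cst: "W (cst a \<otimes>\<^bsub>?PR\<^esub> F)" if "a \<in> carrier A" "W F" for a F
    using that by (auto simp: W_def L_mult \<psi>_cst diff_mult intro: J.I_l_closed)
  have W_V: "W (V j \<otimes>\<^bsub>?PR\<^esub> F)" if j: "j < n" and F: "W F" for j F
  proof -
    have Fc: "F \<in> carrier ?PR" "F \<ominus>\<^bsub>?PR\<^esub> L (\<psi> F) \<in> J" using F by (auto simp: W_def)
    have "V j \<otimes>\<^bsub>?PR\<^esub> F \<ominus>\<^bsub>?PR\<^esub> V j \<otimes>\<^bsub>?PR\<^esub> L (\<psi> F) \<in> J"
      using j Fc by (simp add: diff_mult J.I_l_closed)
    moreover have "V j \<otimes>\<^bsub>?PR\<^esub> L (\<psi> F) \<ominus>\<^bsub>?PR\<^esub> L (\<psi> (V j \<otimes>\<^bsub>?PR\<^esub> F)) \<in> J"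
      using V_L [OF j, of "\<psi> F"] j Fc by (simp add: \<psi>_V)
    ultimately show ?thesis
      unfolding W_def using j Fc vc by (auto intro!: diff_trans [of _ "V j \<otimes>\<^bsub>?PR\<^esub> L (\<psi> F)"])
  qed
  have W_one: "W \<one>\<^bsub>?PR\<^esub>" using gsJ by (simp add: W_def gs_def)
  have W_monom: "W (alg_monom A \<one>\<^bsub>A\<^esub> x)" if "x \<in> carrier ?E" "sum x {..<n} = m" for x m
    using that
  proof (induction m arbitrary: x)
    case 0
    have "x i = 0" for i
    proof (cases "i < n")
      case True
      then show ?thesis using 0(2) by simp
    qed (use 0(1) in \<open>simp add: E\<close>)
    then have "x = \<one>\<^bsub>?E\<^esub>" by (auto simp: E)
    then show ?case using W_one by (simp add: PR monoid_algebra_simps(1))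
  next
    case (Suc m)
    then obtain k where k: "k < n" "x k > 0"
      by (metis gr0I lessThan_iff nat.distinct(1) sum.neutral)
    let ?y = "x(k := x k - 1)"
    have y: "?y \<in> carrier ?E" using Suc.prems k by (auto simp: E)
    have s: "sum f {..<n} = f k + sum f ({..<n} - {k})" for f :: "nat \<Rightarrow> nat"
      using k by (simp add: sum.remove)
    have "sum ?y ({..<n} - {k}) = sum x ({..<n} - {k})" by (intro sum.cong) auto
    then have "sum ?y {..<n} = m" using s [of x] s [of ?y] Suc.prems k by simp
    then have "W (V k \<otimes>\<^bsub>?PR\<^esub> alg_monom A \<one>\<^bsub>A\<^esub> ?y)" using Suc.IH y k W_V by blast
    moreover have "V k \<otimes>\<^bsub>?PR\<^esub> alg_monom A \<one>\<^bsub>A\<^esub> ?y = alg_monom A \<one>\<^bsub>A\<^esub> (\<delta> k \<otimes>\<^bsub>?E\<^esub> ?y)"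
      using y \<delta>c k by (simp add: V_def PR mr.monom_mult)
    moreover have "\<delta> k \<otimes>\<^bsub>?E\<^esub> ?y = x" using k by (auto simp: E \<delta>_def)
    ultimately show ?case by simp
  qed
  have W_all: "W F" if "F \<in> carrier (monoid_algebra A ?E)" for F
    using that
  proof (induction F rule: mr.monoid_algebra_induct)
    case zero
    have "W (cst \<zero>\<^bsub>A\<^esub> \<otimes>\<^bsub>?PR\<^esub> \<one>\<^bsub>?PR\<^esub>)" by (intro W_cst W_one) simp
    then show ?case by (simp add: cst_zero flip: PR)
  next
    case (add a x g)
    have "alg_monom A a x = cst a \<otimes>\<^bsub>?PR\<^esub> alg_monom A \<one>\<^bsub>A\<^esub> x"
      using add by (simp add: cst_def PR mr.monom_mult)
    then have "W (alg_monom A a x)" using W_cst W_monom add by simp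
    then show ?case using W_add add by (simp add: PR)
  qed
  have "ring_hom_ring ?PR B \<psi>"
    by (intro ring_hom_ringI2 PR.ring_axioms B.ring_axioms \<psi>)
  then have ideal_ker: "ideal (a_kernel ?PR B \<psi>) ?PR" by (rule ring_hom_ring.kernel_is_ideal)
  have ker: "F \<in> a_kernel ?PR B \<psi> \<longleftrightarrow> F \<in> carrier ?PR \<and> \<psi> F = \<zero>\<^bsub>B\<^esub>" for F
    unfolding a_kernel_def' by blast
  have kernel: "a_kernel ?PR B \<psi> = J"
  proof
    show "a_kernel ?PR B \<psi> \<subseteq> J"
    proof
      fix F assume "F \<in> a_kernel ?PR B \<psi>"
      then have F: "F \<in> carrier ?PR" "\<psi> F = \<zero>\<^bsub>B\<^esub>" by (simp_all only: ker)
      \<comment> \<open>The linear form congruent to \<open>F\<close> is \<open>L \<zero>\<close>,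
        which vanishes.\<close>
      have "W F" using W_all F(1) by (simp only: PR)
      then have "F \<ominus>\<^bsub>?PR\<^esub> L (\<psi> F) \<in> J" by (simp add: W_def)
      then have "F \<ominus>\<^bsub>?PR\<^esub> \<zero>\<^bsub>?PR\<^esub> \<in> J" unfolding F(2) L_zero .
      moreover have "F \<ominus>\<^bsub>?PR\<^esub> \<zero>\<^bsub>?PR\<^esub> = F" using F(1) by (simp add: PR.minus_eq)
      ultimately show "F \<in> J" by simp
    qed
    have "gs \<subseteq> a_kernel ?PR B \<psi>"
    proof
      fix x assume x: "x \<in> gs"
      have diff: "\<psi> (y \<ominus>\<^bsub>?PR\<^esub> L b) = \<zero>\<^bsub>B\<^esub>" if "y \<in> carrier ?PR" "b \<in> carrier B" "\<psi> y = b" for y b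
        using that by (simp add: PR.minus_eq \<psi>_L B.r_neg)
      have "\<psi> x = \<zero>\<^bsub>B\<^esub>"
        using x unfolding gs_def
      proof
        assume "x \<in> {\<one>\<^bsub>?PR\<^esub> \<ominus>\<^bsub>?PR\<^esub> L \<one>\<^bsub>B\<^esub>}"
        then show ?thesis using diff [of "\<one>\<^bsub>?PR\<^esub>" "\<one>\<^bsub>B\<^esub>"] by simp
      next
        assume "x \<in> (\<lambda>(i, j). V i \<otimes>\<^bsub>?PR\<^esub> V j \<ominus>\<^bsub>?PR\<^esub> L (v i \<otimes>\<^bsub>B\<^esub> v j)) ` ({..<n} \<times> {..<n})"
        then obtain i j where ij: "i < n" "j < n" "x = V i \<otimes>\<^bsub>?PR\<^esub> V j \<ominus>\<^bsub>?PR\<^esub> L (v i \<otimes>\<^bsub>B\<^esub> v j)" by auto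
        then show ?thesis
          using diff [of "V i \<otimes>\<^bsub>?PR\<^esub> V j" "v i \<otimes>\<^bsub>B\<^esub> v j"] vc by (simp add: \<psi>_V)
      qed
      then show "x \<in> a_kernel ?PR B \<psi>" using x gs_closed ker by blast
    qed
    then show "J \<subseteq> a_kernel ?PR B \<psi>"
      unfolding J_def by (rule PR.genideal_minimal [OF ideal_ker])
  qed
  show ?thesis
    unfolding finitely_presented_ring_hom_def
  proof (intro exI conjI)
    show "\<psi> \<in> ring_hom ?PR B" by (rule \<psi>)
    show "\<psi> ` carrier ?PR = carrier B"
    proof
      show "carrier B \<subseteq> \<psi> ` carrier ?PR"
      proof
        fix b assume "b \<in> carrier B"
        then have "b = \<psi> (L b)" "L b \<in> carrier ?PR" by (simp_all add: \<psi>_L)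
        then show "b \<in> \<psi> ` carrier ?PR" by (rule image_eqI)
      qed
    qed auto
    show "\<forall>a\<in>carrier A. \<psi> (\<lambda>e. if e = (\<lambda>i. 0) then a else \<zero>\<^bsub>A\<^esub>) = \<phi> a"
      using \<psi>_cst by (simp add: cst_def alg_monom_def E)
    show "finite gs" by (simp add: gs_def)
    show "gs \<subseteq> carrier ?PR" by (rule gs_closed)
    show "a_kernel ?PR B \<psi> = Idl\<^bsub>?PR\<^esub> gs" using kernel by (simp add: J_def)
  qed
qed

text \<open>The variables of a polynomial ring are numbered, so the basis is renumbered by the
  numbers below \<open>card I\<close>.\<close>

lemma (in finite_free_algebra) finitely_presented_ring_hom: "finitely_presented_ring_hom A B \<phi>"
proof -
  obtain f where f: "bij_betw f {..<card I} I"
    using ex_bij_betw_nat_finite [OF finite_I] by (auto simp: atLeast0LessThan)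
  have fI: "f k \<in> I" if "k < card I" for k using bij_betwE [OF f] that by simp
  have "finite_free_algebra A B \<phi> {..<card I} (\<lambda>k. e (f k)) (\<lambda>k. c (f k))"
  proof (intro finite_free_algebra.intro finite_free_algebra_axioms.intro
      A.cring_axioms B.cring_axioms hom.ring_hom_cring_axioms)
    show "c (f i) (e (f j)) = (if i = j then \<one>\<^bsub>A\<^esub> else \<zero>\<^bsub>A\<^esub>)" if "i \<in> {..<card I}" "j \<in> {..<card I}" for i j
      using that fI c_e inj_onD [OF bij_betw_imp_inj_on [OF f], of i j] by auto
    show "b = (\<Oplus>\<^bsub>B\<^esub>k\<in>{..<card I}. \<phi> (c (f k) b) \<otimes>\<^bsub>B\<^esub> e (f k))" if b: "b \<in> carrier B" for b
    proof -
      have "b = (\<Oplus>\<^bsub>B\<^esub>i\<in>f ` {..<card I}. \<phi> (c i b) \<otimes>\<^bsub>B\<^esub> e i)"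
        using expand [OF b] bij_betw_imp_surj_on [OF f] by simp
      also have "\<dots> = (\<Oplus>\<^bsub>B\<^esub>k\<in>{..<card I}. \<phi> (c (f k) b) \<otimes>\<^bsub>B\<^esub> e (f k))"
        using b fI e_closed c_closed bij_betw_imp_inj_on [OF f] by (intro B.finsum_reindex) auto
      finally show ?thesis .
    qed
  qed (use fI e_closed c_closed c_add c_mult in auto)
  then show ?thesis by (rule finitely_presented_if_free_nat)
qed

section \<open>Kaehler differentials\<close>

lemma free_module_simps:
  "\<zero>\<^bsub>free_module B S\<^esub> = (\<lambda>x. \<zero>\<^bsub>B\<^esub>)"
  "f \<oplus>\<^bsub>free_module B S\<^esub> g = (\<lambda>x. f x \<oplus>\<^bsub>B\<^esub> g x)"
  "b \<odot>\<^bsub>free_module B S\<^esub> f = (\<lambda>x. b \<otimes>\<^bsub>B\<^esub> f x)"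
  by (auto simp: free_module_def)

text \<open>
  The additive group of the free module on the elements of \<open>B\<close> is that of the monoid algebra of the
  multiplicative monoid of \<open>B\<close>.
\<close>

locale free_module_on_ring = B: cring B for B :: "'b ring"
begin

definition mult_monoid :: "'b monoid" where
  "mult_monoid = \<lparr>carrier = carrier B, monoid.mult = (\<lambda>x y. x \<otimes>\<^bsub>B\<^esub> y), one = \<one>\<^bsub>B\<^esub>\<rparr>"

lemma comm_monoid_mult_monoid: "comm_monoid mult_monoid"
  by (rule comm_monoidI) (auto simp: mult_monoid_def B.m_ac)

sublocale alg: monoid_algebra_ring B mult_monoid
  by (intro monoid_algebra_ring.intro B.cring_axioms comm_monoid_mult_monoid)

abbreviation "FM \<equiv> free_module B (carrier B)"

lemma carrier_FM: "carrier FM = carrier (monoid_algebra B mult_monoid)"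
  by (auto simp: free_module_def monoid_algebra_def mult_monoid_def)

lemma carrier_mult_monoid: "carrier mult_monoid = carrier B"
  by (simp add: mult_monoid_def)

lemma smult_closed:
  assumes b: "b \<in> carrier B" and f: "f \<in> carrier FM"
  shows "b \<odot>\<^bsub>FM\<^esub> f \<in> carrier FM"
proof -
  note D = monoid_algebraD [OF f [unfolded carrier_FM]]
  have sub: "{x. b \<otimes>\<^bsub>B\<^esub> f x \<noteq> \<zero>\<^bsub>B\<^esub>} \<subseteq> {x. f x \<noteq> \<zero>\<^bsub>B\<^esub>}" using b by auto
  have "finite {x. b \<otimes>\<^bsub>B\<^esub> f x \<noteq> \<zero>\<^bsub>B\<^esub>}" using sub D(2) by (rule finite_subset)
  moreover have "{x. b \<otimes>\<^bsub>B\<^esub> f x \<noteq> \<zero>\<^bsub>B\<^esub>} \<subseteq> carrier mult_monoid" using sub D(3) by blast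
  ultimately show ?thesis
    unfolding carrier_FM monoid_algebra_carrier_iff free_module_simps using b D(1) by auto
qed

lemma module_FM: "module B FM"
proof (rule moduleI [OF B.cring_axioms])
  have add: "f \<oplus>\<^bsub>FM\<^esub> g = f \<oplus>\<^bsub>alg.RM\<^esub> g" for f g
    by (simp add: free_module_simps monoid_algebra_simps)
  have zero: "\<zero>\<^bsub>FM\<^esub> = \<zero>\<^bsub>alg.RM\<^esub>" by (simp add: free_module_simps monoid_algebra_simps)
  show "abelian_group FM"
  proof (rule abelian_groupI)
    show "\<exists>y\<in>carrier FM. y \<oplus>\<^bsub>FM\<^esub> x = \<zero>\<^bsub>FM\<^esub>" if "x \<in> carrier FM" for x
      using that alg.RM.l_neg [of x] unfolding carrier_FM add zero
      by (intro bexI [of _ "\<ominus>\<^bsub>alg.RM\<^esub> x"]) auto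
  qed (unfold carrier_FM add zero, simp_all add: alg.RM.a_ac)
  fix a b x y assume a: "a \<in> carrier B" and b: "b \<in> carrier B" and x: "x \<in> carrier FM"
  have xc: "x p \<in> carrier B" for p using x unfolding carrier_FM by (rule monoid_algebraD(1))
  show "(a \<oplus>\<^bsub>B\<^esub> b) \<odot>\<^bsub>FM\<^esub> x = a \<odot>\<^bsub>FM\<^esub> x \<oplus>\<^bsub>FM\<^esub> b \<odot>\<^bsub>FM\<^esub> x"
    using a b xc by (simp add: free_module_simps B.l_distr)
  show "a \<otimes>\<^bsub>B\<^esub> b \<odot>\<^bsub>FM\<^esub> x = a \<odot>\<^bsub>FM\<^esub> (b \<odot>\<^bsub>FM\<^esub> x)"
    using a b xc by (simp add: free_module_simps B.m_assoc)
  show "a \<odot>\<^bsub>FM\<^esub> (x \<oplus>\<^bsub>FM\<^esub> y) = a \<odot>\<^bsub>FM\<^esub> x \<oplus>\<^bsub>FM\<^esub> a \<odot>\<^bsub>FM\<^esub> y" if y: "y \<in> carrier FM"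
  proof -
    have "y p \<in> carrier B" for p using y unfolding carrier_FM by (rule monoid_algebraD(1))
    then show ?thesis using a xc by (simp add: free_module_simps B.r_distr)
  qed
next
  fix x assume "x \<in> carrier FM"
  then have "x p \<in> carrier B" for p unfolding carrier_FM by (rule monoid_algebraD(1))
  then show "\<one>\<^bsub>B\<^esub> \<odot>\<^bsub>FM\<^esub> x = x" by (simp add: free_module_simps)
qed (rule smult_closed)

sublocale FM: module B FM by (rule module_FM)

abbreviation "dd \<equiv> free_generator B"

lemma dd_closed [simp]: "b \<in> carrier B \<Longrightarrow> dd b \<in> carrier FM"
  unfolding carrier_FM using alg.monom_closed [of "\<one>\<^bsub>B\<^esub>" b]
  by (simp add: free_generator_def alg_monom_def carrier_mult_monoid)

text \<open>Every element of the free module is a finite combination of the symbols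
  \<open>dd b\<close>, by induction on its support.\<close>

lemma FM_induct:
  assumes H: "submodule H B FM" and d: "\<And>b. b \<in> carrier B \<Longrightarrow> dd b \<in> H"
  shows "H = carrier FM"
proof
  show "H \<subseteq> carrier FM" using FM.submoduleE(1) [OF H] .
  show "carrier FM \<subseteq> H"
  proof
    fix f assume "f \<in> carrier FM"
    then have "f \<in> carrier alg.RM" by (simp add: carrier_FM)
    then show "f \<in> H"
    proof (induction f rule: alg.monoid_algebra_induct)
      case zero
      have "\<zero>\<^bsub>FM\<^esub> \<in> H" using subgroup.one_closed [OF submodule.axioms(1) [OF H]] by simp
      then show ?case by (simp add: free_module_simps monoid_algebra_simps)
    next
      case (add a p g)
      have "alg_monom B a p = a \<odot>\<^bsub>FM\<^esub> dd p"
        using add by (auto simp: alg_monom_def free_module_simps free_generator_def)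
      moreover have "a \<odot>\<^bsub>FM\<^esub> dd p \<in> H"
        using add d by (intro FM.submoduleE(4) [OF H]) (auto simp: carrier_mult_monoid)
      ultimately have "alg_monom B a p \<oplus>\<^bsub>FM\<^esub> g \<in> H"
        using add FM.submoduleE(5) [OF H] by simp
      then show ?case by (simp add: free_module_simps monoid_algebra_simps)
    qed
  qed
qed

end

text \<open>
  If \<open>t ^ n\<close> is in the image of \<open>A\<close>, then \<open>0 = d (t ^ n) = n t ^ (n - 1) d t\<close>, and \<open>d t = 0\<close> if
  \<open>t\<close> and \<open>n\<close> are invertible.
\<close>

lemma unramified_if_generated_by_roots:
  fixes A :: "'a ring" and B :: "'b ring"
  assumes hom: "ring_hom_cring A B \<phi>"
    and T: "finite T" "T \<subseteq> Units B"
    and gen: "\<And>b. b \<in> carrier B \<Longrightarrow> \<exists>c\<in>T \<rightarrow> carrier A. b = (\<Oplus>\<^bsub>B\<^esub>t\<in>T. \<phi> (c t) \<otimes>\<^bsub>B\<^esub> t)"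
    and root: "\<And>t. t \<in> T \<Longrightarrow> \<exists>n::nat. n > 0 \<and> t [^]\<^bsub>B\<^esub> n \<in> \<phi> ` carrier A \<and> [n] \<cdot>\<^bsub>B\<^esub> \<one>\<^bsub>B\<^esub> \<in> Units B"
  shows "unramified_ring_hom A B \<phi>"
proof -
  interpret hom: ring_hom_cring A B \<phi> by (fact hom)
  interpret free_module_on_ring B by (intro free_module_on_ring.intro hom.S.cring_axioms)
  \<comment> \<open>\<open>kaehler_submodule\<close> is an intersection, so each submodule
    \<open>H\<close> in it has to be shown to contain all symbols \<open>dd b\<close>.\<close>
  have all: "H = carrier FM" if H: "submodule H B FM" and rel: "kaehler_relations A B \<phi> \<subseteq> H" for H
  proof (rule FM_induct [OF H])
    note sm = FM.submoduleE [OF H]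
    have minus_left: "x \<in> H" if "x \<ominus>\<^bsub>FM\<^esub> y \<in> H" "y \<in> H" "x \<in> carrier FM" for x y
    proof -
      have "y \<in> carrier FM" using sm(1) that by blast
      then have "x = (x \<ominus>\<^bsub>FM\<^esub> y) \<oplus>\<^bsub>FM\<^esub> y" using that by (simp add: FM.minus_eq FM.a_assoc FM.M.l_neg)
      then show ?thesis using sm(5) that by metis
    qed
    have minus_right: "y \<in> H" if "x \<ominus>\<^bsub>FM\<^esub> y \<in> H" "x \<in> H" "y \<in> carrier FM" for x y
    proof -
      have xc: "x \<in> carrier FM" using sm(1) that by blast
      have "y = x \<oplus>\<^bsub>FM\<^esub> \<ominus>\<^bsub>FM\<^esub> (x \<ominus>\<^bsub>FM\<^esub> y)"
        using xc that by (simp add: FM.minus_eq FM.minus_add FM.r_neg2)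
      then show ?thesis using sm(3,5) that by metis
    qed
    have d_add: "dd (b \<oplus>\<^bsub>B\<^esub> c) \<ominus>\<^bsub>FM\<^esub> (dd b \<oplus>\<^bsub>FM\<^esub> dd c) \<in> H" if "b \<in> carrier B" "c \<in> carrier B" for b c
      using rel that unfolding kaehler_relations_def Let_def by blast
    have d_mult: "dd (b \<otimes>\<^bsub>B\<^esub> c) \<ominus>\<^bsub>FM\<^esub> (b \<odot>\<^bsub>FM\<^esub> dd c \<oplus>\<^bsub>FM\<^esub> c \<odot>\<^bsub>FM\<^esub> dd b) \<in> H"
      if "b \<in> carrier B" "c \<in> carrier B" for b c
      using rel that unfolding kaehler_relations_def Let_def by blast
    have d_\<phi>: "dd (\<phi> a) \<in> H" if "a \<in> carrier A" for a
      using rel that unfolding kaehler_relations_def Let_def by blast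
    have add: "dd (b \<oplus>\<^bsub>B\<^esub> c) \<in> H" if "b \<in> carrier B" "c \<in> carrier B" "dd b \<in> H" "dd c \<in> H" for b c
      using minus_left [OF d_add] that sm(5) by simp
    have mult: "dd (b \<otimes>\<^bsub>B\<^esub> c) \<in> H" if "b \<in> carrier B" "c \<in> carrier B" "dd b \<in> H" "dd c \<in> H" for b c
      using minus_left [OF d_mult] that sm(4,5) by simp
    \<comment> \<open>The power rule modulo \<open>H\<close>, by induction with the product rule; it
      is stated for \<open>Suc n\<close> to avoid a subtraction in the exponent.\<close>
    have d_pow: "dd (t [^]\<^bsub>B\<^esub> Suc n) \<ominus>\<^bsub>FM\<^esub> ([Suc n] \<cdot>\<^bsub>B\<^esub> \<one>\<^bsub>B\<^esub> \<otimes>\<^bsub>B\<^esub> t [^]\<^bsub>B\<^esub> n) \<odot>\<^bsub>FM\<^esub> dd t \<in> H"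
      if t: "t \<in> carrier B" for t and n :: nat
    proof (induction n)
      case 0
      have "dd t \<ominus>\<^bsub>FM\<^esub> dd t = \<zero>\<^bsub>FM\<^esub>" using t by (simp add: FM.minus_eq FM.M.r_neg)
      moreover have "\<zero>\<^bsub>FM\<^esub> \<in> H" using subgroup.one_closed [OF submodule.axioms(1) [OF H]] by simp
      ultimately show ?case using t by simp
    next
      case (Suc n)
      let ?k = "\<lambda>n. [n] \<cdot>\<^bsub>B\<^esub> \<one>\<^bsub>B\<^esub>" and ?p = "\<lambda>n. t [^]\<^bsub>B\<^esub> (n :: nat)"
      have k: "?k m \<in> carrier B" for m :: nat by simp
      have 1: "dd (?p (Suc n) \<otimes>\<^bsub>B\<^esub> t) \<ominus>\<^bsub>FM\<^esub> (?p (Suc n) \<odot>\<^bsub>FM\<^esub> dd t \<oplus>\<^bsub>FM\<^esub> t \<odot>\<^bsub>FM\<^esub> dd (?p (Suc n))) \<in> H"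
        using t by (intro d_mult) auto
      have 2: "t \<odot>\<^bsub>FM\<^esub> (dd (?p (Suc n)) \<ominus>\<^bsub>FM\<^esub> (?k (Suc n) \<otimes>\<^bsub>B\<^esub> ?p n) \<odot>\<^bsub>FM\<^esub> dd t) \<in> H"
        using t Suc by (intro sm(4)) auto
      have 3: "t \<odot>\<^bsub>FM\<^esub> (dd (?p (Suc n)) \<ominus>\<^bsub>FM\<^esub> (?k (Suc n) \<otimes>\<^bsub>B\<^esub> ?p n) \<odot>\<^bsub>FM\<^esub> dd t) =
          t \<odot>\<^bsub>FM\<^esub> dd (?p (Suc n)) \<ominus>\<^bsub>FM\<^esub> (?k (Suc n) \<otimes>\<^bsub>B\<^esub> ?p (Suc n)) \<odot>\<^bsub>FM\<^esub> dd t"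
      proof -
        have "t \<odot>\<^bsub>FM\<^esub> ((?k (Suc n) \<otimes>\<^bsub>B\<^esub> ?p n) \<odot>\<^bsub>FM\<^esub> dd t) = (?k (Suc n) \<otimes>\<^bsub>B\<^esub> ?p (Suc n)) \<odot>\<^bsub>FM\<^esub> dd t"
          using t k by (simp add: hom.S.m_ac flip: FM.smult_assoc1 del: hom.S.add.nat_pow_Suc)
        then show ?thesis
          using t k by (simp add: FM.minus_eq FM.smult_r_distr FM.smult_r_minus del: hom.S.add.nat_pow_Suc hom.S.nat_pow_Suc)
      qed
      let ?u = "?p (Suc n) \<odot>\<^bsub>FM\<^esub> dd t" and ?v = "t \<odot>\<^bsub>FM\<^esub> dd (?p (Suc n))"
        and ?w = "(?k (Suc n) \<otimes>\<^bsub>B\<^esub> ?p (Suc n)) \<odot>\<^bsub>FM\<^esub> dd t" and ?z = "dd (?p (Suc (Suc n)))"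
      have uvwz: "?u \<in> carrier FM" "?v \<in> carrier FM" "?w \<in> carrier FM" "?z \<in> carrier FM"
        using t k by auto
      have "(?z \<ominus>\<^bsub>FM\<^esub> (?u \<oplus>\<^bsub>FM\<^esub> ?v)) \<oplus>\<^bsub>FM\<^esub> (?v \<ominus>\<^bsub>FM\<^esub> ?w) \<in> H"
        using 1 2 t unfolding 3 by (intro sm(5)) simp_all
      also have "(?z \<ominus>\<^bsub>FM\<^esub> (?u \<oplus>\<^bsub>FM\<^esub> ?v)) \<oplus>\<^bsub>FM\<^esub> (?v \<ominus>\<^bsub>FM\<^esub> ?w) = ?z \<ominus>\<^bsub>FM\<^esub> (?w \<oplus>\<^bsub>FM\<^esub> ?u)"
      proof -
        have gen: "(z \<ominus>\<^bsub>FM\<^esub> (u \<oplus>\<^bsub>FM\<^esub> v)) \<oplus>\<^bsub>FM\<^esub> (v \<ominus>\<^bsub>FM\<^esub> w) = z \<ominus>\<^bsub>FM\<^esub> (w \<oplus>\<^bsub>FM\<^esub> u)"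
          if "z \<in> carrier FM" "u \<in> carrier FM" "v \<in> carrier FM" "w \<in> carrier FM" for z u v w
          using that by (simp add: FM.minus_eq FM.minus_add FM.a_ac FM.r_neg1 FM.r_neg2)
        show ?thesis by (rule gen) (use uvwz in auto)
      qed
      also have "?w \<oplus>\<^bsub>FM\<^esub> ?u = (?k (Suc (Suc n)) \<otimes>\<^bsub>B\<^esub> ?p (Suc n)) \<odot>\<^bsub>FM\<^esub> dd t"
      proof -
        have "?k (Suc (Suc n)) \<otimes>\<^bsub>B\<^esub> ?p (Suc n) = ?k (Suc n) \<otimes>\<^bsub>B\<^esub> ?p (Suc n) \<oplus>\<^bsub>B\<^esub> ?p (Suc n)"
          using t k by (subst hom.S.add.nat_pow_Suc) (simp add: hom.S.l_distr del: hom.S.add.nat_pow_Suc hom.S.nat_pow_Suc)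
        then show ?thesis using t k by (simp add: FM.smult_l_distr del: hom.S.add.nat_pow_Suc hom.S.nat_pow_Suc)
      qed
      finally show ?case .
    qed
    have dT: "dd t \<in> H" if t: "t \<in> T" for t
    proof -
      obtain n :: nat where n: "n > 0" "t [^]\<^bsub>B\<^esub> n \<in> \<phi> ` carrier A" "[n] \<cdot>\<^bsub>B\<^esub> \<one>\<^bsub>B\<^esub> \<in> Units B"
        using root [OF t] by blast
      then obtain m where m: "n = Suc m" by (metis gr0_implies_Suc)
      have tU: "t \<in> Units B" using t T by blast
      then have tc: "t \<in> carrier B" by auto
      \<comment> \<open>The factor produced by the power rule. It is a unit, so it can be divided
        out once \<open>t [^] n\<close> is known to come from \<open>A\<close>.\<close>
      let ?u = "[n] \<cdot>\<^bsub>B\<^esub> \<one>\<^bsub>B\<^esub> \<otimes>\<^bsub>B\<^esub> t [^]\<^bsub>B\<^esub> m"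
      have u: "?u \<in> Units B" using n(3) tU hom.S.Units_pow_closed by blast
      have "dd (t [^]\<^bsub>B\<^esub> Suc m) \<in> H" using n(2) d_\<phi> m by auto
      then have "?u \<odot>\<^bsub>FM\<^esub> dd t \<in> H"
        using minus_right [OF d_pow [OF tc, of m]] tc m by simp
      then have "inv\<^bsub>B\<^esub> ?u \<odot>\<^bsub>FM\<^esub> (?u \<odot>\<^bsub>FM\<^esub> dd t) \<in> H"
        using u by (intro sm(4) [of _ "?u \<odot>\<^bsub>FM\<^esub> dd t"]) simp_all
      also have "inv\<^bsub>B\<^esub> ?u \<odot>\<^bsub>FM\<^esub> (?u \<odot>\<^bsub>FM\<^esub> dd t) = (inv\<^bsub>B\<^esub> ?u \<otimes>\<^bsub>B\<^esub> ?u) \<odot>\<^bsub>FM\<^esub> dd t"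
        using u tc by (intro FM.smult_assoc1 [symmetric]) auto
      also have "inv\<^bsub>B\<^esub> ?u \<otimes>\<^bsub>B\<^esub> ?u = \<one>\<^bsub>B\<^esub>" using u by (rule hom.S.Units_l_inv)
      finally show ?thesis using tc by simp
    qed
    fix b assume b: "b \<in> carrier B"
    obtain c where c: "c \<in> T \<rightarrow> carrier A" and bc: "b = (\<Oplus>\<^bsub>B\<^esub>t\<in>T. \<phi> (c t) \<otimes>\<^bsub>B\<^esub> t)"
      using gen [OF b] by blast
    have "dd (\<Oplus>\<^bsub>B\<^esub>t\<in>T'. \<phi> (c t) \<otimes>\<^bsub>B\<^esub> t) \<in> H" if "finite T'" "T' \<subseteq> T" for T'
      using that
    proof (induction T' rule: finite_induct)
      case empty
      then show ?case using d_\<phi> [of "\<zero>\<^bsub>A\<^esub>"] by simp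
    next
      case (insert t T')
      have t: "t \<in> carrier B" "c t \<in> carrier A" using insert.prems T(2) c by auto
      have f: "(\<lambda>t. \<phi> (c t) \<otimes>\<^bsub>B\<^esub> t) \<in> T' \<rightarrow> carrier B"
      proof
        fix x assume "x \<in> T'"
        then have "x \<in> T" using insert.prems by blast
        then have "x \<in> carrier B" "c x \<in> carrier A" using T(2) c by auto
        then show "\<phi> (c x) \<otimes>\<^bsub>B\<^esub> x \<in> carrier B" by simp
      qed
      have "dd (\<phi> (c t) \<otimes>\<^bsub>B\<^esub> t) \<in> H" using t d_\<phi> dT insert.prems by (intro mult) auto
      then have "dd (\<phi> (c t) \<otimes>\<^bsub>B\<^esub> t \<oplus>\<^bsub>B\<^esub> (\<Oplus>\<^bsub>B\<^esub>t\<in>T'. \<phi> (c t) \<otimes>\<^bsub>B\<^esub> t)) \<in> H"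
        using t f insert by (intro add) auto
      then show ?case using t f insert.hyps by simp
    qed
    then show "dd b \<in> H" using T(1) bc by simp
  qed
  have "carrier FM \<subseteq> kaehler_submodule A B \<phi>"
    unfolding kaehler_submodule_def using all by blast
  moreover have "kaehler_submodule A B \<phi> \<subseteq> carrier FM"
  proof -
    have "kaehler_relations A B \<phi> \<subseteq> carrier FM"
      unfolding kaehler_relations_def Let_def by (auto simp: FM.minus_eq)
    then have "carrier FM \<in> {H. submodule H B FM \<and> kaehler_relations A B \<phi> \<subseteq> H}"
      using FM.carrier_is_submodule by blast
    then show ?thesis unfolding kaehler_submodule_def by blast
  qed
  ultimately show ?thesis unfolding unramified_ring_hom_def by blast
qed

section \<open>The monoid algebras of a monoid with a basis of units\<close>

context monoid_algebra_ring
begin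

lemma add_pow_monom:
  fixes n :: nat
  assumes "a \<in> carrier R" "p \<in> carrier M"
  shows "add_pow RM n (alg_monom R a p) = alg_monom R (add_pow R n a) p"
  by (induction n) (simp_all add: monom_zero monom_add assms)

lemma monom_Units:
  assumes "a \<in> Units R" "p \<in> Units M"
  shows "alg_monom R a p \<in> Units RM"
proof -
  have "alg_monom R a p \<otimes>\<^bsub>RM\<^esub> alg_monom R (inv\<^bsub>R\<^esub> a) (inv\<^bsub>M\<^esub> p) = \<one>\<^bsub>RM\<^esub>"
    using assms by (simp add: monom_mult monoid_algebra_simps(1) R.Units_closed M.Units_closed)
  then show ?thesis
    using assms RM.unit_factor [of "alg_monom R a p" "alg_monom R (inv\<^bsub>R\<^esub> a) (inv\<^bsub>M\<^esub> p)"]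
    by (simp add: R.Units_closed M.Units_closed)
qed

end

locale monoid_algebra_map_free = cancel_monoid_map Q P h + k: cring k
  for Q :: "'q monoid" and P :: "'p monoid" (structure) and h :: "'q \<Rightarrow> 'p" and k :: "'k ring" +
  fixes S :: "'p set"
  assumes basis_S: "basis S" and finite_S: "finite S"
begin

sublocale alg: monoid_algebra_hom k Q P h
  by (intro monoid_algebra_hom.intro monoid_algebra_ring.intro monoid_algebra_hom_axioms.intro
      k.cring_axioms Q.comm_monoid_axioms P.comm_monoid_axioms hom)

abbreviation "A \<equiv> monoid_algebra k Q"
abbreviation "B \<equiv> monoid_algebra k P"
abbreviation "\<phi> \<equiv> monoid_algebra_map k h"

text \<open>The coordinate at \<open>x^s\<close> collects the coefficients at the multiples of
  \<open>s\<close>. The value zero off \<open>carrier Q\<close> makes it an element of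
  \<open>k[Q]\<close>.\<close>

definition coord :: "'p \<Rightarrow> ('p \<Rightarrow> 'k) \<Rightarrow> 'q \<Rightarrow> 'k" where
  "coord s b = (\<lambda>q. if q \<in> carrier Q then b (h q \<otimes> s) else \<zero>\<^bsub>k\<^esub>)"

lemma coord_closed:
  assumes s: "s \<in> S" and b: "b \<in> carrier B"
  shows "coord s b \<in> carrier A"
  unfolding monoid_algebra_carrier_iff
proof (intro conjI allI)
  note D = monoid_algebraD [OF b]
  show "coord s b q \<in> carrier k" for q using D(1) by (simp add: coord_def)
  show "{q. coord s b q \<noteq> \<zero>\<^bsub>k\<^esub>} \<subseteq> carrier Q" by (auto simp: coord_def)
  have "inj_on (\<lambda>q. h q \<otimes> s) (carrier Q)"
    using basis_unique [OF basis_S _ _ s s] by (auto simp: inj_on_def)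
  then have "inj_on (\<lambda>q. h q \<otimes> s) {q. coord s b q \<noteq> \<zero>\<^bsub>k\<^esub>}"
    by (rule inj_on_subset) (auto simp: coord_def)
  moreover have "(\<lambda>q. h q \<otimes> s) ` {q. coord s b q \<noteq> \<zero>\<^bsub>k\<^esub>} \<subseteq> {p. b p \<noteq> \<zero>\<^bsub>k\<^esub>}"
    by (auto simp: coord_def)
  ultimately show "finite {q. coord s b q \<noteq> \<zero>\<^bsub>k\<^esub>}"
    using D(2) by (meson finite_imageD finite_subset)
qed

lemma coord_add: "coord s (b \<oplus>\<^bsub>B\<^esub> b') = coord s b \<oplus>\<^bsub>A\<^esub> coord s b'"
  by (auto simp: coord_def monoid_algebra_simps)

lemma coord_zero: "coord s \<zero>\<^bsub>B\<^esub> = \<zero>\<^bsub>A\<^esub>"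
  by (auto simp: coord_def monoid_algebra_simps)

lemma coord_monom:
  assumes "s \<in> S" "t \<in> S" "q \<in> carrier Q"
  shows "coord s (alg_monom k a (h q \<otimes> t)) = (if s = t then alg_monom k a q else \<zero>\<^bsub>A\<^esub>)"
  using basis_unique [OF basis_S _ assms(3,1,2)] assms
  by (auto simp: coord_def alg_monom_def monoid_algebra_simps fun_eq_iff)

lemma coord_monom_mult:
  assumes s: "s \<in> S" and b: "b \<in> carrier B" and a: "a \<in> carrier k" and q: "q \<in> carrier Q"
  shows "coord s (alg_monom k a (h q) \<otimes>\<^bsub>B\<^esub> b) = alg_monom k a q \<otimes>\<^bsub>A\<^esub> coord s b"
  using b
proof (induction b rule: alg.P.monoid_algebra_induct)
  case zero
  then show ?case using a q by (simp add: coord_zero)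
next
  case (add a' p g)
  obtain r t where r: "r \<in> carrier Q" "t \<in> S" "p = h r \<otimes> t" using basis_decomp [OF basis_S add(2)] .
  have tc: "t \<in> carrier P" using basis_carrier [OF basis_S] r by blast
  have "alg_monom k a (h q) \<otimes>\<^bsub>B\<^esub> alg_monom k a' p = alg_monom k (a \<otimes>\<^bsub>k\<^esub> a') (h (q \<otimes>\<^bsub>Q\<^esub> r) \<otimes> t)"
    using a q add r tc by (simp add: alg.P.monom_mult h_mult_assoc)
  then have "coord s (alg_monom k a (h q) \<otimes>\<^bsub>B\<^esub> alg_monom k a' p) = alg_monom k a q \<otimes>\<^bsub>A\<^esub> coord s (alg_monom k a' p)"
    using a q add r s by (simp add: coord_monom alg.Q.monom_mult)
  moreover have "alg_monom k a (h q) \<otimes>\<^bsub>B\<^esub> (alg_monom k a' p \<oplus>\<^bsub>B\<^esub> g) =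
      alg_monom k a (h q) \<otimes>\<^bsub>B\<^esub> alg_monom k a' p \<oplus>\<^bsub>B\<^esub> alg_monom k a (h q) \<otimes>\<^bsub>B\<^esub> g"
    using a q add by (intro alg.P.RM.r_distr) auto
  moreover have "alg_monom k a q \<otimes>\<^bsub>A\<^esub> (coord s (alg_monom k a' p) \<oplus>\<^bsub>A\<^esub> coord s g) =
      alg_monom k a q \<otimes>\<^bsub>A\<^esub> coord s (alg_monom k a' p) \<oplus>\<^bsub>A\<^esub> alg_monom k a q \<otimes>\<^bsub>A\<^esub> coord s g"
    using a q add s coord_closed by (intro alg.Q.RM.r_distr) auto
  ultimately show ?case using add by (simp add: coord_add)
qed

lemma coord_mult:
  assumes s: "s \<in> S" and b: "b \<in> carrier B" and a: "a \<in> carrier A"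
  shows "coord s (\<phi> a \<otimes>\<^bsub>B\<^esub> b) = a \<otimes>\<^bsub>A\<^esub> coord s b"
proof -
  interpret \<phi>: ring_hom_cring A B \<phi> by (rule alg.map_ring_hom_cring)
  show ?thesis
    using a
  proof (induction a rule: alg.Q.monoid_algebra_induct)
    case zero
    then show ?case using b coord_closed [OF s b] by (simp add: coord_zero)
  next
    case (add a q g)
    have "\<phi> (alg_monom k a q \<oplus>\<^bsub>A\<^esub> g) \<otimes>\<^bsub>B\<^esub> b = alg_monom k a (h q) \<otimes>\<^bsub>B\<^esub> b \<oplus>\<^bsub>B\<^esub> \<phi> g \<otimes>\<^bsub>B\<^esub> b"
      using add b by (simp add: alg.map_monom alg.P.RM.l_distr)
    moreover have "(alg_monom k a q \<oplus>\<^bsub>A\<^esub> g) \<otimes>\<^bsub>A\<^esub> coord s b =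
        alg_monom k a q \<otimes>\<^bsub>A\<^esub> coord s b \<oplus>\<^bsub>A\<^esub> g \<otimes>\<^bsub>A\<^esub> coord s b"
      using add coord_closed [OF s b] by (intro alg.Q.RM.l_distr) auto
    ultimately show ?case using add s b by (simp add: coord_add coord_monom_mult)
  qed
qed

text \<open>By linearity this is a statement about monomials, where only the coordinate of the basis
  element below the exponent is nonzero.\<close>

lemma coord_expand:
  assumes b: "b \<in> carrier B"
  shows "b = (\<Oplus>\<^bsub>B\<^esub>s\<in>S. \<phi> (coord s b) \<otimes>\<^bsub>B\<^esub> alg_monom k \<one>\<^bsub>k\<^esub> s)"
proof -
  interpret \<phi>: ring_hom_cring A B \<phi> by (rule alg.map_ring_hom_cring)
  have e: "alg_monom k \<one>\<^bsub>k\<^esub> s \<in> carrier B" if "s \<in> S" for s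
    using basis_carrier [OF basis_S that] by simp
  show ?thesis
    using b
  proof (induction b rule: alg.P.monoid_algebra_induct)
    case zero
    have "(\<Oplus>\<^bsub>B\<^esub>s\<in>S. \<phi> (coord s \<zero>\<^bsub>B\<^esub>) \<otimes>\<^bsub>B\<^esub> alg_monom k \<one>\<^bsub>k\<^esub> s) = (\<Oplus>\<^bsub>B\<^esub>s\<in>S. \<zero>\<^bsub>B\<^esub>)"
      using e by (intro alg.P.RM.finsum_cong') (auto simp: coord_zero)
    then show ?case by (simp add: alg.P.RM.finsum_zero)
  next
    case (add a p g)
    obtain r t where r: "r \<in> carrier Q" "t \<in> S" "p = h r \<otimes> t" using basis_decomp [OF basis_S add(2)] .
    have tc: "t \<in> carrier P" using basis_carrier [OF basis_S] r by blast
    have ap: "alg_monom k a p \<in> carrier B" using add by simp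
    have "(\<Oplus>\<^bsub>B\<^esub>s\<in>S. \<phi> (coord s (alg_monom k a p)) \<otimes>\<^bsub>B\<^esub> alg_monom k \<one>\<^bsub>k\<^esub> s) =
        (\<Oplus>\<^bsub>B\<^esub>s\<in>S. if t = s then alg_monom k a p else \<zero>\<^bsub>B\<^esub>)"
      using e add r tc
      by (intro alg.P.RM.finsum_cong') (auto simp: coord_monom alg.map_monom alg.P.monom_mult)
    also have "\<dots> = alg_monom k a p"
      using r finite_S ap by (intro alg.P.RM.finsum_singleton) auto
    finally have 1: "(\<Oplus>\<^bsub>B\<^esub>s\<in>S. \<phi> (coord s (alg_monom k a p)) \<otimes>\<^bsub>B\<^esub> alg_monom k \<one>\<^bsub>k\<^esub> s) = alg_monom k a p" .
    have "(\<Oplus>\<^bsub>B\<^esub>s\<in>S. \<phi> (coord s (alg_monom k a p \<oplus>\<^bsub>B\<^esub> g)) \<otimes>\<^bsub>B\<^esub> alg_monom k \<one>\<^bsub>k\<^esub> s) =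
        (\<Oplus>\<^bsub>B\<^esub>s\<in>S. \<phi> (coord s (alg_monom k a p)) \<otimes>\<^bsub>B\<^esub> alg_monom k \<one>\<^bsub>k\<^esub> s \<oplus>\<^bsub>B\<^esub>
          \<phi> (coord s g) \<otimes>\<^bsub>B\<^esub> alg_monom k \<one>\<^bsub>k\<^esub> s)"
      using e ap add(3) coord_closed
      by (intro alg.P.RM.finsum_cong') (auto simp: coord_add alg.P.RM.l_distr)
    also have "\<dots> = (\<Oplus>\<^bsub>B\<^esub>s\<in>S. \<phi> (coord s (alg_monom k a p)) \<otimes>\<^bsub>B\<^esub> alg_monom k \<one>\<^bsub>k\<^esub> s) \<oplus>\<^bsub>B\<^esub>
          (\<Oplus>\<^bsub>B\<^esub>s\<in>S. \<phi> (coord s g) \<otimes>\<^bsub>B\<^esub> alg_monom k \<one>\<^bsub>k\<^esub> s)"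
      using e ap add(3) coord_closed by (intro alg.P.RM.finsum_addf) auto
    also have "\<dots> = alg_monom k a p \<oplus>\<^bsub>B\<^esub> g" using 1 add(4) by simp
    finally show ?case ..
  qed
qed

sublocale finite_free_algebra A B \<phi> S "alg_monom k \<one>\<^bsub>k\<^esub>" coord
proof (intro finite_free_algebra.intro finite_free_algebra_axioms.intro
    alg.Q.algebra_cring alg.P.algebra_cring alg.map_ring_hom_cring)
  show "coord i (alg_monom k \<one>\<^bsub>k\<^esub> j) = (if i = j then \<one>\<^bsub>A\<^esub> else \<zero>\<^bsub>A\<^esub>)" if "i \<in> S" "j \<in> S" for i j
    using coord_monom [OF that Q.one_closed, of "\<one>\<^bsub>k\<^esub>"] basis_carrier [OF basis_S that(2)]
    by (simp add: monoid_algebra_simps(1))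
qed (use finite_S basis_carrier [OF basis_S] coord_closed coord_add coord_mult coord_expand in auto)

end

text \<open>\<open>k[P]\<close> is finite and free over \<open>k[Q]\<close>, which gives finiteness,
  flatness and finite presentation. Surjectivity and the vanishing of differentials rest on the
  basis consisting of units.\<close>

lemma (in cancel_monoid_map) finite_etale_cover_if_unit_basis:
  fixes k :: "'k ring"
  assumes S: "unit_basis S" and k: "field k" "char_zero k"
  shows "monoid_algebra_finite_etale_cover k Q P h"
proof -
  interpret k: field k by (fact k)
  have S1: "basis S" and SU: "S \<subseteq> Units P" and fS: "finite S" using S by (auto simp: unit_basis_def)
  interpret monoid_algebra_map_free Q P h k S
    by (intro monoid_algebra_map_free.intro monoid_algebra_map_free_axioms.intro
        cancel_monoid_map_axioms k.cring_axioms S1 fS)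
  \<comment> \<open>The basis element \<open>s0\<close> below \<open>\<one>\<close> need not be
    \<open>\<one>\<close> itself. Dividing the coordinate at \<open>s0\<close> by
    \<open>x^a0\<close> gives a retraction that preserves the identity.\<close>
  obtain a0 s0 where a0: "a0 \<in> Units Q" and s0: "s0 \<in> S" and one: "\<one> = h a0 \<otimes> s0"
    using unit_basis_decomp [OF S P.Units_one_closed] .
  have "Spec_surjective A B \<phi>"
  proof (rule Spec_surjective_if_retraction [OF alg.map_ring_hom_cring,
        where \<rho> = "\<lambda>b. alg_monom k \<one>\<^bsub>k\<^esub> (inv\<^bsub>Q\<^esub> a0) \<otimes>\<^bsub>A\<^esub> coord s0 b"])
    have m: "alg_monom k \<one>\<^bsub>k\<^esub> (inv\<^bsub>Q\<^esub> a0) \<in> carrier A" using a0 by simp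
    show "alg_monom k \<one>\<^bsub>k\<^esub> (inv\<^bsub>Q\<^esub> a0) \<otimes>\<^bsub>A\<^esub> coord s0 b \<in> carrier A" if "b \<in> carrier B" for b
      using m coord_closed [OF s0 that] by simp
    show "alg_monom k \<one>\<^bsub>k\<^esub> (inv\<^bsub>Q\<^esub> a0) \<otimes>\<^bsub>A\<^esub> coord s0 (b \<oplus>\<^bsub>B\<^esub> c) =
        alg_monom k \<one>\<^bsub>k\<^esub> (inv\<^bsub>Q\<^esub> a0) \<otimes>\<^bsub>A\<^esub> coord s0 b \<oplus>\<^bsub>A\<^esub> alg_monom k \<one>\<^bsub>k\<^esub> (inv\<^bsub>Q\<^esub> a0) \<otimes>\<^bsub>A\<^esub> coord s0 c"
      if "b \<in> carrier B" "c \<in> carrier B" for b c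
      using m coord_closed [OF s0] that by (simp add: coord_add alg.Q.RM.r_distr)
    show "alg_monom k \<one>\<^bsub>k\<^esub> (inv\<^bsub>Q\<^esub> a0) \<otimes>\<^bsub>A\<^esub> coord s0 (\<phi> a \<otimes>\<^bsub>B\<^esub> b) =
        a \<otimes>\<^bsub>A\<^esub> (alg_monom k \<one>\<^bsub>k\<^esub> (inv\<^bsub>Q\<^esub> a0) \<otimes>\<^bsub>A\<^esub> coord s0 b)"
      if "a \<in> carrier A" "b \<in> carrier B" for a b
      using m coord_closed [OF s0] s0 that by (simp add: coord_mult alg.Q.RM.m_lcomm)
    have "coord s0 \<one>\<^bsub>B\<^esub> = alg_monom k \<one>\<^bsub>k\<^esub> a0"
      using coord_monom [OF s0 s0, of a0 "\<one>\<^bsub>k\<^esub>"] a0 by (simp add: monoid_algebra_simps(1) one Q.Units_closed)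
    then show "alg_monom k \<one>\<^bsub>k\<^esub> (inv\<^bsub>Q\<^esub> a0) \<otimes>\<^bsub>A\<^esub> coord s0 \<one>\<^bsub>B\<^esub> = \<one>\<^bsub>A\<^esub>"
      using a0 by (simp add: alg.Q.monom_mult monoid_algebra_simps(1) Q.Units_closed)
  qed
  moreover have "unramified_ring_hom A B \<phi>"
  proof (rule unramified_if_generated_by_roots [OF alg.map_ring_hom_cring, where T = "alg_monom k \<one>\<^bsub>k\<^esub> ` S"])
    show "finite (alg_monom k \<one>\<^bsub>k\<^esub> ` S)" using fS by simp
    show "alg_monom k \<one>\<^bsub>k\<^esub> ` S \<subseteq> Units B" using SU alg.P.monom_Units by auto
    show "\<exists>c\<in>alg_monom k \<one>\<^bsub>k\<^esub> ` S \<rightarrow> carrier A. b = (\<Oplus>\<^bsub>B\<^esub>t\<in>alg_monom k \<one>\<^bsub>k\<^esub> ` S. \<phi> (c t) \<otimes>\<^bsub>B\<^esub> t)"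
      if "b \<in> carrier B" for b by (rule image_generates [OF that])
    fix t assume "t \<in> alg_monom k \<one>\<^bsub>k\<^esub> ` S"
    then obtain s where s: "s \<in> S" and t: "t = alg_monom k \<one>\<^bsub>k\<^esub> s" by blast
    have su: "s \<in> Units P" using s SU by blast
    \<comment> \<open>All powers of the unit \<open>s\<close> lie over finitely many basis elements.
      Two powers over the same one have their quotient in the image of \<open>Units Q\<close>, so a
      positive power of \<open>x^s\<close> comes from \<open>k[Q]\<close>.\<close>
    have "\<exists>u\<in>S. \<exists>a\<in>Units Q. s [^] n = h a \<otimes> u" for n :: nat
      using unit_basis_decomp [OF S P.Units_pow_closed [OF su]] by metis
    then obtain f where f: "\<And>n::nat. f n \<in> S \<and> (\<exists>a\<in>Units Q. s [^] n = h a \<otimes> f n)" by metis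
    obtain m n where mn: "m < n" "f m = f n" using infinite_sequence_repeats [OF fS, of f] f by blast
    obtain a where a: "a \<in> Units Q" "s [^] m = h a \<otimes> f m" using f by blast
    obtain b where b: "b \<in> Units Q" "s [^] n = h b \<otimes> f m" using f [of n] mn by auto
    have fc: "f m \<in> carrier P" using f SU by blast
    have "s [^] m \<otimes> s [^] (n - m) = s [^] n"
      using su mn by (simp add: P.nat_pow_mult P.Units_closed)
    also have "\<dots> = s [^] m \<otimes> h (b \<otimes>\<^bsub>Q\<^esub> inv\<^bsub>Q\<^esub> a)"
    proof -
      have "s [^] m \<otimes> h (b \<otimes>\<^bsub>Q\<^esub> inv\<^bsub>Q\<^esub> a) = h (a \<otimes>\<^bsub>Q\<^esub> (b \<otimes>\<^bsub>Q\<^esub> inv\<^bsub>Q\<^esub> a)) \<otimes> f m"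
        using a b fc by (simp add: h_mult P.m_ac Q.Units_closed)
      also have "a \<otimes>\<^bsub>Q\<^esub> (b \<otimes>\<^bsub>Q\<^esub> inv\<^bsub>Q\<^esub> a) = b"
        using a b by (simp add: Q.m_lcomm [of a b] Q.Units_closed)
      finally show ?thesis using b by simp
    qed
    finally have pow: "s [^] (n - m) = h (b \<otimes>\<^bsub>Q\<^esub> inv\<^bsub>Q\<^esub> a)"
      by (rule P.l_cancel) (use a(1) b(1) su in \<open>auto simp: Q.Units_closed P.Units_closed\<close>)
    show "\<exists>n::nat. n > 0 \<and> t [^]\<^bsub>B\<^esub> n \<in> \<phi> ` carrier A \<and> [n] \<cdot>\<^bsub>B\<^esub> \<one>\<^bsub>B\<^esub> \<in> Units B"
    proof (intro exI conjI)
      show "n - m > 0" using mn by simp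
      have "t [^]\<^bsub>B\<^esub> (n - m) = \<phi> (alg_monom k \<one>\<^bsub>k\<^esub> (b \<otimes>\<^bsub>Q\<^esub> inv\<^bsub>Q\<^esub> a))"
        using su a b by (simp add: t alg.P.monom_pow pow alg.map_monom P.Units_closed Q.Units_closed)
      then show "t [^]\<^bsub>B\<^esub> (n - m) \<in> \<phi> ` carrier A"
        using a b by (auto simp: Q.Units_closed)
      \<comment> \<open>Characteristic zero enters here: the exponent in the power rule is
        invertible.\<close>
      have "add_pow k (n - m) \<one>\<^bsub>k\<^esub> \<in> Units k"
        using k(2) mn by (simp add: char_zero_def k.field_Units)
      then show "add_pow B (n - m) \<one>\<^bsub>B\<^esub> \<in> Units B"
        by (simp add: monoid_algebra_simps(1) alg.P.add_pow_monom alg.P.monom_Units)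
    qed
  qed
  ultimately show ?thesis
    unfolding monoid_algebra_finite_etale_cover_def finite_etale_cover_def etale_ring_hom_def
    using alg.map_ring_hom finite_ring_hom finitely_presented_ring_hom flat_ring_hom by blast
qed

section \<open>Etale covers of monoid algebras\<close>

context monoid_algebra_ring
begin

text \<open>The support of a product consists of products of exponents from the two supports, so it
  stays in \<open>D\<close>.\<close>

lemma ideal_supported_on:
  assumes D: "\<And>x y. \<lbrakk>x \<in> carrier M; y \<in> D\<rbrakk> \<Longrightarrow> x \<otimes>\<^bsub>M\<^esub> y \<in> D"
  shows "ideal {f \<in> carrier RM. \<forall>x. f x \<noteq> \<zero>\<^bsub>R\<^esub> \<longrightarrow> x \<in> D} RM"
proof (rule idealI [OF RM.ring_axioms])
  let ?K = "{f \<in> carrier RM. \<forall>x. f x \<noteq> \<zero>\<^bsub>R\<^esub> \<longrightarrow> x \<in> D}"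
  show "subgroup ?K (add_monoid RM)"
  proof (rule RM.add.subgroupI)
    have "\<zero>\<^bsub>RM\<^esub> x = \<zero>\<^bsub>R\<^esub>" for x by (simp add: monoid_algebra_simps(2))
    then have "\<zero>\<^bsub>RM\<^esub> \<in> ?K" using RM.zero_closed by blast
    then show "?K \<noteq> {}" by blast
    fix f g assume f: "f \<in> ?K" and g: "g \<in> ?K"
    show "\<ominus>\<^bsub>RM\<^esub> f \<in> ?K" using f a_inv_apply R.minus_zero by (smt (verit, best) RM.a_inv_closed mem_Collect_eq)
    show "f \<oplus>\<^bsub>RM\<^esub> g \<in> ?K"
    proof (intro CollectI conjI allI impI)
      show "f \<oplus>\<^bsub>RM\<^esub> g \<in> carrier RM" using f g by simp
      fix x assume "(f \<oplus>\<^bsub>RM\<^esub> g) x \<noteq> \<zero>\<^bsub>R\<^esub>"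
      then have "f x \<noteq> \<zero>\<^bsub>R\<^esub> \<or> g x \<noteq> \<zero>\<^bsub>R\<^esub>" by (auto simp: monoid_algebra_simps(3))
      then show "x \<in> D" using f g by blast
    qed
  qed auto
  fix f g assume f: "f \<in> ?K" and g: "g \<in> carrier RM"
  show l: "g \<otimes>\<^bsub>RM\<^esub> f \<in> ?K"
  proof (intro CollectI conjI allI impI)
    show "g \<otimes>\<^bsub>RM\<^esub> f \<in> carrier RM" using f g by simp
    fix p assume "(g \<otimes>\<^bsub>RM\<^esub> f) p \<noteq> \<zero>\<^bsub>R\<^esub>"
    then obtain x y where "g x \<noteq> \<zero>\<^bsub>R\<^esub>" "f y \<noteq> \<zero>\<^bsub>R\<^esub>" "p = x \<otimes>\<^bsub>M\<^esub> y"
      using mult_support [of g f p] by auto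
    then show "p \<in> D" using D f monoid_algebraD(3) [OF g] by blast
  qed
  then show "f \<otimes>\<^bsub>RM\<^esub> g \<in> ?K" using f g by (simp add: RM.m_comm)
qed

lemma ev_smult:
  assumes b: "b \<in> carrier R" and f: "f \<in> carrier RM" and bf: "(\<lambda>x. b \<otimes>\<^bsub>R\<^esub> f x) \<in> carrier RM"
    and w: "\<And>x. x \<in> carrier M \<Longrightarrow> w x \<in> carrier R"
  shows "ev (\<lambda>x. b \<otimes>\<^bsub>R\<^esub> f x) w = b \<otimes>\<^bsub>R\<^esub> ev f w"
proof -
  note D = monoid_algebraD [OF f]
  let ?Z = "{x. f x \<noteq> \<zero>\<^bsub>R\<^esub>}"
  have wZ: "w x \<in> carrier R" if "x \<in> ?Z" for x using D(3) w that by blast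
  have "ev (\<lambda>x. b \<otimes>\<^bsub>R\<^esub> f x) w = (\<Oplus>\<^bsub>R\<^esub>x\<in>?Z. id (b \<otimes>\<^bsub>R\<^esub> f x) \<otimes>\<^bsub>R\<^esub> w x)"
    using b D(2) wZ by (intro ev_superset [OF bf]) auto
  also have "\<dots> = (\<Oplus>\<^bsub>R\<^esub>x\<in>?Z. b \<otimes>\<^bsub>R\<^esub> (f x \<otimes>\<^bsub>R\<^esub> w x))"
    using b D(1) wZ by (intro R.finsum_cong') (auto simp: R.m_assoc)
  also have "\<dots> = b \<otimes>\<^bsub>R\<^esub> (\<Oplus>\<^bsub>R\<^esub>x\<in>?Z. f x \<otimes>\<^bsub>R\<^esub> w x)"
    using b D(1,2) wZ by (intro R.finsum_rdistr [symmetric]) auto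
  finally show ?thesis by (simp add: alg_eval_def)
qed

definition restr :: "'p set \<Rightarrow> ('p \<Rightarrow> 'a) \<Rightarrow> 'p \<Rightarrow> 'a" where
  "restr E f = (\<lambda>p. if p \<in> E then f p else \<zero>\<^bsub>R\<^esub>)"

lemma restr_closed:
  assumes f: "f \<in> carrier RM" shows "restr E f \<in> carrier RM"
proof -
  note D = monoid_algebraD [OF f]
  have sub: "{p. restr E f p \<noteq> \<zero>\<^bsub>R\<^esub>} \<subseteq> {p. f p \<noteq> \<zero>\<^bsub>R\<^esub>}" by (auto simp: restr_def)
  have "finite {p. restr E f p \<noteq> \<zero>\<^bsub>R\<^esub>}" using sub D(2) by (rule finite_subset)
  moreover have "restr E f p \<in> carrier R" for p using D(1) by (simp add: restr_def)
  moreover have "{p. restr E f p \<noteq> \<zero>\<^bsub>R\<^esub>} \<subseteq> carrier M" using sub D(3) by blast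
  ultimately show ?thesis unfolding monoid_algebra_carrier_iff by blast
qed

lemma ev_restr:
  assumes f: "f \<in> carrier RM" and w: "\<And>x. x \<in> carrier M \<Longrightarrow> w x \<in> carrier R"
  shows "ev (restr E f) w = ev f (\<lambda>x. if x \<in> E then w x else \<zero>\<^bsub>R\<^esub>)"
proof -
  note D = monoid_algebraD [OF f]
  let ?Z = "{x. f x \<noteq> \<zero>\<^bsub>R\<^esub>}"
  have wZ: "w x \<in> carrier R" if "x \<in> ?Z" for x using D(3) w that by blast
  have "ev (restr E f) w = (\<Oplus>\<^bsub>R\<^esub>x\<in>?Z. id (restr E f x) \<otimes>\<^bsub>R\<^esub> w x)"
    using D(2) wZ by (intro ev_superset [OF restr_closed [OF f]]) (auto simp: restr_def)
  also have "\<dots> = (\<Oplus>\<^bsub>R\<^esub>x\<in>?Z. f x \<otimes>\<^bsub>R\<^esub> (if x \<in> E then w x else \<zero>\<^bsub>R\<^esub>))"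
    using D(1) wZ by (intro R.finsum_cong') (auto simp: restr_def)
  finally show ?thesis by (simp add: alg_eval_def)
qed

lemma ev_null: "f \<in> carrier RM \<Longrightarrow> ev f (\<lambda>x. \<zero>\<^bsub>R\<^esub>) = \<zero>\<^bsub>R\<^esub>"
  unfolding alg_eval_def using monoid_algebraD(1) [of f R M] by (simp add: R.finsum_zero)

end

lemma (in ideal) quotient_abelian_group: "abelian_group (R Quot I)"
  using quotient_is_ring by (rule ring.is_abelian_group)

text \<open>The module \<open>A\<close> over itself, on singleton lists because the test modules for
  flatness are carried by lists.\<close>

definition list_module :: "'a ring \<Rightarrow> ('a, 'a list) module" where
  "list_module A = \<lparr>carrier = (\<lambda>a. [a]) ` carrier A, monoid.mult = undefined, one = undefined,
     ring.zero = [\<zero>\<^bsub>A\<^esub>], ring.add = (\<lambda>x y. [hd x \<oplus>\<^bsub>A\<^esub> hd y]), smult = (\<lambda>a x. [a \<otimes>\<^bsub>A\<^esub> hd x])\<rparr>"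

lemma list_module_simps:
  "carrier (list_module A) = (\<lambda>a. [a]) ` carrier A"
  "\<zero>\<^bsub>list_module A\<^esub> = [\<zero>\<^bsub>A\<^esub>]"
  "x \<oplus>\<^bsub>list_module A\<^esub> y = [hd x \<oplus>\<^bsub>A\<^esub> hd y]"
  "a \<odot>\<^bsub>list_module A\<^esub> x = [a \<otimes>\<^bsub>A\<^esub> hd x]"
  by (auto simp: list_module_def)

lemma module_list_module:
  fixes A :: "'a ring" assumes "cring A" shows "module A (list_module A)"
proof -
  interpret cring A by (fact assms)
  show ?thesis
  proof (rule moduleI [OF assms])
    show "abelian_group (list_module A)"
    proof (rule abelian_groupI)
      show "\<exists>y\<in>carrier (list_module A). y \<oplus>\<^bsub>list_module A\<^esub> x = \<zero>\<^bsub>list_module A\<^esub>"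
        if "x \<in> carrier (list_module A)" for x
        using that by (intro bexI [of _ "[\<ominus>\<^bsub>A\<^esub> hd x]"]) (auto simp: list_module_simps l_neg)
    qed (auto simp: list_module_simps a_ac)
  qed (auto simp: list_module_simps l_distr r_distr m_assoc)
qed

text \<open>
  Flatness for the inclusion of an ideal \<open>I\<close> into \<open>A\<close>: if \<open>a\<^sub>1 \<otimes> b\<^sub>1\<close> and \<open>a\<^sub>2 \<otimes> b\<^sub>2\<close> agree in
  \<open>A \<otimes> B = B\<close>, they agree in \<open>I \<otimes> B\<close>, hence have the same image under every balanced map.
\<close>

lemma flat_ring_hom_balanced_eq:
  fixes A :: "'a ring" and B :: "'b ring" and C :: "('c, 'd) ring_scheme"
  assumes hom: "ring_hom_cring A B \<phi>" and flat: "flat_ring_hom A B \<phi>" and I: "ideal I A"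
    and C: "abelian_group C"
    and f: "\<And>a b. \<lbrakk>a \<in> I; b \<in> carrier B\<rbrakk> \<Longrightarrow> f a b \<in> carrier C"
    and add_left: "\<And>a a' b. \<lbrakk>a \<in> I; a' \<in> I; b \<in> carrier B\<rbrakk> \<Longrightarrow> f (a \<oplus>\<^bsub>A\<^esub> a') b = f a b \<oplus>\<^bsub>C\<^esub> f a' b"
    and add_right: "\<And>a b b'. \<lbrakk>a \<in> I; b \<in> carrier B; b' \<in> carrier B\<rbrakk> \<Longrightarrow> f a (b \<oplus>\<^bsub>B\<^esub> b') = f a b \<oplus>\<^bsub>C\<^esub> f a b'"
    and smult: "\<And>c a b. \<lbrakk>c \<in> carrier A; a \<in> I; b \<in> carrier B\<rbrakk> \<Longrightarrow> f (c \<otimes>\<^bsub>A\<^esub> a) b = f a (\<phi> c \<otimes>\<^bsub>B\<^esub> b)"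
    and a: "a\<^sub>1 \<in> I" "a\<^sub>2 \<in> I" and b: "b\<^sub>1 \<in> carrier B" "b\<^sub>2 \<in> carrier B"
    and eq: "\<phi> a\<^sub>1 \<otimes>\<^bsub>B\<^esub> b\<^sub>1 = \<phi> a\<^sub>2 \<otimes>\<^bsub>B\<^esub> b\<^sub>2"
  shows "f a\<^sub>1 b\<^sub>1 = f a\<^sub>2 b\<^sub>2"
proof -
  interpret hom: ring_hom_cring A B \<phi> by (fact hom)
  interpret I: ideal I A by (fact I)
  interpret C: abelian_group C by (fact C)
  let ?N = "module_via B \<phi>" and ?M = "list_module A"
  let ?H = "(\<lambda>a. [a]) ` I"
  have M: "module A ?M" using module_list_module hom.R.cring_axioms .
  interpret M: module A ?M by (fact M)
  have H: "submodule ?H A ?M"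
  proof (rule M.submoduleI)
    show "?H \<subseteq> carrier ?M" using I.Icarr by (auto simp: list_module_simps)
    show "\<zero>\<^bsub>?M\<^esub> \<in> ?H" using I.zero_closed by (auto simp: list_module_simps)
    fix x y assume x: "x \<in> ?H" and y: "y \<in> ?H"
    obtain u where u: "x = [u]" "u \<in> I" using x by blast
    have "\<ominus>\<^bsub>?M\<^esub> x = [\<ominus>\<^bsub>A\<^esub> u]"
      using u I.Icarr [of u] by (intro M.minus_equality) (auto simp: list_module_simps hom.R.l_neg)
    then show "\<ominus>\<^bsub>?M\<^esub> x \<in> ?H" using u I.a_inv_closed by auto
    show "x \<oplus>\<^bsub>?M\<^esub> y \<in> ?H" using x y I.a_closed by (auto simp: list_module_simps)
    show "c \<odot>\<^bsub>?M\<^esub> x \<in> ?H" if "c \<in> carrier A" for c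
      using that u I.I_l_closed by (auto simp: list_module_simps)
  qed
  have N: "module A ?N" by (rule module_module_via [OF hom])
  interpret submodule_pair A ?M ?N ?H
    by (intro submodule_pair.intro module_pair.intro M H N)
  have Ns: "carrier ?N = carrier B" "\<And>x y. x \<oplus>\<^bsub>?N\<^esub> y = x \<oplus>\<^bsub>B\<^esub> y" "\<And>a b. a \<odot>\<^bsub>?N\<^esub> b = \<phi> a \<otimes>\<^bsub>B\<^esub> b"
    by (auto simp: module_via_def)
  \<comment> \<open>Over all of \<open>A\<close> the first factor of a tensor can be normalized to
    \<open>\<one>\<close>, so the class is determined by the product in \<open>B\<close>.\<close>
  have one: "frag_of ([a], b) - frag_of ([\<one>\<^bsub>A\<^esub>], \<phi> a \<otimes>\<^bsub>B\<^esub> b) \<in> M.rels" if "a \<in> carrier A" "b \<in> carrier B" for a b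
    using M.rels_smult [of a "[\<one>\<^bsub>A\<^esub>]" b] that by (simp add: list_module_simps Ns)
  let ?z = "frag_of ([a\<^sub>1], b\<^sub>1) - frag_of ([a\<^sub>2], b\<^sub>2)"
  have "?z \<in> M.rels"
    using M.rels_diff [OF one [of a\<^sub>1 b\<^sub>1] one [of a\<^sub>2 b\<^sub>2]] a b eq I.Icarr by simp
  moreover have "Poly_Mapping.keys ?z \<subseteq> ?H \<times> carrier ?N"
    using keys_diff [of "frag_of ([a\<^sub>1], b\<^sub>1)" "frag_of ([a\<^sub>2], b\<^sub>2)"] a b by (auto simp: Ns)
  ultimately have z: "?z \<in> H.rels"
    using flat M H unfolding flat_ring_hom_def flat_module_iff [OF N] by blast
  obtain g where g: "\<And>x y. \<lbrakk>x \<in> carrier (?M\<lparr>carrier := ?H\<rparr>); y \<in> carrier ?N\<rbrakk> \<Longrightarrow> g (frag_of (x, y)) = f (hd x) y"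
    "\<And>z. z \<in> H.rels \<Longrightarrow> g z = \<zero>\<^bsub>C\<^esub>"
    "\<And>x y. \<lbrakk>Poly_Mapping.keys x \<subseteq> carrier (?M\<lparr>carrier := ?H\<rparr>) \<times> carrier ?N;
        Poly_Mapping.keys y \<subseteq> carrier (?M\<lparr>carrier := ?H\<rparr>) \<times> carrier ?N\<rbrakk>
      \<Longrightarrow> g (x - y) = g x \<oplus>\<^bsub>C\<^esub> \<ominus>\<^bsub>C\<^esub> g y"
  proof (rule H.balanced_map_extends [OF C, where f = "\<lambda>x b. f (hd x) b"])
  qed (auto simp: list_module_simps Ns f add_left add_right smult)
  have "g ?z = f a\<^sub>1 b\<^sub>1 \<oplus>\<^bsub>C\<^esub> \<ominus>\<^bsub>C\<^esub> f a\<^sub>2 b\<^sub>2"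
    using g(3) [of "frag_of ([a\<^sub>1], b\<^sub>1)" "frag_of ([a\<^sub>2], b\<^sub>2)"] g(1) a b by (simp add: Ns)
  then have "f a\<^sub>1 b\<^sub>1 \<oplus>\<^bsub>C\<^esub> \<ominus>\<^bsub>C\<^esub> f a\<^sub>2 b\<^sub>2 = \<zero>\<^bsub>C\<^esub>" using g(2) [OF z] by simp
  then show ?thesis
    using f a b by (metis C.minus_equality C.minus_minus C.a_inv_closed)
qed

locale monoid_algebra_map_field = cancel_monoid_map Q P h + k: field k
  for Q :: "'q monoid" and P :: "'p monoid" (structure) and h :: "'q \<Rightarrow> 'p" and k :: "'k ring"
begin

sublocale alg: monoid_algebra_hom k Q P h
  by (intro monoid_algebra_hom.intro monoid_algebra_ring.intro monoid_algebra_hom_axioms.intro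
      k.cring_axioms Q.comm_monoid_axioms P.comm_monoid_axioms hom)

abbreviation "A \<equiv> monoid_algebra k Q"
abbreviation "B \<equiv> monoid_algebra k P"
abbreviation "\<phi> \<equiv> monoid_algebra_map k h"

text \<open>When \<open>x^p\<close> is expanded over generators of \<open>k[P]\<close>, some term
  has a nonzero coefficient at \<open>p\<close>. So \<open>p\<close> is an element of the image of
  \<open>Q\<close> times an exponent from the support of a generator, and there are finitely many
  such exponents.\<close>

lemma finite_hom_if_finite_ring_hom:
  assumes "finite_ring_hom A B \<phi>"
  shows "finite_hom Q P h"
proof -
  obtain T where T: "finite T" "T \<subseteq> carrier B"
    and gen: "\<And>b. b \<in> carrier B \<Longrightarrow> \<exists>c\<in>T \<rightarrow> carrier A. b = (\<Oplus>\<^bsub>B\<^esub>t\<in>T. \<phi> (c t) \<otimes>\<^bsub>B\<^esub> t)"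
    using assms unfolding finite_ring_hom_def by blast
  define S where "S = (\<Union>t\<in>T. {p. t p \<noteq> \<zero>\<^bsub>k\<^esub>})"
  have tB: "t \<in> carrier B" if "t \<in> T" for t using T(2) that by blast
  show ?thesis
    unfolding finite_hom_def
  proof (intro exI conjI)
    show "finite S" unfolding S_def using T(1) monoid_algebraD(2) [OF tB] by blast
    show SP: "S \<subseteq> carrier P" unfolding S_def using monoid_algebraD(3) [OF tB] by blast
    show "carrier P = {h q \<otimes> s |q s. q \<in> carrier Q \<and> s \<in> S}"
    proof
      show "{h q \<otimes> s |q s. q \<in> carrier Q \<and> s \<in> S} \<subseteq> carrier P" using SP by auto
      show "carrier P \<subseteq> {h q \<otimes> s |q s. q \<in> carrier Q \<and> s \<in> S}"
      proof
        fix p assume p: "p \<in> carrier P"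
        obtain c where c: "c \<in> T \<rightarrow> carrier A"
          and eq: "alg_monom k \<one>\<^bsub>k\<^esub> p = (\<Oplus>\<^bsub>B\<^esub>t\<in>T. \<phi> (c t) \<otimes>\<^bsub>B\<^esub> t)"
          using gen [of "alg_monom k \<one>\<^bsub>k\<^esub> p"] p by auto
        have cl: "\<phi> (c t) \<in> carrier B" if "t \<in> T" for t
          by (rule alg.map_closed [OF funcset_mem [OF c that]])
        have "\<one>\<^bsub>k\<^esub> = (\<Oplus>\<^bsub>B\<^esub>t\<in>T. \<phi> (c t) \<otimes>\<^bsub>B\<^esub> t) p"
          unfolding eq [symmetric] by (simp add: alg_monom_apply)
        also have "\<dots> = (\<Oplus>\<^bsub>k\<^esub>t\<in>T. (\<phi> (c t) \<otimes>\<^bsub>B\<^esub> t) p)"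
          using T(1) tB cl by (intro alg.P.finsum_apply) auto
        finally have ne: "(\<Oplus>\<^bsub>k\<^esub>t\<in>T. (\<phi> (c t) \<otimes>\<^bsub>B\<^esub> t) p) \<noteq> \<zero>\<^bsub>k\<^esub>" by auto
        have "\<exists>t\<in>T. (\<phi> (c t) \<otimes>\<^bsub>B\<^esub> t) p \<noteq> \<zero>\<^bsub>k\<^esub>"
        proof (rule ccontr)
          assume "\<not> ?thesis"
          then have "(\<Oplus>\<^bsub>k\<^esub>t\<in>T. (\<phi> (c t) \<otimes>\<^bsub>B\<^esub> t) p) = \<zero>\<^bsub>k\<^esub>"
            by (intro k.add.finprod_one_eqI) blast
          then show False using ne by simp
        qed
        then obtain t where t: "t \<in> T" "(\<phi> (c t) \<otimes>\<^bsub>B\<^esub> t) p \<noteq> \<zero>\<^bsub>k\<^esub>" by blast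
        obtain x y where xy: "\<phi> (c t) x \<noteq> \<zero>\<^bsub>k\<^esub>" "t y \<noteq> \<zero>\<^bsub>k\<^esub>" "p = x \<otimes> y"
          using alg.P.mult_support [OF t(2)] by auto
        obtain q where q: "c t q \<noteq> \<zero>\<^bsub>k\<^esub>" "x = h q" using alg.map_support [OF xy(1)] by auto
        have "q \<in> carrier Q" using monoid_algebraD(3) [of "c t" k Q q] c t q by auto
        moreover have "y \<in> S" using t xy by (auto simp: S_def)
        ultimately show "p \<in> {h q \<otimes> s |q s. q \<in> carrier Q \<and> s \<in> S}" using xy q by blast
      qed
    qed
  qed
qed

text \<open>
  If \<open>h q = h q'\<close>, then \<open>a = x^q - x^q'\<close> maps to \<open>0\<close>, and \<open>a \<otimes> 1 = 0\<close> in \<open>(a) \<otimes> B = B / ann(a) B\<close>.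
  But \<open>ann(a) B\<close> lies in a prime, over any prime that contains \<open>ann(a)\<close>.
\<close>

lemma inj_if_faithfully_flat:
  assumes flat: "flat_ring_hom A B \<phi>" and surj: "Spec_surjective A B \<phi>"
  shows "inj_on h (carrier Q)"
proof (rule inj_onI, rule ccontr)
  interpret \<phi>: ring_hom_cring A B \<phi> by (rule alg.map_ring_hom_cring)
  fix q q' assume q: "q \<in> carrier Q" "q' \<in> carrier Q" and hq: "h q = h q'" and ne: "q \<noteq> q'"
  define a where "a = alg_monom k \<one>\<^bsub>k\<^esub> q \<ominus>\<^bsub>A\<^esub> alg_monom k \<one>\<^bsub>k\<^esub> q'"
  have a: "a \<in> carrier A" using q by (simp add: a_def)
  have "a q = \<one>\<^bsub>k\<^esub>"
    using q ne by (simp add: a_def alg.Q.RM.minus_eq monoid_algebra_simps(3) alg.Q.a_inv_apply alg_monom_apply)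
  then have a0: "a \<noteq> \<zero>\<^bsub>A\<^esub>" by (auto simp: monoid_algebra_simps(2))
  have \<phi>a: "\<phi> a = \<zero>\<^bsub>B\<^esub>"
    using q by (simp add: a_def alg.Q.RM.minus_eq alg.map_monom hq alg.P.RM.r_neg)
  define Ann where "Ann = {c \<in> carrier A. c \<otimes>\<^bsub>A\<^esub> a = \<zero>\<^bsub>A\<^esub>}"
  have Ann: "ideal Ann A"
  proof (rule idealI [OF alg.Q.RM.ring_axioms])
    show "subgroup Ann (add_monoid A)"
      by (rule alg.Q.RM.add.subgroupI) (use a in \<open>auto simp: Ann_def alg.Q.RM.l_distr alg.Q.RM.l_minus\<close>)
    fix c x assume c: "c \<in> Ann" and x: "x \<in> carrier A"
    show "x \<otimes>\<^bsub>A\<^esub> c \<in> Ann" using c x a by (simp add: Ann_def alg.Q.RM.m_assoc)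
    then show "c \<otimes>\<^bsub>A\<^esub> x \<in> Ann" using c x by (simp add: Ann_def alg.Q.RM.m_comm)
  qed
  \<comment> \<open>Since \<open>a\<close> is nonzero, its annihilator is proper and lies in a
    prime, which surjectivity on spectra lifts to \<open>J\<close>.\<close>
  have "\<one>\<^bsub>A\<^esub> \<notin> Ann" using a a0 by (simp add: Ann_def)
  then obtain I0 where I0: "primeideal I0 A" "Ann \<subseteq> I0"
    using alg.Q.RM.prime_ideal_avoiding [OF Ann, of "{\<one>\<^bsub>A\<^esub>}"] by auto
  obtain J where J: "primeideal J B" and JI: "{a \<in> carrier A. \<phi> a \<in> J} = I0"
    using surj I0(1) unfolding Spec_surjective_def by blast
  interpret J: primeideal J B by (fact J)
  have "\<exists>c. c \<in> carrier A \<and> x = c \<otimes>\<^bsub>A\<^esub> a" if "x \<in> PIdl\<^bsub>A\<^esub> a" for x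
    using that by (auto simp: cgenideal_def)
  then obtain d where d: "\<And>x. x \<in> PIdl\<^bsub>A\<^esub> a \<Longrightarrow> d x \<in> carrier A \<and> x = d x \<otimes>\<^bsub>A\<^esub> a" by metis
  \<comment> \<open>The scalar \<open>d x\<close> is determined only up to the annihilator of
    \<open>a\<close>. Its class modulo \<open>J\<close> does not depend on the choice, because
    \<open>J\<close> contains the image of the annihilator.\<close>
  define f where "f x b = J +>\<^bsub>B\<^esub> (\<phi> (d x) \<otimes>\<^bsub>B\<^esub> b)" for x b
  have f_eq: "f x b = J +>\<^bsub>B\<^esub> (\<phi> c \<otimes>\<^bsub>B\<^esub> b)"
    if "x \<in> PIdl\<^bsub>A\<^esub> a" "c \<in> carrier A" "x = c \<otimes>\<^bsub>A\<^esub> a" "b \<in> carrier B" for x b c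
  proof -
    have dx: "d x \<in> carrier A" "d x \<otimes>\<^bsub>A\<^esub> a = c \<otimes>\<^bsub>A\<^esub> a" using d [OF that(1)] that(3) by auto
    have "d x \<ominus>\<^bsub>A\<^esub> c \<in> Ann"
      using dx that a by (simp add: Ann_def alg.Q.RM.minus_eq alg.Q.RM.l_distr alg.Q.RM.l_minus alg.Q.RM.r_neg)
    then have "\<phi> (d x \<ominus>\<^bsub>A\<^esub> c) \<in> J" using I0 JI by blast
    then have "\<phi> (d x \<ominus>\<^bsub>A\<^esub> c) \<otimes>\<^bsub>B\<^esub> b \<in> J" using that by (intro J.I_r_closed)
    moreover have "\<phi> (d x \<ominus>\<^bsub>A\<^esub> c) \<otimes>\<^bsub>B\<^esub> b = \<phi> (d x) \<otimes>\<^bsub>B\<^esub> b \<ominus>\<^bsub>B\<^esub> \<phi> c \<otimes>\<^bsub>B\<^esub> b"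
      using dx that by (simp add: alg.Q.RM.minus_eq alg.P.RM.minus_eq alg.P.RM.l_distr alg.P.RM.l_minus)
    ultimately show ?thesis
      unfolding f_def using alg.P.RM.quotient_eq_iff_same_a_r_cos [OF J.is_ideal] dx that by simp
  qed
  have PI: "ideal (PIdl\<^bsub>A\<^esub> a) A" by (rule alg.Q.RM.cgenideal_ideal [OF a])
  interpret PI: ideal "PIdl\<^bsub>A\<^esub> a" A by (fact PI)
  have fa: "f a \<one>\<^bsub>B\<^esub> = f \<zero>\<^bsub>A\<^esub> \<one>\<^bsub>B\<^esub>"
  proof (rule flat_ring_hom_balanced_eq [OF alg.map_ring_hom_cring flat PI J.quotient_abelian_group])
    show "f x b \<in> carrier (B Quot J)" if "x \<in> PIdl\<^bsub>A\<^esub> a" "b \<in> carrier B" for x b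
      using d [OF that(1)] that by (auto simp: f_def FactRing_def A_RCOSETS_def')
    show "f (x \<oplus>\<^bsub>A\<^esub> y) b = f x b \<oplus>\<^bsub>B Quot J\<^esub> f y b"
      if "x \<in> PIdl\<^bsub>A\<^esub> a" "y \<in> PIdl\<^bsub>A\<^esub> a" "b \<in> carrier B" for x y b
    proof -
      have dx: "d x \<in> carrier A" "x = d x \<otimes>\<^bsub>A\<^esub> a" "d y \<in> carrier A" "y = d y \<otimes>\<^bsub>A\<^esub> a"
        using d that by auto
      have "x \<oplus>\<^bsub>A\<^esub> y = (d x \<oplus>\<^bsub>A\<^esub> d y) \<otimes>\<^bsub>A\<^esub> a"
        using dx a by (metis alg.Q.RM.l_distr)
      then have "f (x \<oplus>\<^bsub>A\<^esub> y) b = J +>\<^bsub>B\<^esub> (\<phi> (d x \<oplus>\<^bsub>A\<^esub> d y) \<otimes>\<^bsub>B\<^esub> b)"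
        using dx that by (intro f_eq PI.a_closed) auto
      then show ?thesis using dx(1,3) that by (simp add: f_def FactRing_def alg.P.RM.l_distr J.a_rcos_sum)
    qed
    show "f x (b \<oplus>\<^bsub>B\<^esub> c) = f x b \<oplus>\<^bsub>B Quot J\<^esub> f x c"
      if "x \<in> PIdl\<^bsub>A\<^esub> a" "b \<in> carrier B" "c \<in> carrier B" for x b c
      using d [OF that(1)] that by (simp add: f_def FactRing_def alg.P.RM.r_distr J.a_rcos_sum)
    show "f (c \<otimes>\<^bsub>A\<^esub> x) b = f x (\<phi> c \<otimes>\<^bsub>B\<^esub> b)"
      if "c \<in> carrier A" "x \<in> PIdl\<^bsub>A\<^esub> a" "b \<in> carrier B" for c x b
    proof -
      have dx: "d x \<in> carrier A" "x = d x \<otimes>\<^bsub>A\<^esub> a" using d that by auto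
      have "c \<otimes>\<^bsub>A\<^esub> x = (c \<otimes>\<^bsub>A\<^esub> d x) \<otimes>\<^bsub>A\<^esub> a"
        using dx a that by (metis alg.Q.RM.m_assoc)
      then have "f (c \<otimes>\<^bsub>A\<^esub> x) b = J +>\<^bsub>B\<^esub> (\<phi> (c \<otimes>\<^bsub>A\<^esub> d x) \<otimes>\<^bsub>B\<^esub> b)"
        using dx that by (intro f_eq PI.I_l_closed) auto
      then show ?thesis using dx(1) that by (simp add: f_def alg.P.RM.m_ac)
    qed
    show "a \<in> PIdl\<^bsub>A\<^esub> a" by (rule alg.Q.RM.cgenideal_self [OF a])
    show "\<zero>\<^bsub>A\<^esub> \<in> PIdl\<^bsub>A\<^esub> a" by (rule PI.zero_closed)
    show "\<phi> a \<otimes>\<^bsub>B\<^esub> \<one>\<^bsub>B\<^esub> = \<phi> \<zero>\<^bsub>A\<^esub> \<otimes>\<^bsub>B\<^esub> \<one>\<^bsub>B\<^esub>" by (simp add: \<phi>a)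
  qed auto
  moreover have "f a \<one>\<^bsub>B\<^esub> = J +>\<^bsub>B\<^esub> (\<phi> \<one>\<^bsub>A\<^esub> \<otimes>\<^bsub>B\<^esub> \<one>\<^bsub>B\<^esub>)"
    using a alg.Q.RM.cgenideal_self [OF a] by (intro f_eq) auto
  moreover have "f \<zero>\<^bsub>A\<^esub> \<one>\<^bsub>B\<^esub> = J +>\<^bsub>B\<^esub> (\<phi> \<zero>\<^bsub>A\<^esub> \<otimes>\<^bsub>B\<^esub> \<one>\<^bsub>B\<^esub>)"
    using a PI.zero_closed by (intro f_eq) auto
  \<comment> \<open>The tensors of \<open>a\<close> and of zero with \<open>\<one>\<close> agree, so
    the identity and zero have the same class modulo \<open>J\<close>, which is a proper
    ideal.\<close>
  ultimately have "J +>\<^bsub>B\<^esub> \<one>\<^bsub>B\<^esub> = J +>\<^bsub>B\<^esub> \<zero>\<^bsub>B\<^esub>" by simp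
  then have "\<one>\<^bsub>B\<^esub> \<ominus>\<^bsub>B\<^esub> \<zero>\<^bsub>B\<^esub> \<in> J"
    using alg.P.RM.quotient_eq_iff_same_a_r_cos [OF J.is_ideal, of "\<one>\<^bsub>B\<^esub>" "\<zero>\<^bsub>B\<^esub>"] by simp
  then have "\<one>\<^bsub>B\<^esub> \<in> J" by (simp add: alg.P.RM.minus_eq)
  then show False using J.one_imp_carrier J.I_notcarr by blast
qed

end

context monoid_algebra_map_field
begin

text \<open>
  Flatness for the ideal \<open>I\<close> spanned by \<open>D = q Q \<union> q' Q\<close>: unless \<open>p\<close> is divisible by some \<open>r\<close> with
  \<open>q r \<in> q' Q\<close>, the functional \<open>\<beta>\<close> that takes the coefficients of all \<open>x^m \<otimes> x^y\<close> with \<open>m\<close> in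
  \<open>q Q - q' Q\<close> and \<open>h m y = h q p\<close> is balanced, and separates \<open>x^q \<otimes> x^p\<close> from \<open>x^q' \<otimes> x^p'\<close>.
\<close>

lemma divisor_if_flat:
  assumes flat: "flat_ring_hom A B \<phi>"
    and q: "q \<in> carrier Q" "q' \<in> carrier Q" and p: "p \<in> carrier P" "p' \<in> carrier P"
    and eq: "h q \<otimes> p = h q' \<otimes> p'"
  shows "\<exists>r\<in>carrier Q. \<exists>r'\<in>carrier Q. \<exists>x\<in>carrier P. q \<otimes>\<^bsub>Q\<^esub> r = q' \<otimes>\<^bsub>Q\<^esub> r' \<and> p = h r \<otimes> x"
proof (rule ccontr)
  assume no: "\<not> ?thesis"
  define D where "D = {q \<otimes>\<^bsub>Q\<^esub> r | r. r \<in> carrier Q} \<union> {q' \<otimes>\<^bsub>Q\<^esub> r | r. r \<in> carrier Q}"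
  \<comment> \<open>The functional is built from exponents in \<open>E\<close> alone: these include
    \<open>q\<close> but not \<open>q'\<close>, so it vanishes on tensors with first factor
    \<open>x^q'\<close>.\<close>
  define E where "E = {q \<otimes>\<^bsub>Q\<^esub> r | r. r \<in> carrier Q} - {q' \<otimes>\<^bsub>Q\<^esub> r | r. r \<in> carrier Q}"
  define I where "I = {f \<in> carrier A. \<forall>x. f x \<noteq> \<zero>\<^bsub>k\<^esub> \<longrightarrow> x \<in> D}"
  have DQ: "x \<otimes>\<^bsub>Q\<^esub> y \<in> D" if x: "x \<in> carrier Q" and y: "y \<in> D" for x y
  proof -
    obtain r where r: "r \<in> carrier Q" "y = q \<otimes>\<^bsub>Q\<^esub> r \<or> y = q' \<otimes>\<^bsub>Q\<^esub> r" using y by (auto simp: D_def)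
    then have "x \<otimes>\<^bsub>Q\<^esub> y = q \<otimes>\<^bsub>Q\<^esub> (x \<otimes>\<^bsub>Q\<^esub> r) \<or> x \<otimes>\<^bsub>Q\<^esub> y = q' \<otimes>\<^bsub>Q\<^esub> (x \<otimes>\<^bsub>Q\<^esub> r)"
      using x q by (auto simp: Q.m_lcomm)
    then show ?thesis using x r unfolding D_def by blast
  qed
  have I: "ideal I A" unfolding I_def by (rule alg.Q.ideal_supported_on [OF DQ])
  define \<delta> where "\<delta> m y = (if h m \<otimes> y = h q \<otimes> p then \<one>\<^bsub>k\<^esub> else \<zero>\<^bsub>k\<^esub>)" for m y
  define W where "W m b = (if m \<in> E then alg.P.ev b (\<delta> m) else \<zero>\<^bsub>k\<^esub>)" for m b
  define \<beta> where "\<beta> u b = alg.Q.ev u (\<lambda>m. W m b)" for u b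
  have \<delta>c: "\<delta> m y \<in> carrier k" for m y by (simp add: \<delta>_def)
  have Wc: "W m b \<in> carrier k" if "b \<in> carrier B" for m b using that \<delta>c by (simp add: W_def)
  have IA: "u \<in> carrier A" if "u \<in> I" for u using that by (simp add: I_def)
  have "\<beta> (alg_monom k \<one>\<^bsub>k\<^esub> q) (alg_monom k \<one>\<^bsub>k\<^esub> p) = \<beta> (alg_monom k \<one>\<^bsub>k\<^esub> q') (alg_monom k \<one>\<^bsub>k\<^esub> p')"
  proof (rule flat_ring_hom_balanced_eq [OF alg.map_ring_hom_cring flat I k.abelian_group_axioms, where f = \<beta>])
    show "\<beta> u b \<in> carrier k" if "u \<in> I" "b \<in> carrier B" for u b
      unfolding \<beta>_def using IA Wc that by (intro alg.Q.ev_closed) auto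
    show "\<beta> (u \<oplus>\<^bsub>A\<^esub> v) b = \<beta> u b \<oplus>\<^bsub>k\<^esub> \<beta> v b" if "u \<in> I" "v \<in> I" "b \<in> carrier B" for u v b
      unfolding \<beta>_def using IA Wc that by (intro alg.Q.ev_add_left) auto
    show "\<beta> u (b \<oplus>\<^bsub>B\<^esub> c) = \<beta> u b \<oplus>\<^bsub>k\<^esub> \<beta> u c" if u: "u \<in> I" and b: "b \<in> carrier B" and c: "c \<in> carrier B" for u b c
    proof -
      have "W m (b \<oplus>\<^bsub>B\<^esub> c) = W m b \<oplus>\<^bsub>k\<^esub> W m c" for m
        using b c \<delta>c by (simp add: W_def alg.P.ev_add_left)
      then show ?thesis unfolding \<beta>_def using IA Wc u b c by (simp add: alg.Q.ev_add_right)
    qed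
    show "\<beta> (c \<otimes>\<^bsub>A\<^esub> u) b = \<beta> u (\<phi> c \<otimes>\<^bsub>B\<^esub> b)" if c: "c \<in> carrier A" and u: "u \<in> I" and b: "b \<in> carrier B" for c u b
    proof -
      have uA: "u \<in> carrier A" using IA u .
      \<comment> \<open>The balancing condition for a monomial \<open>x^n\<close>. Multiplication by
        \<open>n\<close> may move \<open>m\<close> from \<open>E\<close> into the multiples of
        \<open>q'\<close>, where the left side vanishes. The right side then vanishes too, since a
        nonzero value would produce a divisor of \<open>p\<close> of the excluded kind.\<close>
      have key: "W (n \<otimes>\<^bsub>Q\<^esub> m) b = (if m \<in> E then alg.P.ev b (\<lambda>y. \<delta> m (h n \<otimes> y)) else \<zero>\<^bsub>k\<^esub>)"
        if n: "n \<in> carrier Q" and m: "m \<in> D" for n m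
      proof (cases "m \<in> E")
        case False
        then obtain r where r: "r \<in> carrier Q" "m = q' \<otimes>\<^bsub>Q\<^esub> r" using m by (auto simp: D_def E_def)
        have "n \<otimes>\<^bsub>Q\<^esub> m = q' \<otimes>\<^bsub>Q\<^esub> (n \<otimes>\<^bsub>Q\<^esub> r)" using n r q by (simp add: Q.m_lcomm)
        then have "n \<otimes>\<^bsub>Q\<^esub> m \<notin> E" using n r unfolding E_def by blast
        then show ?thesis using False by (simp add: W_def)
      next
        case True
        then obtain r where r: "r \<in> carrier Q" "m = q \<otimes>\<^bsub>Q\<^esub> r" by (auto simp: E_def)
        have mQ: "m \<in> carrier Q" using r q by simp
        have nm: "n \<otimes>\<^bsub>Q\<^esub> m = q \<otimes>\<^bsub>Q\<^esub> (n \<otimes>\<^bsub>Q\<^esub> r)" using n r q by (simp add: Q.m_lcomm)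
        show ?thesis
        proof (cases "n \<otimes>\<^bsub>Q\<^esub> m \<in> E")
          case nE: True
          have "\<delta> (n \<otimes>\<^bsub>Q\<^esub> m) y = \<delta> m (h n \<otimes> y)" if "y \<in> carrier P" for y
            using n mQ that by (simp add: \<delta>_def h_mult P.m_ac)
          then have "alg.P.ev b (\<delta> (n \<otimes>\<^bsub>Q\<^esub> m)) = alg.P.ev b (\<lambda>y. \<delta> m (h n \<otimes> y))"
            using b \<delta>c by (intro alg.P.ev_cong) auto
          then show ?thesis using nE True by (simp add: W_def)
        next
          case nE: False
          then obtain r' where r': "r' \<in> carrier Q" "q \<otimes>\<^bsub>Q\<^esub> (n \<otimes>\<^bsub>Q\<^esub> r) = q' \<otimes>\<^bsub>Q\<^esub> r'"
            using nm n r unfolding E_def by auto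
          have "\<delta> m (h n \<otimes> y) = \<zero>\<^bsub>k\<^esub>" if y: "y \<in> carrier P" for y
          proof -
            have "h m \<otimes> (h n \<otimes> y) \<noteq> h q \<otimes> p"
            proof
              assume "h m \<otimes> (h n \<otimes> y) = h q \<otimes> p"
              moreover have "h m \<otimes> (h n \<otimes> y) = h q \<otimes> (h (n \<otimes>\<^bsub>Q\<^esub> r) \<otimes> y)"
                using y q n r by (simp add: h_mult P.m_ac)
              ultimately have "h q \<otimes> (h (n \<otimes>\<^bsub>Q\<^esub> r) \<otimes> y) = h q \<otimes> p" by metis
              then have "h (n \<otimes>\<^bsub>Q\<^esub> r) \<otimes> y = p"
                by (rule P.l_cancel) (use y q n r p in auto)
              then show False using no r' n r y Q.m_closed by blast
            qed
            then show ?thesis by (simp add: \<delta>_def)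
          qed
          then have "alg.P.ev b (\<lambda>y. \<delta> m (h n \<otimes> y)) = alg.P.ev b (\<lambda>y. \<zero>\<^bsub>k\<^esub>)"
            using b by (intro alg.P.ev_cong) auto
          then show ?thesis using nE b by (simp add: W_def alg.P.ev_null)
        qed
      qed
      have Wm: "W m (\<phi> c \<otimes>\<^bsub>B\<^esub> b) = alg.Q.ev c (\<lambda>n. W (n \<otimes>\<^bsub>Q\<^esub> m) b)" if m: "m \<in> D" for m
      proof (cases "m \<in> E")
        case True
        have "W m (\<phi> c \<otimes>\<^bsub>B\<^esub> b) = alg.P.ev (\<phi> c) (\<lambda>x. alg.P.ev b (\<lambda>y. \<delta> m (x \<otimes> y)))"
          using True b c \<delta>c by (simp add: W_def alg.P.ev_mult)
        also have "\<dots> = alg.Q.ev c (\<lambda>n. alg.P.ev b (\<lambda>y. \<delta> m (h n \<otimes> y)))"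
          using b c \<delta>c by (intro alg.ev_map) auto
        also have "\<dots> = alg.Q.ev c (\<lambda>n. W (n \<otimes>\<^bsub>Q\<^esub> m) b)"
          using b Wc True by (intro alg.Q.ev_cong [OF c]) (auto simp: key [OF _ m] \<delta>c intro!: alg.P.ev_closed)
        finally show ?thesis .
      next
        case False
        have "alg.Q.ev c (\<lambda>n. W (n \<otimes>\<^bsub>Q\<^esub> m) b) = alg.Q.ev c (\<lambda>n. \<zero>\<^bsub>k\<^esub>)"
          using c key m False by (intro alg.Q.ev_cong) auto
        then show ?thesis using False c by (simp add: W_def alg.Q.ev_null)
      qed
      have "\<beta> (c \<otimes>\<^bsub>A\<^esub> u) b = alg.Q.ev c (\<lambda>n. alg.Q.ev u (\<lambda>m. W (n \<otimes>\<^bsub>Q\<^esub> m) b))"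
        unfolding \<beta>_def using c uA b Wc by (intro alg.Q.ev_mult) auto
      also have "\<dots> = alg.Q.ev u (\<lambda>m. alg.Q.ev c (\<lambda>n. W (n \<otimes>\<^bsub>Q\<^esub> m) b))"
        using c uA b Wc by (intro alg.Q.ev_swap) auto
      also have "\<dots> = \<beta> u (\<phi> c \<otimes>\<^bsub>B\<^esub> b)"
        unfolding \<beta>_def
      proof (rule alg.Q.ev_cong [OF uA])
        show "W m (\<phi> c \<otimes>\<^bsub>B\<^esub> b) \<in> carrier k" for m using b c by (intro Wc) auto
        show "alg.Q.ev c (\<lambda>n. W (n \<otimes>\<^bsub>Q\<^esub> m) b) = W m (\<phi> c \<otimes>\<^bsub>B\<^esub> b)" if "u m \<noteq> \<zero>\<^bsub>k\<^esub>" for m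
          using Wm u that by (simp add: I_def)
      qed
      finally show ?thesis .
    qed
    have "q = q \<otimes>\<^bsub>Q\<^esub> \<one>\<^bsub>Q\<^esub>" "q' = q' \<otimes>\<^bsub>Q\<^esub> \<one>\<^bsub>Q\<^esub>" using q by auto
    then have "q \<in> D" "q' \<in> D" unfolding D_def using Q.one_closed by blast+
    then show "alg_monom k \<one>\<^bsub>k\<^esub> q \<in> I" "alg_monom k \<one>\<^bsub>k\<^esub> q' \<in> I"
      using q by (auto simp: I_def alg_monom_apply)
    show "\<phi> (alg_monom k \<one>\<^bsub>k\<^esub> q) \<otimes>\<^bsub>B\<^esub> alg_monom k \<one>\<^bsub>k\<^esub> p = \<phi> (alg_monom k \<one>\<^bsub>k\<^esub> q') \<otimes>\<^bsub>B\<^esub> alg_monom k \<one>\<^bsub>k\<^esub> p'"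
      using q p eq by (simp add: alg.map_monom alg.P.monom_mult)
  qed (use p in auto)
  moreover have "\<beta> (alg_monom k \<one>\<^bsub>k\<^esub> q) (alg_monom k \<one>\<^bsub>k\<^esub> p) = \<one>\<^bsub>k\<^esub>"
  proof -
    \<comment> \<open>If \<open>q\<close> were a multiple of \<open>q'\<close>, the trivial divisor
      \<open>\<one>\<close> of \<open>p\<close> would be of the excluded kind.\<close>
    have "q \<noteq> q' \<otimes>\<^bsub>Q\<^esub> r" if "r \<in> carrier Q" for r
      using no that q p by (metis P.l_one Q.one_closed Q.r_one h_one)
    moreover have "q = q \<otimes>\<^bsub>Q\<^esub> \<one>\<^bsub>Q\<^esub>" using q by simp
    ultimately have "q \<in> E" unfolding E_def using Q.one_closed by blast
    then show ?thesis
      using q p Wc \<delta>c by (simp add: \<beta>_def alg.Q.ev_monom W_def alg.P.ev_monom) (simp add: \<delta>_def)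
  qed
  moreover have "\<beta> (alg_monom k \<one>\<^bsub>k\<^esub> q') (alg_monom k \<one>\<^bsub>k\<^esub> p') = \<zero>\<^bsub>k\<^esub>"
  proof -
    have "q' = q' \<otimes>\<^bsub>Q\<^esub> \<one>\<^bsub>Q\<^esub>" using q by simp
    then have "q' \<notin> E" unfolding E_def using Q.one_closed by blast
    then show ?thesis using q p Wc by (simp add: \<beta>_def alg.Q.ev_monom W_def)
  qed
  ultimately show False by simp
qed

text \<open>\<open>divisor_if_flat\<close> factors only \<open>p\<close>. With the equation in
  \<open>Q\<close> that comes along, cancelling \<open>h q'\<close> factors \<open>p'\<close>
  through the same \<open>x\<close>.\<close>

lemma equationally_flat_if_faithfully_flat:
  assumes flat: "flat_ring_hom A B \<phi>" and surj: "Spec_surjective A B \<phi>"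
  shows equationally_flat
  unfolding equationally_flat_def
proof (intro conjI ballI impI)
  show "inj_on h (carrier Q)" by (rule inj_if_faithfully_flat [OF flat surj])
  fix q q' p p'
  assume q: "q \<in> carrier Q" "q' \<in> carrier Q" and p: "p \<in> carrier P" "p' \<in> carrier P"
    and eq: "h q \<otimes> p = h q' \<otimes> p'"
  obtain r r' x where r: "r \<in> carrier Q" "r' \<in> carrier Q" and x: "x \<in> carrier P"
    and qr: "q \<otimes>\<^bsub>Q\<^esub> r = q' \<otimes>\<^bsub>Q\<^esub> r'" and px: "p = h r \<otimes> x"
    using divisor_if_flat [OF flat q p eq] by blast
  have "h q' \<otimes> p' = h (q \<otimes>\<^bsub>Q\<^esub> r) \<otimes> x" using eq px q r x by (simp add: h_mult_assoc)
  also have "\<dots> = h q' \<otimes> (h r' \<otimes> x)" unfolding qr using q r x by (simp add: h_mult_assoc)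
  finally have "p' = h r' \<otimes> x" using P.l_cancel [of "h q'" p' "h r' \<otimes> x"] q p r x by simp
  then show "\<exists>r\<in>carrier Q. \<exists>r'\<in>carrier Q. \<exists>x\<in>carrier P. p = h r \<otimes> x \<and> p' = h r' \<otimes> x"
    using r x px by blast
qed

text \<open>
  Restricting coefficients to the nonunits outside of \<open>L\<close>, where \<open>L\<close> contains the nonunits of \<open>Q\<close> and
  all products of two nonunits, is a derivation over \<open>A\<close> with values in \<open>B\<close> modulo \<open>L\<close>.
\<close>

lemma nonunits_decompose_if_unramified:
  assumes unr: "unramified_ring_hom A B \<phi>" and p0: "p0 \<in> carrier P - Units P"
  shows "p0 \<in> nonunit_ideal \<or> (\<exists>x\<in>carrier P - Units P. \<exists>y\<in>carrier P - Units P. p0 = x \<otimes> y)"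
proof -
  interpret F: free_module_on_ring B by (intro free_module_on_ring.intro alg.P.algebra_cring)
  define L where "L = nonunit_ideal \<union> {x \<otimes> y | x y. x \<in> carrier P - Units P \<and> y \<in> carrier P - Units P}"
  define E where "E = carrier P - Units P - L"
  define K where "K = {f \<in> carrier B. \<forall>x. f x \<noteq> \<zero>\<^bsub>k\<^esub> \<longrightarrow> x \<in> L}"
  have L_mult: "x \<otimes> y \<in> L" if x: "x \<in> carrier P" and y: "y \<in> L" for x y
    using y unfolding L_def
  proof
    assume y: "y \<in> nonunit_ideal"
    then have "y \<in> carrier P" by auto
    then show "x \<otimes> y \<in> nonunit_ideal \<union> {x \<otimes> y | x y. x \<in> carrier P - Units P \<and> y \<in> carrier P - Units P}"
      using nonunit_ideal_mult [OF y x] x by (simp add: P.m_comm)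
  next
    assume "y \<in> {x \<otimes> y | x y. x \<in> carrier P - Units P \<and> y \<in> carrier P - Units P}"
    then obtain u v where uv: "u \<in> carrier P" "u \<notin> Units P" "v \<in> carrier P" "v \<notin> Units P" "y = u \<otimes> v" by blast
    have "u \<otimes> x \<notin> Units P" using uv x P.unit_factor by blast
    moreover have "x \<otimes> y = (u \<otimes> x) \<otimes> v" using uv x by (simp add: P.m_ac)
    moreover have "u \<otimes> x \<in> carrier P" using uv x by simp
    ultimately show "x \<otimes> y \<in> nonunit_ideal \<union> {x \<otimes> y | x y. x \<in> carrier P - Units P \<and> y \<in> carrier P - Units P}"
      using uv by blast
  qed
  have K: "ideal K B" unfolding K_def by (rule alg.P.ideal_supported_on [OF L_mult])
  interpret K: ideal K B by (fact K)
  let ?D = "alg.P.restr E"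
  \<comment> \<open>The \<open>B\<close>-linear extension to the free module of the map that sends
    the symbol of \<open>b\<close> to the restriction of \<open>b\<close> to
    \<open>E\<close>.\<close>
  define \<Theta> where "\<Theta> f = F.alg.ev f ?D" for f
  have Dc: "?D b \<in> carrier B" if "b \<in> carrier F.mult_monoid" for b
    using that alg.P.restr_closed by (simp add: F.carrier_mult_monoid)
  have Dc': "?D b \<in> carrier B" if "b \<in> carrier B" for b
    using that by (rule alg.P.restr_closed)
  have \<Theta>c: "\<Theta> f \<in> carrier B" if "f \<in> carrier F.FM" for f
    unfolding \<Theta>_def using that Dc by (intro F.alg.ev_closed) (auto simp: F.carrier_FM)
  have \<Theta>_add: "\<Theta> (f \<oplus>\<^bsub>F.FM\<^esub> g) = \<Theta> f \<oplus>\<^bsub>B\<^esub> \<Theta> g" if "f \<in> carrier F.FM" "g \<in> carrier F.FM" for f g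
    using F.alg.ev_add_left [of f g ?D] that Dc
    by (simp add: \<Theta>_def F.carrier_FM free_module_simps monoid_algebra_simps(3))
  have \<Theta>_smult: "\<Theta> (b \<odot>\<^bsub>F.FM\<^esub> f) = b \<otimes>\<^bsub>B\<^esub> \<Theta> f" if "b \<in> carrier B" "f \<in> carrier F.FM" for b f
    using F.alg.ev_smult [of b f ?D] F.smult_closed [OF that] that Dc
    by (simp add: \<Theta>_def F.carrier_FM free_module_simps)
  have \<Theta>_dd: "\<Theta> (F.dd b) = ?D b" if "b \<in> carrier B" for b
  proof -
    have "F.dd b = alg_monom B \<one>\<^bsub>B\<^esub> b" by (auto simp: free_generator_def alg_monom_def)
    then show ?thesis
      using F.alg.ev_monom [of "\<one>\<^bsub>B\<^esub>" b ?D] that Dc' [OF that]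
      by (simp add: \<Theta>_def F.carrier_mult_monoid)
  qed
  have \<Theta>_zero: "\<Theta> \<zero>\<^bsub>F.FM\<^esub> = \<zero>\<^bsub>B\<^esub>"
    by (simp add: \<Theta>_def free_module_simps F.alg.ev_zero)
  have \<Theta>_minus: "\<Theta> (\<ominus>\<^bsub>F.FM\<^esub> f) = \<ominus>\<^bsub>B\<^esub> \<Theta> f" if f: "f \<in> carrier F.FM" for f
  proof -
    have "\<ominus>\<^bsub>F.FM\<^esub> f \<oplus>\<^bsub>F.FM\<^esub> f = \<zero>\<^bsub>F.FM\<^esub>" using f by (rule F.FM.M.l_neg)
    then have "\<Theta> (\<ominus>\<^bsub>F.FM\<^esub> f) \<oplus>\<^bsub>B\<^esub> \<Theta> f = \<zero>\<^bsub>B\<^esub>"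
      using \<Theta>_add [of "\<ominus>\<^bsub>F.FM\<^esub> f" f] f \<Theta>_zero by simp
    then show ?thesis using \<Theta>c f by (intro alg.P.RM.minus_equality [symmetric]) auto
  qed
  \<comment> \<open>The rules of a derivation modulo \<open>K\<close> amount to the inclusion of the
    defining relations in \<open>H\<close>. As the differentials vanish, \<open>H\<close> is then
    the whole free module.\<close>
  define H where "H = {f \<in> carrier F.FM. \<Theta> f \<in> K}"
  have H: "submodule H B F.FM"
  proof (rule F.FM.submoduleI)
    show "\<zero>\<^bsub>F.FM\<^esub> \<in> H" using \<Theta>_zero K.zero_closed by (simp add: H_def)
    fix f g assume f: "f \<in> H" and g: "g \<in> H"
    show "\<ominus>\<^bsub>F.FM\<^esub> f \<in> H" using f K.a_inv_closed by (simp add: H_def \<Theta>_minus)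
    show "f \<oplus>\<^bsub>F.FM\<^esub> g \<in> H" using f g K.a_closed by (simp add: H_def \<Theta>_add)
    show "b \<odot>\<^bsub>F.FM\<^esub> f \<in> H" if "b \<in> carrier B" for b
      using f that K.I_l_closed F.smult_closed by (simp add: H_def \<Theta>_smult)
  qed (auto simp: H_def)
  \<comment> \<open>The product rule for monomials with exponents \<open>x\<close> and
    \<open>y\<close>. Outside of \<open>L\<close> at least one factor is a unit, so a product that
    is a nonunit has exactly one nonunit factor, and exactly one summand survives.\<close>
  have split: "(if p \<in> E \<and> x \<otimes> y = p then \<one>\<^bsub>k\<^esub> else \<zero>\<^bsub>k\<^esub>) =
      (if y \<in> E then (if x \<otimes> y = p then \<one>\<^bsub>k\<^esub> else \<zero>\<^bsub>k\<^esub>) else \<zero>\<^bsub>k\<^esub>) \<oplus>\<^bsub>k\<^esub>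
      (if x \<in> E then (if x \<otimes> y = p then \<one>\<^bsub>k\<^esub> else \<zero>\<^bsub>k\<^esub>) else \<zero>\<^bsub>k\<^esub>)"
    if x: "x \<in> carrier P" and y: "y \<in> carrier P" and p: "p \<notin> L" for x y p
  proof (cases "x \<otimes> y = p")
    case True
    have xy: "y \<otimes> x = p" using True x y by (simp add: P.m_comm)
    have "x \<notin> L" "y \<notin> L" using L_mult [OF y, of x] L_mult [OF x, of y] p True xy by auto
    moreover have "x \<in> Units P \<or> y \<in> Units P" using p True x y unfolding L_def by blast
    moreover have "p \<in> Units P \<longleftrightarrow> x \<in> Units P \<and> y \<in> Units P"
      using True xy x y P.unit_factor [of x y] P.unit_factor [of y x] by auto
    ultimately show ?thesis using True x y p by (auto simp: E_def)
  qed simp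
  have rels: "kaehler_relations A B \<phi> \<subseteq> H"
  proof
    have mem: "u \<in> K" if "u \<in> carrier B" "\<And>p. p \<in> carrier P \<Longrightarrow> p \<notin> L \<Longrightarrow> u p = \<zero>\<^bsub>k\<^esub>" for u
      using that monoid_algebraD(3) [OF that(1)] unfolding K_def by blast
    fix z assume "z \<in> kaehler_relations A B \<phi>"
    then consider (add) b c where "b \<in> carrier B" "c \<in> carrier B"
          "z = F.dd (b \<oplus>\<^bsub>B\<^esub> c) \<ominus>\<^bsub>F.FM\<^esub> (F.dd b \<oplus>\<^bsub>F.FM\<^esub> F.dd c)"
        | (mult) b c where "b \<in> carrier B" "c \<in> carrier B"
          "z = F.dd (b \<otimes>\<^bsub>B\<^esub> c) \<ominus>\<^bsub>F.FM\<^esub> (b \<odot>\<^bsub>F.FM\<^esub> F.dd c \<oplus>\<^bsub>F.FM\<^esub> c \<odot>\<^bsub>F.FM\<^esub> F.dd b)"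
        | (base) a where "a \<in> carrier A" "z = F.dd (\<phi> a)"
      unfolding kaehler_relations_def Let_def by blast
    then show "z \<in> H"
    proof cases
      case add
      have "?D (b \<oplus>\<^bsub>B\<^esub> c) = ?D b \<oplus>\<^bsub>B\<^esub> ?D c"
        by (auto simp: alg.P.restr_def monoid_algebra_simps(3))
      then have "\<Theta> z = \<zero>\<^bsub>B\<^esub>"
        using add Dc' by (simp add: F.FM.minus_eq \<Theta>_add \<Theta>_minus \<Theta>_dd alg.P.RM.r_neg)
      moreover have "z \<in> carrier F.FM" using add by (simp add: F.FM.minus_eq)
      ultimately show ?thesis using K.zero_closed by (simp add: H_def)
    next
      case mult
      let ?w = "\<lambda>p x. if x = p then \<one>\<^bsub>k\<^esub> else \<zero>\<^bsub>k\<^esub>"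
      let ?u = "b \<otimes>\<^bsub>B\<^esub> ?D c \<oplus>\<^bsub>B\<^esub> c \<otimes>\<^bsub>B\<^esub> ?D b"
      have uc: "?u \<in> carrier B" "?D (b \<otimes>\<^bsub>B\<^esub> c) \<in> carrier B" using mult Dc' by auto
      \<comment> \<open>Both sides become double sums over the exponents of \<open>b\<close> and
        \<open>c\<close>, which agree term by term by \<open>split\<close>.\<close>
      have coeff: "?D (b \<otimes>\<^bsub>B\<^esub> c) p = ?u p" if p: "p \<in> carrier P" "p \<notin> L" for p
      proof -
        have bDc: "(b \<otimes>\<^bsub>B\<^esub> ?D c) p = alg.P.ev b (\<lambda>x. alg.P.ev c (\<lambda>y. if y \<in> E then ?w p (x \<otimes> y) else \<zero>\<^bsub>k\<^esub>))"
        proof -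
          have "(b \<otimes>\<^bsub>B\<^esub> ?D c) p = alg.P.ev (b \<otimes>\<^bsub>B\<^esub> ?D c) (?w p)"
            using mult Dc' p by (intro alg.P.ev_coeff [symmetric]) auto
          also have "\<dots> = alg.P.ev b (\<lambda>x. alg.P.ev (?D c) (\<lambda>y. ?w p (x \<otimes> y)))"
            using mult Dc' by (intro alg.P.ev_mult) auto
          also have "\<dots> = alg.P.ev b (\<lambda>x. alg.P.ev c (\<lambda>y. if y \<in> E then ?w p (x \<otimes> y) else \<zero>\<^bsub>k\<^esub>))"
            using mult by (intro alg.P.ev_cong alg.P.ev_restr alg.P.ev_closed) auto
          finally show ?thesis .
        qed
        have cDb: "(c \<otimes>\<^bsub>B\<^esub> ?D b) p = alg.P.ev b (\<lambda>x. alg.P.ev c (\<lambda>y. if x \<in> E then ?w p (x \<otimes> y) else \<zero>\<^bsub>k\<^esub>))"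
        proof -
          have "(c \<otimes>\<^bsub>B\<^esub> ?D b) p = (?D b \<otimes>\<^bsub>B\<^esub> c) p" using mult Dc' by (simp add: alg.P.RM.m_comm)
          also have "\<dots> = alg.P.ev (?D b \<otimes>\<^bsub>B\<^esub> c) (?w p)"
            using mult Dc' p by (intro alg.P.ev_coeff [symmetric]) auto
          also have "\<dots> = alg.P.ev (?D b) (\<lambda>x. alg.P.ev c (\<lambda>y. ?w p (x \<otimes> y)))"
            using mult Dc' by (intro alg.P.ev_mult) auto
          also have "\<dots> = alg.P.ev b (\<lambda>x. if x \<in> E then alg.P.ev c (\<lambda>y. ?w p (x \<otimes> y)) else \<zero>\<^bsub>k\<^esub>)"
            using mult by (intro alg.P.ev_restr alg.P.ev_closed) auto
          also have "\<dots> = alg.P.ev b (\<lambda>x. alg.P.ev c (\<lambda>y. if x \<in> E then ?w p (x \<otimes> y) else \<zero>\<^bsub>k\<^esub>))"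
            using mult by (intro alg.P.ev_cong alg.P.ev_closed) (auto simp: alg.P.ev_null)
          finally show ?thesis .
        qed
        have "?D (b \<otimes>\<^bsub>B\<^esub> c) p = alg.P.ev (?D (b \<otimes>\<^bsub>B\<^esub> c)) (?w p)"
          using uc p by (intro alg.P.ev_coeff [symmetric]) auto
        also have "\<dots> = alg.P.ev (b \<otimes>\<^bsub>B\<^esub> c) (\<lambda>x. if x \<in> E then ?w p x else \<zero>\<^bsub>k\<^esub>)"
          using mult by (intro alg.P.ev_restr) auto
        also have "\<dots> = alg.P.ev (b \<otimes>\<^bsub>B\<^esub> c) (\<lambda>x. if p \<in> E \<and> x = p then \<one>\<^bsub>k\<^esub> else \<zero>\<^bsub>k\<^esub>)"
          using mult by (intro alg.P.ev_cong) auto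
        also have "\<dots> = alg.P.ev b (\<lambda>x. alg.P.ev c (\<lambda>y. if p \<in> E \<and> x \<otimes> y = p then \<one>\<^bsub>k\<^esub> else \<zero>\<^bsub>k\<^esub>))"
          using mult by (intro alg.P.ev_mult) auto
        also have "\<dots> = alg.P.ev b (\<lambda>x. alg.P.ev c (\<lambda>y. (if y \<in> E then ?w p (x \<otimes> y) else \<zero>\<^bsub>k\<^esub>) \<oplus>\<^bsub>k\<^esub>
            (if x \<in> E then ?w p (x \<otimes> y) else \<zero>\<^bsub>k\<^esub>)))"
          using mult split p by (intro alg.P.ev_cong alg.P.ev_closed) auto
        also have "\<dots> = alg.P.ev b (\<lambda>x. alg.P.ev c (\<lambda>y. if y \<in> E then ?w p (x \<otimes> y) else \<zero>\<^bsub>k\<^esub>) \<oplus>\<^bsub>k\<^esub>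
            alg.P.ev c (\<lambda>y. if x \<in> E then ?w p (x \<otimes> y) else \<zero>\<^bsub>k\<^esub>))"
          using mult by (intro alg.P.ev_cong alg.P.ev_add_right) auto
        also have "\<dots> = (b \<otimes>\<^bsub>B\<^esub> ?D c) p \<oplus>\<^bsub>k\<^esub> (c \<otimes>\<^bsub>B\<^esub> ?D b) p"
          unfolding bDc cDb using mult by (intro alg.P.ev_add_right) auto
        finally show ?thesis by (simp add: monoid_algebra_simps(3))
      qed
      have "\<Theta> z = ?D (b \<otimes>\<^bsub>B\<^esub> c) \<ominus>\<^bsub>B\<^esub> ?u"
        using mult Dc' F.smult_closed
        by (simp add: F.FM.minus_eq alg.P.RM.minus_eq \<Theta>_add \<Theta>_minus \<Theta>_smult \<Theta>_dd)
      moreover have "?D (b \<otimes>\<^bsub>B\<^esub> c) \<ominus>\<^bsub>B\<^esub> ?u \<in> K"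
      proof (rule mem)
        show "?D (b \<otimes>\<^bsub>B\<^esub> c) \<ominus>\<^bsub>B\<^esub> ?u \<in> carrier B" using uc by simp
        fix p assume p: "p \<in> carrier P" "p \<notin> L"
        have "?u p \<in> carrier k" using uc(1) by (rule monoid_algebraD(1))
        moreover have "(\<ominus>\<^bsub>B\<^esub> ?u) p = \<ominus>\<^bsub>k\<^esub> (?u p)" using uc(1) by (rule alg.P.a_inv_apply)
        moreover have "(v \<ominus>\<^bsub>B\<^esub> ?u) p = v p \<oplus>\<^bsub>k\<^esub> (\<ominus>\<^bsub>B\<^esub> ?u) p" for v
          by (simp only: alg.P.RM.minus_eq monoid_algebra_simps(3))
        ultimately show "(?D (b \<otimes>\<^bsub>B\<^esub> c) \<ominus>\<^bsub>B\<^esub> ?u) p = \<zero>\<^bsub>k\<^esub>"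
          using coeff [OF p] k.r_neg by simp
      qed
      moreover have "z \<in> carrier F.FM" using mult F.smult_closed by (simp add: F.FM.minus_eq)
      ultimately show ?thesis by (simp add: H_def)
    next
      case base
      \<comment> \<open>The image under \<open>h\<close> of a unit is a unit, and the image of a
        nonunit lies in \<open>L\<close>; neither is in \<open>E\<close>.\<close>
      have "?D (\<phi> a) p = \<zero>\<^bsub>k\<^esub>" for p
      proof (rule ccontr)
        assume "?D (\<phi> a) p \<noteq> \<zero>\<^bsub>k\<^esub>"
        then have p: "p \<in> E" "\<phi> a p \<noteq> \<zero>\<^bsub>k\<^esub>" by (auto simp: alg.P.restr_def split: if_splits)
        obtain q where q: "a q \<noteq> \<zero>\<^bsub>k\<^esub>" "p = h q" using alg.map_support [OF p(2)] by auto
        have qc: "q \<in> carrier Q" using monoid_algebraD(3) [OF base(1) q(1)] .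
        have "q \<notin> Units Q" using p(1) q(2) h_Units by (auto simp: E_def)
        moreover have "p = h q \<otimes> \<one>" using q qc by simp
        ultimately have "p \<in> L" unfolding L_def using qc P.one_closed by blast
        then show False using p(1) by (simp add: E_def)
      qed
      then have "?D (\<phi> a) \<in> K" using base by (intro mem Dc') auto
      then show ?thesis using base by (simp add: H_def \<Theta>_dd)
    qed
  qed
  have "carrier F.FM \<subseteq> H"
    using unr H rels unfolding unramified_ring_hom_def kaehler_submodule_def by blast
  moreover have m: "alg_monom k \<one>\<^bsub>k\<^esub> p0 \<in> carrier B" using p0 by simp
  ultimately have "F.dd (alg_monom k \<one>\<^bsub>k\<^esub> p0) \<in> H" using F.dd_closed by blast
  then have DK: "?D (alg_monom k \<one>\<^bsub>k\<^esub> p0) \<in> K" using m by (simp add: H_def \<Theta>_dd)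
  \<comment> \<open>Otherwise \<open>p0\<close> is in \<open>E\<close>, so the restriction of
    \<open>x^p0\<close> keeps its coefficient there and is not in \<open>K\<close>.\<close>
  have "p0 \<in> L"
  proof (rule ccontr)
    assume "p0 \<notin> L"
    then have "p0 \<in> E" using p0 by (simp add: E_def)
    then have "?D (alg_monom k \<one>\<^bsub>k\<^esub> p0) p0 \<noteq> \<zero>\<^bsub>k\<^esub>" by (simp add: alg.P.restr_def alg_monom_apply)
    then show False using DK \<open>p0 \<notin> L\<close> unfolding K_def by blast
  qed
  then show ?thesis unfolding L_def by blast
qed

lemma unit_basis_if_finite_etale_cover:
  assumes "monoid_algebra_finite_etale_cover k Q P h"
  shows "\<exists>S. unit_basis S"
proof -
  have fin: "finite_ring_hom A B \<phi>" and flat: "flat_ring_hom A B \<phi>"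
    and unr: "unramified_ring_hom A B \<phi>" and surj: "Spec_surjective A B \<phi>"
    using assms unfolding monoid_algebra_finite_etale_cover_def finite_etale_cover_def etale_ring_hom_def
    by auto
  obtain S where "finite S" "basis S"
    using basis_if_finite_equationally_flat [OF finite_hom_if_finite_ring_hom [OF fin]
        equationally_flat_if_faithfully_flat [OF flat surj]] by blast
  then have "unit_basis S"
    using unit_basis_if_nonunits_decompose nonunits_decompose_if_unramified [OF unr] by blast
  then show ?thesis by blast
qed

end

section \<open>A field of characteristic zero on the given type, and the equivalences\<close>

text \<open>The rational numbers are countable, so an infinite type contains a copy of them. This
  keeps the conditions on all fields of characteristic zero from being vacuous.\<close>

lemma ex_char_zero_field:
  assumes "infinite (UNIV :: 'k set)"
  shows "\<exists>k :: 'k ring. field k \<and> char_zero k"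
proof -
  obtain g :: "nat \<Rightarrow> 'k" where g: "inj g"
    using assms infinite_countable_subset by blast
  define f :: "rat \<Rightarrow> 'k" where "f = g \<circ> to_nat"
  have f: "inj f" unfolding f_def using g by (intro inj_compose) auto
  define e where "e = inv_into UNIV f"
  have [simp]: "e (f x) = x" for x unfolding e_def using f by simp
  define k :: "'k ring" where "k = \<lparr>carrier = range f, monoid.mult = (\<lambda>x y. f (e x * e y)), one = f 1,
    ring.zero = f 0, ring.add = (\<lambda>x y. f (e x + e y))\<rparr>"
  have k_simps [simp]: "carrier k = range f" "\<one>\<^bsub>k\<^esub> = f 1" "\<zero>\<^bsub>k\<^esub> = f 0"
      "x \<otimes>\<^bsub>k\<^esub> y = f (e x * e y)" "x \<oplus>\<^bsub>k\<^esub> y = f (e x + e y)" for x y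
    by (simp_all add: k_def)
  have "cring k"
  proof (intro cringI abelian_groupI comm_monoidI)
    fix x assume "x \<in> carrier k"
    then obtain a where "x = f a" by auto
    then have "f (- a) \<oplus>\<^bsub>k\<^esub> x = \<zero>\<^bsub>k\<^esub>" by simp
    then show "\<exists>y\<in>carrier k. y \<oplus>\<^bsub>k\<^esub> x = \<zero>\<^bsub>k\<^esub>" by (rule bexI) simp
  qed (auto simp: algebra_simps)
  then interpret k: cring k .
  have ne: "\<one>\<^bsub>k\<^esub> \<noteq> \<zero>\<^bsub>k\<^esub>" using inj_eq [OF f] by simp
  have "field k"
  proof (rule k.cring_fieldI2)
    show "\<zero>\<^bsub>k\<^esub> \<noteq> \<one>\<^bsub>k\<^esub>" using ne by simp
    fix x assume "x \<in> carrier k" "x \<noteq> \<zero>\<^bsub>k\<^esub>"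
    then obtain a where "x = f a" "a \<noteq> 0" by auto
    then have "x \<otimes>\<^bsub>k\<^esub> f (1 / a) = \<one>\<^bsub>k\<^esub>" by simp
    then show "\<exists>y\<in>carrier k. x \<otimes>\<^bsub>k\<^esub> y = \<one>\<^bsub>k\<^esub>" by (rule bexI) simp
  qed
  moreover have "[n] \<cdot>\<^bsub>k\<^esub> \<one>\<^bsub>k\<^esub> = f (of_nat n)" for n
    by (induction n) (simp_all add: k.add.nat_pow_Suc add.commute)
  then have "char_zero k" using inj_eq [OF f] by (simp add: char_zero_def)
  ultimately show ?thesis by blast
qed

theorem theorem4p12p1:
  fixes Q :: "'q monoid" and P :: "'p monoid" and h :: "'q \<Rightarrow> 'p"
  assumes "fine_monoid Q" and "fine_monoid P" and "h \<in> monoid_homs Q P"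
    and "infinite (UNIV :: 'k set)"
  shows "all_equivalent
    [inj_on h (Units Q) \<and> finite (carrier (units_of P Mod (h ` Units Q))) \<and>
       is_pushout (units_of Q) (units_of P) Q P h (\<lambda>q. q) (\<lambda>p. p) h,
     inj_on h (carrier Q) \<and> sharpening_map P h \<in> iso (sharpening Q) (sharpening P) \<and>
       finite (carrier (cokernel_monoid Q P h)),
     \<exists>S. finite S \<and> S \<subseteq> Units P \<and> monoid_module_basis Q (hom_action P h) (carrier P) S \<and>
       (\<forall>S'. monoid_module_basis Q (hom_action P h) (carrier P) S' \<longrightarrow>
          S' \<subseteq> Units P \<and> (\<exists>b. bij_betw b S S')),
     \<exists>S. finite S \<and> S \<subseteq> Units P \<and> monoid_module_basis Q (hom_action P h) (carrier P) S,
     homeomorphic_map (monoid_Spec P) (monoid_Spec Q) (monoid_Spec_map Q h) \<and>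
       (\<forall>k :: 'k ring. field k \<and> char_zero k \<longrightarrow> monoid_algebra_finite_etale_cover k Q P h),
     \<forall>k :: 'k ring. field k \<and> char_zero k \<longrightarrow> monoid_algebra_finite_etale_cover k Q P h,
     \<exists>k :: 'k ring. field k \<and> monoid_algebra_finite_etale_cover k Q P h,
     finite_hom Q P h \<and> flat_hom Q P h \<and> reduced_hom Q P h \<and> local_hom Q P h,
     finite_hom Q P h \<and> flat_hom Q P h \<and> reduced_hom Q P h]"
    (is "all_equivalent [?c1, ?c2, ?c3, ?c4, ?c5, ?c6, ?c7, ?c8, ?c9]")
proof -
  interpret cancel_monoid_map Q P h
    using assms by (intro cancel_monoid_map.intro cancel_monoid_map_axioms.intro comm_monoid_cancel_of_fine)
  have c4: "?c4 \<longleftrightarrow> (\<exists>S. unit_basis S)" by (simp add: unit_basis_def)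
  have c1: "?c1 \<longleftrightarrow> ?c4"
    unfolding c4 using pushout_if_unit_basis unit_basis_if_pushout by blast
  have c2: "?c2 \<longleftrightarrow> ?c4"
    unfolding c4 using isomorphic_sharpening_if_unit_basis unit_basis_if_isomorphic_sharpening by blast
  have c3: "?c3 \<longleftrightarrow> ?c4"
  proof
    assume ?c4
    then obtain S where S: "unit_basis S" unfolding c4 by blast
    then show ?c3
      using unit_basis_contains_bases [OF S] unfolding unit_basis_def by (intro exI [of _ S]) simp
  qed blast
  have c98: "?c9 \<Longrightarrow> ?c4" "?c8 \<Longrightarrow> ?c9"
    unfolding c4 using unit_basis_if_finite_flat_reduced by blast+
  have c48: "?c4 \<Longrightarrow> ?c8"
    unfolding c4 using finite_hom_if_basis local_hom_if_basis flat_hom_if_finite_basis reduced_hom_if_unit_basis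
    unfolding unit_basis_def by blast
  have c45: "?c4 \<Longrightarrow> ?c5"
    unfolding c4 using homeomorphic_map_if_unit_basis finite_etale_cover_if_unit_basis by blast
  have c56: "?c5 \<Longrightarrow> ?c6" by blast
  have c67: "?c6 \<Longrightarrow> ?c7" using ex_char_zero_field [OF assms(4)] by blast
  have c74: "?c7 \<Longrightarrow> ?c4"
  proof -
    assume ?c7
    then obtain k :: "'k ring" where k: "field k" "monoid_algebra_finite_etale_cover k Q P h" by blast
    interpret monoid_algebra_map_field Q P h k
      by (intro monoid_algebra_map_field.intro cancel_monoid_map_axioms k(1))
    show ?c4 unfolding c4 by (rule unit_basis_if_finite_etale_cover [OF k(2)])
  qed
  have eqs: "?c5 \<longleftrightarrow> ?c4" "?c6 \<longleftrightarrow> ?c4" "?c7 \<longleftrightarrow> ?c4" "?c8 \<longleftrightarrow> ?c4" "?c9 \<longleftrightarrow> ?c4"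
    using c98 c48 c45 c56 c67 c74 by argo+
  have "\<forall>c\<in>set [?c1, ?c2, ?c3, ?c4, ?c5, ?c6, ?c7, ?c8, ?c9]. c \<longleftrightarrow> ?c4"
    unfolding list.set ball_simps by (intro conjI c1 c2 c3 eqs refl TrueI)
  then show ?thesis unfolding all_equivalent_def by blast
qed

end
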